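(* Let $G$ be a smooth bounded domain in $\mathbb R^d$, $\{h_k,k\ge1\}$ an orthonormal basis in $L_2(G)$ with $\sup_{x\in G}|h_k(x)|\le c_k$ for positive numbers $c_k$, $k\ge1$, and $\dot W(x)=\sum_{k\ge1}h_k(x)\xi_k$ the space white noise on $L_2(G)$. Let $T>0$ and consider (summation over repeated indices) $$u_t(t,x)=a_{ij}(x)D_iD_ju(t,x)+b_i(x)D_iu(t,x)+c(x)u(t,x)+f(t,x)+\big(\sigma_i(x)D_iu(t,x)+\nu(x)u(t,x)+g(t,x)\big)\diamond\dot W(x),$$ $0<t\le T$, $x\in G$, with zero boundary conditions and initial condition $u(0,x)=u_0(x)$, where $a_{ij},b_i,c,f,\sigma_i,\nu,g,u_0$ are non-random. Assume (D1) the functions $a_{ij}$ are Lipschitz continuous in $\bar G$, and $b_i,c,\sigma_i,\nu$ are bounded and measurable in $\bar G$; (D2) there exist positive numbers $A_1,A_2$ so that $A_1|y|^2\le a_{ij}(x)y_iy_j\le A_2|y|^2$ for all $x\in\bar G$, $y\in\mathbb R^d$. Let $V=\overset{\circ}{H}{}^1_2(G)$, $H=L_2(G)$, $V'=H_2^{-1}(G)$, $\mathcal V=L_2((0,T);V)$, $\mathcal H=L_2((0,T);H)$, $\mathcal V'=L_2((0,T);V')$. If $f\in\mathcal V'$, $g\in\mathcal H$, $u_0\in H$, then there exist an $\ell>1$ and a number $C>0$, both independent of $u_0,f,g$ (the number $\ell$ in general depending on $T$), so that the solution $u$ of the equation satisfies $u\in\mathcal RL_2(\mathbb F;\mathcal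 V)$ and $$\|u\|_{\mathcal RL_2(\mathbb F;\mathcal V)}\le C\big(\|u_0\|_H+\|f\|_{\mathcal V'}+\|g\|_{\mathcal H}\big),$$ where $\mathcal R$ is defined by the weights $$r_\alpha^2=c^{-2\alpha}(|\alpha|!)^{-1}(2\mathbb N)^{-2\ell\alpha},\qquad c^\alpha=\prod_kc_k^{\alpha_k}.$$
   Context: $\xi_k$, $k\ge1$, are independent standard Gaussian random variables on a complete probability space $\mathbb F=(\Omega,\mathcal F,\mathbb P)$ whose $\sigma$-algebra they generate. $\mathcal J$ is the set of multi-indices $\alpha=(\alpha_1,\alpha_2,\dots)$ of non-negative integers with $|\alpha|=\sum_k\alpha_k<\infty$; $(0)$ is the zero multi-index; $\varepsilon_k$ has $1$ in position $k$ and $0$ elsewhere; $(2\mathbb N)^{p\alpha}=\prod_{k\ge1}(2k)^{p\alpha_k}$. $\xi_\alpha=\prod_k H_{\alpha_k}(\xi_k)/\sqrt{\alpha_k!}$, $H_n(x)=(-1)^ne^{x^2/2}\frac{d^n}{dx^n}e^{-x^2/2}$. For positive weights $\{r_\alpha\}$ and a Hilbert space $X$, $\mathcal RL_2(\mathbb F;X)$ is the space of formal series $v=\sum_\alpha v_\alpha\xi_\alpha$, $v_\alpha\in X$, with $\|v\|^2_{\mathcal RL_2(\mathbb F;X)}=\sum_\alpha r_\alpha^2\|v_\alpha\|_X^2<\infty$. $\overset{\circ}{H}{}^1_2(G)$ is the Sobolev space of functions in $H^1_2(G)$ vanishing on the boundary (usually written $H^1_0(G)$), and $H_2^{-1}(G)$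 is its dual relative to the inner product in $L_2(G)$. Solution: with $\mathbf Au=a_{ij}D_iD_ju+b_iD_iu+cu$ (as an operator $V\to V'$) and $\mathbf M_ku=(\sigma_iD_iu+\nu u)h_k$, the solution is $u=\sum_\alpha u_\alpha\xi_\alpha$ with $u_\alpha\in\mathcal V\cap\mathbf C([0,T];H)$ determined (uniquely, by induction on $|\alpha|$) by the equalities in $V'$, for all $t\in[0,T]$, $\alpha\in\mathcal J$, $$u_\alpha(t)=u_0I_{(\alpha=(0))}+\int_0^t\Big(\mathbf Au_\alpha(s)+F_\alpha(s)+\sum_{k\ge1}\sqrt{\alpha_k}\,\mathbf M_ku_{\alpha-\varepsilon_k}(s)\Big)ds,$$ where $F_{(0)}=f$, $F_{\varepsilon_k}=g\,h_k$, $F_\alpha=0$ for $|\alpha|\ge2$, and terms with $\alpha_k=0$ are zero. *)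

theory Defs
  imports "HOL-Probability.Probability" "HOL-Library.Poly_Mapping"
begin

section \<open>Smooth bounded domains\<close>

definition partial :: "'n::finite \<Rightarrow> (real^'n \<Rightarrow> real) \<Rightarrow> real^'n \<Rightarrow> real" where
  "partial i f x = frechet_derivative f (at x) (axis i 1)"

primrec C_k :: "nat \<Rightarrow> (real^'n::finite \<Rightarrow> real) \<Rightarrow> bool" where
  "C_k 0 f \<longleftrightarrow> continuous_on UNIV f"
| "C_k (Suc k) f \<longleftrightarrow> (\<forall>x. f differentiable (at x)) \<and> (\<forall>i. C_k k (partial i f))"

definition smooth :: "(real^'n::finite \<Rightarrow> real) \<Rightarrow> bool" where
  "smooth f \<longleftrightarrow> (\<forall>k. C_k k f)"

text \<open>Near each boundary point, after a relabelling and reorientation of the coordinate axes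
  (the choice of \<open>i\<close> and of the sign \<open>s\<close>), the set is the part of a ball above the graph of a
  smooth function \<open>\<gamma>\<close> of the other coordinates.\<close>

definition smooth_boundary :: "(real^'n::finite) set \<Rightarrow> bool" where
  "smooth_boundary G \<longleftrightarrow>
     (\<forall>p\<in>frontier G. \<exists>r>0. \<exists>i. \<exists>s\<in>{-1, 1}. \<exists>\<gamma>.
        smooth \<gamma> \<and> (\<forall>x t. \<gamma> (x + t *\<^sub>R axis i 1) = \<gamma> x) \<and>
        G \<inter> ball p r = {x \<in> ball p r. s * x $ i > \<gamma> x})"

definition smooth_bounded_domain :: "(real^'n::finite) set \<Rightarrow> bool" where
  "smooth_bounded_domain G \<longleftrightarrow>
     open G \<and> connected G \<and> G \<noteq> {} \<and> bounded G \<and> smooth_boundary G"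


section \<open>The spaces \<open>L\<^sub>2(G)\<close>, \<open>H\<^sup>1\<^sub>0(G)\<close> and \<open>H\<^sup>-\<^sup>1(G)\<close>\<close>

text \<open>Elements of \<open>L\<^sub>2(G)\<close> and of the Sobolev spaces are functions on the whole of
  \<open>real^'n\<close>, of which only the values almost everywhere in \<open>G\<close> matter; the norms below are
  therefore seminorms, and equality of classes is vanishing of the seminorm of the difference.\<close>

definition L2_fun :: "(real^'n::finite) set \<Rightarrow> (real^'n \<Rightarrow> real) set" where
  "L2_fun G = {u \<in> borel_measurable (lebesgue_on G). integrable (lebesgue_on G) (\<lambda>x. (u x)\<^sup>2)}"

definition L2_inner :: "(real^'n::finite) set \<Rightarrow> (real^'n \<Rightarrow> real) \<Rightarrow> (real^'n \<Rightarrow> real) \<Rightarrow> real" where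
  "L2_inner G u v = (LINT x|lebesgue_on G. u x * v x)"

definition L2_norm :: "(real^'n::finite) set \<Rightarrow> (real^'n \<Rightarrow> real) \<Rightarrow> real" where
  "L2_norm G u = sqrt (L2_inner G u u)"

definition orthonormal_basis_L2 :: "(real^'n::finite) set \<Rightarrow> (nat \<Rightarrow> real^'n \<Rightarrow> real) \<Rightarrow> bool" where
  "orthonormal_basis_L2 G h \<longleftrightarrow>
     (\<forall>k. h k \<in> L2_fun G) \<and>
     (\<forall>j k. L2_inner G (h j) (h k) = (if j = k then 1 else 0)) \<and>
     (\<forall>u\<in>L2_fun G. (\<lambda>n. L2_norm G (\<lambda>x. u x - (\<Sum>k<n. L2_inner G u (h k) * h k x))) \<longlonglongrightarrow> 0)"

definition test_fun :: "(real^'n::finite) set \<Rightarrow> (real^'n \<Rightarrow> real) set" where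
  "test_fun G = {\<phi>. smooth \<phi> \<and> compact (closure {x. \<phi> x \<noteq> 0}) \<and> closure {x. \<phi> x \<noteq> 0} \<subseteq> G}"

definition is_weak_deriv ::
  "(real^'n::finite) set \<Rightarrow> 'n \<Rightarrow> (real^'n \<Rightarrow> real) \<Rightarrow> (real^'n \<Rightarrow> real) \<Rightarrow> bool" where
  "is_weak_deriv G i u v \<longleftrightarrow>
     v \<in> L2_fun G \<and> (\<forall>\<phi>\<in>test_fun G. L2_inner G u (partial i \<phi>) = - L2_inner G v \<phi>)"

definition weak_deriv ::
  "(real^'n::finite) set \<Rightarrow> 'n \<Rightarrow> (real^'n \<Rightarrow> real) \<Rightarrow> real^'n \<Rightarrow> real" where
  "weak_deriv G i u = (SOME v. is_weak_deriv G i u v)"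

definition H1 :: "(real^'n::finite) set \<Rightarrow> (real^'n \<Rightarrow> real) set" where
  "H1 G = {u \<in> L2_fun G. \<forall>i. \<exists>v. is_weak_deriv G i u v}"

definition H1_norm :: "(real^'n::finite) set \<Rightarrow> (real^'n \<Rightarrow> real) \<Rightarrow> real" where
  "H1_norm G u = sqrt ((L2_norm G u)\<^sup>2 + (\<Sum>i\<in>UNIV. (L2_norm G (weak_deriv G i u))\<^sup>2))"

definition H10 :: "(real^'n::finite) set \<Rightarrow> (real^'n \<Rightarrow> real) set" where
  "H10 G = {u \<in> H1 G. \<forall>e>0. \<exists>\<phi>\<in>test_fun G. H1_norm G (\<lambda>x. u x - \<phi> x) < e}"

text \<open>\<open>H\<^sup>-\<^sup>1(G)\<close> consists of the bounded linear functionals on \<open>H10 G\<close> (their values at other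
  functions are irrelevant). A function \<open>v\<close> in \<open>L\<^sub>2(G)\<close> is identified with the functional
  \<open>L2_inner G v\<close>.\<close>

definition Hm1 :: "(real^'n::finite) set \<Rightarrow> ((real^'n \<Rightarrow> real) \<Rightarrow> real) set" where
  "Hm1 G = {F. (\<forall>\<phi>\<in>H10 G. \<forall>\<psi>\<in>H10 G. \<forall>p q. F (\<lambda>x. p * \<phi> x + q * \<psi> x) = p * F \<phi> + q * F \<psi>) \<and>
               (\<exists>K. \<forall>\<phi>\<in>H10 G. \<bar>F \<phi>\<bar> \<le> K * H1_norm G \<phi>)}"

definition Hm1_norm :: "(real^'n::finite) set \<Rightarrow> ((real^'n \<Rightarrow> real) \<Rightarrow> real) \<Rightarrow> real" where
  "Hm1_norm G F = Sup {\<bar>F \<phi>\<bar> | \<phi>. \<phi> \<in> H10 G \<and> H1_norm G \<phi> \<le> 1}"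


section \<open>Curves with values in these spaces\<close>

text \<open>A seminormed space of real functions is given by its carrier \<open>S\<close> and its seminorm \<open>N\<close>;
  this covers \<open>(L2_fun G, L2_norm G)\<close>, \<open>(H10 G, H1_norm G)\<close> and \<open>(Hm1 G, Hm1_norm G)\<close>.
  Measurability is strong (Bochner) measurability.\<close>

definition simple_curve :: "real set \<Rightarrow> ('b \<Rightarrow> real) set \<Rightarrow> (real \<Rightarrow> 'b \<Rightarrow> real) \<Rightarrow> bool" where
  "simple_curve I S s \<longleftrightarrow>
     finite (s ` I) \<and> s ` I \<subseteq> S \<and> (\<forall>y. {t\<in>I. s t = y} \<in> sets lebesgue)"

definition strongly_measurable ::
  "real set \<Rightarrow> ('b \<Rightarrow> real) set \<Rightarrow> (('b \<Rightarrow> real) \<Rightarrow> real) \<Rightarrow> (real \<Rightarrow> 'b \<Rightarrow> real) \<Rightarrow> bool" where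
  "strongly_measurable I S N w \<longleftrightarrow>
     (\<exists>s. (\<forall>n. simple_curve I S (s n)) \<and>
          (AE t in lebesgue_on I. (\<lambda>n. N (\<lambda>z. w t z - s n t z)) \<longlonglongrightarrow> 0))"

definition L2_curve ::
  "real \<Rightarrow> ('b \<Rightarrow> real) set \<Rightarrow> (('b \<Rightarrow> real) \<Rightarrow> real) \<Rightarrow> (real \<Rightarrow> 'b \<Rightarrow> real) set" where
  "L2_curve T S N =
     {w. (AE t in lebesgue_on {0<..<T}. w t \<in> S) \<and> strongly_measurable {0<..<T} S N w \<and>
         integrable (lebesgue_on {0<..<T}) (\<lambda>t. (N (w t))\<^sup>2)}"

definition L2_curve_norm ::
  "real \<Rightarrow> (('b \<Rightarrow> real) \<Rightarrow> real) \<Rightarrow> (real \<Rightarrow> 'b \<Rightarrow> real) \<Rightarrow> real" where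
  "L2_curve_norm T N w = sqrt (LINT t|lebesgue_on {0<..<T}. (N (w t))\<^sup>2)"

definition C_curve ::
  "real \<Rightarrow> ('b \<Rightarrow> real) set \<Rightarrow> (('b \<Rightarrow> real) \<Rightarrow> real) \<Rightarrow> (real \<Rightarrow> 'b \<Rightarrow> real) set" where
  "C_curve T S N =
     {w. \<forall>t\<in>{0..T}. w t \<in> S \<and> ((\<lambda>s. N (\<lambda>z. w s z - w t z)) \<longlongrightarrow> 0) (at t within {0..T})}"


section \<open>Multi-indices and weighted chaos spaces\<close>

text \<open>The set of multi-indices is the type \<open>nat \<Rightarrow>\<^sub>0 nat\<close>. Positions are counted from \<open>0\<close>,
  so \<open>h k\<close>, \<open>\<xi> k\<close> and \<open>ck k\<close> stand for the objects with index \<open>k + 1\<close>, and the base \<open>2k\<close> of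
  \<open>(2\<nat>)\<^sup>\<alpha>\<close> becomes \<open>2 (k + 1)\<close>.\<close>

type_synonym multi_index = "nat \<Rightarrow>\<^sub>0 nat"

abbreviation eps :: "nat \<Rightarrow> multi_index" where
  "eps k \<equiv> Poly_Mapping.single k 1"

definition mi_deg :: "multi_index \<Rightarrow> nat" where
  "mi_deg \<alpha> = (\<Sum>k\<in>Poly_Mapping.keys \<alpha>. Poly_Mapping.lookup \<alpha> k)"

definition mi_power :: "(nat \<Rightarrow> real) \<Rightarrow> multi_index \<Rightarrow> real" where
  "mi_power ck \<alpha> = (\<Prod>k\<in>Poly_Mapping.keys \<alpha>. ck k ^ Poly_Mapping.lookup \<alpha> k)"

definition two_nat_power :: "real \<Rightarrow> multi_index \<Rightarrow> real" where
  "two_nat_power p \<alpha> = (\<Prod>k\<in>Poly_Mapping.keys \<alpha>. (2 * real (k + 1)) powr (p * real (Poly_Mapping.lookup \<alpha> k)))"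

definition weight_r :: "(nat \<Rightarrow> real) \<Rightarrow> real \<Rightarrow> multi_index \<Rightarrow> real" where
  "weight_r ck l \<alpha> =
     sqrt (inverse ((mi_power ck \<alpha>)\<^sup>2) * inverse (fact (mi_deg \<alpha>)) * two_nat_power (- 2 * l) \<alpha>)"

definition gaussian_noise_space :: "'w measure \<Rightarrow> (nat \<Rightarrow> 'w \<Rightarrow> real) \<Rightarrow> bool" where
  "gaussian_noise_space P \<xi> \<longleftrightarrow>
     prob_space P \<and> complete_measure P \<and>
     prob_space.indep_vars P (\<lambda>_. borel) \<xi> UNIV \<and>
     (\<forall>k. distributed P lborel (\<xi> k) std_normal_density) \<and>
     sets P = sigma_sets (space P)
                ({\<xi> k -` B \<inter> space P | k B. B \<in> sets borel} \<union> null_sets P)"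

text \<open>A formal series \<open>\<Sum>\<^sub>\<alpha> v\<^sub>\<alpha> \<xi>\<^sub>\<alpha>\<close> is its family of coefficients \<open>v\<close>.\<close>

definition RL2 :: "(multi_index \<Rightarrow> real) \<Rightarrow> 'x set \<Rightarrow> ('x \<Rightarrow> real) \<Rightarrow> (multi_index \<Rightarrow> 'x) set" where
  "RL2 r X N = {v. (\<forall>\<alpha>. v \<alpha> \<in> X) \<and> (\<lambda>\<alpha>. (r \<alpha>)\<^sup>2 * (N (v \<alpha>))\<^sup>2) summable_on UNIV}"

definition RL2_norm :: "(multi_index \<Rightarrow> real) \<Rightarrow> ('x \<Rightarrow> real) \<Rightarrow> (multi_index \<Rightarrow> 'x) \<Rightarrow> real" where
  "RL2_norm r N v = sqrt (\<Sum>\<^sub>\<infinity>\<alpha>. (r \<alpha>)\<^sup>2 * (N (v \<alpha>))\<^sup>2)"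


section \<open>The equation\<close>

text \<open>\<open>a\<^sub>i\<^sub>j D\<^sub>i D\<^sub>j v\<close> is the Lipschitz function \<open>a\<^sub>i\<^sub>j\<close> times the distribution \<open>D\<^sub>i (D\<^sub>j v)\<close>, so
  its value at \<open>\<phi>\<close> is \<open>- (D\<^sub>j v, D\<^sub>i (a\<^sub>i\<^sub>j \<phi>))\<close>.\<close>

definition op_A ::
  "(real^'n::finite) set \<Rightarrow> ('n \<Rightarrow> 'n \<Rightarrow> real^'n \<Rightarrow> real) \<Rightarrow> ('n \<Rightarrow> real^'n \<Rightarrow> real) \<Rightarrow>
   (real^'n \<Rightarrow> real) \<Rightarrow> (real^'n \<Rightarrow> real) \<Rightarrow> (real^'n \<Rightarrow> real) \<Rightarrow> real" where
  "op_A G a b c v \<phi> =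
     (\<Sum>i\<in>UNIV. \<Sum>j\<in>UNIV. - L2_inner G (weak_deriv G j v) (weak_deriv G i (\<lambda>x. a i j x * \<phi> x))) +
     L2_inner G (\<lambda>x. (\<Sum>i\<in>UNIV. b i x * weak_deriv G i v x) + c x * v x) \<phi>"

definition op_M ::
  "(real^'n::finite) set \<Rightarrow> ('n \<Rightarrow> real^'n \<Rightarrow> real) \<Rightarrow> (real^'n \<Rightarrow> real) \<Rightarrow>
   (real^'n \<Rightarrow> real) \<Rightarrow> (real^'n \<Rightarrow> real) \<Rightarrow> (real^'n \<Rightarrow> real) \<Rightarrow> real" where
  "op_M G \<sigma> \<nu> hk v = L2_inner G (\<lambda>x. ((\<Sum>i\<in>UNIV. \<sigma> i x * weak_deriv G i v x) + \<nu> x * v x) * hk x)"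

definition forcing ::
  "(real^'n::finite) set \<Rightarrow> (nat \<Rightarrow> real^'n \<Rightarrow> real) \<Rightarrow> (real \<Rightarrow> (real^'n \<Rightarrow> real) \<Rightarrow> real) \<Rightarrow>
   (real \<Rightarrow> real^'n \<Rightarrow> real) \<Rightarrow> multi_index \<Rightarrow> real \<Rightarrow> (real^'n \<Rightarrow> real) \<Rightarrow> real" where
  "forcing G h f g \<alpha> t =
     (if \<alpha> = 0 then f t
      else if mi_deg \<alpha> = 1 then L2_inner G (\<lambda>x. g t x * h (THE k. \<alpha> = eps k) x)
      else (\<lambda>\<phi>. 0))"

text \<open>The coefficients of the solution satisfy an integral equation in \<open>Hm1 G\<close>; an equality of
  functionals is an equality of their values at every \<open>\<phi>\<close> in \<open>H10 G\<close>, and the value at \<open>\<phi>\<close> of the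
  integral of a curve of functionals is the integral of the values.\<close>

definition chaos_solution ::
  "(real^'n::finite) set \<Rightarrow> (nat \<Rightarrow> real^'n \<Rightarrow> real) \<Rightarrow> real \<Rightarrow>
   ('n \<Rightarrow> 'n \<Rightarrow> real^'n \<Rightarrow> real) \<Rightarrow> ('n \<Rightarrow> real^'n \<Rightarrow> real) \<Rightarrow> (real^'n \<Rightarrow> real) \<Rightarrow>
   ('n \<Rightarrow> real^'n \<Rightarrow> real) \<Rightarrow> (real^'n \<Rightarrow> real) \<Rightarrow>
   (real^'n \<Rightarrow> real) \<Rightarrow> (real \<Rightarrow> (real^'n \<Rightarrow> real) \<Rightarrow> real) \<Rightarrow> (real \<Rightarrow> real^'n \<Rightarrow> real) \<Rightarrow>
   (multi_index \<Rightarrow> real \<Rightarrow> real^'n \<Rightarrow> real) \<Rightarrow> bool" where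
  "chaos_solution G h T a b c \<sigma> \<nu> u0 f g u \<longleftrightarrow>
     (\<forall>\<alpha>. u \<alpha> \<in> L2_curve T (H10 G) (H1_norm G) \<inter> C_curve T (L2_fun G) (L2_norm G) \<and>
       (\<forall>t\<in>{0..T}. \<forall>\<phi>\<in>H10 G.
          L2_inner G (u \<alpha> t) \<phi> =
          (if \<alpha> = 0 then L2_inner G u0 \<phi> else 0) +
          (LINT s|lebesgue_on {0..t}.
             op_A G a b c (u \<alpha> s) \<phi> + forcing G h f g \<alpha> s \<phi> +
             (\<Sum>k\<in>Poly_Mapping.keys \<alpha>. sqrt (real (Poly_Mapping.lookup \<alpha> k)) * op_M G \<sigma> \<nu> (h k) (u (\<alpha> - eps k) s) \<phi>))))"

end

theory Submission
  imports Defs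
begin

text \<open>The coefficients with respect to \<open>h\<close> identify \<open>L\<^sub>2(G)\<close> with \<open>\<ell>\<^sub>2\<close>, and \<open>u \<mapsto> (u, D\<^sub>1 u, \<dots>, D\<^sub>n u)\<close>
  identifies \<open>H\<^sup>1\<^sub>0(G)\<close> with a closed subspace \<open>V\<close> of \<open>\<ell>\<^sub>2 \<times> \<ell>\<^sub>2\<^sup>n\<close>. Every coefficient \<open>u\<^sub>\<alpha>\<close> then solves an
  abstract parabolic problem in \<open>V\<close> with a Garding inequality. An energy estimate with a weighted
  Gronwall argument bounds it by its data; it exists because the equations solvable with a
  square-integrable time derivative are dense among all right-hand sides. Hence the norms
  \<open>N\<^sub>\<alpha>\<close> of \<open>u\<^sub>\<alpha>\<close> in \<open>L\<^sub>2((0,T);V)\<close> satisfy \<open>N\<^sub>\<alpha> \<le> C \<Sum>\<^sub>k \<surd>\<alpha>\<^sub>k c\<^sub>k N\<close> at \<open>\<alpha> - \<epsilon>\<^sub>k\<close>, up to absorbing the data into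
  \<open>N\<close> at the zero multi-index. By Cauchy-Schwarz and \<open>\<Sum>\<^sub>k \<alpha>\<^sub>k = \<bar>\<alpha>\<bar>\<close>, the weighted squares \<open>Y\<^sub>\<alpha> = r\<^sub>\<alpha>\<^sup>2 N\<^sub>\<alpha>\<^sup>2\<close> are
  bounded by \<open>\<Sum>\<^sub>k q\<^sub>k Y\<close> at \<open>\<alpha> - \<epsilon>\<^sub>k\<close> with \<open>q\<^sub>k = C\<^sup>2 (2k)\<close> to the power \<open>-2\<ell>\<close>. For large \<open>\<ell>\<close> the sum of
  the \<open>q\<^sub>k\<close> is at most \<open>1/2\<close>, so the sums of \<open>Y\<close> over the levels \<open>\<bar>\<alpha>\<bar> = n\<close> decay geometrically.\<close>

section \<open>Square-integrable maps into Hilbert spaces\<close>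

text \<open>The obstacle is that a solution \<open>u\<close> has a time derivative only in the dual
  of \<open>V\<close>, so the pairing of \<open>u'\<close> with \<open>u\<close> has no direct
  integration by parts. Energy identities are therefore proved for curves whose derivative takes
  values in the form space, where they are Fubini's theorem on a triangle. Differences of such
  curves are again of this kind, so a single a priori bound becomes a Cauchy criterion for
  approximate solutions. Uniqueness reads the integrated equation as an equation for the primitive
  of a solution, which is again such a curve. Every solution thus coincides with the constructed one
  and inherits its bound.

  The constant of the recursion does not depend on \<open>\<alpha>\<close>: the index
  \<open>k\<close> enters the noise operator only through multiplication by \<open>h k\<close>,
  which costs \<open>c\<^sub>k\<close>. The weights cancel exactly this factor, and the factorial
  cancels the \<open>\<bar>\<alpha>\<bar>\<close> that comes from Cauchy-Schwarz, so
  \<open>\<ell>\<close> has only to beat that constant. Since \<open>g\<close> acts at degree one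
  only, raising the bound at the zero multi-index to a multiple of all the data makes the recursion
  homogeneous.\<close>

class separable_hilbert = real_inner + banach + second_countable_topology

instance real :: separable_hilbert ..
instance prod :: (separable_hilbert, separable_hilbert) separable_hilbert ..

text \<open>The target is separable, so Borel measurability can stand for strong measurability.
  Functions are not identified modulo null sets: \<open>nrm\<close> is a seminorm, and limits are
  determined almost everywhere.\<close>

definition sqi :: "'a measure \<Rightarrow> ('a \<Rightarrow> 'b::separable_hilbert) set" where
  "sqi M = {f \<in> borel_measurable M. integrable M (\<lambda>x. (norm (f x))\<^sup>2)}"

definition ip :: "'a measure \<Rightarrow> ('a \<Rightarrow> 'b::separable_hilbert) \<Rightarrow> ('a \<Rightarrow> 'b) \<Rightarrow> real" where
  "ip M f g = (\<integral>x. f x \<bullet> g x \<partial>M)"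

definition nrm :: "'a measure \<Rightarrow> ('a \<Rightarrow> 'b::separable_hilbert) \<Rightarrow> real" where
  "nrm M f = sqrt (\<integral>x. (norm (f x))\<^sup>2 \<partial>M)"

lemma nrm_ip: "(nrm M f)\<^sup>2 = ip M f f"
  by (simp add: nrm_def ip_def power2_norm_eq_inner)

lemma nrm_sq: "(nrm M f)\<^sup>2 = (\<integral>x. (norm (f x))\<^sup>2 \<partial>M)"
  by (simp add: nrm_def)

lemma nrm_nonneg [simp]: "0 \<le> nrm M f"
  by (simp add: nrm_def)

lemma sqi_measurable [measurable_dest]: "f \<in> sqi M \<Longrightarrow> f \<in> borel_measurable M"
  by (simp add: sqi_def)

lemma sqi_integrable: "f \<in> sqi M \<Longrightarrow> integrable M (\<lambda>x. (norm (f x))\<^sup>2)"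
  by (simp add: sqi_def)

lemma sqi_inner:
  assumes "f \<in> sqi M" "g \<in> sqi M"
  shows "integrable M (\<lambda>x. f x \<bullet> g x)"
proof (rule Bochner_Integration.integrable_bound)
  show "integrable M (\<lambda>x. (norm (f x))\<^sup>2 + (norm (g x))\<^sup>2)"
    using assms by (intro Bochner_Integration.integrable_add sqi_integrable)
  show "(\<lambda>x. f x \<bullet> g x) \<in> borel_measurable M"
    using assms[THEN sqi_measurable] by measurable
  have "\<bar>u \<bullet> v\<bar> \<le> (norm u)\<^sup>2 + (norm v)\<^sup>2" for u v :: 'b
  proof -
    have "\<bar>u \<bullet> v\<bar> \<le> norm u * norm v" by (rule Cauchy_Schwarz_ineq2)
    also have "2 * (norm u * norm v) \<le> (norm u)\<^sup>2 + (norm v)\<^sup>2"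
      using sum_squares_bound[of "norm u" "norm v"] by (simp add: mult.assoc)
    finally show ?thesis using zero_le_power2[of "norm u"] zero_le_power2[of "norm v"] by linarith
  qed
  then show "AE x in M. norm (f x \<bullet> g x) \<le> norm ((norm (f x))\<^sup>2 + (norm (g x))\<^sup>2)"
    by (intro AE_I2) (simp)
qed

lemma sqi_scaleR: "f \<in> sqi M \<Longrightarrow> (\<lambda>x. c *\<^sub>R f x) \<in> sqi M"
  by (auto simp: sqi_def power_mult_distrib)

lemma sqi_add:
  assumes "f \<in> sqi M" "g \<in> sqi M"
  shows "(\<lambda>x. f x + g x) \<in> sqi M"
proof -
  have "integrable M (\<lambda>x. (norm (f x))\<^sup>2 + 2 * (f x \<bullet> g x) + (norm (g x))\<^sup>2)"
    using assms by (intro Bochner_Integration.integrable_add integrable_mult_right sqi_inner sqi_integrable)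
  moreover have "(norm (f x + g x))\<^sup>2 = (norm (f x))\<^sup>2 + 2 * (f x \<bullet> g x) + (norm (g x))\<^sup>2" for x
    by (simp add: power2_norm_eq_inner algebra_simps inner_commute)
  ultimately show ?thesis
    using assms[THEN sqi_measurable] by (simp add: sqi_def)
qed

lemma sqi_zero [simp]: "(\<lambda>x. 0) \<in> sqi M"
  by (simp add: sqi_def)

lemma sqi_minus: "f \<in> sqi M \<Longrightarrow> (\<lambda>x. - f x) \<in> sqi M"
  using sqi_scaleR[of f M "-1"] by simp

lemma sqi_diff: "f \<in> sqi M \<Longrightarrow> g \<in> sqi M \<Longrightarrow> (\<lambda>x. f x - g x) \<in> sqi M"
  using sqi_add[OF _ sqi_minus, of f M g] by simp

lemma sqi_sum: "(\<And>i. i \<in> I \<Longrightarrow> f i \<in> sqi M) \<Longrightarrow> (\<lambda>x. \<Sum>i\<in>I. f i x) \<in> sqi M"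
  by (induction I rule: infinite_finite_induct) (auto intro: sqi_add)

lemma ip_commute: "ip M f g = ip M g f"
  by (simp add: ip_def inner_commute)

lemma ip_add_left:
  "f \<in> sqi M \<Longrightarrow> g \<in> sqi M \<Longrightarrow> k \<in> sqi M \<Longrightarrow> ip M (\<lambda>x. f x + g x) k = ip M f k + ip M g k"
  by (simp add: ip_def inner_add_left sqi_inner)

lemma ip_scaleR_left: "ip M (\<lambda>x. c *\<^sub>R f x) k = c * ip M f k"
  by (simp add: ip_def)

lemma ip_diff_left:
  "f \<in> sqi M \<Longrightarrow> g \<in> sqi M \<Longrightarrow> k \<in> sqi M \<Longrightarrow> ip M (\<lambda>x. f x - g x) k = ip M f k - ip M g k"
  by (simp add: ip_def inner_diff_left sqi_inner)

lemma ip_add_right: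
  "f \<in> sqi M \<Longrightarrow> g \<in> sqi M \<Longrightarrow> k \<in> sqi M \<Longrightarrow> ip M k (\<lambda>x. f x + g x) = ip M k f + ip M k g"
  by (simp add: ip_def inner_add_right sqi_inner)

lemma ip_diff_right:
  "f \<in> sqi M \<Longrightarrow> g \<in> sqi M \<Longrightarrow> k \<in> sqi M \<Longrightarrow> ip M k (\<lambda>x. f x - g x) = ip M k f - ip M k g"
  by (simp add: ip_def inner_diff_right sqi_inner)

lemma ip_scaleR_right: "ip M k (\<lambda>x. c *\<^sub>R f x) = c * ip M k f"
  by (simp add: ip_def)

text \<open>The discriminant of a nonnegative quadratic cannot be positive. Besides Cauchy-Schwarz
  this yields, with \<open>a = 0\<close>, orthogonality from the minimality of a distance.\<close>

lemma nonneg_quadratic: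
  fixes a b c :: real
  assumes "\<And>t. 0 \<le> a - 2 * t * b + t\<^sup>2 * c" "0 \<le> c"
  shows "b\<^sup>2 \<le> a * c"
proof (cases "c = 0")
  case True
  have "b = 0"
  proof (rule ccontr)
    assume "b \<noteq> 0"
    \<comment> \<open>At this value of \<open>t\<close> the remaining linear expression equals
      \<open>-1\<close>.\<close>
    then show False using assms(1)[of "(a + 1) / (2 * b)"] True by simp
  qed
  then show ?thesis using True by simp
next
  case False
  then have "0 \<le> c * (a - 2 * (b / c) * b + (b / c)\<^sup>2 * c)"
    by (intro mult_nonneg_nonneg assms)
  also have "\<dots> = a * c - b\<^sup>2"
    using False by (simp add: field_simps power2_eq_square)
  finally show ?thesis by simp
qed

lemma nrm_diff_scaleR:
  assumes "f \<in> sqi M" "g \<in> sqi M"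
  shows "(nrm M (\<lambda>x. f x - t *\<^sub>R g x))\<^sup>2 = (nrm M f)\<^sup>2 - 2 * t * ip M f g + t\<^sup>2 * (nrm M g)\<^sup>2"
  unfolding nrm_ip using assms by (simp add: ip_diff_left ip_diff_right sqi_diff sqi_scaleR ip_scaleR_left ip_scaleR_right
      ip_commute[of M g f])
    (simp add: algebra_simps power2_eq_square)

lemma ip_le_nrm:
  assumes "f \<in> sqi M" "g \<in> sqi M"
  shows "\<bar>ip M f g\<bar> \<le> nrm M f * nrm M g"
proof -
  have "(ip M f g)\<^sup>2 \<le> (nrm M f)\<^sup>2 * (nrm M g)\<^sup>2"
    by (rule nonneg_quadratic) (simp_all flip: nrm_diff_scaleR[OF assms])
  then show ?thesis
    by (metis abs_le_square_iff abs_of_nonneg mult_nonneg_nonneg nrm_nonneg power_mult_distrib)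
qed

lemma nrm_scaleR: "nrm M (\<lambda>x. c *\<^sub>R f x) = \<bar>c\<bar> * nrm M f"
  by (simp add: nrm_def power_mult_distrib real_sqrt_mult)

lemma nrm_minus_commute: "nrm M (\<lambda>x. f x - g x) = nrm M (\<lambda>x. g x - f x)"
  by (simp add: nrm_def norm_minus_commute)

lemma nrm_triangle:
  assumes "f \<in> sqi M" "g \<in> sqi M"
  shows "nrm M (\<lambda>x. f x + g x) \<le> nrm M f + nrm M g"
proof -
  have "(nrm M (\<lambda>x. f x + g x))\<^sup>2 = (nrm M f)\<^sup>2 + 2 * ip M f g + (nrm M g)\<^sup>2"
    using assms by (simp add: nrm_ip ip_add_left ip_add_right sqi_add ip_commute[of M g f])
  also have "\<dots> \<le> (nrm M f)\<^sup>2 + 2 * (nrm M f * nrm M g) + (nrm M g)\<^sup>2"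
    using ip_le_nrm[OF assms] by simp
  also have "\<dots> = (nrm M f + nrm M g)\<^sup>2"
    by (simp add: power2_sum)
  finally show ?thesis
    by (rule power2_le_imp_le) simp
qed

lemma nrm_triangle_diff:
  assumes "f \<in> sqi M" "g \<in> sqi M" "h \<in> sqi M"
  shows "nrm M (\<lambda>x. f x - h x) \<le> nrm M (\<lambda>x. f x - g x) + nrm M (\<lambda>x. g x - h x)"
  using nrm_triangle[OF sqi_diff[OF assms(1,2)] sqi_diff[OF assms(2,3)]] by simp

lemma nrm_sum:
  "(\<And>i. i \<in> I \<Longrightarrow> f i \<in> sqi M) \<Longrightarrow> nrm M (\<lambda>x. \<Sum>i\<in>I. f i x) \<le> (\<Sum>i\<in>I. nrm M (f i))"
proof (induction I rule: infinite_finite_induct)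
  case (insert i I)
  have "nrm M (\<lambda>x. f i x + (\<Sum>i\<in>I. f i x)) \<le> nrm M (f i) + nrm M (\<lambda>x. \<Sum>i\<in>I. f i x)"
    using insert by (intro nrm_triangle sqi_sum) auto
  then show ?case using insert by auto
qed (simp_all add: nrm_def)

lemma nrm_cong_AE:
  assumes "f \<in> borel_measurable M" "g \<in> borel_measurable M" "AE x in M. f x = g x"
  shows "nrm M f = nrm M g"
  unfolding nrm_def using assms by (intro arg_cong[where f=sqrt] integral_cong_AE) auto

lemma nrm_eq_0:
  assumes "f \<in> sqi M" "nrm M f = 0"
  shows "AE x in M. f x = 0"
proof -
  have "(\<integral>x. (norm (f x))\<^sup>2 \<partial>M) = 0" using assms(2) by (simp add: nrm_def)
  then have "AE x in M. (norm (f x))\<^sup>2 = 0"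
    using integral_nonneg_eq_0_iff_AE[OF sqi_integrable[OF assms(1)]] by simp
  then show ?thesis by simp
qed

lemma nrm_mono_AE:
  assumes "f \<in> borel_measurable M" "g \<in> sqi M" "AE x in M. norm (f x) \<le> K * norm (g x)" "0 \<le> K"
  shows "f \<in> sqi M" "nrm M f \<le> K * nrm M g"
proof -
  have *: "AE x in M. (norm (f x))\<^sup>2 \<le> K\<^sup>2 * (norm (g x))\<^sup>2"
    using assms(3) by eventually_elim (metis norm_ge_zero power_mono power_mult_distrib)
  have "integrable M (\<lambda>x. (norm (f x))\<^sup>2)"
    by (rule Bochner_Integration.integrable_bound[OF integrable_mult_right[OF sqi_integrable[OF assms(2)], of "K\<^sup>2"]])
       (use assms * in auto)
  then show f: "f \<in> sqi M" using assms by (simp add: sqi_def)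
  have "(\<integral>x. (norm (f x))\<^sup>2 \<partial>M) \<le> (\<integral>x. K\<^sup>2 * (norm (g x))\<^sup>2 \<partial>M)"
    using assms(2) f * by (intro integral_mono_AE) (auto simp: sqi_integrable)
  then have "(nrm M f)\<^sup>2 \<le> (K * nrm M g)\<^sup>2"
    by (simp add: nrm_sq power_mult_distrib)
  then show "nrm M f \<le> K * nrm M g"
    by (rule power2_le_imp_le) (use assms in simp)
qed

lemma sqi_bounded_linear:
  assumes "bounded_linear A" "f \<in> sqi M"
  shows "(\<lambda>x. A (f x)) \<in> sqi M" "nrm M (\<lambda>x. A (f x)) \<le> onorm A * nrm M f"
proof -
  have m: "(\<lambda>x. A (f x)) \<in> borel_measurable M"
    by (rule measurable_compose[OF sqi_measurable[OF assms(2)]])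
       (intro borel_measurable_continuous_onI linear_continuous_on assms)
  have "AE x in M. norm (A (f x)) \<le> onorm A * norm (f x)"
    by (intro AE_I2 onorm assms)
  from nrm_mono_AE[OF m assms(2) this onorm_pos_le[OF assms(1)]]
  show "(\<lambda>x. A (f x)) \<in> sqi M" "nrm M (\<lambda>x. A (f x)) \<le> onorm A * nrm M f" by auto
qed

lemma (in finite_measure) sqi_imp_integrable:
  assumes "f \<in> sqi M"
  shows "integrable M f"
proof (rule Bochner_Integration.integrable_bound)
  show "integrable M (\<lambda>x. 1 + (norm (f x))\<^sup>2)"
    using assms by (intro Bochner_Integration.integrable_add sqi_integrable) auto
  have "norm y \<le> 1 + (norm y)\<^sup>2" for y :: 'b
  proof -
    have "1 + (norm y)\<^sup>2 - norm y = (norm y - 1/2)\<^sup>2 + 3/4"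
      by (simp add: power2_eq_square algebra_simps)
    then show ?thesis using zero_le_power2[of "norm y - 1/2"] by linarith
  qed
  then show "AE x in M. norm (f x) \<le> norm (1 + (norm (f x))\<^sup>2)" by auto
qed (use assms in measurable)

section \<open>Completeness of the space of square-integrable maps\<close>

lemma telescoping_convergent:
  fixes g :: "nat \<Rightarrow> 'b::banach"
  assumes "summable (\<lambda>k. norm (g (Suc k) - g k))"
  shows "convergent g"
proof -
  have "summable (\<lambda>k. g (Suc k) - g k)" using assms by (rule summable_norm_cancel)
  then have "convergent (\<lambda>n. \<Sum>k<n. g (Suc k) - g k)" by (simp add: summable_iff_convergent)
  then have "convergent (\<lambda>n. g n - g 0)" by (simp add: sum_lessThan_telescope)
  then show ?thesis using convergent_diff_const_right_iff by blast
qed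

text \<open>Along a subsequence with increments of norm at most \<open>2\<^sup>-\<^sup>k\<close>, the weighted sum
  \<open>\<Sum>\<^sub>k 2\<^sup>k \<bar>f\<^sub>k\<^sub>+\<^sub>1 - f\<^sub>k\<bar>\<^sup>2\<close> has a finite integral, which forces convergence almost everywhere.\<close>

lemma sqi_complete:
  fixes f :: "nat \<Rightarrow> 'a \<Rightarrow> 'b::separable_hilbert"
  assumes f: "\<And>n. f n \<in> sqi M"
    and Cauchy: "\<And>e. e > 0 \<Longrightarrow> \<exists>N. \<forall>m\<ge>N. \<forall>n\<ge>N. nrm M (\<lambda>x. f m x - f n x) < e"
  shows "\<exists>g\<in>sqi M. (\<lambda>n. nrm M (\<lambda>x. f n x - g x)) \<longlonglongrightarrow> 0"
proof -
  note [measurable] = sqi_measurable[OF f]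
  have "\<exists>N. \<forall>k. \<forall>m\<ge>N k. \<forall>n\<ge>N k. nrm M (\<lambda>x. f m x - f n x) < (1/2)^k"
    by (intro choice allI Cauchy) simp
  then obtain N where N: "\<And>k m n. m \<ge> N k \<Longrightarrow> n \<ge> N k \<Longrightarrow> nrm M (\<lambda>x. f m x - f n x) < (1/2)^k"
    by blast
  \<comment> \<open>Summing the thresholds makes \<open>r j\<close> exceed \<open>N k\<close> for
    every \<open>k \<le> j\<close>.\<close>
  define r where "r k = (\<Sum>j\<le>k. N j)" for k
  have r: "r k \<ge> N k" for k by (auto simp: r_def intro: member_le_sum)
  have rSuc: "r (Suc k) \<ge> N k" for k using r[of k] by (simp add: r_def)
  have r_mono: "j \<ge> k \<Longrightarrow> r j \<ge> N k" for j k
    using r[of k] by (smt (verit, best) atMost_subset_iff finite_atMost le_trans r_def sum_mono2 zero_le)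
  define g where "g x = lim (\<lambda>k. f (r k) x)" for x
  have [measurable]: "g \<in> borel_measurable M" unfolding g_def by measurable
  define d where "d k x = norm (f (r (Suc k)) x - f (r k) x)" for k x
  have [measurable]: "d k \<in> borel_measurable M" for k unfolding d_def by measurable
  have nn: "(\<integral>\<^sup>+x. ennreal ((norm (f m x - f n x))\<^sup>2) \<partial>M) = ennreal ((nrm M (\<lambda>x. f m x - f n x))\<^sup>2)" for m n
    unfolding nrm_sq by (intro nn_integral_eq_integral sqi_integrable sqi_diff f) auto
  have "(\<integral>\<^sup>+x. (suminf (\<lambda>k. ennreal (2^k * (d k x)\<^sup>2))) \<partial>M) = suminf (\<lambda>k. \<integral>\<^sup>+x. ennreal (2^k * (d k x)\<^sup>2) \<partial>M)"
    by (intro nn_integral_suminf) measurable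
  also have "\<dots> \<le> suminf (\<lambda>k. ennreal ((1/2)^k))"
  proof (intro suminf_le summableI)
    fix k
    have "(\<integral>\<^sup>+x. ennreal (2^k * (d k x)\<^sup>2) \<partial>M) = ennreal (2^k) * ennreal ((nrm M (\<lambda>x. f (r (Suc k)) x - f (r k) x))\<^sup>2)"
      unfolding d_def by (simp add: ennreal_mult nn_integral_cmult nn)
    also have "\<dots> = ennreal (2^k * (nrm M (\<lambda>x. f (r (Suc k)) x - f (r k) x))\<^sup>2)"
      by (simp add: ennreal_mult)
    also have "\<dots> \<le> ennreal (2^k * ((1/2)^k)\<^sup>2)"
      using N[OF rSuc r, of k] by (intro ennreal_leI mult_left_mono power_mono) auto
    also have "2^k * ((1/2)^k)\<^sup>2 = ((1/2)^k :: real)"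
      by (simp add: power2_eq_square field_simps)
    finally show "(\<integral>\<^sup>+x. ennreal (2^k * (d k x)\<^sup>2) \<partial>M) \<le> ennreal ((1/2)^k)" .
  qed
  also have "\<dots> = ennreal (suminf (\<lambda>k. (1/2)^k))"
    by (intro suminf_ennreal2) (auto simp: summable_geometric)
  also have "\<dots> < \<infinity>" by simp
  finally have "AE x in M. (suminf (\<lambda>k. ennreal (2^k * (d k x)\<^sup>2))) \<noteq> \<infinity>"
    by (intro nn_integral_PInf_AE) auto
  then have conv: "AE x in M. (\<lambda>k. f (r k) x) \<longlonglongrightarrow> g x"
  proof eventually_elim
    case (elim x)
    then obtain C where C: "(suminf (\<lambda>k. ennreal (2^k * (d k x)\<^sup>2))) = ennreal C" "C \<ge> 0"
      by (metis ennreal_cases infinity_ennreal_def)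
    \<comment> \<open>A single term of the weighted series is at most its sum \<open>C\<close>, so
      the increments decay geometrically with ratio \<open>sqrt (1/2)\<close>.\<close>
    have dle: "d k x \<le> sqrt C * (sqrt (1/2))^k" for k
    proof -
      have "ennreal (2^k * (d k x)\<^sup>2) \<le> ennreal C"
        unfolding C(1)[symmetric] using sum_le_suminf[OF summableI, of "{k}"] by simp
      then have "2^k * (d k x)\<^sup>2 \<le> C" using C by simp
      then have "(d k x)\<^sup>2 \<le> C * (1/2)^k" by (simp add: field_simps)
      then have "d k x \<le> sqrt (C * (1/2)^k)" by (rule real_le_rsqrt)
      then show ?thesis by (simp add: real_sqrt_mult real_sqrt_power)
    qed
    have "summable (\<lambda>k. d k x)"
    proof (rule summable_comparison_test')
      show "summable (\<lambda>k. sqrt C * (sqrt (1/2))^k)"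
        by (intro summable_mult summable_geometric) (simp add: real_less_lsqrt)
      show "norm (d k x) \<le> sqrt C * (sqrt (1/2))^k" if "k \<ge> 0" for k
        using dle[of k] by (simp add: d_def)
    qed
    then have "convergent (\<lambda>k. f (r k) x)"
      unfolding d_def by (rule telescoping_convergent)
    then show ?case unfolding g_def by (simp add: convergent_LIMSEQ_iff)
  qed
  \<comment> \<open>Fatou's lemma turns almost everywhere convergence along the subsequence into a
    norm bound for the whole sequence.\<close>
  have key: "(\<integral>\<^sup>+x. ennreal ((norm (f m x - g x))\<^sup>2) \<partial>M) \<le> ennreal (((1/2)^k)\<^sup>2)" if m: "m \<ge> N k" for m k
  proof -
    have "(\<integral>\<^sup>+x. ennreal ((norm (f m x - g x))\<^sup>2) \<partial>M) =
        (\<integral>\<^sup>+x. liminf (\<lambda>j. ennreal ((norm (f m x - f (r j) x))\<^sup>2)) \<partial>M)"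
    proof (rule nn_integral_cong_AE, use conv in eventually_elim)
      fix x assume "(\<lambda>k. f (r k) x) \<longlonglongrightarrow> g x"
      then have "(\<lambda>j. ennreal ((norm (f m x - f (r j) x))\<^sup>2)) \<longlonglongrightarrow> ennreal ((norm (f m x - g x))\<^sup>2)"
        by (intro tendsto_intros tendsto_ennrealI)
      then show "ennreal ((norm (f m x - g x))\<^sup>2) = liminf (\<lambda>j. ennreal ((norm (f m x - f (r j) x))\<^sup>2))"
        by (rule lim_imp_Liminf[symmetric, rotated]) simp
    qed
    also have "\<dots> \<le> liminf (\<lambda>j. \<integral>\<^sup>+x. ennreal ((norm (f m x - f (r j) x))\<^sup>2) \<partial>M)"
      by (intro nn_integral_liminf) measurable
    also have "\<dots> \<le> ennreal (((1/2)^k)\<^sup>2)"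
    proof (rule Liminf_le)
      show "\<forall>\<^sub>F j in sequentially. (\<integral>\<^sup>+x. ennreal ((norm (f m x - f (r j) x))\<^sup>2) \<partial>M) \<le> ennreal (((1/2)^k)\<^sup>2)"
      proof (rule eventually_sequentiallyI[of k])
        fix j assume "k \<le> j"
        have "nrm M (\<lambda>x. f m x - f (r j) x) \<le> (1/2)^k"
          using N[OF m r_mono[OF \<open>k \<le> j\<close>]] by (rule less_imp_le)
        then show "(\<integral>\<^sup>+x. ennreal ((norm (f m x - f (r j) x))\<^sup>2) \<partial>M) \<le> ennreal (((1/2)^k)\<^sup>2)"
          unfolding nn by (intro ennreal_leI power_mono nrm_nonneg)
      qed
    qed simp
    finally show ?thesis .
  qed
  have sq: "(\<lambda>x. f m x - g x) \<in> sqi M" if "m \<ge> N k" for m k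
  proof -
    have "(\<integral>\<^sup>+x. ennreal ((norm (f m x - g x))\<^sup>2) \<partial>M) < \<infinity>"
      using key[OF that] by (simp add: le_less_trans)
    then have "integrable M (\<lambda>x. (norm (f m x - g x))\<^sup>2)"
      by (intro integrableI_nonneg) auto
    then show ?thesis by (simp add: sqi_def)
  qed
  have g: "g \<in> sqi M"
    using sqi_diff[OF f[of "N 0"] sq[of 0 "N 0"]] by simp
  have le: "nrm M (\<lambda>x. f m x - g x) \<le> (1/2)^k" if "m \<ge> N k" for m k
  proof -
    have "ennreal ((nrm M (\<lambda>x. f m x - g x))\<^sup>2) \<le> ennreal (((1/2)^k)\<^sup>2)"
      using key[OF that] unfolding nrm_sq
      by (subst nn_integral_eq_integral[symmetric]) (auto intro!: sqi_integrable[OF sqi_diff[OF f g]])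
    then have "(nrm M (\<lambda>x. f m x - g x))\<^sup>2 \<le> ((1/2)^k)\<^sup>2"
      by (subst (asm) ennreal_le_iff) auto
    then show ?thesis by (rule power2_le_imp_le) simp
  qed
  have "(\<lambda>n. nrm M (\<lambda>x. f n x - g x)) \<longlonglongrightarrow> 0"
  proof (rule LIMSEQ_I)
    fix e :: real assume "e > 0"
    then obtain k where "(1/2)^k < e" using real_arch_pow_inv[of e "1/2"] by auto
    then show "\<exists>no. \<forall>n\<ge>no. norm (nrm M (\<lambda>x. f n x - g x) - 0) < e"
      using le[of k] by (intro exI[of _ "N k"]) (auto intro: le_less_trans)
  qed
  with g show ?thesis by blast
qed

text \<open>The parallelogram argument in abstract form: \<open>e\<close> is the squared distance
  and \<open>z\<close> the midpoint, which cannot lie below the infimum, so near-minimisers are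
  close to each other. The form covers vectors as well as square-integrable maps, whose
  \<open>nrm\<close> is only a seminorm.\<close>

lemma minimizing_sequence:
  fixes d :: "'i \<Rightarrow> real" and e :: "'i \<Rightarrow> 'i \<Rightarrow> real"
  assumes "X \<noteq> {}" and d: "\<And>x. d x \<ge> 0"
    and mid: "\<And>x y. x \<in> X \<Longrightarrow> y \<in> X \<Longrightarrow> \<exists>z\<in>X. d z \<le> (d x + d y) / 2 - e x y / 4"
  shows "\<exists>s. (\<forall>n. s n \<in> X) \<and> (\<lambda>n. d (s n)) \<longlonglongrightarrow> Inf (d ` X) \<and>
    (\<forall>\<epsilon>>0. \<exists>N. \<forall>m\<ge>N. \<forall>n\<ge>N. e (s m) (s n) < \<epsilon>)"
proof -
  define i where "i = Inf (d ` X)"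
  have bdd: "bdd_below (d ` X)" using d by (auto intro!: bdd_belowI[of _ 0])
  have le: "i \<le> d x" if "x \<in> X" for x
    unfolding i_def using bdd that by (simp add: cINF_lower)
  have "\<exists>x\<in>X. d x < i + 1 / Suc n" for n
    using cINF_less_iff[OF assms(1) bdd, of "i + 1 / Suc n"] by (simp add: i_def)
  then obtain s where s: "\<And>n. s n \<in> X" "\<And>n. d (s n) < i + 1 / Suc n" by metis
  have 1: "(\<lambda>n. d (s n)) \<longlonglongrightarrow> i"
  proof (rule tendsto_sandwich[OF _ _ tendsto_const])
    show "(\<lambda>n. i + 1 / Suc n) \<longlonglongrightarrow> i"
      using tendsto_add[OF tendsto_const[of i] LIMSEQ_inverse_real_of_nat] by (simp add: inverse_eq_divide)
    show "\<forall>\<^sub>F n in sequentially. d (s n) \<le> i + 1 / Suc n"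
      using s(2) by (intro always_eventually allI less_imp_le)
  qed (use le s(1) in auto)
  have 2: "\<exists>N. \<forall>m\<ge>N. \<forall>n\<ge>N. e (s m) (s n) < \<epsilon>" if "\<epsilon> > 0" for \<epsilon>
  proof -
    have "\<epsilon> / 4 > 0" using that by simp
    from reals_Archimedean[OF this] obtain N :: nat where N: "1 / Suc N < \<epsilon> / 4"
      unfolding inverse_eq_divide by blast
    show ?thesis
    proof (intro exI allI impI)
      fix m n assume mn: "m \<ge> N" "n \<ge> N"
      then have "1 / Suc m \<le> 1 / Suc N" "1 / Suc n \<le> 1 / Suc N"
        by (auto simp: frac_le)
      then have "d (s m) < i + \<epsilon> / 4" "d (s n) < i + \<epsilon> / 4"
        using s(2)[of m] s(2)[of n] N by linarith+
      moreover obtain z where "z \<in> X" "d z \<le> (d (s m) + d (s n)) / 2 - e (s m) (s n) / 4"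
        using mid s(1) by blast
      ultimately show "e (s m) (s n) < \<epsilon>" using le[OF \<open>z \<in> X\<close>] by argo
    qed
  qed
  show ?thesis using s(1) 1 2 unfolding i_def by blast
qed

lemma closed_subspace_projection_exists:
  fixes S :: "'b::separable_hilbert set"
  assumes S: "closed S" "subspace S"
  shows "\<exists>p. p \<in> S \<and> (\<forall>y\<in>S. (x - p) \<bullet> y = 0)"
proof -
  define d where "d y = (norm (x - y))\<^sup>2" for y
  have "\<exists>s. (\<forall>n. s n \<in> S) \<and> (\<lambda>n. d (s n)) \<longlonglongrightarrow> Inf (d ` S) \<and>
    (\<forall>\<epsilon>>0. \<exists>N. \<forall>m\<ge>N. \<forall>n\<ge>N. (norm (s m - s n))\<^sup>2 < \<epsilon>)"
  proof (rule minimizing_sequence)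
    show "S \<noteq> {}" using subspace_0[OF S(2)] by auto
    fix y z assume "y \<in> S" "z \<in> S"
    then have "(1/2) *\<^sub>R (y + z) \<in> S" using S(2) by (simp add: subspace_add subspace_scale)
    moreover have "d ((1/2) *\<^sub>R (y + z)) = (d y + d z) / 2 - (norm (y - z))\<^sup>2 / 4"
      unfolding d_def power2_norm_eq_inner
      by (simp add: inner_add_left inner_add_right inner_diff_left inner_diff_right inner_commute[of y x]
          inner_commute[of z x] inner_commute[of z y] field_simps)
    ultimately show "\<exists>w\<in>S. d w \<le> (d y + d z) / 2 - (norm (y - z))\<^sup>2 / 4" by force
  qed (simp add: d_def)
  then obtain s where s: "\<And>n. s n \<in> S" "(\<lambda>n. d (s n)) \<longlonglongrightarrow> Inf (d ` S)"
    "\<And>\<epsilon>. \<epsilon> > 0 \<Longrightarrow> \<exists>N. \<forall>m\<ge>N. \<forall>n\<ge>N. (norm (s m - s n))\<^sup>2 < \<epsilon>" by blast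
  have "Cauchy s"
  proof (rule metric_CauchyI)
    fix e :: real assume "e > 0"
    then obtain N where "\<forall>m\<ge>N. \<forall>n\<ge>N. (norm (s m - s n))\<^sup>2 < e\<^sup>2" using s(3)[of "e\<^sup>2"] by auto
    then show "\<exists>M. \<forall>m\<ge>M. \<forall>n\<ge>M. dist (s m) (s n) < e"
      using \<open>e > 0\<close> by (metis dist_norm less_imp_le power2_less_imp_less)
  qed
  then obtain p where p: "s \<longlonglongrightarrow> p" using Cauchy_convergent convergent_def by blast
  have pS: "p \<in> S" using closed_sequentially[OF S(1) _ p] s(1) by blast
  have "(\<lambda>n. d (s n)) \<longlonglongrightarrow> d p" unfolding d_def by (intro tendsto_intros p)
  then have dp: "d p = Inf (d ` S)" using s(2) LIMSEQ_unique by blast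
  have "(x - p) \<bullet> y = 0" if "y \<in> S" for y
  proof -
    \<comment> \<open>Moving the minimiser along \<open>y\<close> does not decrease the distance, so
      the quadratic in \<open>t\<close> has constant term 0 and its linear coefficient must
      vanish.\<close>
    have "((x - p) \<bullet> y)\<^sup>2 \<le> 0 * (y \<bullet> y)"
    proof (rule nonneg_quadratic)
      fix t
      have "p + t *\<^sub>R y \<in> S" using S(2) pS that by (simp add: subspace_add subspace_scale)
      then have "d p \<le> d (p + t *\<^sub>R y)"
        unfolding dp by (intro cINF_lower) (auto intro!: bdd_belowI[of _ 0] simp: d_def)
      then show "0 \<le> 0 - 2 * t * ((x - p) \<bullet> y) + t\<^sup>2 * (y \<bullet> y)"
        unfolding d_def power2_norm_eq_inner
        by (simp add: algebra_simps inner_commute power2_eq_square)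
    qed simp
    then show ?thesis by simp
  qed
  with pS show ?thesis by blast
qed

section \<open>Orthogonal projections\<close>

definition proj :: "'b set \<Rightarrow> 'b::separable_hilbert \<Rightarrow> 'b" where
  "proj S x = (SOME p. p \<in> S \<and> (\<forall>y\<in>S. (x - p) \<bullet> y = 0))"

context
  fixes S :: "'b::separable_hilbert set"
  assumes S: "closed S" "subspace S"
begin

lemma proj_in: "proj S x \<in> S" and proj_orthogonal: "y \<in> S \<Longrightarrow> (x - proj S x) \<bullet> y = 0"
  using someI_ex[OF closed_subspace_projection_exists[OF S, of x]] by (auto simp: proj_def)

lemma proj_unique:
  assumes "p \<in> S" "\<And>y. y \<in> S \<Longrightarrow> (x - p) \<bullet> y = 0"
  shows "proj S x = p"
proof -
  have "p - proj S x \<in> S" using assms proj_in S(2) by (simp add: subspace_diff)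
  then have "(x - proj S x) \<bullet> (p - proj S x) = 0" "(x - p) \<bullet> (p - proj S x) = 0"
    using assms(2) proj_orthogonal by auto
  then have "(p - proj S x) \<bullet> (p - proj S x) = 0" by (simp add: inner_diff_left)
  then show ?thesis by simp
qed

lemma proj_id: "y \<in> S \<Longrightarrow> proj S y = y"
  by (rule proj_unique) auto

lemma proj_inner: "y \<in> S \<Longrightarrow> proj S x \<bullet> y = x \<bullet> y"
  using proj_orthogonal[of y x] by (simp add: inner_diff_left)

lemma norm_proj_le: "norm (proj S x) \<le> norm x"
proof -
  have "proj S x \<bullet> proj S x = x \<bullet> proj S x" by (rule proj_inner[OF proj_in])
  also have "\<dots> \<le> norm x * norm (proj S x)" by (rule norm_cauchy_schwarz)
  finally show ?thesis
    by (cases "norm (proj S x) = 0") (simp_all add: power2_eq_square flip: power2_norm_eq_inner)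
qed

lemma bounded_linear_proj: "bounded_linear (proj S)"
proof (rule bounded_linear_intro[where K=1])
  fix x y and r :: real
  show "proj S (x + y) = proj S x + proj S y"
    by (rule proj_unique)
      (auto simp: proj_in S subspace_add inner_diff_left inner_add_left proj_inner)
  show "proj S (r *\<^sub>R x) = r *\<^sub>R proj S x"
    by (rule proj_unique) (auto simp: proj_in S subspace_scale inner_diff_left proj_inner)
  show "norm (proj S x) \<le> norm x * 1" using norm_proj_le by simp
qed

end

section \<open>Representation of functionals and bilinear forms\<close>

lemma riesz_representation:
  fixes F :: "'b::separable_hilbert \<Rightarrow> real"
  assumes "bounded_linear F"
  shows "\<exists>z. \<forall>x. F x = z \<bullet> x"
proof (cases "\<forall>x. F x = 0")
  case True
  then have "\<forall>x. F x = 0 \<bullet> x" by simp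
  then show ?thesis by blast
next
  case False
  interpret F: bounded_linear F by fact
  let ?S = "{x. F x = 0}"
  have S: "closed ?S" "subspace ?S"
    by (rule closed_Collect_eq[OF linear_continuous_on[OF assms] continuous_on_const])
       (simp add: subspace_def F.add F.scaleR F.zero)
  obtain x0 where x0: "F x0 \<noteq> 0" using False by blast
  \<comment> \<open>\<open>n\<close> is orthogonal to the kernel of \<open>F\<close>, and every
    vector is a multiple of \<open>n\<close> modulo that kernel.\<close>
  define n where "n = x0 - proj ?S x0"
  have Fn: "F n = F x0" using proj_in[OF S, of x0] by (simp add: n_def F.diff)
  then have n0: "n \<bullet> n \<noteq> 0" using x0 F.zero by auto
  have "F x = ((F n / (n \<bullet> n)) *\<^sub>R n) \<bullet> x" for x
  proof -
    have "x - (F x / F n) *\<^sub>R n \<in> ?S" using Fn x0 by (simp add: F.diff F.scaleR)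
    then have "n \<bullet> (x - (F x / F n) *\<^sub>R n) = 0"
      unfolding n_def by (rule proj_orthogonal[OF S])
    then have "n \<bullet> x = (F x / F n) * (n \<bullet> n)" by (simp add: inner_diff_right)
    then show ?thesis using n0 Fn x0 by simp
  qed
  then show ?thesis by blast
qed

text \<open>Riesz in the second argument; testing with \<open>A x\<close> itself bounds
  \<open>A\<close>. It supplies the operator \<open>J\<close> through which time derivatives enter
  the equation.\<close>

lemma bounded_bilinear_representation:
  fixes B :: "'a::separable_hilbert \<Rightarrow> 'b::separable_hilbert \<Rightarrow> real"
  assumes "bounded_bilinear B"
  shows "\<exists>A. bounded_linear A \<and> (\<forall>x y. B x y = A x \<bullet> y)"
proof -
  interpret B: bounded_bilinear B by fact
  have "\<forall>x. \<exists>z. \<forall>y. B x y = z \<bullet> y"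
    using riesz_representation[OF B.bounded_linear_right] by blast
  then obtain A where A: "\<And>x y. B x y = A x \<bullet> y" by metis
  obtain K where K: "K > 0" "\<And>x y. norm (B x y) \<le> norm x * norm y * K" using B.pos_bounded by blast
  have "bounded_linear A"
  proof (rule bounded_linear_intro[where K=K])
    fix x y and r :: real
    show "A (x + y) = A x + A y"
      by (rule vector_eq_rdot[THEN iffD1]) (simp add: inner_add_left flip: A, simp add: B.add_left)
    show "A (r *\<^sub>R x) = r *\<^sub>R A x"
      by (rule vector_eq_rdot[THEN iffD1]) (simp flip: A, simp add: B.scaleR_left)
    have "norm (A x) * norm (A x) \<le> norm x * norm (A x) * K"
      using K(2)[of x "A x"] by (simp add: A flip: power2_norm_eq_inner power2_eq_square)
    then show "norm (A x) \<le> norm x * K"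
      using K(1) by (cases "norm (A x) = 0") (simp_all add: mult.commute mult.left_commute)
  qed
  with A show ?thesis by blast
qed

text \<open>The distance from \<open>f\<close> to \<open>R\<close> is approached by a minimising
  sequence in \<open>R\<close>, whose limit \<open>p\<close> satisfies the orthogonality relations;
  by \<open>orth\<close> the rest \<open>f - p\<close> is null. The projection argument is repeated
  because \<open>sqi M\<close> is a set with a seminorm, not a type.\<close>

lemma sqi_dense:
  fixes R :: "('a \<Rightarrow> 'b::separable_hilbert) set"
  assumes R: "R \<subseteq> sqi M" "R \<noteq> {}" and add: "\<And>f g. f \<in> R \<Longrightarrow> g \<in> R \<Longrightarrow> (\<lambda>x. f x + g x) \<in> R"
    and scale: "\<And>f c. f \<in> R \<Longrightarrow> (\<lambda>x. c *\<^sub>R f x) \<in> R"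
    and orth: "\<And>g. g \<in> sqi M \<Longrightarrow> (\<And>r. r \<in> R \<Longrightarrow> ip M g r = 0) \<Longrightarrow> nrm M g = 0"
    and f: "f \<in> sqi M" and "e > 0"
  shows "\<exists>r\<in>R. nrm M (\<lambda>x. f x - r x) < e"
proof -
  define d where "d r = (nrm M (\<lambda>x. f x - r x))\<^sup>2" for r
  have "\<exists>s. (\<forall>n. s n \<in> R) \<and> (\<lambda>n. d (s n)) \<longlonglongrightarrow> Inf (d ` R) \<and>
    (\<forall>\<epsilon>>0. \<exists>N. \<forall>m\<ge>N. \<forall>n\<ge>N. (nrm M (\<lambda>x. s m x - s n x))\<^sup>2 < \<epsilon>)"
  proof (rule minimizing_sequence)
    fix y z assume yz: "y \<in> R" "z \<in> R"
    have [simp]: "y \<in> sqi M" "z \<in> sqi M" using yz R by auto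
    have "(\<lambda>x. (1/2) *\<^sub>R (y x + z x)) \<in> R" using yz by (intro scale add)
    moreover have "d (\<lambda>x. (1/2) *\<^sub>R (y x + z x)) = (d y + d z) / 2 - (nrm M (\<lambda>x. y x - z x))\<^sup>2 / 4"
      unfolding d_def nrm_ip using f
      by (simp add: ip_add_left ip_add_right ip_diff_left ip_diff_right sqi_add sqi_diff sqi_scaleR
          ip_scaleR_left ip_scaleR_right ip_commute[of M y f] ip_commute[of M z f] ip_commute[of M z y] field_simps)
    ultimately show "\<exists>w\<in>R. d w \<le> (d y + d z) / 2 - (nrm M (\<lambda>x. y x - z x))\<^sup>2 / 4" by force
  qed (use R in \<open>auto simp: d_def\<close>)
  then obtain s where s: "\<And>n. s n \<in> R" "(\<lambda>n. d (s n)) \<longlonglongrightarrow> Inf (d ` R)"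
    "\<And>\<epsilon>. \<epsilon> > 0 \<Longrightarrow> \<exists>N. \<forall>m\<ge>N. \<forall>n\<ge>N. (nrm M (\<lambda>x. s m x - s n x))\<^sup>2 < \<epsilon>" by blast
  have sq: "s n \<in> sqi M" for n using s(1) R by blast
  have "\<exists>p\<in>sqi M. (\<lambda>n. nrm M (\<lambda>x. s n x - p x)) \<longlonglongrightarrow> 0"
  proof (rule sqi_complete[OF sq])
    fix e :: real assume "e > 0"
    then obtain N where "\<forall>m\<ge>N. \<forall>n\<ge>N. (nrm M (\<lambda>x. s m x - s n x))\<^sup>2 < e\<^sup>2" using s(3)[of "e\<^sup>2"] by auto
    then show "\<exists>N. \<forall>m\<ge>N. \<forall>n\<ge>N. nrm M (\<lambda>x. s m x - s n x) < e"
      using \<open>e > 0\<close> by (metis less_imp_le power2_less_imp_less)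
  qed
  then obtain p where p: "p \<in> sqi M" "(\<lambda>n. nrm M (\<lambda>x. s n x - p x)) \<longlonglongrightarrow> 0" by blast
  have lim_d: "d p \<le> Inf (d ` R)"
  proof -
    have "(\<lambda>n. (nrm M (\<lambda>x. s n x - p x) + sqrt (d (s n)))\<^sup>2) \<longlonglongrightarrow> (0 + sqrt (Inf (d ` R)))\<^sup>2"
      by (intro tendsto_intros p s)
    moreover have "0 \<le> Inf (d ` R)" using R by (intro cINF_greatest) (auto simp: d_def)
    moreover have "d p \<le> (nrm M (\<lambda>x. s n x - p x) + sqrt (d (s n)))\<^sup>2" for n
      unfolding d_def using nrm_triangle_diff[OF f sq p(1), of n]
      by (intro power_mono) (auto simp: add.commute)
    ultimately show ?thesis by (intro LIMSEQ_le_const) auto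
  qed
  have "ip M (\<lambda>x. f x - p x) r = 0" if r: "r \<in> R" for r
  proof -
    have rs: "r \<in> sqi M" using r R by auto
    have "(ip M (\<lambda>x. f x - p x) r)\<^sup>2 \<le> 0 * (nrm M r)\<^sup>2"
    proof (rule nonneg_quadratic)
      fix t
      define g where "g x = f x - p x" for x
      have g: "g \<in> sqi M" unfolding g_def by (intro sqi_diff f p)
      \<comment> \<open>The limit \<open>p\<close> need not belong to \<open>R\<close>, so the
        comparison uses \<open>s n + t r\<close> and pays the distance from \<open>s n\<close> to
        \<open>p\<close>, which tends to 0.\<close>
      have le: "(nrm M g)\<^sup>2 \<le> (nrm M (\<lambda>x. g x - t *\<^sub>R r x) + nrm M (\<lambda>x. s n x - p x))\<^sup>2" for n
      proof -
        have "(nrm M g)\<^sup>2 \<le> Inf (d ` R)" using lim_d unfolding d_def g_def by simp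
        also have "\<dots> \<le> d (\<lambda>x. s n x + t *\<^sub>R r x)"
          by (intro cINF_lower add s scale r) (auto intro!: bdd_belowI[of _ 0] simp: d_def)
        also have "\<dots> = (nrm M (\<lambda>x. (g x - t *\<^sub>R r x) + (p x - s n x)))\<^sup>2"
          by (simp add: d_def g_def algebra_simps)
        also have "\<dots> \<le> (nrm M (\<lambda>x. g x - t *\<^sub>R r x) + nrm M (\<lambda>x. p x - s n x))\<^sup>2"
          by (intro power_mono nrm_triangle sqi_diff sqi_scaleR g rs p sq) auto
        finally show ?thesis by (simp add: nrm_minus_commute[of M p])
      qed
      have "(\<lambda>n. (nrm M (\<lambda>x. g x - t *\<^sub>R r x) + nrm M (\<lambda>x. s n x - p x))\<^sup>2) \<longlonglongrightarrow> (nrm M (\<lambda>x. g x - t *\<^sub>R r x) + 0)\<^sup>2"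
        by (intro tendsto_intros p)
      then have "(nrm M g)\<^sup>2 \<le> (nrm M (\<lambda>x. g x - t *\<^sub>R r x) + 0)\<^sup>2"
        by (rule LIMSEQ_le_const) (use le in blast)
      then show "0 \<le> 0 - 2 * t * ip M (\<lambda>x. f x - p x) r + t\<^sup>2 * (nrm M r)\<^sup>2"
        unfolding g_def[symmetric] using nrm_diff_scaleR[OF g rs, of t] by simp
    qed simp
    then show ?thesis by simp
  qed
  then have 0: "nrm M (\<lambda>x. f x - p x) = 0" by (intro orth sqi_diff f p)
  have "\<forall>\<^sub>F n in sequentially. nrm M (\<lambda>x. s n x - p x) < e"
    using p(2) \<open>e > 0\<close> by (auto dest: order_tendstoD)
  then obtain n where "nrm M (\<lambda>x. s n x - p x) < e" by (auto simp: eventually_sequentially)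
  then have "nrm M (\<lambda>x. f x - s n x) < e"
    using nrm_triangle_diff[OF f p(1) sq, of n] 0 by (simp add: nrm_minus_commute[of M p])
  with s(1) show ?thesis by blast
qed

section \<open>Lebesgue measure\<close>

lemma complete_measure_lebesgue_on:
  assumes "S \<in> sets lebesgue"
  shows "complete_measure (lebesgue_on S)"
proof
  fix A N :: "'a set" assume A: "A \<subseteq> N" "N \<in> null_sets (lebesgue_on S)"
  then have N: "N \<in> null_sets lebesgue" "N \<subseteq> S"
    using assms by (auto simp: null_sets_restrict_space)
  then have "A \<in> sets lebesgue" using A completion.complete by blast
  then show "A \<in> sets (lebesgue_on S)"
    using assms A N by (auto simp: sets_restrict_space_iff)
qed

text \<open>Curves and integrands of the problem are tied to measurable maps only almost everywhere;
  completeness makes them measurable themselves.\<close>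

lemma (in complete_measure) borel_measurable_AE_eq:
  fixes f g :: "'a \<Rightarrow> 'b::{second_countable_topology, metric_space}"
  assumes f: "f \<in> borel_measurable M" and eq: "AE x in M. f x = g x"
  shows "g \<in> borel_measurable M"
proof (rule measurableI)
  fix A :: "'b set" assume "A \<in> sets borel"
  then have "f -` A \<inter> space M \<in> sets M" using f by measurable
  then show "g -` A \<inter> space M \<in> sets M"
    by (rule in_sets_AE[rotated]) (use eq in \<open>auto elim!: eventually_mono\<close>)
qed simp

lemma sigma_finite_lebesgue: "sigma_finite_measure (lebesgue :: 'a::euclidean_space measure)"
proof
  obtain A :: "'a set set" where "countable A" "A \<subseteq> sets lborel" "\<Union>A = space lborel" "\<forall>a\<in>A. emeasure lborel a \<noteq> \<infinity>"
    using lborel.sigma_finite_countable by blast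
  then show "\<exists>A::'a set set. countable A \<and> A \<subseteq> sets lebesgue \<and> \<Union> A = space lebesgue \<and> (\<forall>a\<in>A. emeasure lebesgue a \<noteq> \<infinity>)"
    by (intro exI[of _ A]) (auto simp: subset_eq)
qed

text \<open>Open boxes form an intersection-stable generator of the Borel sets, so vanishing of the
  integral spreads to Borel sets by a Dynkin argument and to Lebesgue sets by completion. It serves
  both the time interval and the domain \<open>G\<close>.\<close>

lemma AE_lebesgue_eq_0_if_box_integrals_0:
  fixes f :: "'a::euclidean_space \<Rightarrow> 'b::{banach, second_countable_topology}"
  assumes f: "integrable lebesgue f"
    and box: "\<And>a b. (LINT x:box a b|lebesgue. f x) = 0"
  shows "AE x in lebesgue. f x = 0"
proof -
  interpret sigma_finite_measure "lebesgue :: 'a measure" by (rule sigma_finite_lebesgue)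
  have si: "set_integrable lebesgue A f" if "A \<in> sets lebesgue" for A
    unfolding set_integrable_def using that f by (rule integrable_mult_indicator)
  \<comment> \<open>Complements in the induction require the total integral, which is reached
    through an exhaustion by cubes.\<close>
  have UNIV: "(LINT x|lebesgue. f x) = 0"
  proof -
    have "(\<lambda>n. LINT x:box (- real n *\<^sub>R One) (real n *\<^sub>R One)|lebesgue. f x) \<longlonglongrightarrow> (LINT x|lebesgue. f x)"
      unfolding set_lebesgue_integral_def
    proof (rule integral_dominated_convergence)
      show "integrable lebesgue (\<lambda>x. norm (f x))" using f by simp
      show "AE x in lebesgue. (\<lambda>n. indicat_real (box (- real n *\<^sub>R One) (real n *\<^sub>R One)) x *\<^sub>R f x) \<longlonglongrightarrow> f x"
      proof (intro AE_I2 tendsto_eventually)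
        fix x :: 'a
        obtain n0 :: nat where n0: "norm x < real n0" using reals_Archimedean2 by blast
        have "x \<in> box (- real n *\<^sub>R One) (real n *\<^sub>R One)" if "n \<ge> n0" for n
        proof -
          have "\<bar>x \<bullet> i\<bar> < real n" if "i \<in> Basis" for i
            using Basis_le_norm[OF that, of x] n0 \<open>n \<ge> n0\<close> by linarith
          then show ?thesis by (force simp: mem_box abs_less_iff minus_less_iff)
        qed
        then show "\<forall>\<^sub>F n in sequentially. indicat_real (box (- real n *\<^sub>R One) (real n *\<^sub>R One)) x *\<^sub>R f x = f x"
          by (intro eventually_sequentiallyI[of n0]) simp
      qed
      show "AE x in lebesgue. norm (indicat_real (box (- real n *\<^sub>R One) (real n *\<^sub>R One)) x *\<^sub>R f x) \<le> norm (f x)" for n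
        by (auto simp: indicator_def)
      show "f \<in> borel_measurable lebesgue" using f by simp
      then show "(\<lambda>x. indicat_real (box (- real n *\<^sub>R One) (real n *\<^sub>R One)) x *\<^sub>R f x) \<in> borel_measurable lebesgue" for n
        by (intro borel_measurable_scaleR borel_measurable_indicator) auto
    qed
    then show ?thesis unfolding box by (rule LIMSEQ_unique[OF _ tendsto_const])
  qed
  have sg: "sigma_sets UNIV (range (\<lambda>(a, b). box a b :: 'a set)) = sets borel"
    unfolding borel_eq_box by simp
  have borel: "(LINT x:A|lebesgue. f x) = 0" if "A \<in> sets borel" for A
  proof -
    have "Int_stable (range (\<lambda>(a, b). box a b :: 'a set))"
      by (auto simp: Int_stable_def box_Int_box)
    moreover have "(range (\<lambda>(a, b). box a b :: 'a set)) \<subseteq> Pow UNIV" by auto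
    moreover have "A \<in> sigma_sets UNIV (range (\<lambda>(a, b). box a b))"
      using that sg by simp
    ultimately show ?thesis
    proof (induction rule: sigma_sets_induct_disjoint)
      case (basic A)
      then show ?case using box by auto
    next
      case empty
      then show ?case by (simp add: set_lebesgue_integral_def)
    next
      case (compl A)
      then have A: "A \<in> sets lebesgue" unfolding sg by simp
      have "(LINT x:UNIV - A|lebesgue. f x) = (LINT x|lebesgue. f x - indicator A x *\<^sub>R f x)"
        unfolding set_lebesgue_integral_def by (intro Bochner_Integration.integral_cong) (auto simp: indicator_def)
      also have "\<dots> = (LINT x|lebesgue. f x) - (LINT x:A|lebesgue. f x)"
        using si[OF A] f unfolding set_lebesgue_integral_def set_integrable_def
        by (intro Bochner_Integration.integral_diff)
      finally show ?case using compl UNIV by simp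
    next
      case (union A)
      have A: "A i \<in> sets lebesgue" for i
        using union(2) unfolding sg by auto
      have "(LINT x:(\<Union>i. A i)|lebesgue. f x) = suminf (\<lambda>i. LINT x:(A i)|lebesgue. f x)"
        by (rule lebesgue_integral_countable_add)
          (use A union(1) in \<open>auto simp: disjoint_family_on_def intro!: si\<close>)
      then show ?case using union by simp
    qed
  qed
  have "AE x in lebesgue. f x = (\<lambda>_. 0) x"
  proof (rule density_unique_banach[OF f])
    fix A :: "'a set" assume "A \<in> sets lebesgue"
    then obtain S N N' where S: "A = S \<union> N" "N \<subseteq> N'" "N' \<in> null_sets lborel" "S \<in> sets lborel"
      by (rule sets_completionE)
    then have "N' \<in> null_sets lebesgue" by (intro null_sets_completionI)
    then have "AE x in lebesgue. x \<notin> N'" by (rule AE_not_in)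
    then have "AE x in lebesgue. indicator A x *\<^sub>R f x = indicator S x *\<^sub>R f x"
      by eventually_elim (use S in \<open>auto simp: indicator_def\<close>)
    moreover have "(\<lambda>x. indicator B x *\<^sub>R f x) \<in> borel_measurable lebesgue" if "B \<in> sets lebesgue" for B
      using f that by (intro borel_measurable_scaleR borel_measurable_indicator) auto
    ultimately have "(LINT x:A|lebesgue. f x) = (LINT x:S|lebesgue. f x)"
      unfolding set_lebesgue_integral_def using \<open>A \<in> sets lebesgue\<close> S(4) by (intro integral_cong_AE) auto
    then show "(LINT x:A|lebesgue. f x) = (LINT x:A|lebesgue. 0)"
      using borel S by (simp add: set_lebesgue_integral_def)
  qed simp
  then show ?thesis by simp
qed

section \<open>Primitives on a time interval\<close>

abbreviation tm :: "real \<Rightarrow> real measure" where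
  "tm T \<equiv> lebesgue_on {0<..<T}"

text \<open>Through the indicator the primitive exists for every real \<open>t\<close> and is
  constant outside \<open>[0, T]\<close>, so continuity can be stated on the whole line.\<close>

definition prim :: "real \<Rightarrow> (real \<Rightarrow> 'b::{banach, second_countable_topology}) \<Rightarrow> real \<Rightarrow> 'b" where
  "prim T w t = (\<integral>s. indicat_real {..t} s *\<^sub>R w s \<partial>tm T)"

text \<open>The adjoint of \<open>prim\<close>, see \<open>integral_prim_post\<close>.\<close>

definition post :: "real \<Rightarrow> (real \<Rightarrow> 'b::{banach, second_countable_topology}) \<Rightarrow> real \<Rightarrow> 'b" where
  "post T w t = (\<integral>s. indicat_real {t..} s *\<^sub>R w s \<partial>tm T)"

lemma finite_measure_tm: "finite_measure (tm T)"
  by (rule finite_measure_lebesgue_on) (simp add: lmeasurable_interval)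

interpretation tm: finite_measure "tm T" for T by (rule finite_measure_tm)
interpretation tm: complete_measure "tm T" for T by (rule complete_measure_lebesgue_on) simp
interpretation tm2: pair_sigma_finite "tm T" "tm T" for T ..

lemma measurable_ident_tm [measurable]: "(\<lambda>t. t) \<in> borel_measurable (tm T)"
  using id_borel_measurable_lebesgue_on[of "{0<..<T}"] by (simp add: id_def)

lemma borel_sets_tm [measurable]: "A \<in> sets borel \<Longrightarrow> (\<lambda>t. indicat_real A t) \<in> borel_measurable (tm T)"
  by (rule measurable_compose[OF measurable_ident_tm]) (rule borel_measurable_indicator)

lemma AE_tm_neq: "AE s in tm T. s \<noteq> (t::real)"
  using AE_completion[OF AE_lborel_singleton[of t]] by (subst AE_restrict_space_iff) (auto elim: eventually_mono)

lemma measure_tm: "T \<ge> 0 \<Longrightarrow> measure (tm T) (space (tm T)) = T"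
  by (simp add: measure_restrict_space)

lemma integrable_indicator_tm:
  "integrable (tm T) w \<Longrightarrow> A \<in> sets borel \<Longrightarrow> integrable (tm T) (\<lambda>s. indicat_real A s *\<^sub>R w s)"
  for w :: "real \<Rightarrow> 'b::{banach, second_countable_topology}"
  by (rule Bochner_Integration.integrable_bound[of _ w]) (auto simp: indicator_def)

lemma prim_add:
  "integrable (tm T) v \<Longrightarrow> integrable (tm T) w \<Longrightarrow> prim T (\<lambda>s. v s + w s) t = prim T v t + prim T w t"
  by (simp add: prim_def scaleR_add_right integrable_indicator_tm)

lemma prim_scaleR: "prim T (\<lambda>s. c *\<^sub>R v s) t = c *\<^sub>R prim T v t"
proof -
  have "prim T (\<lambda>s. c *\<^sub>R v s) t = (\<integral>s. c *\<^sub>R (indicat_real {..t} s *\<^sub>R v s) \<partial>tm T)"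
    by (simp add: prim_def mult.commute)
  then show ?thesis by (simp add: prim_def del: scaleR_scaleR)
qed

lemma prim_diff:
  "integrable (tm T) v \<Longrightarrow> integrable (tm T) w \<Longrightarrow> prim T (\<lambda>s. v s - w s) t = prim T v t - prim T w t"
  by (simp add: prim_def scaleR_diff_right integrable_indicator_tm)

lemma prim_bounded_linear:
  assumes "bounded_linear A" "integrable (tm T) v"
  shows "A (prim T v t) = prim T (\<lambda>s. A (v s)) t"
proof -
  interpret A: bounded_linear A by fact
  show ?thesis unfolding prim_def
    using integral_bounded_linear[OF assms(1) integrable_indicator_tm[OF assms(2)], of "{..t}"] by (simp add: A.scaleR)
qed

lemma prim_mono:
  fixes v w :: "real \<Rightarrow> real"
  assumes "integrable (tm T) v" "integrable (tm T) w" "AE s in tm T. v s \<le> w s"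
  shows "prim T v t \<le> prim T w t"
  unfolding prim_def
  by (intro integral_mono_AE integrable_indicator_tm assms) (use assms(3) in \<open>auto simp: indicator_def elim: eventually_mono\<close>)

lemma continuous_prim:
  fixes w :: "real \<Rightarrow> 'b::{banach, second_countable_topology}"
  assumes w: "integrable (tm T) w"
  shows "continuous_on UNIV (prim T w)"
proof -
  have "(\<lambda>n. prim T w (x n)) \<longlonglongrightarrow> prim T w t" if x: "x \<longlonglongrightarrow> t" for x t
    unfolding prim_def
  proof (rule integral_dominated_convergence)
    show "integrable (tm T) (\<lambda>s. norm (w s))" using w by simp
    \<comment> \<open>The indicators converge at every \<open>s\<close> except possibly the single
      point \<open>s = t\<close>.\<close>
    show "AE s in tm T. (\<lambda>n. indicat_real {..x n} s *\<^sub>R w s) \<longlonglongrightarrow> indicat_real {..t} s *\<^sub>R w s"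
      using AE_tm_neq[of t]
    proof eventually_elim
      case (elim s)
      have "\<forall>\<^sub>F n in sequentially. indicat_real {..x n} s = indicat_real {..t} s"
      proof (cases "s < t")
        case True
        then have "\<forall>\<^sub>F n in sequentially. s < x n" using x by (rule order_tendstoD(1)[rotated])
        then show ?thesis by eventually_elim (use True in auto)
      next
        case False
        then have "t < s" using elim by simp
        then have "\<forall>\<^sub>F n in sequentially. x n < s" using x by (rule order_tendstoD(2)[rotated])
        then show ?thesis by eventually_elim (use False elim in auto)
      qed
      then show ?case by (intro tendsto_eventually) (auto elim: eventually_mono)
    qed
  qed (use w in \<open>auto simp: indicator_def\<close>)
  then show ?thesis
    by (auto simp: continuous_on_def tendsto_at_iff_sequentially comp_def)
qed

lemma measurable_prim [measurable]:
  fixes w :: "real \<Rightarrow> 'b::{banach, second_countable_topology}"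
  assumes "integrable (tm T) w"
  shows "prim T w \<in> borel_measurable (tm T)"
  by (rule measurable_compose[OF measurable_ident_tm borel_measurable_continuous_onI[OF continuous_prim[OF assms]]])

lemma post_eq:
  fixes w :: "real \<Rightarrow> 'b::{banach, second_countable_topology}"
  assumes w: "integrable (tm T) w"
  shows "post T w t = (\<integral>s. w s \<partial>tm T) - prim T w t"
proof -
  have "post T w t = (\<integral>s. w s - indicat_real {..t} s *\<^sub>R w s \<partial>tm T)"
    unfolding post_def
  proof (rule integral_cong_AE)
    show "AE s in tm T. indicat_real {t..} s *\<^sub>R w s = w s - indicat_real {..t} s *\<^sub>R w s"
      using AE_tm_neq[of t] by eventually_elim (auto simp: indicator_def)
  qed (use w in measurable)
  also have "\<dots> = (\<integral>s. w s \<partial>tm T) - prim T w t"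
    unfolding prim_def by (intro Bochner_Integration.integral_diff w integrable_indicator_tm) simp
  finally show ?thesis .
qed

lemma measurable_post [measurable]:
  fixes w :: "real \<Rightarrow> 'b::{banach, second_countable_topology}"
  assumes "integrable (tm T) w"
  shows "post T w \<in> borel_measurable (tm T)"
  unfolding post_eq[OF assms, abs_def] using assms by measurable

lemma norm_prim_le:
  fixes w :: "real \<Rightarrow> 'b::{banach, second_countable_topology}"
  assumes w: "integrable (tm T) w"
  shows "norm (prim T w t) \<le> (\<integral>s. norm (w s) \<partial>tm T)"
proof -
  have "norm (prim T w t) \<le> (\<integral>s. norm (indicat_real {..t} s *\<^sub>R w s) \<partial>tm T)"
    unfolding prim_def by (rule integral_norm_bound)
  also have "\<dots> \<le> (\<integral>s. norm (w s) \<partial>tm T)"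
    by (intro integral_mono Bochner_Integration.integrable_norm integrable_indicator_tm w) (auto simp: indicator_def)
  finally show ?thesis .
qed

lemma norm_post_le:
  fixes w :: "real \<Rightarrow> 'b::{banach, second_countable_topology}"
  assumes w: "integrable (tm T) w"
  shows "norm (post T w t) \<le> (\<integral>s. norm (w s) \<partial>tm T)"
proof -
  have "norm (post T w t) \<le> (\<integral>s. norm (indicat_real {t..} s *\<^sub>R w s) \<partial>tm T)"
    unfolding post_def by (rule integral_norm_bound)
  also have "\<dots> \<le> (\<integral>s. norm (w s) \<partial>tm T)"
    by (intro integral_mono Bochner_Integration.integrable_norm integrable_indicator_tm w) (auto simp: indicator_def)
  finally show ?thesis .
qed

lemma sqi_bounded:
  fixes f :: "real \<Rightarrow> 'b::separable_hilbert"
  assumes "f \<in> borel_measurable (tm T)" "\<And>t. norm (f t) \<le> K"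
  shows "f \<in> sqi (tm T)"
proof -
  have "integrable (tm T) (\<lambda>x. (norm (f x))\<^sup>2)"
    by (rule tm.integrable_const_bound[of _ "K\<^sup>2"]) (use assms in \<open>auto intro!: power_mono AE_I2\<close>)
  then show ?thesis using assms by (simp add: sqi_def)
qed

lemma sqi_prim: "integrable (tm T) w \<Longrightarrow> prim T w \<in> sqi (tm T)" for w :: "real \<Rightarrow> 'b::separable_hilbert"
  by (rule sqi_bounded[OF measurable_prim norm_prim_le])

lemma sqi_post: "integrable (tm T) w \<Longrightarrow> post T w \<in> sqi (tm T)" for w :: "real \<Rightarrow> 'b::separable_hilbert"
  by (rule sqi_bounded[OF measurable_post norm_post_le])

text \<open>Fubini on the triangle \<open>s \<le> t\<close>. This is the integration by parts behind
  the energy identities and both Gronwall arguments.\<close>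

lemma integral_prim_post:
  fixes g w :: "real \<Rightarrow> 'b::separable_hilbert"
  assumes g[measurable]: "integrable (tm T) g" and w[measurable]: "integrable (tm T) w"
  shows "(\<integral>t. g t \<bullet> prim T w t \<partial>tm T) = (\<integral>s. post T g s \<bullet> w s \<partial>tm T)"
proof -
  let ?F = "\<lambda>t s. indicat_real {(t, s). s \<le> t} (t, s) * (g t \<bullet> w s)"
  have [measurable]: "(\<lambda>p. g (fst p)) \<in> borel_measurable (tm T \<Otimes>\<^sub>M tm T)"
    "(\<lambda>p. w (snd p)) \<in> borel_measurable (tm T \<Otimes>\<^sub>M tm T)"
    "(\<lambda>p. fst p) \<in> borel_measurable (tm T \<Otimes>\<^sub>M tm T)"
    "(\<lambda>p. snd p) \<in> borel_measurable (tm T \<Otimes>\<^sub>M tm T)"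
    using g w by (auto intro!: measurable_compose[OF measurable_fst] measurable_compose[OF measurable_snd])
  have eqF: "case_prod ?F = (\<lambda>p. (if snd p \<le> fst p then 1 else 0) * (g (fst p) \<bullet> w (snd p)))"
    by (auto simp: fun_eq_iff indicator_def)
  have meas: "case_prod ?F \<in> borel_measurable (tm T \<Otimes>\<^sub>M tm T)"
    unfolding eqF by measurable
  have int: "integrable (tm T \<Otimes>\<^sub>M tm T) (\<lambda>p. norm (g (fst p)) * norm (w (snd p)))"
    by (rule tm2.Fubini_integrable) (use g w in auto)
  have F: "integrable (tm T \<Otimes>\<^sub>M tm T) (case_prod ?F)"
  proof (rule Bochner_Integration.integrable_bound[OF int meas])
    show "AE p in tm T \<Otimes>\<^sub>M tm T. norm (case_prod ?F p) \<le> norm (norm (g (fst p)) * norm (w (snd p)))"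
      by (auto simp: indicator_def Cauchy_Schwarz_ineq2)
  qed
  have 1: "(\<integral>s. ?F t s \<partial>tm T) = g t \<bullet> prim T w t" for t
  proof -
    have "(\<integral>s. ?F t s \<partial>tm T) = (\<integral>s. g t \<bullet> (indicat_real {..t} s *\<^sub>R w s) \<partial>tm T)"
      by (intro Bochner_Integration.integral_cong) (auto simp: indicator_def)
    also have "\<dots> = g t \<bullet> prim T w t"
      unfolding prim_def by (rule integral_inner_right) (use w in \<open>simp add: integrable_indicator_tm\<close>)
    finally show ?thesis .
  qed
  have 2: "(\<integral>t. ?F t s \<partial>tm T) = post T g s \<bullet> w s" for s
  proof -
    have "(\<integral>t. ?F t s \<partial>tm T) = (\<integral>t. (indicat_real {s..} t *\<^sub>R g t) \<bullet> w s \<partial>tm T)"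
      by (intro Bochner_Integration.integral_cong) (auto simp: indicator_def)
    also have "\<dots> = post T g s \<bullet> w s"
      unfolding post_def by (rule integral_inner_left) (use g in \<open>simp add: integrable_indicator_tm\<close>)
    finally show ?thesis .
  qed
  show ?thesis using tm2.Fubini_integral[OF F] unfolding 1 2 by simp
qed

text \<open>In \<open>integral_prim_post\<close> with both maps equal to \<open>w\<close>, the tail
  integral is the total minus the primitive, so twice the left side is the squared norm of the
  total. This replaces differentiating the square of the primitive.\<close>

lemma integral_self_prim:
  fixes w :: "real \<Rightarrow> 'b::separable_hilbert"
  assumes w: "integrable (tm T) w"
  shows "(\<integral>t. w t \<bullet> prim T w t \<partial>tm T) = (norm (\<integral>t. w t \<partial>tm T))\<^sup>2 / 2"
    and "(\<integral>t. post T w t \<bullet> w t \<partial>tm T) = (norm (\<integral>t. w t \<partial>tm T))\<^sup>2 / 2"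
proof -
  have i: "integrable (tm T) (\<lambda>t. w t \<bullet> prim T w t)"
  proof (rule Bochner_Integration.integrable_bound)
    show "integrable (tm T) (\<lambda>t. (\<integral>s. norm (w s) \<partial>tm T) * norm (w t))" using w by simp
    show "(\<lambda>t. w t \<bullet> prim T w t) \<in> borel_measurable (tm T)" using w by measurable
    show "AE t in tm T. norm (w t \<bullet> prim T w t) \<le> norm ((\<integral>s. norm (w s) \<partial>tm T) * norm (w t))"
    proof (intro AE_I2)
      fix t
      have "norm (w t \<bullet> prim T w t) \<le> norm (w t) * norm (prim T w t)" by (simp add: Cauchy_Schwarz_ineq2)
      also have "\<dots> \<le> norm (w t) * (\<integral>s. norm (w s) \<partial>tm T)" by (intro mult_left_mono norm_prim_le w) simp
      finally show "norm (w t \<bullet> prim T w t) \<le> norm ((\<integral>s. norm (w s) \<partial>tm T) * norm (w t))"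
        by (simp add: mult.commute)
    qed
  qed
  have "(\<integral>t. post T w t \<bullet> w t \<partial>tm T) = (\<integral>t. (\<integral>s. w s \<partial>tm T) \<bullet> w t - w t \<bullet> prim T w t \<partial>tm T)"
    by (intro Bochner_Integration.integral_cong) (simp_all add: post_eq w inner_diff_left inner_diff_right inner_commute)
  also have "\<dots> = (\<integral>s. w s \<partial>tm T) \<bullet> (\<integral>s. w s \<partial>tm T) - (\<integral>t. w t \<bullet> prim T w t \<partial>tm T)"
    using i w by simp
  finally show "(\<integral>t. w t \<bullet> prim T w t \<partial>tm T) = (norm (\<integral>t. w t \<partial>tm T))\<^sup>2 / 2"
    "(\<integral>t. post T w t \<bullet> w t \<partial>tm T) = (norm (\<integral>t. w t \<partial>tm T))\<^sup>2 / 2"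
    using integral_prim_post[OF w w] by (simp_all add: power2_norm_eq_inner)
qed

section \<open>A weighted Gronwall argument\<close>

lemma exp_tail_integral:
  fixes k s T :: real
  assumes "k > 0" "s \<le> T"
  shows "(\<integral>t. indicator {s..T} t * exp (- (2 * k * t)) \<partial>lborel) \<le> exp (- (2 * k * s)) / (2 * k)"
    and "0 \<le> s \<Longrightarrow> (\<integral>t. indicator {0..s} t * exp (2 * k * t) \<partial>lborel) \<le> exp (2 * k * s) / (2 * k)"
proof -
  have "(\<integral>t. exp (- (2 * k * t)) * indicator {s..T} t \<partial>lborel) = (- exp (- (2 * k * T)) / (2 * k)) - (- exp (- (2 * k * s)) / (2 * k))"
    by (rule integral_FTC_Icc_real) (use assms in \<open>auto intro!: derivative_eq_intros continuous_intros simp: field_simps\<close>)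
  then show "(\<integral>t. indicator {s..T} t * exp (- (2 * k * t)) \<partial>lborel) \<le> exp (- (2 * k * s)) / (2 * k)"
    using assms(1) by (simp add: mult.commute[of "indicator _ _"])
  assume "0 \<le> s"
  have "(\<integral>t. exp (2 * k * t) * indicator {0..s} t \<partial>lborel) = (exp (2 * k * s) / (2 * k)) - (exp (2 * k * 0) / (2 * k))"
    by (rule integral_FTC_Icc_real) (use assms \<open>0 \<le> s\<close> in \<open>auto intro!: derivative_eq_intros continuous_intros simp: field_simps\<close>)
  then show "(\<integral>t. indicator {0..s} t * exp (2 * k * t) \<partial>lborel) \<le> exp (2 * k * s) / (2 * k)"
    using assms(1) by (simp add: mult.commute[of "indicator _ _"])
qed

text \<open>Passes from the completed measure on the open interval to \<open>lborel\<close>, where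
  the exponential weights are integrated by the fundamental theorem of calculus.\<close>

lemma integral_tm_le:
  fixes f :: "real \<Rightarrow> real"
  assumes "continuous_on UNIV f" "\<And>x. f x \<ge> 0" "\<And>x. x \<in> A \<Longrightarrow> 0 < x \<Longrightarrow> x < T \<Longrightarrow> x \<in> {a..b}" "A \<in> sets borel"
  shows "(\<integral>t. indicat_real A t * f t \<partial>tm T) \<le> (\<integral>t. indicator {a..b} t * f t \<partial>lborel)"
proof -
  have [measurable]: "f \<in> borel_measurable borel" using assms(1) by (rule borel_measurable_continuous_onI)
  note [measurable] = assms(4)
  have "(\<integral>t. indicat_real A t * f t \<partial>tm T) = (\<integral>t. indicator {0<..<T} t * (indicator A t * f t) \<partial>lebesgue)"
    by (subst integral_restrict_space) auto
  also have "\<dots> = (\<integral>t. indicator {0<..<T} t * (indicator A t * f t) \<partial>lborel)"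
    by (subst integral_completion) auto
  also have "\<dots> \<le> (\<integral>t. indicator {a..b} t * f t \<partial>lborel)"
  proof (rule integral_mono_AE')
    have "continuous_on {a..b} f" using assms(1) continuous_on_subset by blast
    from borel_integrable_atLeastAtMost'[OF this]
    show "integrable lborel (\<lambda>t. indicator {a..b} t * f t)" by (simp add: set_integrable_def)
  qed (use assms in \<open>auto simp: indicator_def\<close>)
  finally show ?thesis .
qed

text \<open>Multiply by \<open>exp (- 2 k t)\<close> and integrate. Fubini moves the primitive onto
  the weight, whose tail integral is at most the weight divided by \<open>2 * k\<close>, so the
  integral term is half of the left side and can be absorbed. The inequality is used only almost
  everywhere and nothing is differentiated.\<close>

lemma gronwall:
  fixes \<phi> :: "real \<Rightarrow> real"
  assumes \<phi>: "integrable (tm T) \<phi>" "AE t in tm T. 0 \<le> \<phi> t" and k: "k > 0" and T: "T > 0" and a: "a \<ge> 0"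
    and le: "AE t in tm T. \<phi> t \<le> a + k * prim T \<phi> t"
  shows "(\<integral>t. \<phi> t \<partial>tm T) \<le> 2 * a * T * exp (2 * k * T)"
proof -
  define m where "m t = exp (- (2 * k * t))" for t
  have [measurable]: "\<phi> \<in> borel_measurable (tm T)" "m \<in> borel_measurable (tm T)"
    using \<phi> unfolding m_def by measurable
  have m1: "AE t in tm T. 0 \<le> m t \<and> m t \<le> 1"
    using k by (intro AE_I2) (auto simp: m_def)
  have im: "integrable (tm T) m"
    by (rule tm.integrable_const_bound[of _ 1]) (use m1 in auto)
  have ib: "integrable (tm T) (\<lambda>t. m t * f t)" if "integrable (tm T) f" for f :: "real \<Rightarrow> real"
  proof (rule Bochner_Integration.integrable_bound[OF that])
    show "AE t in tm T. norm (m t * f t) \<le> norm (f t)"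
      using m1 by eventually_elim (simp add: abs_mult mult_left_le_one_le)
  qed (use that in measurable)
  have ip: "integrable (tm T) (prim T \<phi>)" using sqi_prim[OF \<phi>(1)] by (rule tm.sqi_imp_integrable)
  have "(\<integral>t. m t * \<phi> t \<partial>tm T) \<le> (\<integral>t. a * m t + k * (m t * prim T \<phi> t) \<partial>tm T)"
  proof (rule integral_mono_AE)
    show "AE t in tm T. m t * \<phi> t \<le> a * m t + k * (m t * prim T \<phi> t)"
      using le
    proof eventually_elim
      case (elim t)
      then have "m t * \<phi> t \<le> m t * (a + k * prim T \<phi> t)" by (intro mult_left_mono) (auto simp: m_def)
      then show ?case by (simp add: algebra_simps)
    qed
  qed (use ib[OF \<phi>(1)] ib[OF ip] im in auto)
  also have "\<dots> = a * (\<integral>t. m t \<partial>tm T) + k * (\<integral>t. m t \<bullet> prim T \<phi> t \<partial>tm T)"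
    using ib[OF ip] im by simp
  also have "(\<integral>t. m t \<bullet> prim T \<phi> t \<partial>tm T) = (\<integral>t. post T m t \<bullet> \<phi> t \<partial>tm T)"
    by (rule integral_prim_post[OF im \<phi>(1)])
  also have "\<dots> \<le> (\<integral>t. (m t * \<phi> t) / (2 * k) \<partial>tm T)"
  proof (rule integral_mono_AE)
    have post: "post T m t \<le> m t / (2 * k)" if "t < T" for t
    proof -
      have "post T m t = (\<integral>s. indicat_real {t..} s * exp (- (2 * k * s)) \<partial>tm T)" by (simp add: post_def m_def)
      also have "\<dots> \<le> (\<integral>s. indicator {t..T} s * exp (- (2 * k * s)) \<partial>lborel)"
        by (rule integral_tm_le) (auto intro!: continuous_intros)
      also have "\<dots> \<le> m t / (2 * k)" unfolding m_def using that k by (intro exp_tail_integral) auto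
      finally show ?thesis .
    qed
    show "AE t in tm T. post T m t \<bullet> \<phi> t \<le> (m t * \<phi> t) / (2 * k)"
      using \<phi>(2) AE_space
    proof eventually_elim
      case (elim t)
      then have "post T m t * \<phi> t \<le> (m t / (2 * k)) * \<phi> t" by (intro mult_right_mono post) auto
      then show ?case by simp
    qed
    show "integrable (tm T) (\<lambda>t. post T m t \<bullet> \<phi> t)"
    proof (rule Bochner_Integration.integrable_bound[OF integrable_mult_right[OF \<phi>(1), of "\<integral>s. norm (m s) \<partial>tm T"]])
      show "(\<lambda>t. post T m t \<bullet> \<phi> t) \<in> borel_measurable (tm T)" using im by measurable
      show "AE t in tm T. norm (post T m t \<bullet> \<phi> t) \<le> norm ((\<integral>s. norm (m s) \<partial>tm T) * \<phi> t)"
        using norm_post_le[OF im] by (intro AE_I2) (auto simp: abs_mult intro!: mult_right_mono)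
    qed
  qed (use ib[OF \<phi>(1)] in auto)
  finally have "(\<integral>t. m t * \<phi> t \<partial>tm T) \<le> 2 * (a * (\<integral>t. m t \<partial>tm T))"
    using k by (simp add: field_simps)
  also have "\<dots> \<le> 2 * (a * T)"
  proof -
    have "(\<integral>t. m t \<partial>tm T) \<le> (\<integral>t. 1 \<partial>tm T)"
      by (rule integral_mono_AE) (use im m1 in auto)
    also have "\<dots> = T" using measure_tm[of T] T by simp
    finally show ?thesis using a by (simp add: mult_left_mono)
  qed
  finally have 1: "(\<integral>t. m t * \<phi> t \<partial>tm T) \<le> 2 * (a * T)" .
  have "exp (- (2 * k * T)) * (\<integral>t. \<phi> t \<partial>tm T) = (\<integral>t. exp (- (2 * k * T)) * \<phi> t \<partial>tm T)" by simp
  also have "\<dots> \<le> (\<integral>t. m t * \<phi> t \<partial>tm T)"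
  proof (rule integral_mono_AE)
    show "AE t in tm T. exp (- (2 * k * T)) * \<phi> t \<le> m t * \<phi> t"
      using \<phi>(2) AE_space
      by eventually_elim (use k in \<open>auto simp: m_def intro!: mult_right_mono\<close>)
  qed (use ib[OF \<phi>(1)] \<phi> in auto)
  finally have "exp (- (2 * k * T)) * (\<integral>t. \<phi> t \<partial>tm T) \<le> 2 * (a * T)" using 1 by linarith
  then show ?thesis by (simp add: exp_minus field_simps)
qed

text \<open>The mirror image, with the growing weight \<open>exp (2 k t)\<close>. There is no
  additive term, so absorbing half of the left side leaves nothing.\<close>

lemma gronwall_backward:
  fixes \<phi> :: "real \<Rightarrow> real"
  assumes \<phi>: "integrable (tm T) \<phi>" "AE t in tm T. 0 \<le> \<phi> t" and k: "k > 0"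
    and le: "AE t in tm T. \<phi> t \<le> k * post T \<phi> t"
  shows "(\<integral>t. \<phi> t \<partial>tm T) \<le> 0"
proof -
  define m where "m t = exp (2 * k * t)" for t
  have [measurable]: "\<phi> \<in> borel_measurable (tm T)" "m \<in> borel_measurable (tm T)"
    using \<phi> unfolding m_def by measurable
  have m1: "AE t in tm T. 1 \<le> m t \<and> m t \<le> exp (2 * k * T)"
    using AE_space by eventually_elim (use k in \<open>auto simp: m_def\<close>)
  have im: "integrable (tm T) m"
    by (rule tm.integrable_const_bound[of _ "exp (2 * k * T)"]) (rule AE_mp[OF m1], auto)
  have ib: "integrable (tm T) (\<lambda>t. m t * f t)" if "integrable (tm T) f" for f :: "real \<Rightarrow> real"
  proof (rule Bochner_Integration.integrable_bound[OF integrable_mult_right[OF that, of "exp (2 * k * T)"]])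
    show "AE t in tm T. norm (m t * f t) \<le> norm (exp (2 * k * T) * f t)"
      using m1 by eventually_elim (simp add: abs_mult mult_right_mono)
  qed (use that in measurable)
  have ip: "integrable (tm T) (post T \<phi>)" using sqi_post[OF \<phi>(1)] by (rule tm.sqi_imp_integrable)
  have "(\<integral>t. m t * \<phi> t \<partial>tm T) \<le> (\<integral>t. k * (m t * post T \<phi> t) \<partial>tm T)"
  proof (rule integral_mono_AE)
    show "AE t in tm T. m t * \<phi> t \<le> k * (m t * post T \<phi> t)"
      using le
    proof eventually_elim
      case (elim t)
      then have "m t * \<phi> t \<le> m t * (k * post T \<phi> t)" by (intro mult_left_mono) (auto simp: m_def)
      then show ?case by (simp add: algebra_simps)
    qed
  qed (use ib[OF \<phi>(1)] ib[OF ip] im in auto)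
  also have "\<dots> = k * (\<integral>t. post T \<phi> t \<bullet> m t \<partial>tm T)"
    by (simp add: mult.commute)
  also have "(\<integral>t. post T \<phi> t \<bullet> m t \<partial>tm T) = (\<integral>t. \<phi> t \<bullet> prim T m t \<partial>tm T)"
    by (rule integral_prim_post[OF \<phi>(1) im, symmetric])
  also have "\<dots> \<le> (\<integral>t. (m t * \<phi> t) / (2 * k) \<partial>tm T)"
  proof (rule integral_mono_AE)
    have prim: "prim T m t \<le> m t / (2 * k)" if "0 < t" "t < T" for t
    proof -
      have "prim T m t = (\<integral>s. indicat_real {..t} s * exp (2 * k * s) \<partial>tm T)" by (simp add: prim_def m_def)
      also have "\<dots> \<le> (\<integral>s. indicator {0..t} s * exp (2 * k * s) \<partial>lborel)"
        by (rule integral_tm_le) (auto intro!: continuous_intros)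
      also have "\<dots> \<le> m t / (2 * k)" unfolding m_def using that k by (intro exp_tail_integral(2)[of k t T]) auto
      finally show ?thesis .
    qed
    show "AE t in tm T. \<phi> t \<bullet> prim T m t \<le> (m t * \<phi> t) / (2 * k)"
      using \<phi>(2) AE_space
    proof eventually_elim
      case (elim t)
      then have "prim T m t * \<phi> t \<le> (m t / (2 * k)) * \<phi> t" by (intro mult_right_mono prim) auto
      then show ?case by (simp add: mult.commute)
    qed
    show "integrable (tm T) (\<lambda>t. \<phi> t \<bullet> prim T m t)"
    proof (rule Bochner_Integration.integrable_bound[OF integrable_mult_right[OF \<phi>(1), of "\<integral>s. norm (m s) \<partial>tm T"]])
      show "(\<lambda>t. \<phi> t \<bullet> prim T m t) \<in> borel_measurable (tm T)" using im by measurable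
      show "AE t in tm T. norm (\<phi> t \<bullet> prim T m t) \<le> norm ((\<integral>s. norm (m s) \<partial>tm T) * \<phi> t)"
        using norm_prim_le[OF im] by (intro AE_I2) (auto simp: abs_mult mult.commute[of "\<bar>\<phi> _\<bar>"] intro!: mult_right_mono)
    qed
  qed (use ib[OF \<phi>(1)] in auto)
  finally have 1: "(\<integral>t. m t * \<phi> t \<partial>tm T) \<le> 0"
    using k by (simp add: field_simps)
  have "(\<integral>t. \<phi> t \<partial>tm T) \<le> (\<integral>t. m t * \<phi> t \<partial>tm T)"
  proof (rule integral_mono_AE)
    show "AE t in tm T. \<phi> t \<le> m t * \<phi> t"
      using \<phi>(2) m1 by eventually_elim (simp add: mult_le_cancel_right1)
  qed (use ib[OF \<phi>(1)] \<phi> in auto)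
  with 1 show ?thesis by linarith
qed

section \<open>Abstract parabolic equations\<close>

lemma prim_end: "prim T w T = (\<integral>s. w s \<partial>tm T)"
  unfolding prim_def by (intro Bochner_Integration.integral_cong) auto

lemma post_begin: "post T w 0 = (\<integral>s. w s \<partial>tm T)"
  unfolding post_def by (intro Bochner_Integration.integral_cong) auto

lemma prim_cong_AE:
  fixes v w :: "real \<Rightarrow> 'b::{banach, second_countable_topology}"
  assumes "v \<in> borel_measurable (tm T)" "w \<in> borel_measurable (tm T)" "AE s in tm T. v s = w s"
  shows "prim T v t = prim T w t"
  unfolding prim_def using assms by (intro integral_cong_AE borel_measurable_scaleR borel_sets_tm) auto

lemma prim_indicator: "t \<le> \<tau> \<Longrightarrow> prim T (\<lambda>s. indicat_real {..\<tau>} s *\<^sub>R v s) t = prim T v t"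
  unfolding prim_def by (intro Bochner_Integration.integral_cong) (auto simp: indicator_def)

lemma post_indicator: "\<tau> \<le> t \<Longrightarrow> post T (\<lambda>s. indicat_real {\<tau>..} s *\<^sub>R v s) t = post T v t"
  unfolding post_def by (intro Bochner_Integration.integral_cong) (auto simp: indicator_def)

lemma prim_cmult: "prim T (\<lambda>s. c * v s) t = c * prim T v t" for c :: real
  using prim_scaleR[of T c v t] by simp

lemma post_cmult: "post T (\<lambda>s. c * v s) t = c * post T v t" for c :: real
proof -
  have "post T (\<lambda>s. c * v s) t = (\<integral>s. c * (indicat_real {t..} s *\<^sub>R v s) \<partial>tm T)"
    by (simp add: post_def mult.left_commute)
  then show ?thesis by (simp add: post_def)
qed

lemma post_add:
  "integrable (tm T) v \<Longrightarrow> integrable (tm T) w \<Longrightarrow> post T (\<lambda>s. v s + w s) t = post T v t + post T w t"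
  by (simp add: post_def scaleR_add_right integrable_indicator_tm)

text \<open>Cutting \<open>v\<close> off after \<open>\<tau>\<close> does not change its primitive
  up to \<open>\<tau>\<close> and reduces the claim to the identity for the full interval.\<close>

lemma prim_self:
  fixes v :: "real \<Rightarrow> 'b::separable_hilbert"
  assumes v: "integrable (tm T) v"
  shows "prim T (\<lambda>t. v t \<bullet> prim T v t) \<tau> = (norm (prim T v \<tau>))\<^sup>2 / 2"
proof -
  let ?v = "\<lambda>s. indicat_real {..\<tau>} s *\<^sub>R v s"
  have "prim T (\<lambda>t. v t \<bullet> prim T v t) \<tau> = (\<integral>t. ?v t \<bullet> prim T ?v t \<partial>tm T)"
  proof -
    have "indicat_real {..\<tau>} t *\<^sub>R (v t \<bullet> prim T v t) = ?v t \<bullet> prim T ?v t" for t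
      by (cases "t \<le> \<tau>") (simp_all add: prim_indicator)
    then show ?thesis by (simp only: prim_def[of _ _ \<tau>])
  qed
  also have "\<dots> = (norm (\<integral>t. ?v t \<partial>tm T))\<^sup>2 / 2"
    by (intro integral_self_prim integrable_indicator_tm v) simp
  finally show ?thesis by (simp add: prim_def)
qed

lemma post_self:
  fixes v :: "real \<Rightarrow> 'b::separable_hilbert"
  assumes v: "integrable (tm T) v"
  shows "post T (\<lambda>t. post T v t \<bullet> v t) \<tau> = (norm (post T v \<tau>))\<^sup>2 / 2"
proof -
  let ?v = "\<lambda>s. indicat_real {\<tau>..} s *\<^sub>R v s"
  have "post T (\<lambda>t. post T v t \<bullet> v t) \<tau> = (\<integral>t. post T ?v t \<bullet> ?v t \<partial>tm T)"
  proof -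
    have "indicat_real {\<tau>..} t *\<^sub>R (post T v t \<bullet> v t) = post T ?v t \<bullet> ?v t" for t
      by (cases "\<tau> \<le> t") (simp_all add: post_indicator)
    then show ?thesis by (simp only: post_def[of _ _ \<tau>])
  qed
  also have "\<dots> = (norm (\<integral>t. ?v t \<partial>tm T))\<^sup>2 / 2"
    by (intro integral_self_prim integrable_indicator_tm v) simp
  finally show ?thesis by (simp add: post_def)
qed

lemma post_bounded_linear:
  assumes "bounded_linear A" "integrable (tm T) v"
  shows "A (post T v t) = post T (\<lambda>s. A (v s)) t"
proof -
  interpret A: bounded_linear A by fact
  show ?thesis unfolding post_def
    using integral_bounded_linear[OF assms(1) integrable_indicator_tm[OF assms(2)], of "{t..}"] by (simp add: A.scaleR)
qed

lemma post_mono: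
  fixes v w :: "real \<Rightarrow> real"
  assumes "integrable (tm T) v" "integrable (tm T) w" "AE s in tm T. v s \<le> w s"
  shows "post T v t \<le> post T w t"
  unfolding post_def
  by (intro integral_mono_AE integrable_indicator_tm assms) (use assms(3) in \<open>auto simp: indicator_def elim: eventually_mono\<close>)

lemma AE_0_if_prim_0:
  fixes g :: "real \<Rightarrow> 'b::{banach, second_countable_topology}"
  assumes g: "integrable (tm T) g" and 0: "\<And>t. prim T g t = 0"
  shows "AE t in tm T. g t = 0"
proof -
  have "AE t in lebesgue. indicat_real {0<..<T} t *\<^sub>R g t = 0"
  proof (rule AE_lebesgue_eq_0_if_box_integrals_0)
    show "integrable lebesgue (\<lambda>t. indicat_real {0<..<T} t *\<^sub>R g t)"
      using g by (subst (asm) integrable_restrict_space) auto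
    fix a b :: real
    show "(LINT t:box a b|lebesgue. indicat_real {0<..<T} t *\<^sub>R g t) = 0"
    proof (cases "a < b")
      case True
      have "(LINT t:box a b|lebesgue. indicat_real {0<..<T} t *\<^sub>R g t) = (\<integral>t. indicat_real {a<..<b} t *\<^sub>R g t \<partial>tm T)"
        unfolding set_lebesgue_integral_def by (subst integral_restrict_space) (auto simp: ac_simps box_real)
      also have "\<dots> = (\<integral>t. indicat_real {..b} t *\<^sub>R g t - indicat_real {..a} t *\<^sub>R g t \<partial>tm T)"
      proof (rule integral_cong_AE)
        show "AE t in tm T. indicat_real {a<..<b} t *\<^sub>R g t = indicat_real {..b} t *\<^sub>R g t - indicat_real {..a} t *\<^sub>R g t"
          using AE_tm_neq[of b] by eventually_elim (use True in \<open>auto simp: indicator_def\<close>)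
      qed (use g in measurable)
      also have "\<dots> = prim T g b - prim T g a"
        unfolding prim_def by (intro Bochner_Integration.integral_diff integrable_indicator_tm g) auto
      finally show ?thesis using 0 by simp
    qed (simp add: set_lebesgue_integral_def)
  qed
  then show ?thesis by (subst AE_restrict_space_iff) (auto elim!: eventually_mono simp: indicator_def)
qed

text \<open>The tail integral vanishes only almost everywhere. Since \<open>prim T g\<close> is
  continuous, the set where it equals the total integral is closed and hence contains all of
  \<open>[0, T]\<close>; at time 0 the total itself is seen to be 0.\<close>

lemma AE_0_if_post_0:
  fixes g :: "real \<Rightarrow> 'b::{banach, second_countable_topology}"
  assumes T: "T > 0" and g: "integrable (tm T) g" and 0: "AE t in tm T. post T g t = 0"
  shows "AE t in tm T. g t = 0"
proof (rule AE_0_if_prim_0[OF g])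
  let ?c = "\<integral>s. g s \<partial>tm T"
  let ?C = "{t. prim T g t = ?c}"
  have C: "closed ?C" by (intro closed_Collect_eq continuous_prim g continuous_on_const)
  have "AE t in lebesgue. t \<in> {0<..<T} \<longrightarrow> t \<in> ?C"
    using 0 by (subst (asm) AE_restrict_space_iff) (auto simp: post_eq g elim!: eventually_mono)
  then have "{0<..<T} \<subseteq> ?C"
    using mem_closed_if_AE_lebesgue_open[of "{0<..<T}" ?C] C by auto
  then have sub: "{0..T} \<subseteq> ?C"
    using closure_minimal[OF _ C, of "{0<..<T}"] T by simp
  have le0: "prim T g t = 0" if "t \<le> 0" for t
  proof -
    have "prim T g t = (\<integral>s. 0 \<partial>tm T)"
      unfolding prim_def using that by (intro Bochner_Integration.integral_cong) auto
    then show ?thesis by simp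
  qed
  then have c: "?c = 0" using sub T by force
  fix t
  consider "t \<le> 0" | "t \<in> {0..T}" | "t > T" by force
  then show "prim T g t = 0"
  proof cases
    case 3
    then have "prim T g t = ?c"
      unfolding prim_def by (intro Bochner_Integration.integral_cong) auto
    then show ?thesis using c by simp
  qed (use le0 sub c in auto)
qed

text \<open>\<open>'v\<close> is the form space, \<open>'h\<close> the pivot space, and
  \<open>A\<close> represents the bilinear form through the inner product of \<open>'v\<close>. The
  equation is \<open>(\<iota> u)' + A u = f\<close>, tested against \<open>'v\<close>. The map
  \<open>\<iota>\<close> may have a kernel, as it will after composition with a projection.\<close>

locale parabolic =
  fixes \<iota> :: "'v::separable_hilbert \<Rightarrow> 'h::separable_hilbert" and A :: "'v \<Rightarrow> 'v" and T \<delta> \<Lambda> :: real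
  assumes \<iota>: "bounded_linear \<iota>" and A: "bounded_linear A" and T: "T > 0" and \<delta>: "\<delta> > 0" and \<Lambda>: "\<Lambda> > 0"
    and garding: "\<delta> * (norm x)\<^sup>2 \<le> A x \<bullet> x + \<Lambda> * (norm (\<iota> x))\<^sup>2"
    and dense: "closure (range \<iota>) = UNIV"
begin

sublocale \<iota>: bounded_linear \<iota> by (rule \<iota>)
sublocale A: bounded_linear A by (rule A)

text \<open>The adjoint of \<open>\<iota>\<close> composed with \<open>\<iota>\<close>: it carries a
  time derivative with values in \<open>'v\<close> into the dual, which Riesz identifies with
  \<open>'v\<close>.\<close>

definition J :: "'v \<Rightarrow> 'v" where
  "J = (SOME J. bounded_linear J \<and> (\<forall>x y. \<iota> x \<bullet> \<iota> y = J x \<bullet> y))"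

lemma J: "bounded_linear J" and J_inner: "\<iota> x \<bullet> \<iota> y = J x \<bullet> y"
proof -
  have "bounded_bilinear (\<lambda>x y. \<iota> x \<bullet> \<iota> y)"
    using bounded_bilinear.comp[OF bounded_bilinear_inner \<iota> \<iota>] .
  from someI_ex[OF bounded_bilinear_representation[OF this]]
  show "bounded_linear J" "\<iota> x \<bullet> \<iota> y = J x \<bullet> y" unfolding J_def by blast+
qed

sublocale J: bounded_linear J by (rule J)

lemma integrable_inner:
  "f \<in> sqi (tm T) \<Longrightarrow> g \<in> sqi (tm T) \<Longrightarrow> integrable (tm T) (\<lambda>t. f t \<bullet> g t)"
  for f :: "real \<Rightarrow> 'c::separable_hilbert"
  by (rule sqi_inner)

lemma sqi_const [simp]: "(\<lambda>_. c) \<in> sqi (tm T)" for c :: "'c::separable_hilbert"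
  by (simp add: sqi_def)

lemmas sqi_\<iota> = sqi_bounded_linear(1)[OF \<iota>]
lemmas sqi_A = sqi_bounded_linear(1)[OF A]
lemmas sqi_J = sqi_bounded_linear(1)[OF J]

lemma garding_prim:
  assumes u: "u \<in> sqi (tm T)"
  shows "\<delta> * prim T (\<lambda>t. (norm (u t))\<^sup>2) \<tau> \<le> prim T (\<lambda>t. A (u t) \<bullet> u t) \<tau> + \<Lambda> * prim T (\<lambda>t. (norm (\<iota> (u t)))\<^sup>2) \<tau>"
proof -
  have i: "integrable (tm T) (\<lambda>t. (norm (u t))\<^sup>2)" "integrable (tm T) (\<lambda>t. A (u t) \<bullet> u t)"
    "integrable (tm T) (\<lambda>t. (norm (\<iota> (u t)))\<^sup>2)"
    by (intro sqi_integrable integrable_inner sqi_A sqi_\<iota> u)+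
  have "prim T (\<lambda>t. \<delta> * (norm (u t))\<^sup>2) \<tau> \<le> prim T (\<lambda>t. A (u t) \<bullet> u t + \<Lambda> * (norm (\<iota> (u t)))\<^sup>2) \<tau>"
    by (rule prim_mono) (use i garding in auto)
  also have "\<dots> = prim T (\<lambda>t. A (u t) \<bullet> u t) \<tau> + \<Lambda> * prim T (\<lambda>t. (norm (\<iota> (u t)))\<^sup>2) \<tau>"
    using i by (subst prim_add) (auto simp: prim_cmult)
  finally show ?thesis by (simp add: prim_cmult)
qed

lemma garding_post:
  assumes u: "u \<in> sqi (tm T)"
  shows "\<delta> * post T (\<lambda>t. (norm (u t))\<^sup>2) \<tau> \<le> post T (\<lambda>t. A (u t) \<bullet> u t) \<tau> + \<Lambda> * post T (\<lambda>t. (norm (\<iota> (u t)))\<^sup>2) \<tau>"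
proof -
  have i: "integrable (tm T) (\<lambda>t. (norm (u t))\<^sup>2)" "integrable (tm T) (\<lambda>t. A (u t) \<bullet> u t)"
    "integrable (tm T) (\<lambda>t. (norm (\<iota> (u t)))\<^sup>2)"
    by (intro sqi_integrable integrable_inner sqi_A sqi_\<iota> u)+
  have "post T (\<lambda>t. \<delta> * (norm (u t))\<^sup>2) \<tau> \<le> post T (\<lambda>t. A (u t) \<bullet> u t + \<Lambda> * (norm (\<iota> (u t)))\<^sup>2) \<tau>"
    by (rule post_mono) (use i garding in auto)
  also have "\<dots> = post T (\<lambda>t. A (u t) \<bullet> u t) \<tau> + \<Lambda> * post T (\<lambda>t. (norm (\<iota> (u t)))\<^sup>2) \<tau>"
    using i by (subst post_add) (auto simp: post_cmult)
  finally show ?thesis by (simp add: post_cmult)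
qed

section \<open>Energy estimates for curves with a derivative in the form space\<close>

definition nice :: "'v \<Rightarrow> (real \<Rightarrow> 'v) \<Rightarrow> real \<Rightarrow> 'v" where
  "nice w0 w t = w0 + prim T w t"

text \<open>The curve \<open>nice w0 w\<close> has derivative \<open>w\<close> and initial value
  \<open>w0\<close>; \<open>rhs\<close> is the data of the equation that it solves, with
  \<open>J w\<close> as the time derivative.\<close>

definition rhs :: "'v \<Rightarrow> (real \<Rightarrow> 'v) \<Rightarrow> real \<Rightarrow> 'v" where
  "rhs w0 w t = J (w t) + A (nice w0 w t)"

lemma nice_sqi: "w \<in> sqi (tm T) \<Longrightarrow> nice w0 w \<in> sqi (tm T)"
  unfolding nice_def[abs_def] by (intro sqi_add sqi_const sqi_prim tm.sqi_imp_integrable)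

lemma rhs_sqi: "w \<in> sqi (tm T) \<Longrightarrow> rhs w0 w \<in> sqi (tm T)"
  unfolding rhs_def[abs_def] by (intro sqi_add sqi_J sqi_A nice_sqi)

lemma nice_diff:
  "w \<in> sqi (tm T) \<Longrightarrow> w' \<in> sqi (tm T) \<Longrightarrow> nice (w0 - w0') (\<lambda>t. w t - w' t) t = nice w0 w t - nice w0' w' t"
  by (simp add: nice_def prim_diff tm.sqi_imp_integrable)

lemma rhs_diff:
  "w \<in> sqi (tm T) \<Longrightarrow> w' \<in> sqi (tm T) \<Longrightarrow> rhs (w0 - w0') (\<lambda>t. w t - w' t) t = rhs w0 w t - rhs w0' w' t"
  by (simp add: rhs_def nice_diff J.diff A.diff)

lemma continuous_nice: "w \<in> sqi (tm T) \<Longrightarrow> continuous_on UNIV (\<lambda>t. \<iota> (nice w0 w t))"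
  unfolding nice_def[abs_def]
  by (intro \<iota>.continuous_on continuous_intros continuous_prim tm.sqi_imp_integrable)

text \<open>The equation is paired with the curve itself. By the definition of \<open>J\<close> the
  derivative term is an inner product in \<open>'h\<close>, which \<open>prim_self\<close>
  integrates to half the difference of the squared norms.\<close>

lemma energy_nice:
  assumes w: "w \<in> sqi (tm T)"
  shows "(norm (\<iota> (nice w0 w \<tau>)))\<^sup>2 / 2 + prim T (\<lambda>t. A (nice w0 w t) \<bullet> nice w0 w t) \<tau> =
    (norm (\<iota> w0))\<^sup>2 / 2 + prim T (\<lambda>t. rhs w0 w t \<bullet> nice w0 w t) \<tau>"
proof -
  let ?u = "nice w0 w"
  have wi: "integrable (tm T) w" using w by (rule tm.sqi_imp_integrable)
  have \<iota>w: "(\<lambda>t. \<iota> (w t)) \<in> sqi (tm T)" by (intro sqi_\<iota> w)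
  then have \<iota>wi: "integrable (tm T) (\<lambda>t. \<iota> (w t))" by (rule tm.sqi_imp_integrable)
  have Jw: "J (w t) \<bullet> ?u t = \<iota> (w t) \<bullet> \<iota> w0 + \<iota> (w t) \<bullet> prim T (\<lambda>t. \<iota> (w t)) t" for t
    by (simp add: nice_def inner_add_right prim_bounded_linear[OF \<iota> wi, symmetric] flip: J_inner)
  have i1: "integrable (tm T) (\<lambda>t. \<iota> (w t) \<bullet> \<iota> w0)" "integrable (tm T) (\<lambda>t. \<iota> (w t) \<bullet> prim T (\<lambda>t. \<iota> (w t)) t)"
    by (intro integrable_inner \<iota>w sqi_const sqi_prim \<iota>wi)+
  have "prim T (\<lambda>t. J (w t) \<bullet> ?u t) \<tau> = prim T (\<lambda>t. \<iota> (w t) \<bullet> \<iota> w0) \<tau> + prim T (\<lambda>t. \<iota> (w t) \<bullet> prim T (\<lambda>t. \<iota> (w t)) t) \<tau>"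
    unfolding Jw by (rule prim_add[OF i1])
  also have "prim T (\<lambda>t. \<iota> (w t) \<bullet> \<iota> w0) \<tau> = \<iota> (prim T w \<tau>) \<bullet> \<iota> w0"
    using prim_bounded_linear[OF bounded_linear_compose[OF bounded_linear_inner_left[of "\<iota> w0"] \<iota>] wi, of \<tau>] by simp
  also have "prim T (\<lambda>t. \<iota> (w t) \<bullet> prim T (\<lambda>t. \<iota> (w t)) t) \<tau> = (norm (\<iota> (prim T w \<tau>)))\<^sup>2 / 2"
    by (subst prim_self[OF \<iota>wi]) (simp add: prim_bounded_linear[OF \<iota> wi])
  finally have 1: "prim T (\<lambda>t. J (w t) \<bullet> ?u t) \<tau> = (norm (\<iota> (?u \<tau>)))\<^sup>2 / 2 - (norm (\<iota> w0))\<^sup>2 / 2"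
    by (simp add: nice_def \<iota>.add power2_norm_eq_inner inner_add_left inner_add_right inner_commute add_divide_distrib)
  have "prim T (\<lambda>t. rhs w0 w t \<bullet> ?u t) \<tau> = prim T (\<lambda>t. J (w t) \<bullet> ?u t) \<tau> + prim T (\<lambda>t. A (?u t) \<bullet> ?u t) \<tau>"
    unfolding rhs_def inner_add_left
    by (intro prim_add integrable_inner sqi_J sqi_A w nice_sqi)
  with 1 show ?thesis by simp
qed

text \<open>Young's inequality spends half of the coercivity on the right-hand side, and Gronwall
  absorbs the lower-order term. Both bounds are needed later: the first makes approximations Cauchy
  in the form space, the second makes their values in \<open>'h\<close> converge uniformly, so that
  the limit is continuous.\<close>

lemma energy_estimate:
  "\<exists>C>0. \<forall>w0. \<forall>w\<in>sqi (tm T). nrm (tm T) (nice w0 w) \<le> C * (norm (\<iota> w0) + nrm (tm T) (rhs w0 w)) \<and>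
    (\<forall>t. norm (\<iota> (nice w0 w t)) \<le> C * (norm (\<iota> w0) + nrm (tm T) (rhs w0 w)))"
proof -
  \<comment> \<open>\<open>K\<close> is the factor by which Gronwall enlarges \<open>a\<close>,
    \<open>c\<close> bounds \<open>a\<close> by the squared data, and
    \<open>1 + 1 / \<delta>\<close> in \<open>C\<close> covers both asserted bounds at once.\<close>
  define K where "K = 1 + 4 * \<Lambda> * T * exp (4 * \<Lambda> * T)"
  define c where "c = 1 / 2 + 1 / (2 * \<delta>)"
  define C where "C = sqrt (2 * K * c * (1 + 1 / \<delta>))"
  have K: "K > 0" using \<Lambda> T by (simp add: K_def add_pos_nonneg)
  have c: "c > 0" using \<delta> by (simp add: c_def add_pos_nonneg)
  have C: "C > 0" using K c \<delta> by (simp add: C_def add_pos_pos)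
  have "nrm (tm T) (nice w0 w) \<le> C * (norm (\<iota> w0) + nrm (tm T) (rhs w0 w)) \<and>
    (\<forall>t. norm (\<iota> (nice w0 w t)) \<le> C * (norm (\<iota> w0) + nrm (tm T) (rhs w0 w)))" if w: "w \<in> sqi (tm T)" for w0 w
  proof -
    let ?u = "nice w0 w" and ?f = "rhs w0 w"
    define D where "D = norm (\<iota> w0) + nrm (tm T) ?f"
    define a where "a = (norm (\<iota> w0))\<^sup>2 / 2 + (nrm (tm T) ?f)\<^sup>2 / (2 * \<delta>)"
    define \<phi> where "\<phi> t = (norm (\<iota> (?u t)))\<^sup>2 / 2" for t
    note [simp] = nice_sqi[OF w, of w0] rhs_sqi[OF w, of w0]
    have a0: "a \<ge> 0" using \<delta> by (simp add: a_def)
    have aD: "a \<le> c * D\<^sup>2"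
    proof -
      have "(norm (\<iota> w0))\<^sup>2 \<le> D\<^sup>2" "(nrm (tm T) ?f)\<^sup>2 \<le> D\<^sup>2" unfolding D_def by (intro power_mono; simp)+
      then have "a \<le> D\<^sup>2 / 2 + D\<^sup>2 / (2 * \<delta>)" unfolding a_def using \<delta> by (intro add_mono divide_right_mono) auto
      then show ?thesis by (simp add: c_def algebra_simps)
    qed
    have iu: "integrable (tm T) (\<lambda>t. (norm (?u t))\<^sup>2)" "integrable (tm T) (\<lambda>t. (norm (?f t))\<^sup>2)"
      "integrable (tm T) (\<lambda>t. (norm (\<iota> (?u t)))\<^sup>2)"
      by (auto intro!: sqi_integrable sqi_\<iota>)
    have i\<phi>: "integrable (tm T) \<phi>" using iu(3) by (simp add: \<phi>_def[abs_def])
    have p\<phi>: "prim T (\<lambda>t. (norm (\<iota> (?u t)))\<^sup>2) \<tau> = 2 * prim T \<phi> \<tau>" for \<tau>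
      using prim_scaleR[of T 2 \<phi> \<tau>] by (simp add: \<phi>_def)
    have fu: "prim T (\<lambda>t. ?f t \<bullet> ?u t) \<tau> \<le> \<delta> / 2 * prim T (\<lambda>t. (norm (?u t))\<^sup>2) \<tau> + (nrm (tm T) ?f)\<^sup>2 / (2 * \<delta>)" for \<tau>
    proof -
      \<comment> \<open>Young's inequality weighted so that exactly half of the coercivity constant
        is used.\<close>
      have pt: "x \<bullet> y \<le> \<delta> / 2 * (norm y)\<^sup>2 + 1 / (2 * \<delta>) * (norm x)\<^sup>2" for x y :: 'v
      proof -
        have "x \<bullet> y \<le> norm x * norm y" by (rule norm_cauchy_schwarz)
        moreover have "0 \<le> (\<delta> * norm y - norm x)\<^sup>2 / (2 * \<delta>)" using \<delta> by simp
        moreover have "(\<delta> * norm y - norm x)\<^sup>2 / (2 * \<delta>) = \<delta> / 2 * (norm y)\<^sup>2 + 1 / (2 * \<delta>) * (norm x)\<^sup>2 - norm x * norm y"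
          using \<delta> by (simp add: power2_eq_square field_simps)
        ultimately show ?thesis by linarith
      qed
      have "prim T (\<lambda>t. ?f t \<bullet> ?u t) \<tau> \<le> prim T (\<lambda>t. (\<delta> / 2) * (norm (?u t))\<^sup>2 + (1 / (2 * \<delta>)) * (norm (?f t))\<^sup>2) \<tau>"
        by (rule prim_mono) (use iu pt in \<open>auto intro!: integrable_inner\<close>)
      also have "\<dots> = \<delta> / 2 * prim T (\<lambda>t. (norm (?u t))\<^sup>2) \<tau> + 1 / (2 * \<delta>) * prim T (\<lambda>t. (norm (?f t))\<^sup>2) \<tau>"
        using iu by (subst prim_add) (simp_all only: prim_cmult integrable_mult_right)
      also have "prim T (\<lambda>t. (norm (?f t))\<^sup>2) \<tau> \<le> (nrm (tm T) ?f)\<^sup>2"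
        unfolding prim_def nrm_sq using iu by (intro integral_mono integrable_indicator_tm) (auto simp: indicator_def)
      finally show ?thesis using \<delta> by (simp add: divide_right_mono)
    qed
    have main: "\<phi> \<tau> + \<delta> / 2 * prim T (\<lambda>t. (norm (?u t))\<^sup>2) \<tau> \<le> a + (2 * \<Lambda>) * prim T \<phi> \<tau>" for \<tau>
      using energy_nice[OF w, of w0 \<tau>] garding_prim[of ?u \<tau>] fu[of \<tau>] p\<phi>[of \<tau>]
      unfolding \<phi>_def a_def by simp
    have pu: "prim T (\<lambda>t. (norm (?u t))\<^sup>2) \<tau> \<ge> 0" for \<tau>
      unfolding prim_def by (intro integral_nonneg_AE) auto
    have g: "(\<integral>t. \<phi> t \<partial>tm T) \<le> 2 * a * T * exp (2 * (2 * \<Lambda>) * T)"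
    proof (rule gronwall[OF i\<phi>])
      have "\<phi> t \<le> a + 2 * \<Lambda> * prim T \<phi> t" for t
        using main[of t] pu[of t] \<delta> by (smt (verit) half_gt_zero mult_nonneg_nonneg)
      then show "AE t in tm T. \<phi> t \<le> a + 2 * \<Lambda> * prim T \<phi> t" by simp
    qed (use \<Lambda> T a0 in \<open>auto simp: \<phi>_def\<close>)
    have "prim T \<phi> \<tau> \<le> (\<integral>t. \<phi> t \<partial>tm T)" for \<tau>
      unfolding prim_def by (intro integral_mono integrable_indicator_tm i\<phi>) (auto simp: indicator_def \<phi>_def)
    then have pb: "2 * \<Lambda> * prim T \<phi> \<tau> \<le> 2 * \<Lambda> * (2 * a * T * exp (2 * (2 * \<Lambda>) * T))" for \<tau>
      using g \<Lambda> by (intro mult_left_mono) (auto intro: order_trans)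
    have "a * K = a + 2 * \<Lambda> * (2 * a * T * exp (2 * (2 * \<Lambda>) * T))" by (simp add: K_def algebra_simps)
    then have tot: "\<phi> \<tau> + \<delta> / 2 * prim T (\<lambda>t. (norm (?u t))\<^sup>2) \<tau> \<le> a * K" for \<tau>
      using main[of \<tau>] pb[of \<tau>] by linarith
    have aK: "a * K \<le> K * c * D\<^sup>2" using aD K by (simp add: mult.commute mult.left_commute)
    have "(nrm (tm T) ?u)\<^sup>2 \<le> (C * D)\<^sup>2"
    proof -
      have "\<delta> / 2 * (nrm (tm T) ?u)\<^sup>2 \<le> K * c * D\<^sup>2"
      proof -
        have "0 \<le> \<phi> T" by (simp add: \<phi>_def)
        then have "\<delta> / 2 * prim T (\<lambda>t. (norm (?u t))\<^sup>2) T \<le> K * c * D\<^sup>2" using tot[of T] aK by linarith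
        then show ?thesis by (simp add: prim_end nrm_sq)
      qed
      then have "(nrm (tm T) ?u)\<^sup>2 \<le> 2 * K * c * (1 / \<delta>) * D\<^sup>2" using \<delta> by (simp add: field_simps)
      also have "\<dots> \<le> 2 * K * c * (1 + 1 / \<delta>) * D\<^sup>2"
        using K c by (intro mult_right_mono mult_left_mono) auto
      also have "\<dots> = (C * D)\<^sup>2" using K c \<delta> by (simp add: C_def power_mult_distrib)
      finally show ?thesis .
    qed
    then have 1: "nrm (tm T) ?u \<le> C * D" by (rule power2_le_imp_le) (use C in \<open>simp add: D_def\<close>)
    have "norm (\<iota> (?u \<tau>)) \<le> C * D" for \<tau>
    proof -
      have "0 \<le> \<delta> / 2 * prim T (\<lambda>t. (norm (?u t))\<^sup>2) \<tau>" using pu \<delta> by simp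
      then have "\<phi> \<tau> \<le> K * c * D\<^sup>2" using tot[of \<tau>] aK by linarith
      then have "(norm (\<iota> (?u \<tau>)))\<^sup>2 \<le> 2 * K * c * 1 * D\<^sup>2" by (simp add: \<phi>_def)
      also have "\<dots> \<le> 2 * K * c * (1 + 1 / \<delta>) * D\<^sup>2"
        using K c \<delta> by (intro mult_right_mono mult_left_mono) auto
      also have "\<dots> = (C * D)\<^sup>2" using K c \<delta> by (simp add: C_def power_mult_distrib)
      finally show ?thesis by (rule power2_le_imp_le) (use C in \<open>simp add: D_def\<close>)
    qed
    with 1 show ?thesis by (simp add: D_def)
  qed
  with C show ?thesis by blast
qed

text \<open>The range of \<open>w \<mapsto> J w + A \<integral>w\<close> is dense because a function \<open>g\<close> orthogonal to it
  can be tested with \<open>w = \<Gamma>\<close>, where \<open>\<Gamma> t\<close> is the integral of \<open>g\<close> over \<open>[t, T]\<close>.\<close>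

lemma rhs_dense:
  assumes f: "f \<in> sqi (tm T)" and "e > 0"
  shows "\<exists>w\<in>sqi (tm T). nrm (tm T) (\<lambda>t. f t - rhs 0 w t) < e"
proof -
  let ?R = "rhs 0 ` sqi (tm T)"
  have "\<exists>r\<in>?R. nrm (tm T) (\<lambda>t. f t - r t) < e"
  proof (rule sqi_dense[OF _ _ _ _ _ f \<open>e > 0\<close>])
    show "?R \<subseteq> sqi (tm T)" by (auto intro: rhs_sqi)
    show "?R \<noteq> {}" using sqi_zero by blast
    show "(\<lambda>x. p x + q x) \<in> ?R" if "p \<in> ?R" "q \<in> ?R" for p q
    proof -
      from that obtain v w where vw: "v \<in> sqi (tm T)" "w \<in> sqi (tm T)" "p = rhs 0 v" "q = rhs 0 w" by (elim imageE)
      then have "(\<lambda>x. p x + q x) = rhs 0 (\<lambda>t. v t + w t)"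
        by (auto simp: fun_eq_iff rhs_def nice_def prim_add tm.sqi_imp_integrable J.add A.add)
      then show ?thesis using vw sqi_add by blast
    qed
    show "(\<lambda>x. c *\<^sub>R p x) \<in> ?R" if "p \<in> ?R" for p c
    proof -
      from that obtain v where v: "v \<in> sqi (tm T)" "p = rhs 0 v" by (elim imageE)
      then have "(\<lambda>x. c *\<^sub>R p x) = rhs 0 (\<lambda>t. c *\<^sub>R v t)"
        by (auto simp: fun_eq_iff rhs_def nice_def prim_scaleR J.scaleR A.scaleR scaleR_add_right)
      then show ?thesis using v sqi_scaleR by blast
    qed
    fix g assume g: "g \<in> sqi (tm T)" and orth: "\<And>r. r \<in> ?R \<Longrightarrow> ip (tm T) g r = 0"
    have gi: "integrable (tm T) g" using g by (rule tm.sqi_imp_integrable)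
    define \<Gamma> where "\<Gamma> = post T g"
    have \<Gamma>: "\<Gamma> \<in> sqi (tm T)" unfolding \<Gamma>_def by (rule sqi_post[OF gi])
    have \<iota>g: "integrable (tm T) (\<lambda>t. \<iota> (g t))" by (intro tm.sqi_imp_integrable sqi_\<iota> g)
    have \<iota>\<Gamma>: "\<iota> (\<Gamma> t) = post T (\<lambda>t. \<iota> (g t)) t" for t
      unfolding \<Gamma>_def by (rule post_bounded_linear[OF \<iota> gi])
    have id: "(norm (\<iota> (\<Gamma> \<tau>)))\<^sup>2 / 2 + post T (\<lambda>t. A (\<Gamma> t) \<bullet> \<Gamma> t) \<tau> = 0" for \<tau>
    proof -
      \<comment> \<open>Cutting \<open>\<Gamma>\<close> off before \<open>\<tau>\<close> localises
        the identity to \<open>[\<tau>, T]\<close>; the backward Gronwall argument needs it for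
        every \<open>\<tau>\<close>.\<close>
      define w where "w t = indicat_real {\<tau>..} t *\<^sub>R \<Gamma> t" for t
      have w: "w \<in> sqi (tm T)"
      proof (rule nrm_mono_AE[OF _ \<Gamma>])
        show "w \<in> borel_measurable (tm T)" unfolding w_def[abs_def] using \<Gamma> by measurable
        show "AE t in tm T. norm (w t) \<le> 1 * norm (\<Gamma> t)" by (auto simp: w_def indicator_def)
      qed simp
      have wi: "integrable (tm T) w" using w by (rule tm.sqi_imp_integrable)
      have "0 = ip (tm T) g (rhs 0 w)" using orth w by auto
      also have "\<dots> = ip (tm T) g (\<lambda>t. J (w t)) + ip (tm T) g (\<lambda>t. A (prim T w t))"
        unfolding rhs_def[abs_def] nice_def add_0
        by (intro ip_add_right sqi_J sqi_A w sqi_prim wi g)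
      also have "ip (tm T) g (\<lambda>t. J (w t)) = post T (\<lambda>t. post T (\<lambda>t. \<iota> (g t)) t \<bullet> \<iota> (g t)) \<tau>"
        unfolding ip_def post_def[of _ _ \<tau>]
        by (intro Bochner_Integration.integral_cong refl)
          (simp add: w_def J.scaleR inner_commute[of "g _"] \<iota>\<Gamma> flip: J_inner)
      also have "\<dots> = (norm (\<iota> (\<Gamma> \<tau>)))\<^sup>2 / 2"
        by (subst post_self[OF \<iota>g]) (simp add: \<iota>\<Gamma>)
      also have "ip (tm T) g (\<lambda>t. A (prim T w t)) = (\<integral>t. g t \<bullet> prim T (\<lambda>t. A (w t)) t \<partial>tm T)"
        unfolding ip_def by (simp add: prim_bounded_linear[OF A wi])
      also have "\<dots> = (\<integral>t. post T g t \<bullet> A (w t) \<partial>tm T)"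
        by (intro integral_prim_post gi tm.sqi_imp_integrable sqi_A w)
      also have "\<dots> = post T (\<lambda>t. A (\<Gamma> t) \<bullet> \<Gamma> t) \<tau>"
        unfolding post_def[of _ _ \<tau>]
        by (intro Bochner_Integration.integral_cong refl) (simp add: w_def A.scaleR inner_commute \<Gamma>_def)
      finally show ?thesis by simp
    qed
    define \<phi> where "\<phi> t = (norm (\<iota> (\<Gamma> t)))\<^sup>2" for t
    have i\<phi>: "integrable (tm T) \<phi>" unfolding \<phi>_def[abs_def] by (intro sqi_integrable sqi_\<iota> \<Gamma>)
    have main: "\<phi> \<tau> / 2 + \<delta> * post T (\<lambda>t. (norm (\<Gamma> t))\<^sup>2) \<tau> \<le> \<Lambda> * post T \<phi> \<tau>" for \<tau>
      using id[of \<tau>] garding_post[OF \<Gamma>, of \<tau>] by (simp add: \<phi>_def[abs_def])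
    have p0: "0 \<le> \<delta> * post T (\<lambda>t. (norm (\<Gamma> t))\<^sup>2) \<tau>" for \<tau>
      unfolding post_def using \<delta> by (intro mult_nonneg_nonneg integral_nonneg_AE) auto
    have "(\<integral>t. \<phi> t \<partial>tm T) \<le> 0"
    proof (rule gronwall_backward[OF i\<phi>])
      have "\<phi> t \<le> 2 * \<Lambda> * post T \<phi> t" for t using main[of t] p0[of t] by linarith
      then show "AE t in tm T. \<phi> t \<le> 2 * \<Lambda> * post T \<phi> t" by simp
    qed (use \<Lambda> in \<open>auto simp: \<phi>_def\<close>)
    then have "\<Lambda> * post T \<phi> 0 \<le> 0" using \<Lambda> by (simp add: post_begin mult_le_0_iff)
    moreover have "0 \<le> \<phi> 0" by (simp add: \<phi>_def)
    ultimately have "\<delta> * post T (\<lambda>t. (norm (\<Gamma> t))\<^sup>2) 0 \<le> 0" using main[of 0] by linarith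
    then have "\<delta> * (nrm (tm T) \<Gamma>)\<^sup>2 \<le> 0" by (simp add: post_begin nrm_sq)
    then have "nrm (tm T) \<Gamma> = 0" using \<delta> by (simp add: mult_le_0_iff)
    then have "AE t in tm T. g t = 0"
      using nrm_eq_0[OF \<Gamma>] AE_0_if_post_0[OF T gi] by (simp add: \<Gamma>_def)
    then have "nrm (tm T) g = nrm (tm T) (\<lambda>_. 0 :: 'v)" using g by (intro nrm_cong_AE) auto
    then show "nrm (tm T) g = 0" by (simp add: nrm_def)
  qed
  then show ?thesis by blast
qed

section \<open>Existence and uniqueness\<close>

lemma nrm_const: "nrm (tm T) (\<lambda>_. c :: 'c::separable_hilbert) = sqrt T * norm c"
  using measure_tm[of T] T by (simp add: nrm_def real_sqrt_mult)

text \<open>\<open>v\<close> is the continuous representative of the image of \<open>u\<close> under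
  \<open>\<iota>\<close>; \<open>u\<close> itself is determined only almost everywhere, while the
  equation is to hold at every time.\<close>

definition solution :: "'h \<Rightarrow> (real \<Rightarrow> 'v) \<Rightarrow> (real \<Rightarrow> 'v) \<Rightarrow> (real \<Rightarrow> 'h) \<Rightarrow> bool" where
  "solution u0 f u v \<longleftrightarrow> u \<in> sqi (tm T) \<and> continuous_on {0..T} v \<and> (AE t in tm T. v t = \<iota> (u t)) \<and>
     (\<forall>t\<in>{0..T}. \<forall>y. v t \<bullet> \<iota> y = u0 \<bullet> \<iota> y + prim T (\<lambda>s. (f s - A (u s)) \<bullet> y) t)"

text \<open>Both data are approximated, the initial value through the dense range of
  \<open>\<iota>\<close> and the right-hand side through \<open>rhs_dense\<close>. By linearity
  \<open>energy_estimate\<close> applies to differences of the approximate solutions, which are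
  Cauchy in the form space and, after \<open>\<iota>\<close>, uniformly in time.\<close>

lemma existence:
  "\<exists>C>0. \<forall>u0. \<forall>f\<in>sqi (tm T). \<exists>u v. solution u0 f u v \<and> nrm (tm T) u \<le> C * (norm u0 + nrm (tm T) f)"
proof -
  obtain C where C: "C > 0" and
    est: "\<And>w0 w. w \<in> sqi (tm T) \<Longrightarrow> nrm (tm T) (nice w0 w) \<le> C * (norm (\<iota> w0) + nrm (tm T) (rhs w0 w))"
    "\<And>w0 w t. w \<in> sqi (tm T) \<Longrightarrow> norm (\<iota> (nice w0 w t)) \<le> C * (norm (\<iota> w0) + nrm (tm T) (rhs w0 w))"
    using energy_estimate by blast
  have "\<exists>u v. solution u0 f u v \<and> nrm (tm T) u \<le> C * (norm u0 + nrm (tm T) f)" if f: "f \<in> sqi (tm T)" for u0 f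
  proof -
    have "\<exists>w0. norm (\<iota> w0 - u0) < 1 / Suc n" for n
      using dense closure_approachable[of u0 "range \<iota>"] by (force simp: dist_norm)
    then obtain w0 where w0: "\<And>n. norm (\<iota> (w0 n) - u0) < 1 / Suc n" by metis
    \<comment> \<open>\<open>rhs_dense\<close> concerns curves that start at 0, so the contribution
      of the constant curve \<open>w0 n\<close> is moved to the right-hand side.\<close>
    have "\<exists>w\<in>sqi (tm T). nrm (tm T) (\<lambda>t. f t - A (w0 n) - rhs 0 w t) < 1 / Suc n" for n
      by (rule rhs_dense) (auto intro!: sqi_diff f)
    then obtain w where w: "\<And>n. w n \<in> sqi (tm T)"
      and "\<And>n. nrm (tm T) (\<lambda>t. f t - A (w0 n) - rhs 0 (w n) t) < 1 / Suc n" by metis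
    moreover have "rhs (w0 n) (w n) t = A (w0 n) + rhs 0 (w n) t" for n t
      by (simp add: rhs_def nice_def A.add)
    ultimately have fn: "nrm (tm T) (\<lambda>t. f t - rhs (w0 n) (w n) t) < 1 / Suc n" for n
      by (simp add: diff_diff_eq)
    define u where "u n = nice (w0 n) (w n)" for n
    define F where "F n = rhs (w0 n) (w n)" for n
    define \<rho> where "\<rho> n = 1 / real (Suc n)" for n
    have \<rho>: "\<rho> \<longlonglongrightarrow> 0" unfolding \<rho>_def using LIMSEQ_inverse_real_of_nat by (simp add: inverse_eq_divide)
    have u: "u n \<in> sqi (tm T)" and F: "F n \<in> sqi (tm T)" for n
      unfolding u_def F_def by (intro nice_sqi rhs_sqi w)+
    have fF: "nrm (tm T) (\<lambda>t. F n t - f t) \<le> \<rho> n" for n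
      using fn[of n] by (simp add: F_def \<rho>_def nrm_minus_commute[of _ f])
    have D: "norm (\<iota> (w0 m - w0 n)) + nrm (tm T) (rhs (w0 m - w0 n) (\<lambda>t. w m t - w n t)) \<le> 2 * (\<rho> m + \<rho> n)" for m n
    proof -
      have "norm (\<iota> (w0 m - w0 n)) \<le> \<rho> m + \<rho> n"
        using w0[of m] w0[of n] norm_triangle_ineq4[of "\<iota> (w0 m) - u0" "\<iota> (w0 n) - u0"]
        by (simp add: \<iota>.diff \<rho>_def)
      moreover have "nrm (tm T) (\<lambda>t. F m t - F n t) \<le> \<rho> m + \<rho> n"
        using nrm_triangle_diff[OF F f F, of m n] fF[of m] fF[of n] by (simp add: nrm_minus_commute[of _ f])
      moreover have "rhs (w0 m - w0 n) (\<lambda>t. w m t - w n t) = (\<lambda>t. F m t - F n t)"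
        by (simp add: fun_eq_iff rhs_diff w F_def)
      ultimately show ?thesis by simp
    qed
    have small: "\<exists>N. \<forall>m\<ge>N. \<forall>n\<ge>N. C * (2 * (\<rho> m + \<rho> n)) < e" if "e > 0" for e
    proof -
      have "e / (4 * C) > 0" using that C by simp
      then obtain N where N: "\<And>n. n \<ge> N \<Longrightarrow> \<rho> n < e / (4 * C)"
        using order_tendstoD(2)[OF \<rho>] by (auto simp: eventually_sequentially)
      have "C * (2 * (\<rho> m + \<rho> n)) < e" if "m \<ge> N" "n \<ge> N" for m n
      proof -
        have "\<rho> m + \<rho> n < e / (2 * C)" using N[OF that(1)] N[OF that(2)] by simp
        then show ?thesis using C by (simp add: field_simps)
      qed
      then show ?thesis by blast
    qed
    have udiff: "nrm (tm T) (\<lambda>t. u m t - u n t) \<le> C * (2 * (\<rho> m + \<rho> n))" for m n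
    proof -
      have eq: "(\<lambda>t. u m t - u n t) = nice (w0 m - w0 n) (\<lambda>t. w m t - w n t)"
        by (simp add: fun_eq_iff u_def nice_diff w)
      show ?thesis unfolding eq
        using est(1)[OF sqi_diff[OF w w], of "w0 m - w0 n" m n] mult_left_mono[OF D[of m n] less_imp_le[OF C]] by (rule order_trans)
    qed
    have \<iota>diff: "norm (\<iota> (u m t) - \<iota> (u n t)) \<le> C * (2 * (\<rho> m + \<rho> n))" for m n t
    proof -
      have eq: "\<iota> (u m t) - \<iota> (u n t) = \<iota> (nice (w0 m - w0 n) (\<lambda>t. w m t - w n t) t)"
        by (simp add: u_def nice_diff w \<iota>.diff)
      show ?thesis unfolding eq
        using est(2)[OF sqi_diff[OF w w], of "w0 m - w0 n" m n t] mult_left_mono[OF D[of m n] less_imp_le[OF C]]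
        by (rule order_trans)
    qed
    have "\<exists>U\<in>sqi (tm T). (\<lambda>n. nrm (tm T) (\<lambda>t. u n t - U t)) \<longlonglongrightarrow> 0"
    proof (rule sqi_complete[OF u])
      fix e :: real assume "e > 0"
      from small[OF this] show "\<exists>N. \<forall>m\<ge>N. \<forall>n\<ge>N. nrm (tm T) (\<lambda>t. u m t - u n t) < e"
        using le_less_trans[OF udiff] by blast
    qed
    then obtain U where U: "U \<in> sqi (tm T)" and Ulim: "(\<lambda>n. nrm (tm T) (\<lambda>t. u n t - U t)) \<longlonglongrightarrow> 0" by blast
    have "uniformly_Cauchy_on UNIV (\<lambda>n t. \<iota> (u n t))"
      unfolding uniformly_Cauchy_on_def dist_norm
    proof (intro allI impI)
      fix e :: real assume "e > 0"
      from small[OF this] show "\<exists>M. \<forall>t\<in>UNIV. \<forall>m\<ge>M. \<forall>n\<ge>M. norm (\<iota> (u m t) - \<iota> (u n t)) < e"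
        using le_less_trans[OF \<iota>diff] by blast
    qed
    then obtain v where v: "uniform_limit UNIV (\<lambda>n t. \<iota> (u n t)) v sequentially"
      using Cauchy_uniformly_convergent unfolding uniformly_convergent_on_def by blast
    have vlim: "(\<lambda>n. \<iota> (u n t)) \<longlonglongrightarrow> v t" for t
      using v by (rule tendsto_uniform_limitI) simp
    have cont: "continuous_on UNIV v"
      by (rule uniform_limit_theorem[OF _ v]) (auto simp: u_def continuous_nice w)
    have vm: "v \<in> borel_measurable (tm T)"
      by (rule measurable_compose[OF measurable_ident_tm borel_measurable_continuous_onI[OF cont]])
    \<comment> \<open>The uniform limit \<open>v\<close> and the image of the limit \<open>U\<close>
      are square-integrable limits of the same sequence.\<close>
    have AE: "AE t in tm T. v t = \<iota> (U t)"
    proof -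
      have le: "nrm (tm T) (\<lambda>t. v t - \<iota> (u n t)) \<le> C * (2 * \<rho> n) * sqrt T" and sq: "(\<lambda>t. v t - \<iota> (u n t)) \<in> sqi (tm T)" for n
      proof -
        have "norm (v t - \<iota> (u n t)) \<le> C * (2 * (0 + \<rho> n))" for t
        proof (rule LIMSEQ_le)
          show "(\<lambda>m. norm (\<iota> (u m t) - \<iota> (u n t))) \<longlonglongrightarrow> norm (v t - \<iota> (u n t))" by (intro tendsto_intros vlim)
          show "(\<lambda>m. C * (2 * (\<rho> m + \<rho> n))) \<longlonglongrightarrow> C * (2 * (0 + \<rho> n))" by (intro tendsto_intros \<rho>)
        qed (use \<iota>diff in blast)
        then have *: "AE t in tm T. norm (v t - \<iota> (u n t)) \<le> C * (2 * \<rho> n) * norm (1::real)" by simp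
        have m: "(\<lambda>t. v t - \<iota> (u n t)) \<in> borel_measurable (tm T)"
          using vm sqi_measurable[OF sqi_\<iota>[OF u]] by measurable
        have 0: "0 \<le> C * (2 * \<rho> n)" using C by (simp add: \<rho>_def)
        show "nrm (tm T) (\<lambda>t. v t - \<iota> (u n t)) \<le> C * (2 * \<rho> n) * sqrt T" "(\<lambda>t. v t - \<iota> (u n t)) \<in> sqi (tm T)"
          using nrm_mono_AE[OF m sqi_const * 0] by (simp_all add: nrm_const)
      qed
      have vs: "v \<in> sqi (tm T)" using sqi_add[OF sq sqi_\<iota>[OF u], of 0 0] by simp
      have "nrm (tm T) (\<lambda>t. v t - \<iota> (U t)) \<le> C * (2 * \<rho> n) * sqrt T + onorm \<iota> * nrm (tm T) (\<lambda>t. u n t - U t)" for n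
        using nrm_triangle_diff[OF vs sqi_\<iota>[OF u] sqi_\<iota>[OF U], of n] le[of n]
          sqi_bounded_linear(2)[OF \<iota> sqi_diff[OF u U], of n] by (simp add: \<iota>.diff)
      moreover have "(\<lambda>n. C * (2 * \<rho> n) * sqrt T + onorm \<iota> * nrm (tm T) (\<lambda>t. u n t - U t)) \<longlonglongrightarrow> C * (2 * 0) * sqrt T + onorm \<iota> * 0"
        by (intro tendsto_intros \<rho> Ulim)
      ultimately have "nrm (tm T) (\<lambda>t. v t - \<iota> (U t)) \<le> C * (2 * 0) * sqrt T + onorm \<iota> * 0"
        by (intro LIMSEQ_le_const) auto
      then have "nrm (tm T) (\<lambda>t. v t - \<iota> (U t)) = 0" by (simp add: antisym)
      from nrm_eq_0[OF sqi_diff[OF vs sqi_\<iota>[OF U]] this] show ?thesis by simp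
    qed
    have eq: "v t \<bullet> \<iota> y = u0 \<bullet> \<iota> y + prim T (\<lambda>s. (f s - A (U s)) \<bullet> y) t" for t y
    proof -
      \<comment> \<open>For fixed \<open>t\<close> and \<open>y\<close> the primitive is an inner
        product with \<open>?g\<close>, hence continuous under convergence in
        \<open>nrm\<close>.\<close>
      let ?g = "\<lambda>s. indicat_real {..t} s *\<^sub>R y"
      have g: "?g \<in> sqi (tm T)"
        by (rule sqi_bounded[where K="norm y"]) (auto simp: indicator_def)
      have ipp: "prim T (\<lambda>s. q s \<bullet> y) t = ip (tm T) q ?g" for q :: "real \<Rightarrow> 'v"
        unfolding prim_def ip_def by simp
      have un: "\<iota> (u n t) \<bullet> \<iota> y = \<iota> (w0 n) \<bullet> \<iota> y + ip (tm T) (\<lambda>s. F n s - A (u n s)) ?g" for n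
      proof -
        have wi: "integrable (tm T) (w n)" using w by (rule tm.sqi_imp_integrable)
        have "\<iota> (u n t) \<bullet> \<iota> y = \<iota> (w0 n) \<bullet> \<iota> y + J (prim T (w n) t) \<bullet> y"
          by (simp add: u_def nice_def \<iota>.add inner_add_left J_inner)
        also have "J (prim T (w n) t) \<bullet> y = prim T (\<lambda>s. J (w n s) \<bullet> y) t"
          using prim_bounded_linear[OF bounded_linear_compose[OF bounded_linear_inner_left[of y] J] wi] by simp
        finally show ?thesis by (simp add: ipp F_def rhs_def u_def)
      qed
      have "(\<lambda>n. ip (tm T) (\<lambda>s. F n s - A (u n s)) ?g) \<longlonglongrightarrow> ip (tm T) (\<lambda>s. f s - A (U s)) ?g"
      proof (rule LIM_zero_cancel, rule Lim_null_comparison)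
        have "norm (ip (tm T) (\<lambda>s. F n s - A (u n s)) ?g - ip (tm T) (\<lambda>s. f s - A (U s)) ?g)
            \<le> (\<rho> n + onorm A * nrm (tm T) (\<lambda>t. u n t - U t)) * nrm (tm T) ?g" for n
        proof -
          have s: "(\<lambda>s. F n s - f s) \<in> sqi (tm T)" "(\<lambda>s. A (u n s - U s)) \<in> sqi (tm T)"
            by (intro sqi_diff sqi_A F f u U)+
          have "ip (tm T) (\<lambda>s. F n s - A (u n s)) ?g - ip (tm T) (\<lambda>s. f s - A (U s)) ?g
              = ip (tm T) (\<lambda>s. (F n s - A (u n s)) - (f s - A (U s))) ?g"
            by (rule ip_diff_left[symmetric]) (intro sqi_diff sqi_A F f u U g)+
          also have "(\<lambda>s. (F n s - A (u n s)) - (f s - A (U s))) = (\<lambda>s. (F n s - f s) - A (u n s - U s))"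
            by (simp add: fun_eq_iff A.diff)
          also have "ip (tm T) \<dots> ?g = ip (tm T) (\<lambda>s. F n s - f s) ?g - ip (tm T) (\<lambda>s. A (u n s - U s)) ?g"
            by (rule ip_diff_left[OF s g])
          also have "norm \<dots> \<le> nrm (tm T) (\<lambda>s. F n s - f s) * nrm (tm T) ?g + nrm (tm T) (\<lambda>s. A (u n s - U s)) * nrm (tm T) ?g"
            using ip_le_nrm[OF s(1) g] ip_le_nrm[OF s(2) g] by simp
          also have "\<dots> \<le> \<rho> n * nrm (tm T) ?g + (onorm A * nrm (tm T) (\<lambda>t. u n t - U t)) * nrm (tm T) ?g"
            by (rule add_mono[OF mult_right_mono[OF fF nrm_nonneg]
                  mult_right_mono[OF sqi_bounded_linear(2)[OF A sqi_diff[OF u U]] nrm_nonneg]])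
          finally show ?thesis by (simp add: distrib_right)
        qed
        then show "\<forall>\<^sub>F n in sequentially. norm (ip (tm T) (\<lambda>s. F n s - A (u n s)) ?g - ip (tm T) (\<lambda>s. f s - A (U s)) ?g)
            \<le> (\<rho> n + onorm A * nrm (tm T) (\<lambda>t. u n t - U t)) * nrm (tm T) ?g" by simp
        have "(\<lambda>n. (\<rho> n + onorm A * nrm (tm T) (\<lambda>t. u n t - U t)) * nrm (tm T) ?g) \<longlonglongrightarrow> (0 + onorm A * 0) * nrm (tm T) ?g"
          by (intro tendsto_intros \<rho> Ulim)
        then show "(\<lambda>n. (\<rho> n + onorm A * nrm (tm T) (\<lambda>t. u n t - U t)) * nrm (tm T) ?g) \<longlonglongrightarrow> 0" by simp
      qed
      moreover have w0lim: "(\<lambda>n. \<iota> (w0 n)) \<longlonglongrightarrow> u0"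
        by (rule LIM_zero_cancel, rule Lim_null_comparison[OF _ \<rho>])
           (use w0 in \<open>auto simp: \<rho>_def intro!: always_eventually less_imp_le\<close>)
      ultimately have "(\<lambda>n. \<iota> (w0 n) \<bullet> \<iota> y + ip (tm T) (\<lambda>s. F n s - A (u n s)) ?g) \<longlonglongrightarrow> u0 \<bullet> \<iota> y + ip (tm T) (\<lambda>s. f s - A (U s)) ?g"
        by (intro tendsto_intros)
      moreover have "(\<lambda>n. \<iota> (u n t) \<bullet> \<iota> y) \<longlonglongrightarrow> v t \<bullet> \<iota> y" by (intro tendsto_intros vlim)
      ultimately show ?thesis unfolding un ipp by (rule LIMSEQ_unique[rotated])
    qed
    have "nrm (tm T) U \<le> C * (norm u0 + nrm (tm T) f)"
    proof -
      have "nrm (tm T) U \<le> nrm (tm T) (\<lambda>t. u n t - U t) + C * ((norm u0 + \<rho> n) + (nrm (tm T) f + \<rho> n))" for n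
      proof -
        have "nrm (tm T) U \<le> nrm (tm T) (\<lambda>t. U t - u n t) + nrm (tm T) (u n)"
          using nrm_triangle[OF sqi_diff[OF U u] u, of n n] by simp
        moreover have "nrm (tm T) (u n) \<le> C * (norm (\<iota> (w0 n)) + nrm (tm T) (F n))"
          unfolding u_def F_def by (rule est(1)[OF w])
        moreover have "C * (norm (\<iota> (w0 n)) + nrm (tm T) (F n)) \<le> C * ((norm u0 + \<rho> n) + (nrm (tm T) f + \<rho> n))"
        proof (intro mult_left_mono add_mono)
          show "norm (\<iota> (w0 n)) \<le> norm u0 + \<rho> n"
            using w0[of n] norm_triangle_sub[of "\<iota> (w0 n)" u0] by (simp add: \<rho>_def)
          show "nrm (tm T) (F n) \<le> nrm (tm T) f + \<rho> n"
            using nrm_triangle[OF sqi_diff[OF F f] f, of n] fF[of n] by simp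
        qed (use C in simp)
        ultimately show ?thesis by (simp add: nrm_minus_commute[of _ U])
      qed
      moreover have "(\<lambda>n. nrm (tm T) (\<lambda>t. u n t - U t) + C * ((norm u0 + \<rho> n) + (nrm (tm T) f + \<rho> n))) \<longlonglongrightarrow>
          0 + C * ((norm u0 + 0) + (nrm (tm T) f + 0))"
        by (intro tendsto_intros \<rho> Ulim)
      ultimately have "nrm (tm T) U \<le> 0 + C * ((norm u0 + 0) + (nrm (tm T) f + 0))"
        by (intro LIMSEQ_le_const) auto
      then show ?thesis by simp
    qed
    moreover have "solution u0 f U v"
      unfolding solution_def using U AE eq continuous_on_subset[OF cont] by blast
    ultimately show ?thesis by blast
  qed
  with C show ?thesis by blast
qed

text \<open>The energy identity is applied not to \<open>u\<close> but to its primitive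
  \<open>U\<close>, whose derivative \<open>u\<close> takes values in the form space. In terms of
  \<open>U\<close> the hypothesis reads \<open>\<iota> U' + A U = 0\<close> in weak form, and it is
  tested with \<open>U\<close> itself.\<close>

lemma uniqueness:
  assumes u: "u \<in> sqi (tm T)" and eq: "AE t in tm T. \<forall>y. \<iota> (u t) \<bullet> \<iota> y = prim T (\<lambda>s. (- A (u s)) \<bullet> y) t"
  shows "AE t in tm T. \<iota> (u t) = 0"
proof -
  have ui: "integrable (tm T) u" using u by (rule tm.sqi_imp_integrable)
  define U where "U = prim T u"
  have U: "U \<in> sqi (tm T)" unfolding U_def by (rule sqi_prim[OF ui])
  have \<iota>ui: "integrable (tm T) (\<lambda>t. \<iota> (u t))" by (intro tm.sqi_imp_integrable sqi_\<iota> u)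
  have \<iota>U: "prim T (\<lambda>t. \<iota> (u t)) t = \<iota> (U t)" for t
    unfolding U_def by (rule prim_bounded_linear[OF \<iota> ui, symmetric])
  have AU: "prim T (\<lambda>s. - (A (u s) \<bullet> y)) t = - (A (U t) \<bullet> y)" for y t
    using prim_bounded_linear[OF bounded_linear_compose[OF bounded_linear_inner_left[of "-y"] A] ui, of t] by (simp add: U_def)
  define \<phi> where "\<phi> t = (norm (\<iota> (U t)))\<^sup>2" for t
  have i\<phi>: "integrable (tm T) \<phi>" unfolding \<phi>_def[abs_def] by (intro sqi_integrable sqi_\<iota> U)
  have main: "\<phi> \<tau> / 2 + \<delta> * prim T (\<lambda>t. (norm (U t))\<^sup>2) \<tau> \<le> \<Lambda> * prim T \<phi> \<tau>" for \<tau>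
  proof -
    have "\<phi> \<tau> / 2 = prim T (\<lambda>t. \<iota> (u t) \<bullet> prim T (\<lambda>t. \<iota> (u t)) t) \<tau>"
      by (subst prim_self[OF \<iota>ui]) (simp add: \<phi>_def \<iota>U)
    also have "\<dots> = prim T (\<lambda>t. (-1) * (A (U t) \<bullet> U t)) \<tau>"
    proof (rule prim_cong_AE)
      show "AE t in tm T. \<iota> (u t) \<bullet> prim T (\<lambda>t. \<iota> (u t)) t = (-1) * (A (U t) \<bullet> U t)"
        using eq by eventually_elim (simp add: \<iota>U AU)
      show "(\<lambda>t. \<iota> (u t) \<bullet> prim T (\<lambda>t. \<iota> (u t)) t) \<in> borel_measurable (tm T)"
        using \<iota>ui by measurable
      show "(\<lambda>t. (-1) * (A (U t) \<bullet> U t)) \<in> borel_measurable (tm T)"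
        using integrable_inner[OF sqi_A[OF U] U] by measurable
    qed
    also have "\<dots> = - prim T (\<lambda>t. A (U t) \<bullet> U t) \<tau>" by (subst prim_cmult) simp
    finally show ?thesis using garding_prim[OF U, of \<tau>] by (simp add: \<phi>_def[abs_def])
  qed
  have p0: "0 \<le> \<delta> * prim T (\<lambda>t. (norm (U t))\<^sup>2) \<tau>" for \<tau>
    unfolding prim_def using \<delta> by (intro mult_nonneg_nonneg integral_nonneg_AE) auto
  have "(\<integral>t. \<phi> t \<partial>tm T) \<le> 2 * 0 * T * exp (2 * (2 * \<Lambda>) * T)"
  proof (rule gronwall[OF i\<phi>])
    have "\<phi> t \<le> 0 + 2 * \<Lambda> * prim T \<phi> t" for t using main[of t] p0[of t] by linarith
    then show "AE t in tm T. \<phi> t \<le> 0 + 2 * \<Lambda> * prim T \<phi> t" by simp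
  qed (use \<Lambda> T in \<open>auto simp: \<phi>_def\<close>)
  then have "\<Lambda> * prim T \<phi> T \<le> 0" using \<Lambda> by (simp add: prim_end mult_le_0_iff)
  moreover have "0 \<le> \<phi> T" by (simp add: \<phi>_def)
  ultimately have "\<delta> * prim T (\<lambda>t. (norm (U t))\<^sup>2) T \<le> 0" using main[of T] by linarith
  then have "\<delta> * (nrm (tm T) U)\<^sup>2 \<le> 0" by (simp add: prim_end nrm_sq)
  then have "nrm (tm T) U = 0" using \<delta> by (simp add: mult_le_0_iff)
  \<comment> \<open>Where \<open>U t = 0\<close>, the equation tested with \<open>u t\<close> says
    that the squared norm of \<open>\<iota> (u t)\<close> is 0.\<close>
  from nrm_eq_0[OF U this] eq show ?thesis
  proof eventually_elim
    case (elim t)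
    then have "\<iota> (u t) \<bullet> \<iota> (u t) = 0" by (simp add: AU A.zero)
    then show ?case by simp
  qed
qed

end

section \<open>Equations posed on a closed subspace\<close>

definition weak_solution ::
  "'v set \<Rightarrow> ('v::separable_hilbert \<Rightarrow> 'h::separable_hilbert) \<Rightarrow> ('v \<Rightarrow> 'v) \<Rightarrow> real \<Rightarrow> 'h \<Rightarrow>
    (real \<Rightarrow> 'v) \<Rightarrow> (real \<Rightarrow> 'v) \<Rightarrow> (real \<Rightarrow> 'h) \<Rightarrow> bool" where
  "weak_solution V \<iota> A T u0 f u v \<longleftrightarrow>
     u \<in> sqi (tm T) \<and> (AE t in tm T. u t \<in> V) \<and> continuous_on {0..T} v \<and> (AE t in tm T. v t = \<iota> (u t)) \<and>
     (\<forall>t\<in>{0..T}. \<forall>y\<in>V. v t \<bullet> \<iota> y = u0 \<bullet> \<iota> y + prim T (\<lambda>s. (f s - A (u s)) \<bullet> y) t)"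

text \<open>The problem on the subspace \<open>V\<close> is extended to the whole space by letting the form be the
  identity on the orthogonal complement of \<open>V\<close> and replacing \<open>\<iota>\<close> by \<open>\<iota> \<circ> proj V\<close>.\<close>

theorem weak_solution_wellposed:
  fixes \<iota> :: "'v::separable_hilbert \<Rightarrow> 'h::separable_hilbert" and A :: "'v \<Rightarrow> 'v"
  assumes V: "closed V" "subspace V" and \<iota>_bl: "bounded_linear \<iota>" and A_bl: "bounded_linear A" and T: "T > 0" and \<delta>: "\<delta> > 0"
    and garding: "\<And>x. x \<in> V \<Longrightarrow> \<delta> * (norm x)\<^sup>2 \<le> A x \<bullet> x + \<Lambda> * (norm (\<iota> x))\<^sup>2"
    and dense: "closure (\<iota> ` V) = UNIV" and inj: "\<And>x. x \<in> V \<Longrightarrow> \<iota> x = 0 \<Longrightarrow> x = 0"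
  shows "\<exists>C>0. \<forall>u0. \<forall>f\<in>sqi (tm T). (\<exists>u v. weak_solution V \<iota> A T u0 f u v) \<and>
    (\<forall>u v. weak_solution V \<iota> A T u0 f u v \<longrightarrow> nrm (tm T) u \<le> C * (norm u0 + nrm (tm T) f))"
proof -
  let ?P = "proj V"
  interpret io: bounded_linear \<iota> by (rule \<iota>_bl)
  interpret A0: bounded_linear A by (rule A_bl)
  have P: "bounded_linear ?P" by (rule bounded_linear_proj[OF V])
  interpret P: bounded_linear ?P by (rule P)
  note Pin = proj_in[OF V] and Pid = proj_id[OF V] and Pinner = proj_inner[OF V]
  have Psym: "?P x \<bullet> y = x \<bullet> ?P y" for x y
    by (metis Pin Pinner inner_commute)
  define B where "B x = ?P (A (?P x)) + (x - ?P x)" for x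
  have B: "bounded_linear B" unfolding B_def[abs_def]
    by (intro bounded_linear_add bounded_linear_sub bounded_linear_ident P
        bounded_linear_compose[OF P bounded_linear_compose[OF A_bl P]])
  interpret parabolic "\<lambda>x. \<iota> (?P x)" B T "min \<delta> 1" "max \<Lambda> 1"
  proof (rule parabolic.intro)
    show "bounded_linear (\<lambda>x. \<iota> (?P x))" by (rule bounded_linear_compose[OF \<iota>_bl P])
    have "range ?P = V"
    proof (intro equalityI subsetI)
      fix y assume "y \<in> V"
      then have "y = ?P y" by (rule Pid[symmetric])
      then show "y \<in> range ?P" by (rule range_eqI)
    qed (use Pin in auto)
    then have "range (\<lambda>x. \<iota> (?P x)) = \<iota> ` V" by (metis image_image)
    then show "closure (range (\<lambda>x. \<iota> (?P x))) = UNIV" using dense by simp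
    fix x :: 'v
    have orth: "(x - ?P x) \<bullet> ?P x = 0" by (rule proj_orthogonal[OF V Pin])
    have n: "(norm x)\<^sup>2 = (norm (?P x))\<^sup>2 + (norm (x - ?P x))\<^sup>2"
      using orth by (simp add: power2_norm_eq_inner inner_diff_left inner_diff_right inner_commute)
    have "min \<delta> 1 * (norm x)\<^sup>2 \<le> \<delta> * (norm (?P x))\<^sup>2 + 1 * (norm (x - ?P x))\<^sup>2"
      unfolding n distrib_left by (intro add_mono mult_right_mono) auto
    also have "\<delta> * (norm (?P x))\<^sup>2 \<le> A (?P x) \<bullet> ?P x + \<Lambda> * (norm (\<iota> (?P x)))\<^sup>2" by (rule garding[OF Pin])
    also have "\<Lambda> * (norm (\<iota> (?P x)))\<^sup>2 \<le> max \<Lambda> 1 * (norm (\<iota> (?P x)))\<^sup>2" by (intro mult_right_mono) auto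
    also have "A (?P x) \<bullet> ?P x = ?P (A (?P x)) \<bullet> x" by (simp add: Psym)
    also have "1 * (norm (x - ?P x))\<^sup>2 = (x - ?P x) \<bullet> x"
      using orth by (simp add: power2_norm_eq_inner inner_diff_left inner_diff_right)
    finally show "min \<delta> 1 * (norm x)\<^sup>2 \<le> B x \<bullet> x + max \<Lambda> 1 * (norm (\<iota> (?P x)))\<^sup>2"
      by (simp add: B_def inner_add_left)
  qed (use B T \<delta> in auto)
  obtain C where C: "C > 0" "\<And>u0 f. f \<in> sqi (tm T) \<Longrightarrow> \<exists>u v. solution u0 f u v \<and> nrm (tm T) u \<le> C * (norm u0 + nrm (tm T) f)"
    using existence by blast
  have ex: "\<exists>u v. weak_solution V \<iota> A T u0 f u v \<and> nrm (tm T) u \<le> C * (norm u0 + nrm (tm T) f)" if f: "f \<in> sqi (tm T)" for u0 f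
  proof -
    obtain u v where uv: "solution u0 f u v" "nrm (tm T) u \<le> C * (norm u0 + nrm (tm T) f)" using C(2)[OF f] by blast
    then have u: "u \<in> sqi (tm T)" by (simp add: solution_def)
    have "weak_solution V \<iota> A T u0 f (\<lambda>t. ?P (u t)) v"
      unfolding weak_solution_def
    proof (intro conjI ballI)
      show "(\<lambda>t. ?P (u t)) \<in> sqi (tm T)" by (rule sqi_bounded_linear(1)[OF P u])
      show "AE t in tm T. ?P (u t) \<in> V" using Pin by simp
      fix t y assume t: "t \<in> {0..T}" and y: "y \<in> V"
      have eq: "(f s - B (u s)) \<bullet> y = (f s - A (?P (u s))) \<bullet> y" for s
        using Pinner[OF y, of "A (?P (u s))"] proj_orthogonal[OF V y, of "u s"]
        by (simp add: B_def inner_diff_left inner_add_left)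
      show "v t \<bullet> \<iota> y = u0 \<bullet> \<iota> y + prim T (\<lambda>s. (f s - A (?P (u s))) \<bullet> y) t"
      proof -
        have "v t \<bullet> \<iota> (?P y) = u0 \<bullet> \<iota> (?P y) + prim T (\<lambda>s. (f s - B (u s)) \<bullet> y) t"
          using uv(1) t unfolding solution_def by blast
        then show ?thesis by (simp only: Pid[OF y] eq)
      qed
    qed (use uv in \<open>auto simp: solution_def\<close>)
    moreover have "nrm (tm T) (\<lambda>t. ?P (u t)) \<le> 1 * nrm (tm T) u"
      by (rule nrm_mono_AE[OF sqi_measurable[OF sqi_bounded_linear(1)[OF P u]] u]) (auto simp: norm_proj_le[OF V])
    ultimately show ?thesis using uv(2) by force
  qed
  \<comment> \<open>A given solution is compared with the constructed one. Their difference solves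
    the homogeneous problem, and \<open>inj\<close> lifts the vanishing of its image under
    \<open>\<iota>\<close> to the difference itself.\<close>
  have "nrm (tm T) u \<le> C * (norm u0 + nrm (tm T) f)"
    if f: "f \<in> sqi (tm T)" and w: "weak_solution V \<iota> A T u0 f u v" for u0 f u v
  proof -
    obtain u' v' where w': "weak_solution V \<iota> A T u0 f u' v'" and le: "nrm (tm T) u' \<le> C * (norm u0 + nrm (tm T) f)"
      using ex[OF f] by blast
    have u: "u \<in> sqi (tm T)" "u' \<in> sqi (tm T)" using w w' by (auto simp: weak_solution_def)
    have V_AE: "AE t in tm T. u t \<in> V" "AE t in tm T. u' t \<in> V" using w w' by (auto simp: weak_solution_def)
    \<comment> \<open>The projection puts the difference into \<open>V\<close> at every time;
      without it membership would hold only almost everywhere.\<close>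
    define d where "d t = ?P (u t - u' t)" for t
    have d: "d \<in> sqi (tm T)" unfolding d_def[abs_def] by (rule sqi_bounded_linear(1)[OF P sqi_diff[OF u]])
    have d_AE: "AE t in tm T. d t = u t - u' t"
      using V_AE by eventually_elim (simp add: d_def Pid V subspace_diff)
    have "AE t in tm T. \<iota> (?P (d t)) = 0"
    proof (rule uniqueness[OF d])
      have AE1: "AE t in tm T. v t = \<iota> (u t)" "AE t in tm T. v' t = \<iota> (u' t)"
        using w w' by (auto simp: weak_solution_def)
      from AE1 d_AE AE_space show "AE t in tm T. \<forall>y. \<iota> (?P (d t)) \<bullet> \<iota> (?P y) = prim T (\<lambda>s. (- B (d s)) \<bullet> y) t"
      proof eventually_elim
        case (elim t)
        show ?case
        proof
          fix y
          let ?y = "?P y"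
          have t: "t \<in> {0..T}" using elim by simp
          have i1: "integrable (tm T) (\<lambda>s. (f s - A (u s)) \<bullet> ?y)"
            by (rule sqi_inner[OF sqi_diff[OF f sqi_bounded_linear(1)[OF A_bl u(1)]] sqi_const])
          have i2: "integrable (tm T) (\<lambda>s. (f s - A (u' s)) \<bullet> ?y)"
            by (rule sqi_inner[OF sqi_diff[OF f sqi_bounded_linear(1)[OF A_bl u(2)]] sqi_const])
          have "?P (d t) = d t" unfolding d_def by (rule Pid[OF Pin])
          then have "?P (d t) = u t - u' t" using elim by simp
          then have "\<iota> (?P (d t)) \<bullet> \<iota> ?y = v t \<bullet> \<iota> ?y - v' t \<bullet> \<iota> ?y"
            using elim by (simp add: io.diff inner_diff_left)
          also have "\<dots> = prim T (\<lambda>s. (f s - A (u s)) \<bullet> ?y) t - prim T (\<lambda>s. (f s - A (u' s)) \<bullet> ?y) t"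
            using w w' t Pin[of y] by (simp add: weak_solution_def)
          also have "\<dots> = prim T (\<lambda>s. (f s - A (u s)) \<bullet> ?y - (f s - A (u' s)) \<bullet> ?y) t"
            by (rule prim_diff[OF i1 i2, symmetric])
          also have "\<dots> = prim T (\<lambda>s. (- B (d s)) \<bullet> y) t"
          proof (rule prim_cong_AE)
            show "(\<lambda>s. (- B (d s)) \<bullet> y) \<in> borel_measurable (tm T)"
              using sqi_measurable[OF sqi_bounded_linear(1)[OF B d]] by measurable
            show "AE s in tm T. (f s - A (u s)) \<bullet> ?y - (f s - A (u' s)) \<bullet> ?y = (- B (d s)) \<bullet> y"
              using d_AE
            proof eventually_elim
              case (elim s)
              have "?P (d s) = d s" by (simp add: d_def Pid Pin)
              then show ?case using elim by (simp add: B_def Psym A0.diff inner_diff_left)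
            qed
          qed (use i1 i2 in measurable)
          finally show "\<iota> (?P (d t)) \<bullet> \<iota> ?y = prim T (\<lambda>s. (- B (d s)) \<bullet> y) t" .
        qed
      qed
    qed
    then have "AE t in tm T. u t = u' t"
      using d_AE
    proof eventually_elim
      case (elim t)
      have dV: "d t \<in> V" unfolding d_def by (rule Pin)
      have "\<iota> (d t) = 0" using elim(1) by (simp only: Pid[OF dV])
      then have "d t = 0" by (rule inj[OF dV])
      then show ?case using elim by simp
    qed
    then have "nrm (tm T) u = nrm (tm T) u'" using u by (intro nrm_cong_AE) auto
    with le show ?thesis by simp
  qed
  with C(1) ex show ?thesis by blast
qed

declare measurable_ident_tm [measurable del] borel_sets_tm [measurable del]

section \<open>Smooth functions and bumps\<close>

lemma partial_eq: "(f has_derivative f') (at x) \<Longrightarrow> partial i f x = f' (axis i 1)"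
  unfolding partial_def using frechet_derivative_at by metis

lemma C_k_SucD: "C_k (Suc k) f \<Longrightarrow> C_k k f"
proof (induction k arbitrary: f)
  case 0
  then show ?case
    by (auto intro!: continuous_at_imp_continuous_on differentiable_imp_continuous_within)
next
  case (Suc k)
  then show ?case by (metis C_k.simps(2))
qed

lemma C_k_const: "C_k k (\<lambda>x. c)"
proof (induction k arbitrary: c)
  case (Suc k)
  have "partial i (\<lambda>x. c) = (\<lambda>x. 0)" for i :: 'a
    by (rule ext) (auto intro!: partial_eq[where f'="\<lambda>_. 0", simplified])
  then show ?case using Suc by simp
qed simp

lemma C_k_add: "C_k k f \<Longrightarrow> C_k k g \<Longrightarrow> C_k k (\<lambda>x. f x + g x)"
proof (induction k arbitrary: f g)
  case (Suc k)
  then have d: "\<And>x. f differentiable (at x)" "\<And>x. g differentiable (at x)" by auto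
  have "partial i (\<lambda>x. f x + g x) = (\<lambda>x. partial i f x + partial i g x)" for i
    using d by (intro ext partial_eq[THEN trans]) (auto simp: frechet_derivative_works partial_def intro!: has_derivative_add)
  then show ?case using Suc d by (auto intro!: differentiable_add)
qed (auto intro: continuous_intros)

lemma partial_mult:
  assumes "f differentiable (at x)" "g differentiable (at x)"
  shows "partial i (\<lambda>x. f x * g x) x = f x * partial i g x + partial i f x * g x"
proof -
  have "((\<lambda>x. f x * g x) has_derivative (\<lambda>h. f x * frechet_derivative g (at x) h + frechet_derivative f (at x) h * g x)) (at x)"
    using assms unfolding frechet_derivative_works by (rule has_derivative_mult)
  from partial_eq[OF this] show ?thesis by (simp add: partial_def)
qed

lemma C_k_mult: "C_k k f \<Longrightarrow> C_k k g \<Longrightarrow> C_k k (\<lambda>x. f x * g x)"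
proof (induction k arbitrary: f g)
  case (Suc k)
  then have d: "\<And>x. f differentiable (at x)" "\<And>x. g differentiable (at x)" by auto
  have "partial i (\<lambda>x. f x * g x) = (\<lambda>x. f x * partial i g x + partial i f x * g x)" for i
    by (intro ext partial_mult d)
  moreover have "C_k k (\<lambda>x. f x * partial i g x + partial i f x * g x)" for i
    using Suc.prems by (intro C_k_add Suc.IH C_k_SucD[of k f] C_k_SucD[of k g]) auto
  ultimately show ?case using d by (auto intro!: differentiable_mult)
qed (auto intro: continuous_intros)

lemma smooth_const: "smooth (\<lambda>x. c)" by (simp add: smooth_def C_k_const)
lemma smooth_add: "smooth f \<Longrightarrow> smooth g \<Longrightarrow> smooth (\<lambda>x. f x + g x)" by (simp add: smooth_def C_k_add)
lemma smooth_mult: "smooth f \<Longrightarrow> smooth g \<Longrightarrow> smooth (\<lambda>x. f x * g x)" by (simp add: smooth_def C_k_mult)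
lemma smooth_prod: "finite S \<Longrightarrow> (\<And>i. i \<in> S \<Longrightarrow> smooth (f i)) \<Longrightarrow> smooth (\<lambda>x. \<Prod>i\<in>S. f i x)"
  by (induction S rule: finite_induct) (auto intro: smooth_mult smooth_const)
lemma smooth_differentiable: "smooth f \<Longrightarrow> f differentiable (at x)"
  unfolding smooth_def by (metis C_k.simps(2))
lemma smooth_partial: "smooth f \<Longrightarrow> smooth (partial i f)"
  unfolding smooth_def by (metis C_k.simps(2))
lemma smooth_continuous: "smooth f \<Longrightarrow> continuous_on A f"
  unfolding smooth_def by (metis C_k.simps(1) continuous_on_subset subset_UNIV)

text \<open>Carrying the whole sequence of derivatives closes the induction: a partial derivative of
  \<open>F m (x $ i)\<close> is a constant times \<open>F (Suc m) (x $ i)\<close>.\<close>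

lemma C_k_coordinate:
  fixes F :: "nat \<Rightarrow> real \<Rightarrow> real"
  assumes "\<And>m t. (F m has_real_derivative F (Suc m) t) (at t)"
  shows "C_k k (\<lambda>x::real^'n::finite. F m (x $ i))"
proof (induction k arbitrary: m)
  case 0
  have "continuous_on UNIV (F m)" using assms by (meson DERIV_isCont continuous_at_imp_continuous_on)
  then have "continuous_on UNIV (\<lambda>x::real^'n. F m (x $ i))"
    by (rule continuous_on_compose2) (auto intro!: continuous_intros)
  then show ?case by simp
next
  case (Suc k)
  have d: "((\<lambda>x::real^'n. F m (x $ i)) has_derivative (\<lambda>h. F (Suc m) (x $ i) * h $ i)) (at x)" for x
    using has_derivative_compose[OF _ assms[unfolded has_field_derivative_def], of "\<lambda>x. x $ i" "\<lambda>h. h $ i" x UNIV m]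
    by (simp add: bounded_linear_vec_nth bounded_linear_imp_has_derivative)
  then have "partial j (\<lambda>x::real^'n. F m (x $ i)) = (\<lambda>x. F (Suc m) (x $ i) * (axis j 1 :: real^'n) $ i)" for j
    by (intro ext partial_eq)
  moreover have "C_k k (\<lambda>x::real^'n. F (Suc m) (x $ i) * (axis j 1 :: real^'n) $ i)" for j
    by (intro C_k_mult Suc C_k_const)
  ultimately show ?case using d by (auto intro: differentiableI)
qed

section \<open>Flat functions and bumps supported in boxes\<close>

definition flat :: "real poly \<Rightarrow> real \<Rightarrow> real" where
  "flat p t = (if t > 0 then poly p (1 / t) * exp (- 1 / t) else 0)"

lemma poly_div_exp_tendsto_0: "((\<lambda>s::real. poly p s / exp s) \<longlongrightarrow> 0) at_top"
proof -
  have "((\<lambda>s::real. \<Sum>i\<le>degree p. coeff p i * (s ^ i / exp s)) \<longlongrightarrow> (\<Sum>i\<le>degree p. coeff p i * 0)) at_top"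
    by (intro tendsto_intros tendsto_power_div_exp_0)
  then show ?thesis by (simp add: poly_altdef sum_divide_distrib)
qed

lemma flat_tendsto_0: "((\<lambda>h. flat p h) \<longlongrightarrow> 0) (at 0)"
proof -
  have "((\<lambda>h::real. poly p (inverse h) / exp (inverse h)) \<longlongrightarrow> 0) (at_right 0)"
    by (rule filterlim_compose[OF poly_div_exp_tendsto_0 filterlim_inverse_at_top_right])
  then have "((\<lambda>h. flat p h) \<longlongrightarrow> 0) (at_right 0)"
  proof (rule Lim_transform_eventually)
    show "\<forall>\<^sub>F h in at_right 0. poly p (inverse h) / exp (inverse h) = flat p h"
      using eventually_at_right_less[of "0::real"]
      by eventually_elim (simp add: flat_def exp_minus divide_inverse)
  qed
  moreover have "((\<lambda>h. flat p h) \<longlongrightarrow> 0) (at_left 0)"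
    by (rule tendsto_eventually) (auto simp: flat_def eventually_at_filter)
  ultimately show ?thesis by (simp add: filterlim_split_at)
qed

text \<open>For \<open>t > 0\<close> put \<open>s = 1 / t\<close>: differentiating
  \<open>p(s) exp (- s)\<close> in \<open>t\<close> gives
  \<open>s^2 (p(s) - p'(s)) exp (- s)\<close>, and \<open>[:0, 0, 1:]\<close> is the square of the
  variable. So the family is closed under differentiation, and \<open>flat 1\<close> is
  smooth.\<close>

lemma flat_deriv: "(flat p has_real_derivative flat ([:0, 0, 1:] * (p - pderiv p)) t) (at t)"
proof -
  consider "t > 0" | "t < 0" | "t = 0" by linarith
  then show ?thesis
  proof cases
    case 1
    have "((\<lambda>t. poly p (1 / t) * exp (- 1 / t)) has_real_derivative flat ([:0, 0, 1:] * (p - pderiv p)) t) (at t)"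
      using 1 by (auto intro!: derivative_eq_intros DERIV_chain2[OF poly_DERIV] simp: flat_def field_simps power2_eq_square)
    then show ?thesis
      by (rule has_field_derivative_transform_within_open[of _ _ _ "{0<..}"]) (use 1 in \<open>auto simp: flat_def\<close>)
  next
    case 2
    have "((\<lambda>t. 0) has_real_derivative flat ([:0, 0, 1:] * (p - pderiv p)) t) (at t)"
      using 2 by (auto simp: flat_def)
    then show ?thesis
      by (rule has_field_derivative_transform_within_open[of _ _ _ "{..<0}"]) (use 2 in \<open>auto simp: flat_def\<close>)
  next
    case 3
    \<comment> \<open>Dividing by \<open>h\<close> multiplies the polynomial by its variable, which
      gives \<open>pCons 0 p\<close>; the quotient is again a flat function.\<close>
    have "((\<lambda>h. flat p h / h) \<longlongrightarrow> 0) (at 0)"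
      by (rule Lim_transform_eventually[OF flat_tendsto_0[of "pCons 0 p"]])
         (auto simp: flat_def eventually_at_filter)
    then show ?thesis using 3 by (simp add: has_field_derivative_iff flat_def)
  qed
qed

primrec flat_poly :: "nat \<Rightarrow> real poly" where
  "flat_poly 0 = 1"
| "flat_poly (Suc m) = [:0, 0, 1:] * (flat_poly m - pderiv (flat_poly m))"

lemma smooth_flat_affine: "smooth (\<lambda>x::real^'n::finite. flat 1 (c * x $ i + d))"
proof -
  have "((\<lambda>t. c ^ m * flat (flat_poly m) (c * t + d)) has_real_derivative c ^ Suc m * flat (flat_poly (Suc m)) (c * t + d)) (at t)" for m t
    by (rule derivative_eq_intros DERIV_chain2[OF flat_deriv] refl | simp)+
  from C_k_coordinate[where F="\<lambda>m t. c ^ m * flat (flat_poly m) (c * t + d)" and m=0 and i=i, OF this]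
  show ?thesis unfolding smooth_def by simp
qed

lemma flat_1: "0 \<le> flat 1 t" "flat 1 t \<le> 1" "flat 1 t \<noteq> 0 \<longleftrightarrow> t > 0"
  by (auto simp: flat_def)

lemma flat_1_tendsto: "t > 0 \<Longrightarrow> (\<lambda>n. flat 1 (real (Suc n) * t)) \<longlonglongrightarrow> 1"
proof -
  assume t: "t > 0"
  have "(\<lambda>n. exp (- (inverse (real (Suc n)) / t))) \<longlonglongrightarrow> exp (- (0 / t))"
    by (intro tendsto_intros LIMSEQ_inverse_real_of_nat) (use t in simp)
  moreover have "flat 1 (real (Suc n) * t) = exp (- (inverse (real (Suc n)) / t))" for n
    using t by (simp add: flat_def divide_inverse mult.commute)
  ultimately show ?thesis by simp
qed

text \<open>Each factor is \<open>exp (- 1 / (n s))\<close> inside the box and tends to 1, so these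
  test functions converge boundedly to the indicator of the open box.\<close>

definition box_bump :: "real^'n::finite \<Rightarrow> real^'n \<Rightarrow> nat \<Rightarrow> real^'n \<Rightarrow> real" where
  "box_bump a b n x = (\<Prod>i\<in>UNIV. flat 1 (real (Suc n) * (x $ i - a $ i)) * flat 1 (real (Suc n) * (b $ i - x $ i)))"

lemma box_bump_support: "box_bump a b n x \<noteq> 0 \<longleftrightarrow> x \<in> box a b"
  by (auto simp: box_bump_def mem_box_cart flat_1 zero_less_mult_iff)

lemma box_bump_bounds: "0 \<le> box_bump a b n x" "box_bump a b n x \<le> 1"
  unfolding box_bump_def by (intro prod_nonneg prod_le_1 conjI mult_nonneg_nonneg mult_le_one flat_1 ballI)+

lemma box_bump_tendsto: "(\<lambda>n. box_bump a b n x) \<longlonglongrightarrow> indicator (box a b) x"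
proof (cases "x \<in> box a b")
  case True
  have "(\<lambda>n. box_bump a b n x) \<longlonglongrightarrow> (\<Prod>i\<in>(UNIV::'a set). 1 * 1)"
    unfolding box_bump_def using True by (intro tendsto_intros flat_1_tendsto) (auto simp: mem_box_cart)
  then show ?thesis using True by simp
next
  case False
  then have "(\<lambda>n. box_bump a b n x) = (\<lambda>n. 0)" using box_bump_support[of a b _ x] by auto
  then show ?thesis using False by simp
qed

lemma box_bump_test:
  assumes "cbox a b \<subseteq> G"
  shows "box_bump a b n \<in> test_fun G"
proof -
  have "smooth (\<lambda>x. flat 1 (real (Suc n) * (x $ i - a $ i)))" for i
    using smooth_flat_affine[of "real (Suc n)" i "- real (Suc n) * a $ i"] by (simp add: algebra_simps)
  moreover have "smooth (\<lambda>x. flat 1 (real (Suc n) * (b $ i - x $ i)))" for i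
    using smooth_flat_affine[of "- real (Suc n)" i "real (Suc n) * b $ i"] by (simp add: algebra_simps)
  ultimately have "smooth (box_bump a b n)"
    unfolding box_bump_def[abs_def] by (intro smooth_prod smooth_mult) auto
  moreover have "closure {x. box_bump a b n x \<noteq> 0} \<subseteq> cbox a b"
    by (rule closure_minimal) (auto simp: box_bump_support subset_eq mem_box_cart intro: less_imp_le)
  moreover from this have "compact (closure {x. box_bump a b n x \<noteq> 0})"
    by (meson bounded_cbox bounded_subset closed_closure compact_eq_bounded_closed)
  ultimately show ?thesis using assms by (auto simp: test_fun_def)
qed

section \<open>Test functions\<close>

lemma L2_fun_sqi: "L2_fun G = sqi (lebesgue_on G)"
  by (auto simp: L2_fun_def sqi_def)

lemma L2_inner_ip: "L2_inner G u v = ip (lebesgue_on G) u v"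
  by (simp add: L2_inner_def ip_def)

lemma L2_norm_nrm: "L2_norm G u = nrm (lebesgue_on G) u"
  by (simp add: L2_norm_def L2_inner_def nrm_def power2_eq_square)

lemma smooth_measurable: "smooth f \<Longrightarrow> f \<in> borel_measurable borel"
  by (intro borel_measurable_continuous_onI smooth_continuous)

lemma test_fun_bounded:
  assumes "\<phi> \<in> test_fun G"
  shows "\<exists>B\<ge>0. \<forall>x. \<bar>\<phi> x\<bar> \<le> B"
proof -
  let ?K = "closure {x. \<phi> x \<noteq> 0}"
  have "compact (\<phi> ` ?K)"
    using assms by (intro compact_continuous_image smooth_continuous) (auto simp: test_fun_def)
  then obtain B where B: "\<And>x. x \<in> ?K \<Longrightarrow> \<bar>\<phi> x\<bar> \<le> B"
    by (metis bounded_iff compact_imp_bounded imageI real_norm_def)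
  have "\<bar>\<phi> x\<bar> \<le> max B 0" for x
    using B[of x] closure_subset[of "{x. \<phi> x \<noteq> 0}"] by (cases "\<phi> x = 0") (auto simp: subset_eq le_max_iff_disj)
  then show ?thesis by (intro exI[of _ "max B 0"]) auto
qed

lemma compact_closed_subset': "closure A \<subseteq> K \<Longrightarrow> compact K \<Longrightarrow> compact (closure A)" for A :: "'a::heine_borel set"
  by (meson bounded_subset closed_closure compact_eq_bounded_closed)

lemma test_fun_partial:
  assumes "\<phi> \<in> test_fun G"
  shows "partial i \<phi> \<in> test_fun G"
proof -
  have "partial i \<phi> x = 0" if "x \<notin> closure {x. \<phi> x \<noteq> 0}" for x
  proof -
    have "(\<phi> has_derivative (\<lambda>_. 0)) (at x)"
      by (rule has_derivative_transform_within_open[of "\<lambda>_. 0" _ _ _ "- closure {x. \<phi> x \<noteq> 0}"])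
         (use that closure_subset in \<open>auto simp: subset_eq\<close>)
    then show ?thesis by (simp add: partial_eq)
  qed
  then have "closure {x. partial i \<phi> x \<noteq> 0} \<subseteq> closure {x. \<phi> x \<noteq> 0}"
    by (intro closure_minimal) auto
  then show ?thesis
    using assms smooth_partial unfolding test_fun_def by (blast intro: compact_closed_subset')
qed

lemma test_fun_mult:
  assumes "\<phi> \<in> test_fun G" "smooth \<psi>"
  shows "(\<lambda>x. \<psi> x * \<phi> x) \<in> test_fun G"
proof -
  have "closure {x. \<psi> x * \<phi> x \<noteq> 0} \<subseteq> closure {x. \<phi> x \<noteq> 0}"
    by (intro closure_mono) auto
  moreover from this have "compact (closure {x. \<psi> x * \<phi> x \<noteq> 0})"
    using assms unfolding test_fun_def by (blast intro: compact_closed_subset')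
  ultimately show ?thesis
    using assms by (auto simp: test_fun_def smooth_mult)
qed

lemma test_fun_lincomb:
  assumes "\<phi> \<in> test_fun G" "\<psi> \<in> test_fun G"
  shows "(\<lambda>x. p * \<phi> x + q * \<psi> x) \<in> test_fun G"
proof -
  have "closure {x. p * \<phi> x + q * \<psi> x \<noteq> 0} \<subseteq> closure ({x. \<phi> x \<noteq> 0} \<union> {x. \<psi> x \<noteq> 0})"
    by (intro closure_mono) auto
  then have sub: "closure {x. p * \<phi> x + q * \<psi> x \<noteq> 0} \<subseteq> closure {x. \<phi> x \<noteq> 0} \<union> closure {x. \<psi> x \<noteq> 0}"
    by (simp add: closure_Un)
  moreover have "compact (closure {x. \<phi> x \<noteq> 0} \<union> closure {x. \<psi> x \<noteq> 0})"
    using assms by (auto simp: test_fun_def)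
  ultimately have "compact (closure {x. p * \<phi> x + q * \<psi> x \<noteq> 0})"
    by (meson bounded_subset closed_closure compact_eq_bounded_closed)
  then show ?thesis
    using assms sub by (auto simp: test_fun_def intro!: smooth_add smooth_mult smooth_const)
qed

section \<open>Testing and integration by parts on a bounded open set\<close>

locale bounded_open =
  fixes G :: "(real^'n::finite) set"
  assumes open_G: "open G" and bounded_G: "bounded G"
begin

lemma G_sets [measurable, simp]: "G \<in> sets lebesgue" "G \<in> sets borel"
  using open_G by auto

lemma finite_G: "finite_measure (lebesgue_on G)"
  by (intro finite_measure_lebesgue_on lmeasurable_open bounded_G open_G)

sublocale fin: finite_measure "lebesgue_on G" by (rule finite_G)
sublocale compl: complete_measure "lebesgue_on G" by (rule complete_measure_lebesgue_on) simp

lemma borel_lebesgue_on: "f \<in> borel_measurable borel \<Longrightarrow> f \<in> borel_measurable (lebesgue_on G)"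
  by (intro measurable_restrict_space1 measurable_completion) simp

lemma bounded_sqi:
  fixes f :: "real^'n \<Rightarrow> real"
  assumes "f \<in> borel_measurable (lebesgue_on G)" "\<And>x. x \<in> G \<Longrightarrow> \<bar>f x\<bar> \<le> B"
  shows "f \<in> sqi (lebesgue_on G)"
proof -
  have "integrable (lebesgue_on G) (\<lambda>x. (norm (f x))\<^sup>2)"
    by (rule fin.integrable_const_bound[of _ "B\<^sup>2"])
       (use assms power_mono[OF assms(2) abs_ge_zero, of _ 2] in auto)
  then show ?thesis using assms by (simp add: sqi_def)
qed

lemma test_sqi: "\<phi> \<in> test_fun G \<Longrightarrow> \<phi> \<in> sqi (lebesgue_on G)"
  using test_fun_bounded[of \<phi> G] by (auto intro!: bounded_sqi borel_lebesgue_on smooth_measurable simp: test_fun_def)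

text \<open>Bumps show that \<open>v\<close> has integral 0 over every box whose closure lies in
  \<open>G\<close>. Inside one such box every further intersection with a box is again of this kind,
  so \<open>v\<close> vanishes there almost everywhere, and countably many of these boxes cover
  \<open>G\<close>.\<close>

lemma du_Bois_Reymond:
  assumes v: "v \<in> sqi (lebesgue_on G)" and 0: "\<And>\<phi>. \<phi> \<in> test_fun G \<Longrightarrow> ip (lebesgue_on G) v \<phi> = 0"
  shows "AE x in lebesgue_on G. v x = 0"
proof -
  have vi: "integrable (lebesgue_on G) v" using v by (rule fin.sqi_imp_integrable)
  have box0: "(\<integral>x. indicat_real (box a b) x * v x \<partial>lebesgue_on G) = 0" if ab: "cbox a b \<subseteq> G" for a b
  proof -
    have "(\<lambda>n. \<integral>x. box_bump a b n x * v x \<partial>lebesgue_on G) \<longlonglongrightarrow> (\<integral>x. indicat_real (box a b) x * v x \<partial>lebesgue_on G)"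
    proof (rule integral_dominated_convergence)
      show "integrable (lebesgue_on G) (\<lambda>x. norm (v x))" using vi by simp
      show "AE x in lebesgue_on G. (\<lambda>n. box_bump a b n x * v x) \<longlonglongrightarrow> indicat_real (box a b) x * v x"
        by (intro AE_I2 tendsto_intros box_bump_tendsto)
      show "AE x in lebesgue_on G. norm (box_bump a b n x * v x) \<le> norm (v x)" for n
        using box_bump_bounds[of a b n] by (intro AE_I2) (simp add: abs_mult mult_left_le_one_le)
      have "box_bump a b n \<in> borel_measurable (lebesgue_on G)" for n
        using box_bump_test[OF ab, of n] by (intro borel_lebesgue_on smooth_measurable) (simp add: test_fun_def)
      then show "(\<lambda>x. box_bump a b n x * v x) \<in> borel_measurable (lebesgue_on G)" for n
        using vi by measurable
      have "indicat_real (box a b) \<in> borel_measurable (lebesgue_on G)"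
        by (intro borel_lebesgue_on) simp
      then show "(\<lambda>x. indicat_real (box a b) x * v x) \<in> borel_measurable (lebesgue_on G)"
        using vi by measurable
    qed
    moreover have "(\<integral>x. box_bump a b n x * v x \<partial>lebesgue_on G) = 0" for n
      using 0[OF box_bump_test[OF ab]] by (simp add: ip_def mult.commute)
    ultimately show ?thesis using LIMSEQ_const_iff[of "0::real"] by simp
  qed
  have AE_box: "AE x in lebesgue. x \<in> box p q \<longrightarrow> v x = 0" if pq: "cbox p q \<subseteq> G" for p q
  proof -
    have "AE x in lebesgue. indicat_real (box p q) x * v x = 0"
    proof (rule AE_lebesgue_eq_0_if_box_integrals_0)
      have eq: "indicat_real G x *\<^sub>R indicat_real (box p q) x *\<^sub>R v x = indicat_real (box p q) x * v x" for x
        using pq box_subset_cbox[of p q] by (auto simp: indicator_def)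
      have "integrable (lebesgue_on G) (\<lambda>x. indicat_real (box p q) x *\<^sub>R v x)"
      proof (rule Bochner_Integration.integrable_bound[OF vi])
        have "indicat_real (box p q) \<in> borel_measurable (lebesgue_on G)"
          by (intro borel_lebesgue_on) simp
        then show "(\<lambda>x. indicat_real (box p q) x *\<^sub>R v x) \<in> borel_measurable (lebesgue_on G)"
          using vi by measurable
      qed (auto simp: indicator_def)
      then show "integrable lebesgue (\<lambda>x. indicat_real (box p q) x * v x)"
        by (subst (asm) integrable_restrict_space, simp) (simp only: eq)
      fix a b :: "real^'n"
      define p' q' where "p' = (\<chi> i. max (a $ i) (p $ i))" and "q' = (\<chi> i. min (b $ i) (q $ i))"
      have b: "box a b \<inter> box p q = box p' q'" "cbox a b \<inter> cbox p q = cbox p' q'"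
        unfolding p'_def q'_def by (auto simp: mem_box_cart)
      have "(LINT x:box a b|lebesgue. indicat_real (box p q) x * v x) = (LINT x|lebesgue. indicat_real G x *\<^sub>R (indicat_real (box p' q') x * v x))"
        unfolding set_lebesgue_integral_def b(1)[symmetric]
        using pq box_subset_cbox[of p q] by (intro Bochner_Integration.integral_cong) (auto simp: indicator_def)
      also have "\<dots> = (\<integral>x. indicat_real (box p' q') x * v x \<partial>lebesgue_on G)"
        by (subst integral_restrict_space) auto
      also have "\<dots> = 0" by (rule box0) (use b(2) pq in auto)
      finally show "(LINT x:box a b|lebesgue. indicat_real (box p q) x * v x) = 0" .
    qed
    then show ?thesis by (auto elim!: eventually_mono simp: indicator_def)
  qed
  define F where "F = {box p q | p q :: real^'n. cbox p q \<subseteq> G}"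
  have "\<And>S. S \<in> F \<Longrightarrow> open S" by (auto simp: F_def)
  then obtain F' where F': "F' \<subseteq> F" "countable F'" "\<Union>F' = \<Union>F" by (rule Lindelof)
  have "G \<subseteq> \<Union>F"
  proof
    fix x assume "x \<in> G"
    from open_contains_cbox[OF open_G this] obtain p q where "cbox p q \<subseteq> G" "x \<in> box p q" by metis
    then show "x \<in> \<Union>F" by (auto simp: F_def)
  qed
  moreover have "AE x in lebesgue. \<forall>S\<in>F'. x \<in> S \<longrightarrow> v x = 0"
    using F'(1) AE_box by (subst AE_ball_countable[OF F'(2)]) (auto simp: F_def)
  ultimately show ?thesis
    using F'(3) by (subst AE_restrict_space_iff) (auto elim!: eventually_mono)
qed

lemma difference_quotient_bound:
  assumes \<psi>: "\<psi> \<in> test_fun G" and B: "\<And>x. \<bar>partial i \<psi> x\<bar> \<le> B" and t: "t > 0"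
  shows "\<bar>(\<psi> (x + t *\<^sub>R axis i 1) - \<psi> x) / t\<bar> \<le> B"
proof -
  have d: "((\<lambda>s. \<psi> (x + s *\<^sub>R axis i 1)) has_real_derivative partial i \<psi> (x + s *\<^sub>R axis i 1)) (at s)" for s
  proof -
    have D: "(\<psi> has_derivative frechet_derivative \<psi> (at (x + s *\<^sub>R axis i 1))) (at (x + s *\<^sub>R axis i 1))"
      using \<psi> by (simp add: test_fun_def smooth_differentiable flip: frechet_derivative_works)
    have L: "((\<lambda>s. x + s *\<^sub>R axis i 1) has_derivative (\<lambda>h. h *\<^sub>R axis i 1)) (at s)"
      by (auto intro!: derivative_eq_intros)
    have "((\<lambda>s. \<psi> (x + s *\<^sub>R axis i 1)) has_derivative (\<lambda>h. frechet_derivative \<psi> (at (x + s *\<^sub>R axis i 1)) (h *\<^sub>R axis i 1))) (at s)"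
      using has_derivative_compose[OF L D] .
    then show ?thesis
      unfolding has_field_derivative_def partial_def
      by (simp add: linear_cmul[OF linear_frechet_derivative[OF differentiableI[OF D]]] mult.commute[of _ "frechet_derivative _ _ _"] mult_commute_abs)
  qed
  obtain z where "\<psi> (x + t *\<^sub>R axis i 1) - \<psi> (x + 0 *\<^sub>R axis i 1) = (t - 0) * partial i \<psi> (x + z *\<^sub>R axis i 1)"
    using MVT2[OF t d] by blast
  then show ?thesis using B[of "x + z *\<^sub>R axis i 1"] t by simp
qed

lemma difference_quotient_tendsto:
  assumes \<psi>: "\<psi> \<in> test_fun G"
  shows "(\<lambda>n. (\<psi> (x + inverse (real (Suc n)) *\<^sub>R axis i 1) - \<psi> x) / inverse (real (Suc n))) \<longlonglongrightarrow> partial i \<psi> x"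
proof -
  have D: "(\<psi> has_derivative frechet_derivative \<psi> (at (x + 0 *\<^sub>R axis i 1))) (at (x + 0 *\<^sub>R axis i 1))"
    using \<psi> by (simp add: test_fun_def smooth_differentiable flip: frechet_derivative_works)
  have L: "((\<lambda>s. x + s *\<^sub>R axis i 1) has_derivative (\<lambda>h. h *\<^sub>R axis i 1)) (at 0)"
    by (auto intro!: derivative_eq_intros)
  have "((\<lambda>s. \<psi> (x + s *\<^sub>R axis i 1)) has_derivative (\<lambda>h. frechet_derivative \<psi> (at (x + 0 *\<^sub>R axis i 1)) (h *\<^sub>R axis i 1))) (at 0)"
    using has_derivative_compose[OF L D] .
  then have "((\<lambda>s. \<psi> (x + s *\<^sub>R axis i 1)) has_real_derivative partial i \<psi> x) (at 0)"
    unfolding has_field_derivative_def partial_def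
    by (simp add: linear_cmul[OF linear_frechet_derivative[OF differentiableI[OF D]], simplified] mult_commute_abs)
  then have "((\<lambda>h. (\<psi> (x + h *\<^sub>R axis i 1) - \<psi> x) / h) \<longlongrightarrow> partial i \<psi> x) (at 0)"
    by (simp add: has_field_derivative_iff)
  moreover have "filterlim (\<lambda>n. inverse (real (Suc n))) (at 0) sequentially"
    using LIMSEQ_inverse_real_of_nat by (simp add: filterlim_at)
  ultimately show ?thesis by (rule filterlim_compose)
qed

lemma integral_G_lborel:
  fixes f :: "real^'n \<Rightarrow> real"
  assumes "f \<in> borel_measurable borel" "\<And>x. x \<notin> G \<Longrightarrow> f x = 0"
  shows "(\<integral>x. f x \<partial>lebesgue_on G) = (\<integral>x. f x \<partial>lborel)"
proof -
  have "(\<integral>x. f x \<partial>lebesgue_on G) = (\<integral>x. indicat_real G x *\<^sub>R f x \<partial>lebesgue)"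
    by (rule integral_restrict_space) simp
  also have "\<dots> = (\<integral>x. f x \<partial>lebesgue)"
    using assms(2) by (intro Bochner_Integration.integral_cong) (auto simp: indicator_def)
  also have "\<dots> = (\<integral>x. f x \<partial>lborel)"
    using assms(1) by (intro integral_completion) simp
  finally show ?thesis .
qed

text \<open>Discrete integration by parts: translation invariance moves the shift from
  \<open>\<psi>\<close> to \<open>\<alpha>\<close>, exactly as soon as it is shorter than the
  distance from the support of \<open>\<psi>\<close> to the complement of \<open>G\<close>. A
  constant \<open>\<alpha>\<close> gives the vanishing integral of a partial derivative, and a
  Lipschitz coefficient obtains its weak derivative from it.\<close>

lemma difference_quotient_limit:
  fixes \<alpha> :: "real^'n \<Rightarrow> real"
  assumes \<psi>: "\<psi> \<in> test_fun G" and \<alpha>: "\<alpha> \<in> borel_measurable borel" "\<And>x. \<bar>\<alpha> x\<bar> \<le> B"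
  shows "(\<lambda>n. \<integral>x. (\<alpha> (x - inverse (real (Suc n)) *\<^sub>R axis i 1) - \<alpha> x) / inverse (real (Suc n)) * \<psi> x \<partial>lebesgue_on G)
    \<longlonglongrightarrow> (\<integral>x. \<alpha> x * partial i \<psi> x \<partial>lebesgue_on G)"
proof -
  let ?t = "\<lambda>n. inverse (real (Suc n))" and ?e = "axis i 1 :: real^'n"
  note [measurable] = \<alpha>(1)
  have \<psi>b[measurable]: "\<psi> \<in> borel_measurable borel" "partial i \<psi> \<in> borel_measurable borel"
    using \<psi> test_fun_partial[OF \<psi>] by (auto intro: smooth_measurable simp: test_fun_def)
  obtain B' where B': "\<And>x. \<bar>partial i \<psi> x\<bar> \<le> B'" using test_fun_bounded[OF test_fun_partial[OF \<psi>]] by blast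
  obtain B2 where B2: "\<And>x. \<bar>\<psi> x\<bar> \<le> B2" using test_fun_bounded[OF \<psi>] by blast
  have B0: "0 \<le> B" using \<alpha>(2)[of 0] by linarith
  have lim: "(\<lambda>n. \<integral>x. \<alpha> x * ((\<psi> (x + ?t n *\<^sub>R ?e) - \<psi> x) / ?t n) \<partial>lebesgue_on G)
    \<longlonglongrightarrow> (\<integral>x. \<alpha> x * partial i \<psi> x \<partial>lebesgue_on G)"
  proof (rule integral_dominated_convergence)
    show "integrable (lebesgue_on G) (\<lambda>x. B * B')" by simp
    show "AE x in lebesgue_on G. (\<lambda>n. \<alpha> x * ((\<psi> (x + ?t n *\<^sub>R ?e) - \<psi> x) / ?t n)) \<longlonglongrightarrow> \<alpha> x * partial i \<psi> x"
      by (intro AE_I2 tendsto_mult tendsto_const difference_quotient_tendsto \<psi>)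
    show "AE x in lebesgue_on G. norm (\<alpha> x * ((\<psi> (x + ?t n *\<^sub>R ?e) - \<psi> x) / ?t n)) \<le> B * B'" for n
      unfolding real_norm_def abs_mult using B0
      by (intro AE_I2 mult_mono \<alpha>(2) difference_quotient_bound[OF \<psi> B']) auto
    show "(\<lambda>x. \<alpha> x * partial i \<psi> x) \<in> borel_measurable (lebesgue_on G)"
      by (rule borel_lebesgue_on) measurable
    show "(\<lambda>x. \<alpha> x * ((\<psi> (x + ?t n *\<^sub>R ?e) - \<psi> x) / ?t n)) \<in> borel_measurable (lebesgue_on G)" for n
      by (rule borel_lebesgue_on) measurable
  qed
  let ?K = "closure {x. \<psi> x \<noteq> 0}"
  obtain d where d: "d > 0" "(\<Union>x\<in>?K. ball x d) \<subseteq> G"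
    using compact_subset_open_imp_ball_epsilon_subset[of ?K G] \<psi> open_G by (auto simp: test_fun_def)
  have "\<forall>\<^sub>F n in sequentially. ?t n < d"
    using LIMSEQ_inverse_real_of_nat d(1) by (rule order_tendstoD)
  then have "\<forall>\<^sub>F n in sequentially. (\<integral>x. \<alpha> x * ((\<psi> (x + ?t n *\<^sub>R ?e) - \<psi> x) / ?t n) \<partial>lebesgue_on G)
      = (\<integral>x. (\<alpha> (x - ?t n *\<^sub>R ?e) - \<alpha> x) / ?t n * \<psi> x \<partial>lebesgue_on G)"
  proof eventually_elim
    case (elim n)
    let ?t = "?t n"
    have t: "?t > 0" by simp
    have \<psi>G: "\<psi> x = 0" if "x \<notin> G" for x
      using that \<psi> closure_subset[of "{x. \<psi> x \<noteq> 0}"] by (auto simp: test_fun_def)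
    have \<psi>shift: "\<psi> (x + ?t *\<^sub>R ?e) = 0" if "x \<notin> G" for x
    proof (rule ccontr)
      assume "\<psi> (x + ?t *\<^sub>R ?e) \<noteq> 0"
      then have "x + ?t *\<^sub>R ?e \<in> ?K" using closure_subset[of "{x. \<psi> x \<noteq> 0}"] by auto
      moreover have "x \<in> ball (x + ?t *\<^sub>R ?e) d" using elim t by (simp add: dist_norm)
      ultimately show False using d(2) that by blast
    qed
    have bi: "integrable (lebesgue_on G) f" if "f \<in> borel_measurable borel" "\<And>x. \<bar>f x\<bar> \<le> c" for f :: "real^'n \<Rightarrow> real" and c
      by (rule fin.integrable_const_bound[of _ c]) (use that in \<open>auto intro: borel_lebesgue_on\<close>)
    have i1: "integrable (lebesgue_on G) (\<lambda>x. \<alpha> x * \<psi> (x + ?t *\<^sub>R ?e))"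
      by (rule bi[where c="B * B2"]) (measurable, simp only: abs_mult, intro mult_mono \<alpha>(2) B2 B0 abs_ge_zero)
    have i2: "integrable (lebesgue_on G) (\<lambda>x. \<alpha> x * \<psi> x)"
      by (rule bi[where c="B * B2"]) (measurable, simp only: abs_mult, intro mult_mono \<alpha>(2) B2 B0 abs_ge_zero)
    have i3: "integrable (lebesgue_on G) (\<lambda>x. \<alpha> (x - ?t *\<^sub>R ?e) * \<psi> x)"
      by (rule bi[where c="B * B2"]) (measurable, simp only: abs_mult, intro mult_mono \<alpha>(2) B2 B0 abs_ge_zero)
    have m: "(\<lambda>x. \<alpha> x * \<psi> (x + ?t *\<^sub>R ?e)) \<in> borel_measurable borel" by measurable
    have "(\<integral>x. \<alpha> x * \<psi> (x + ?t *\<^sub>R ?e) \<partial>lebesgue_on G) = (\<integral>x. \<alpha> x * \<psi> (x + ?t *\<^sub>R ?e) \<partial>lborel)"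
      by (rule integral_G_lborel[OF m]) (simp only: \<psi>shift mult_zero_right simp_thms)
    also have "\<dots> = (\<integral>x. \<alpha> x * \<psi> (x + ?t *\<^sub>R ?e) \<partial>(distr lborel borel ((+) (- (?t *\<^sub>R ?e)))))"
      by (simp add: lborel_distr_plus)
    also have "\<dots> = (\<integral>x. \<alpha> (x - ?t *\<^sub>R ?e) * \<psi> x \<partial>lborel)"
      by (subst integral_distr) (auto simp: algebra_simps)
    also have "\<dots> = (\<integral>x. \<alpha> (x - ?t *\<^sub>R ?e) * \<psi> x \<partial>lebesgue_on G)"
      by (rule integral_G_lborel[symmetric]) (measurable, simp add: \<psi>G)
    finally have shift: "(\<integral>x. \<alpha> x * \<psi> (x + ?t *\<^sub>R ?e) \<partial>lebesgue_on G) = (\<integral>x. \<alpha> (x - ?t *\<^sub>R ?e) * \<psi> x \<partial>lebesgue_on G)" .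
    have "(\<integral>x. \<alpha> x * ((\<psi> (x + ?t *\<^sub>R ?e) - \<psi> x) / ?t) \<partial>lebesgue_on G) =
        (\<integral>x. (\<alpha> x * \<psi> (x + ?t *\<^sub>R ?e) - \<alpha> x * \<psi> x) / ?t \<partial>lebesgue_on G)"
      by (intro Bochner_Integration.integral_cong) (auto simp: algebra_simps)
    also have "\<dots> = (\<integral>x. (\<alpha> (x - ?t *\<^sub>R ?e) * \<psi> x - \<alpha> x * \<psi> x) / ?t \<partial>lebesgue_on G)"
      using i1 i2 i3 shift by simp
    also have "\<dots> = (\<integral>x. (\<alpha> (x - ?t *\<^sub>R ?e) - \<alpha> x) / ?t * \<psi> x \<partial>lebesgue_on G)"
      by (intro Bochner_Integration.integral_cong) (auto simp: algebra_simps)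
    finally show ?case .
  qed
  with lim show ?thesis by (rule Lim_transform_eventually)
qed

lemma integral_partial_test:
  assumes "\<psi> \<in> test_fun G"
  shows "(\<integral>x. partial i \<psi> x \<partial>lebesgue_on G) = 0"
  using difference_quotient_limit[OF assms, of "\<lambda>_. 1" 1 i] LIMSEQ_const_iff[of "0::real"] by simp

end

section \<open>The sequence space\<close>

lemma countable_dense_imp_countable_basis:
  fixes D :: "'a::metric_space set"
  assumes D: "countable D" and dense: "\<And>x e. e > 0 \<Longrightarrow> \<exists>d\<in>D. dist x d < e"
  shows "\<exists>B::'a set set. countable B \<and> open = generate_topology B"
proof -
  define B where "B = (\<lambda>(d, n). ball d (inverse (real (Suc n)))) ` (D \<times> (UNIV :: nat set))"
  have "topological_basis B"
  proof (rule topological_basisI)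
    show "open b" if "b \<in> B" for b using that by (auto simp: B_def)
    fix U x assume "open U" "x \<in> (U :: 'a set)"
    then obtain e where e: "e > 0" "ball x e \<subseteq> U" by (auto simp: open_contains_ball)
    then obtain n where n: "inverse (real (Suc n)) < e / 2" using reals_Archimedean[of "e/2"] by auto
    obtain d where d: "d \<in> D" "dist x d < inverse (real (Suc n))" using dense[of "inverse (real (Suc n))" x] by auto
    have "ball d (inverse (real (Suc n))) \<subseteq> U"
    proof
      fix y assume "y \<in> ball d (inverse (real (Suc n)))"
      then have "dist x y < e" using d n dist_triangle[of x y d] by (simp del: of_nat_Suc)
      then show "y \<in> U" using e by auto
    qed
    moreover have "x \<in> ball d (inverse (real (Suc n)))" using d by (simp add: dist_commute)
    moreover have "ball d (inverse (real (Suc n))) \<in> B" using d by (auto simp: B_def)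
    ultimately show "\<exists>b\<in>B. x \<in> b \<and> b \<subseteq> U" by blast
  qed
  then have "open = generate_topology B" by (rule topological_basis_imp_subbasis)
  moreover have "countable B" unfolding B_def using D by auto
  ultimately show ?thesis by blast
qed

lemma dist_vec_le_sum: "dist x y \<le> (\<Sum>i\<in>UNIV. dist (x $ i) (y $ i))"
  unfolding dist_vec_def by (rule L2_set_le_sum) simp

instance vec :: ("{metric_space, second_countable_topology}", finite) second_countable_topology
proof
  obtain D :: "'a set" where D: "countable D" "\<And>X. open X \<Longrightarrow> X \<noteq> {} \<Longrightarrow> \<exists>d\<in>D. d \<in> X"
    using countable_dense_exists by metis
  have "{v :: 'a ^ 'b. \<forall>i. v $ i \<in> D} \<subseteq> vec_lambda ` (PiE UNIV (\<lambda>_. D))"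
    by (auto intro!: image_eqI[where x="vec_nth _"])
  then have "countable {v :: 'a ^ 'b. \<forall>i. v $ i \<in> D}"
    by (rule countable_subset) (intro countable_image countable_PiE D finite)
  moreover have "\<exists>d\<in>{v :: 'a ^ 'b. \<forall>i. v $ i \<in> D}. dist x d < e" if "e > 0" for x e
  proof -
    define r where "r = e / real CARD('b)"
    have "r > 0" using that by (simp add: r_def)
    then have "\<exists>d\<in>D. d \<in> ball (x $ i) r" for i by (intro D) auto
    then obtain f where f: "\<And>i. f i \<in> D" "\<And>i. dist (x $ i) (f i) < r" by (metis mem_ball)
    have "dist x (\<chi> i. f i) \<le> (\<Sum>i\<in>UNIV. dist (x $ i) (f i))" using dist_vec_le_sum[of x "\<chi> i. f i"] by simp
    also have "\<dots> < (\<Sum>i\<in>(UNIV::'b set). r)" by (rule sum_strict_mono) (auto simp: f)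
    also have "\<dots> = e" by (simp add: r_def)
    finally show ?thesis using f(1) by (intro bexI[of _ "\<chi> i. f i"]) auto
  qed
  ultimately show "\<exists>B::('a ^ 'b) set set. countable B \<and> open = generate_topology B"
    by (rule countable_dense_imp_countable_basis)
qed

instance vec :: (separable_hilbert, finite) separable_hilbert ..

abbreviation cs :: "nat measure" where "cs \<equiv> count_space UNIV"

text \<open>The operators and curves need a Hilbert space that is a type, whereas
  \<open>L2_fun G\<close> is a set of functions with a seminorm. Over the counting measure there are
  no null functions besides 0, so \<open>nrm\<close> becomes a norm and the facts on
  \<open>sqi\<close> give the inner product axioms and completeness.\<close>

typedef ell2 = "sqi cs :: (nat \<Rightarrow> real) set"
  by (rule exI[of _ "\<lambda>_. 0"]) simp

setup_lifting type_definition_ell2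

lemma nrm_cs_0: "f \<in> sqi cs \<Longrightarrow> nrm cs f = 0 \<Longrightarrow> f = (\<lambda>_. 0)" for f :: "nat \<Rightarrow> real"
  using nrm_eq_0[of f cs] by (auto simp: AE_count_space)

instantiation ell2 :: real_inner
begin

lift_definition zero_ell2 :: ell2 is "\<lambda>_. 0" by simp
lift_definition plus_ell2 :: "ell2 \<Rightarrow> ell2 \<Rightarrow> ell2" is "\<lambda>f g n. f n + g n" by (rule sqi_add)
lift_definition minus_ell2 :: "ell2 \<Rightarrow> ell2 \<Rightarrow> ell2" is "\<lambda>f g n. f n - g n" by (rule sqi_diff)
lift_definition uminus_ell2 :: "ell2 \<Rightarrow> ell2" is "\<lambda>f n. - f n" by (rule sqi_minus)
lift_definition scaleR_ell2 :: "real \<Rightarrow> ell2 \<Rightarrow> ell2" is "\<lambda>c f n. c *\<^sub>R f n" by (rule sqi_scaleR)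
lift_definition inner_ell2 :: "ell2 \<Rightarrow> ell2 \<Rightarrow> real" is "\<lambda>f g. ip cs f g" .
definition norm_ell2 :: "ell2 \<Rightarrow> real" where "norm_ell2 x = sqrt (inner x x)"
definition dist_ell2 :: "ell2 \<Rightarrow> ell2 \<Rightarrow> real" where "dist_ell2 x y = norm (x - y)"
definition sgn_ell2 :: "ell2 \<Rightarrow> ell2" where "sgn_ell2 x = scaleR (inverse (norm x)) x"
definition uniformity_ell2 :: "(ell2 \<times> ell2) filter" where
  "uniformity_ell2 = (INF e\<in>{0<..}. principal {(x, y). dist x y < e})"
definition open_ell2 :: "ell2 set \<Rightarrow> bool" where
  "open_ell2 U = (\<forall>x\<in>U. \<forall>\<^sub>F (x', y) in uniformity. x' = x \<longrightarrow> y \<in> U)"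

instance
proof
  fix x y z :: ell2 and r s :: real
  show "x + y + z = x + (y + z)" by transfer (simp add: add.assoc)
  show "x + y = y + x" by transfer (simp add: add.commute)
  show "0 + x = x" by transfer simp
  show "- x + x = 0" by transfer simp
  show "x - y = x + - y" by transfer simp
  show "r *\<^sub>R (x + y) = r *\<^sub>R x + r *\<^sub>R y" by transfer (simp add: distrib_left)
  show "(r + s) *\<^sub>R x = r *\<^sub>R x + s *\<^sub>R x" by transfer (simp add: distrib_right)
  show "r *\<^sub>R s *\<^sub>R x = (r * s) *\<^sub>R x" by transfer (simp add: mult.assoc)
  show "1 *\<^sub>R x = x" by transfer simp
  show "dist x y = norm (x - y)" by (rule dist_ell2_def)
  show "sgn x = scaleR (inverse (norm x)) x" by (rule sgn_ell2_def)
  show "uniformity = (INF e\<in>{0<..}. principal {(x, y). dist (x::ell2) y < e})" by (rule uniformity_ell2_def)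
  show "open U = (\<forall>x\<in>U. \<forall>\<^sub>F (x', y) in uniformity. x' = x \<longrightarrow> y \<in> U)" for U :: "ell2 set" by (rule open_ell2_def)
  show "inner x y = inner y x" by transfer (rule ip_commute)
  show "inner (x + y) z = inner x z + inner y z" by transfer (rule ip_add_left)
  show "inner (r *\<^sub>R x) y = r * inner x y" by transfer (rule ip_scaleR_left)
  show "0 \<le> inner x x" by transfer (simp flip: nrm_ip)
  show "(inner x x = 0) = (x = 0)"
    by transfer (auto simp: nrm_cs_0 simp flip: nrm_ip, simp add: nrm_def)
  show "norm x = sqrt (inner x x)" by (rule norm_ell2_def)
qed

end

lemma norm_ell2_nrm: "norm x = nrm cs (Rep_ell2 x)"
  by (simp add: norm_ell2_def inner_ell2.rep_eq flip: nrm_ip)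

instance ell2 :: banach
proof
  fix X :: "nat \<Rightarrow> ell2" assume X: "Cauchy X"
  have d: "nrm cs (\<lambda>k. Rep_ell2 (X m) k - Rep_ell2 (X n) k) = dist (X m) (X n)" for m n
    by (simp add: dist_norm norm_ell2_nrm minus_ell2.rep_eq)
  have "\<exists>g\<in>sqi cs. (\<lambda>n. nrm cs (\<lambda>k. Rep_ell2 (X n) k - g k)) \<longlonglongrightarrow> 0"
    by (rule sqi_complete) (use Rep_ell2 X in \<open>auto simp: d Cauchy_def\<close>)
  then obtain g where g: "g \<in> sqi cs" "(\<lambda>n. nrm cs (\<lambda>k. Rep_ell2 (X n) k - g k)) \<longlonglongrightarrow> 0" by blast
  have "nrm cs (\<lambda>k. Rep_ell2 (X n) k - g k) = norm (X n - Abs_ell2 g)" for n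
    by (simp add: norm_ell2_nrm minus_ell2.rep_eq Abs_ell2_inverse g)
  then have "X \<longlonglongrightarrow> Abs_ell2 g" using g(2) by (simp add: tendsto_norm_zero_iff LIM_zero_iff)
  then show "convergent X" by (auto simp: convergent_def)
qed

lemma sqi_cs_iff: "f \<in> sqi cs \<longleftrightarrow> summable (\<lambda>n. (f n)\<^sup>2)" for f :: "nat \<Rightarrow> real"
  by (simp add: sqi_def integrable_count_space_nat_iff)

lemma norm_ell2_suminf: "(norm x)\<^sup>2 = suminf (\<lambda>n. (Rep_ell2 x n)\<^sup>2)" and summable_ell2: "summable (\<lambda>n. (Rep_ell2 x n)\<^sup>2)"
proof -
  have "Rep_ell2 x \<in> sqi cs" by (rule Rep_ell2)
  then show "summable (\<lambda>n. (Rep_ell2 x n)\<^sup>2)" by (simp add: sqi_cs_iff)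
  have "integrable cs (\<lambda>n. (Rep_ell2 x n)\<^sup>2)" using sqi_integrable[OF \<open>Rep_ell2 x \<in> sqi cs\<close>] by simp
  then show "(norm x)\<^sup>2 = suminf (\<lambda>n. (Rep_ell2 x n)\<^sup>2)"
    by (simp add: norm_ell2_nrm nrm_sq integral_count_space_nat)
qed

lemma finite_sqi_cs: "(\<And>n. n \<ge> N \<Longrightarrow> f n = 0) \<Longrightarrow> f \<in> sqi cs" for f :: "nat \<Rightarrow> real"
  unfolding sqi_cs_iff by (rule summable_finite[of "{..<N}"]) (auto simp: not_less)

definition trunc :: "nat \<Rightarrow> ell2 \<Rightarrow> ell2" where
  "trunc N x = Abs_ell2 (\<lambda>n. if n < N then Rep_ell2 x n else 0)"

lemma Rep_trunc: "Rep_ell2 (trunc N x) n = (if n < N then Rep_ell2 x n else 0)"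
  unfolding trunc_def by (subst Abs_ell2_inverse) (auto intro: finite_sqi_cs[of N])

lemma trunc_tendsto: "(\<lambda>N. trunc N x) \<longlonglongrightarrow> x"
proof (rule metric_LIMSEQ_I)
  fix e :: real assume "e > 0"
  obtain N where N: "\<And>n. n \<ge> N \<Longrightarrow> norm (suminf (\<lambda>i. (Rep_ell2 x (i + n))\<^sup>2)) < e\<^sup>2"
    using suminf_exist_split[OF _ summable_ell2, of "e\<^sup>2" x] \<open>e > 0\<close> by auto
  have "dist (trunc n x) x < e" if "n \<ge> N" for n
  proof -
    have r: "(Rep_ell2 (trunc n x - x) i)\<^sup>2 = (if i < n then 0 else (Rep_ell2 x i)\<^sup>2)" for i
      by (simp add: minus_ell2.rep_eq Rep_trunc)
    have "(norm (trunc n x - x))\<^sup>2 = suminf (\<lambda>i. if i < n then 0 else (Rep_ell2 x i)\<^sup>2)"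
      by (simp add: norm_ell2_suminf r)
    also have "\<dots> = suminf (\<lambda>i. (Rep_ell2 x (i + n))\<^sup>2)"
      using suminf_split_initial_segment[of "\<lambda>i. if i < n then 0 else (Rep_ell2 x i)\<^sup>2" n]
        summable_ell2[of "trunc n x - x"] by (simp add: r)
    also have "\<dots> < e\<^sup>2" using N[OF that] by simp
    finally show ?thesis using \<open>e > 0\<close> by (simp add: dist_norm power2_less_imp_less)
  qed
  then show "\<exists>no. \<forall>n\<ge>no. dist (trunc n x) x < e" by blast
qed

instance ell2 :: second_countable_topology
proof
  define f where "f xs = Abs_ell2 (\<lambda>n. if n < length xs then real_of_rat (xs ! n) else 0)" for xs
  have Rf: "Rep_ell2 (f xs) n = (if n < length xs then real_of_rat (xs ! n) else 0)" for xs n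
    unfolding f_def by (subst Abs_ell2_inverse) (auto intro: finite_sqi_cs[of "length xs"])
  have c: "countable (range f)" by (rule countable_image) (rule countableI_type)
  have dense: "\<exists>d\<in>range f. dist x d < e" if "e > 0" for x e
  proof -
    have "e / 2 > 0" using that by simp
    from metric_LIMSEQ_D[OF trunc_tendsto this] obtain N where N: "dist (trunc N x) x < e / 2" by blast
    \<comment> \<open>Fewer than \<open>Suc N\<close> coordinates are each approximated within
      \<open>r\<close>, so the error is at most \<open>Suc N * r = e / 2\<close>.\<close>
    define r where "r = e / (2 * real (Suc N))"
    have r: "r > 0" using that by (simp add: r_def)
    have "\<exists>q. \<bar>Rep_ell2 x n - real_of_rat q\<bar> < r" for n
    proof -
      obtain q where "Rep_ell2 x n < real_of_rat q" "real_of_rat q < Rep_ell2 x n + r"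
        using of_rat_dense[of "Rep_ell2 x n" "Rep_ell2 x n + r"] r by auto
      then have "\<bar>Rep_ell2 x n - real_of_rat q\<bar> < r" by linarith
      then show ?thesis by blast
    qed
    then obtain q where q: "\<And>n. \<bar>Rep_ell2 x n - real_of_rat (q n)\<bar> < r" by metis
    let ?y = "f (map q [0..<N])"
    have d: "Rep_ell2 (trunc N x - ?y) n = (if n < N then Rep_ell2 x n - real_of_rat (q n) else 0)" for n
      by (simp add: minus_ell2.rep_eq Rep_trunc Rf)
    have "(norm (trunc N x - ?y))\<^sup>2 = suminf (\<lambda>n. (Rep_ell2 (trunc N x - ?y) n)\<^sup>2)" by (rule norm_ell2_suminf)
    also have "\<dots> = (\<Sum>n<N. (Rep_ell2 (trunc N x - ?y) n)\<^sup>2)"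
      by (rule suminf_finite) (auto simp: d)
    also have "\<dots> \<le> (\<Sum>n<N. r\<^sup>2)"
    proof (rule sum_mono)
      fix n assume "n \<in> {..<N}"
      then have "\<bar>Rep_ell2 (trunc N x - ?y) n\<bar> \<le> \<bar>r\<bar>" using q[of n] r by (simp add: d)
      then show "(Rep_ell2 (trunc N x - ?y) n)\<^sup>2 \<le> r\<^sup>2" by (simp only: abs_le_square_iff)
    qed
    also have "\<dots> = real N * r\<^sup>2" by simp
    also have "\<dots> \<le> (real (Suc N))\<^sup>2 * r\<^sup>2"
      by (rule mult_right_mono) (simp_all add: power2_eq_square algebra_simps)
    also have "\<dots> = (real (Suc N) * r)\<^sup>2" by (simp only: power_mult_distrib)
    also have "\<dots> = (e / 2)\<^sup>2"
    proof -
      have "real (Suc N) * r = e / 2" by (simp add: r_def del: of_nat_Suc)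
      then show ?thesis by (simp only:)
    qed
    finally have "(norm (trunc N x - ?y))\<^sup>2 \<le> (e / 2)\<^sup>2" .
    then have "norm (trunc N x - ?y) \<le> e / 2" by (rule power2_le_imp_le) (use that in simp)
    then have "dist x ?y < e"
      using N dist_triangle[of x ?y "trunc N x"] unfolding dist_norm norm_minus_commute[of x "trunc N x"] by linarith
    then show ?thesis by blast
  qed
  show "\<exists>B::ell2 set set. countable B \<and> open = generate_topology B"
    by (rule countable_dense_imp_countable_basis[OF c dense])
qed

instance ell2 :: separable_hilbert ..

section \<open>Coordinates with respect to an orthonormal basis\<close>

locale onb = bounded_open G for G :: "(real^'n::finite) set" +
  fixes h :: "nat \<Rightarrow> real^'n \<Rightarrow> real"
  assumes h: "orthonormal_basis_L2 G h"
begin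

abbreviation "M \<equiv> lebesgue_on G"

lemma h_sqi: "h k \<in> sqi M" and h_orth: "ip M (h j) (h k) = (if j = k then 1 else 0)"
  and h_basis: "u \<in> sqi M \<Longrightarrow> (\<lambda>n. nrm M (\<lambda>x. u x - (\<Sum>k<n. ip M u (h k) * h k x))) \<longlonglongrightarrow> 0"
  using h unfolding orthonormal_basis_L2_def L2_fun_sqi L2_inner_ip L2_norm_nrm by auto

lemma sqi_cmult: "u \<in> sqi M \<Longrightarrow> (\<lambda>x. c * u x) \<in> sqi M" for u :: "real^'n \<Rightarrow> real"
  using sqi_scaleR[of u M c] by simp

lemma ip_cmult: "ip M (\<lambda>x. c * u x) v = c * ip M u v" for u :: "real^'n \<Rightarrow> real"
  using ip_scaleR_left[of M c u v] by simp

lemma partial_sum_sqi: "(\<lambda>x. \<Sum>k<n. c k * h k x) \<in> sqi M"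
  by (intro sqi_sum sqi_cmult h_sqi)

lemma ip_partial_sum:
  assumes u: "u \<in> sqi M"
  shows "ip M (\<lambda>x. \<Sum>k<n. c k * h k x) u = (\<Sum>k<n. c k * ip M (h k) u)"
proof (induction n)
  case (Suc n)
  have "ip M (\<lambda>x. (\<Sum>k<n. c k * h k x) + c n * h n x) u = ip M (\<lambda>x. \<Sum>k<n. c k * h k x) u + ip M (\<lambda>x. c n * h n x) u"
    by (intro ip_add_left partial_sum_sqi sqi_cmult h_sqi u)
  then show ?case using Suc by (simp add: ip_cmult)
qed (simp add: ip_def)

text \<open>Pythagoras for the partial sums: the squared error is the squared norm minus the sum of
  the squared coefficients, and it tends to 0 because \<open>h\<close> is a basis.\<close>

lemma parseval: "u \<in> sqi M \<Longrightarrow> (\<lambda>k. (ip M u (h k))\<^sup>2) sums (nrm M u)\<^sup>2"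
proof -
  assume u: "u \<in> sqi M"
  let ?c = "\<lambda>k. ip M u (h k)"
  let ?s = "\<lambda>n x. \<Sum>k<n. ?c k * h k x"
  have us: "ip M u (?s n) = (\<Sum>k<n. (?c k)\<^sup>2)" for n
    by (subst ip_commute) (simp add: ip_partial_sum u power2_eq_square ip_commute[of M "h _"])
  have sh: "ip M (?s n) (h k) = ?c k" if "k < n" for n k
    using that by (simp add: ip_partial_sum h_sqi h_orth if_distrib sum.delta cong: if_cong)
  have ss: "ip M (?s n) (?s n) = (\<Sum>k<n. (?c k)\<^sup>2)" for n
    by (subst ip_partial_sum[OF partial_sum_sqi]) (simp add: ip_commute[of M "h _"] sh power2_eq_square)
  have "(nrm M (\<lambda>x. u x - ?s n x))\<^sup>2 = (nrm M u)\<^sup>2 - (\<Sum>k<n. (?c k)\<^sup>2)" for n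
    using us[of n] ss[of n] unfolding nrm_ip
    by (simp add: ip_diff_left ip_diff_right sqi_diff partial_sum_sqi u ip_commute[of M "?s n" u])
  moreover have "(\<lambda>n. (nrm M (\<lambda>x. u x - ?s n x))\<^sup>2) \<longlonglongrightarrow> 0\<^sup>2" by (intro tendsto_intros h_basis u)
  ultimately have "(\<lambda>n. (nrm M u)\<^sup>2 - (\<Sum>k<n. (?c k)\<^sup>2)) \<longlonglongrightarrow> 0" by simp
  then have "(\<lambda>n. (nrm M u)\<^sup>2 - ((nrm M u)\<^sup>2 - (\<Sum>k<n. (?c k)\<^sup>2))) \<longlonglongrightarrow> (nrm M u)\<^sup>2 - 0" by (intro tendsto_intros)
  then show ?thesis by (simp add: sums_def)
qed

definition \<Phi> :: "(real^'n \<Rightarrow> real) \<Rightarrow> ell2" where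
  "\<Phi> u = Abs_ell2 (\<lambda>k. ip M u (h k))"

lemma Rep_\<Phi>: "u \<in> sqi M \<Longrightarrow> Rep_ell2 (\<Phi> u) k = ip M u (h k)"
  unfolding \<Phi>_def using parseval[of u] by (subst Abs_ell2_inverse) (auto simp: sqi_cs_iff sums_iff)

lemma norm_\<Phi>: "u \<in> sqi M \<Longrightarrow> norm (\<Phi> u) = nrm M u"
proof -
  assume u: "u \<in> sqi M"
  have "(norm (\<Phi> u))\<^sup>2 = (nrm M u)\<^sup>2"
    unfolding norm_ell2_suminf Rep_\<Phi>[OF u] using parseval[OF u] by (simp add: sums_iff)
  then show ?thesis by (simp add: power2_eq_iff_nonneg)
qed

lemma \<Phi>_add: "u \<in> sqi M \<Longrightarrow> v \<in> sqi M \<Longrightarrow> \<Phi> (\<lambda>x. u x + v x) = \<Phi> u + \<Phi> v"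
  by (rule Rep_ell2_inject[THEN iffD1]) (auto simp: plus_ell2.rep_eq Rep_\<Phi> sqi_add ip_add_left h_sqi)

lemma \<Phi>_cmult: "u \<in> sqi M \<Longrightarrow> \<Phi> (\<lambda>x. c * u x) = c *\<^sub>R \<Phi> u"
  by (rule Rep_ell2_inject[THEN iffD1]) (auto simp: scaleR_ell2.rep_eq Rep_\<Phi> sqi_cmult ip_cmult)

lemma \<Phi>_diff: "u \<in> sqi M \<Longrightarrow> v \<in> sqi M \<Longrightarrow> \<Phi> (\<lambda>x. u x - v x) = \<Phi> u - \<Phi> v"
  using \<Phi>_add[OF _ sqi_cmult, of u v "-1"] \<Phi>_cmult[of v "-1"] by simp

lemma \<Phi>_sum: "(\<And>i. i \<in> I \<Longrightarrow> u i \<in> sqi M) \<Longrightarrow> \<Phi> (\<lambda>x. \<Sum>i\<in>I. u i x) = (\<Sum>i\<in>I. \<Phi> (u i))"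
proof (induction I rule: infinite_finite_induct)
  case (insert i I)
  then show ?case by (simp add: \<Phi>_add sqi_sum)
next
  case (infinite I)
  then show ?case using \<Phi>_cmult[of "\<lambda>_. 0" 0] by simp
qed (use \<Phi>_cmult[of "\<lambda>_. 0" 0] in simp)

text \<open>Polarisation of \<open>norm_\<Phi>\<close>.\<close>

lemma inner_\<Phi>: "u \<in> sqi M \<Longrightarrow> v \<in> sqi M \<Longrightarrow> \<Phi> u \<bullet> \<Phi> v = ip M u v"
proof -
  assume uv: "u \<in> sqi M" "v \<in> sqi M"
  have "(norm (\<Phi> u + \<Phi> v))\<^sup>2 = (nrm M (\<lambda>x. u x + v x))\<^sup>2"
    using norm_\<Phi>[OF sqi_add[OF uv]] uv by (simp add: \<Phi>_add)
  moreover have "(norm (\<Phi> u))\<^sup>2 = (nrm M u)\<^sup>2" "(norm (\<Phi> v))\<^sup>2 = (nrm M v)\<^sup>2" using norm_\<Phi> uv by auto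
  ultimately show ?thesis
    unfolding power2_norm_eq_inner nrm_ip
    by (simp add: inner_add_left inner_add_right ip_add_left ip_add_right uv sqi_add inner_commute ip_commute)
qed

lemma \<Phi>_eq_iff: "u \<in> sqi M \<Longrightarrow> v \<in> sqi M \<Longrightarrow> \<Phi> u = \<Phi> v \<longleftrightarrow> (AE x in M. u x = v x)"
proof
  assume uv: "u \<in> sqi M" "v \<in> sqi M"
  show "AE x in M. u x = v x" if "\<Phi> u = \<Phi> v"
    using nrm_eq_0[OF sqi_diff[OF uv]] norm_\<Phi>[OF sqi_diff[OF uv]] that by (simp add: \<Phi>_diff uv)
  assume *: "AE x in M. u x = v x"
  have "nrm M (\<lambda>x. u x - v x) = nrm M (\<lambda>x. 0 :: real)"
    by (rule nrm_cong_AE) (use * uv[THEN sqi_measurable] in auto)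
  then show "\<Phi> u = \<Phi> v" using norm_\<Phi>[OF sqi_diff[OF uv]] by (simp add: \<Phi>_diff uv nrm_def)
qed

text \<open>The partial sums of the series with coefficients \<open>x\<close> are mapped to the
  truncations of \<open>x\<close>. The isometry makes them Cauchy, and completeness of
  \<open>sqi M\<close> supplies the preimage.\<close>

lemma \<Phi>_surj: "\<exists>u\<in>sqi M. \<Phi> u = x"
proof -
  define s where "s n z = (\<Sum>k<n. Rep_ell2 x k * h k z)" for n z
  have s: "s n \<in> sqi M" for n unfolding s_def[abs_def] by (rule partial_sum_sqi)
  have \<Phi>s: "\<Phi> (s n) = trunc n x" for n
  proof (rule Rep_ell2_inject[THEN iffD1], rule ext)
    fix k
    have "Rep_ell2 (\<Phi> (s n)) k = (\<Sum>j<n. Rep_ell2 x j * ip M (h j) (h k))"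
      unfolding Rep_\<Phi>[OF s] unfolding s_def by (rule ip_partial_sum[OF h_sqi])
    then show "Rep_ell2 (\<Phi> (s n)) k = Rep_ell2 (trunc n x) k"
      by (simp add: Rep_trunc h_orth if_distrib sum.delta cong: if_cong)
  qed
  have "Cauchy (\<lambda>n. \<Phi> (s n))" unfolding \<Phi>s using trunc_tendsto by (rule LIMSEQ_imp_Cauchy)
  then have "\<exists>u\<in>sqi M. (\<lambda>n. nrm M (\<lambda>z. s n z - u z)) \<longlonglongrightarrow> 0"
    by (intro sqi_complete s) (simp add: Cauchy_def dist_norm norm_\<Phi>[symmetric] sqi_diff s \<Phi>_diff)
  then obtain u where u: "u \<in> sqi M" "(\<lambda>n. nrm M (\<lambda>z. s n z - u z)) \<longlonglongrightarrow> 0" by blast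
  then have "(\<lambda>n. norm (trunc n x - \<Phi> u)) \<longlonglongrightarrow> 0"
    by (simp add: norm_\<Phi>[symmetric] sqi_diff s \<Phi>_diff \<Phi>s)
  then have "(\<lambda>n. trunc n x) \<longlonglongrightarrow> \<Phi> u" by (simp add: tendsto_norm_zero_iff LIM_zero_iff)
  then have "\<Phi> u = x" using trunc_tendsto LIMSEQ_unique by blast
  with u show ?thesis by blast
qed

text \<open>A chosen representative of the class; as a map into functions it is linear only modulo
  null functions.\<close>

definition \<Phi>inv :: "ell2 \<Rightarrow> real^'n \<Rightarrow> real" where
  "\<Phi>inv x = (SOME u. u \<in> sqi M \<and> \<Phi> u = x)"

lemma \<Phi>inv: "\<Phi>inv x \<in> sqi M" "\<Phi> (\<Phi>inv x) = x"
  using someI_ex[of "\<lambda>u. u \<in> sqi M \<and> \<Phi> u = x"] \<Phi>_surj[of x] unfolding \<Phi>inv_def by blast+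

lemma \<Phi>inv_\<Phi>: "u \<in> sqi M \<Longrightarrow> AE x in M. \<Phi>inv (\<Phi> u) x = u x"
  using \<Phi>_eq_iff[of "\<Phi>inv (\<Phi> u)" u] \<Phi>inv by auto

definition bmeas :: "(real^'n \<Rightarrow> real) \<Rightarrow> bool" where
  "bmeas m \<longleftrightarrow> m \<in> borel_measurable M \<and> (\<exists>B. \<forall>x\<in>G. \<bar>m x\<bar> \<le> B)"

definition mult :: "(real^'n \<Rightarrow> real) \<Rightarrow> ell2 \<Rightarrow> ell2" where
  "mult m x = \<Phi> (\<lambda>z. m z * \<Phi>inv x z)"

lemma bmeas_mult_sqi:
  assumes "m \<in> borel_measurable M" "\<And>x. x \<in> G \<Longrightarrow> \<bar>m x\<bar> \<le> B" "u \<in> sqi M"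
  shows "(\<lambda>z. m z * u z) \<in> sqi M" "nrm M (\<lambda>z. m z * u z) \<le> \<bar>B\<bar> * nrm M u"
proof -
  have 1: "(\<lambda>z. m z * u z) \<in> borel_measurable M" using assms sqi_measurable by measurable
  have 2: "AE z in M. norm (m z * u z) \<le> \<bar>B\<bar> * norm (u z)"
  proof (rule AE_I2)
    fix z assume "z \<in> space M"
    then have "\<bar>m z\<bar> \<le> \<bar>B\<bar>" using assms(2)[of z] by simp
    then show "norm (m z * u z) \<le> \<bar>B\<bar> * norm (u z)" by (simp add: abs_mult mult_right_mono)
  qed
  show "(\<lambda>z. m z * u z) \<in> sqi M" "nrm M (\<lambda>z. m z * u z) \<le> \<bar>B\<bar> * nrm M u"
    using nrm_mono_AE[OF 1 assms(3) 2] by auto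
qed

lemma bmeas_sqi: "bmeas m \<Longrightarrow> u \<in> sqi M \<Longrightarrow> (\<lambda>z. m z * u z) \<in> sqi M"
  unfolding bmeas_def using bmeas_mult_sqi(1) by blast

text \<open>The operator does not depend on the representative chosen by
  \<open>\<Phi>inv\<close>.\<close>

lemma mult_\<Phi>: "bmeas m \<Longrightarrow> u \<in> sqi M \<Longrightarrow> mult m (\<Phi> u) = \<Phi> (\<lambda>z. m z * u z)"
  unfolding mult_def using \<Phi>inv_\<Phi>[of u] \<Phi>inv(1)[of "\<Phi> u"]
  by (subst \<Phi>_eq_iff) (auto simp: bmeas_sqi elim!: eventually_mono)

lemma inner_mult: "bmeas m \<Longrightarrow> u \<in> sqi M \<Longrightarrow> v \<in> sqi M \<Longrightarrow> mult m (\<Phi> u) \<bullet> \<Phi> v = (\<integral>x. m x * u x * v x \<partial>M)"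
  by (simp add: mult_\<Phi> inner_\<Phi> bmeas_sqi) (simp add: ip_def)

text \<open>Moves a coefficient from the test function onto the solution when the operator is
  rewritten in \<open>op_A_eq\<close>.\<close>

lemma mult_symm:
  assumes m: "bmeas m"
  shows "mult m x \<bullet> y = x \<bullet> mult m y"
proof -
  have e: "mult m x \<bullet> y = (\<integral>z. m z * \<Phi>inv x z * \<Phi>inv y z \<partial>M)" for x y
    using inner_mult[OF m \<Phi>inv(1) \<Phi>inv(1), of x y] unfolding \<Phi>inv(2) .
  have "mult m x \<bullet> y = (\<integral>z. m z * \<Phi>inv y z * \<Phi>inv x z \<partial>M)"
    unfolding e by (intro Bochner_Integration.integral_cong) (simp_all only: ac_simps)
  also have "\<dots> = x \<bullet> mult m y" by (simp only: e[symmetric] inner_commute)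
  finally show ?thesis .
qed

lemma norm_mult_le:
  assumes "m \<in> borel_measurable M" "\<And>x. x \<in> G \<Longrightarrow> \<bar>m x\<bar> \<le> B" "0 \<le> B"
  shows "norm (mult m x) \<le> B * norm x"
proof -
  have "norm (mult m x) = nrm M (\<lambda>z. m z * \<Phi>inv x z)"
    unfolding mult_def by (rule norm_\<Phi>[OF bmeas_mult_sqi(1)[OF assms(1,2) \<Phi>inv(1)]])
  also have "\<dots> \<le> \<bar>B\<bar> * nrm M (\<Phi>inv x)" by (rule bmeas_mult_sqi(2)[OF assms(1,2) \<Phi>inv(1)])
  also have "nrm M (\<Phi>inv x) = norm x" using norm_\<Phi>[OF \<Phi>inv(1), of x] unfolding \<Phi>inv(2) by simp
  finally show ?thesis using assms(3) by simp
qed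

lemma bounded_linear_mult:
  assumes m: "bmeas m"
  shows "bounded_linear (mult m)"
proof -
  obtain B where B: "m \<in> borel_measurable M" "\<And>x. x \<in> G \<Longrightarrow> \<bar>m x\<bar> \<le> B" using m unfolding bmeas_def by blast
  show ?thesis
  proof (rule bounded_linear_intro[where K="\<bar>B\<bar>"])
    fix x y and r :: real
    have "mult m (\<Phi> (\<lambda>z. \<Phi>inv x z + \<Phi>inv y z)) = \<Phi> (\<lambda>z. m z * \<Phi>inv x z + m z * \<Phi>inv y z)"
      by (subst mult_\<Phi>) (auto simp: m sqi_add \<Phi>inv distrib_left)
    then show "mult m (x + y) = mult m x + mult m y"
      by (simp add: \<Phi>_add \<Phi>inv bmeas_sqi m mult_def[of m x] mult_def[of m y])
    have "mult m (\<Phi> (\<lambda>z. r * \<Phi>inv x z)) = \<Phi> (\<lambda>z. r * (m z * \<Phi>inv x z))"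
      by (subst mult_\<Phi>) (auto simp: m sqi_cmult \<Phi>inv mult.left_commute)
    then show "mult m (r *\<^sub>R x) = r *\<^sub>R mult m x"
      by (simp add: \<Phi>_cmult \<Phi>inv bmeas_sqi m mult_def[of m x])
    show "norm (mult m x) \<le> norm x * \<bar>B\<bar>"
      using norm_mult_le[of m "\<bar>B\<bar>" x] B by (force simp: mult.commute)
  qed
qed

end

section \<open>Sobolev spaces\<close>

lemma subspace_closure:
  fixes S :: "'a::real_normed_vector set"
  assumes "subspace S"
  shows "subspace (closure S)"
  unfolding subspace_def
proof (intro conjI ballI allI)
  show "0 \<in> closure S" using subspace_0[OF assms] closure_subset by blast
  fix x y assume "x \<in> closure S" "y \<in> closure S"
  then obtain f g where "\<And>n. f n \<in> S" "f \<longlonglongrightarrow> x" "\<And>n. g n \<in> S" "g \<longlonglongrightarrow> y"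
    unfolding closure_sequential by metis
  then have "(\<lambda>n. f n + g n) \<longlonglongrightarrow> x + y" "\<And>n. f n + g n \<in> S"
    using assms by (auto intro: tendsto_add subspace_add)
  then show "x + y \<in> closure S" unfolding closure_sequential by (intro exI[of _ "\<lambda>n. f n + g n"]) auto
next
  fix c x assume "x \<in> closure S"
  then obtain f where "\<And>n. f n \<in> S" "f \<longlonglongrightarrow> x" unfolding closure_sequential by metis
  then have "(\<lambda>n. c *\<^sub>R f n) \<longlonglongrightarrow> c *\<^sub>R x" "\<And>n. c *\<^sub>R f n \<in> S"
    using assms by (auto intro: tendsto_scaleR subspace_scale)
  then show "c *\<^sub>R x \<in> closure S" unfolding closure_sequential by (intro exI[of _ "\<lambda>n. c *\<^sub>R f n"]) auto
qed

lemma subspace_imageI: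
  fixes f :: "'a \<Rightarrow> 'b::real_vector"
  assumes 1: "\<And>u v p q. u \<in> S \<Longrightarrow> v \<in> S \<Longrightarrow> p *\<^sub>R f u + q *\<^sub>R f v \<in> f ` S" and "u \<in> S"
  shows "subspace (f ` S)"
  unfolding subspace_def
proof (intro conjI ballI allI)
  show "0 \<in> f ` S" using 1[OF assms(2,2), of 0 0] by simp
  show "x + y \<in> f ` S" if "x \<in> f ` S" "y \<in> f ` S" for x y
    using that 1[of _ _ 1 1] by (elim imageE) simp
  show "c *\<^sub>R x \<in> f ` S" if "x \<in> f ` S" for x c
    using that 1[of _ _ c 0] by (elim imageE) simp
qed

lemma bounded_linear_vec_lambda:
  fixes f :: "'n::finite \<Rightarrow> 'a::real_normed_vector \<Rightarrow> 'b::real_normed_vector"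
  assumes f: "\<And>i. bounded_linear (f i)"
  shows "bounded_linear (\<lambda>x. \<chi> i. f i x)"
proof (rule bounded_linear_intro[where K="\<Sum>i\<in>UNIV. onorm (f i)"])
  fix x y and r :: real
  show "(\<chi> i. f i (x + y)) = (\<chi> i. f i x) + (\<chi> i. f i y)"
    by (simp add: vec_eq_iff linear_add[OF bounded_linear.linear[OF f]])
  show "(\<chi> i. f i (r *\<^sub>R x)) = r *\<^sub>R (\<chi> i. f i x)"
    by (simp add: vec_eq_iff linear_scale[OF bounded_linear.linear[OF f]])
  have "norm (\<chi> i. f i x) \<le> (\<Sum>i\<in>UNIV. norm (f i x))"
    unfolding norm_vec_def using L2_set_le_sum[of UNIV "\<lambda>i. norm (f i x)"] by simp
  also have "\<dots> \<le> (\<Sum>i\<in>UNIV. onorm (f i) * norm x)" by (intro sum_mono onorm f)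
  finally show "norm (\<chi> i. f i x) \<le> norm x * (\<Sum>i\<in>UNIV. onorm (f i))"
    by (simp add: sum_distrib_left mult.commute)
qed

text \<open>The bound lets convergence of the pairings spread from \<open>D\<close> to its closure,
  and the limit functional is bounded, hence represented by Riesz. It is applied to difference
  quotients, whose pairings with test functions are known to converge.\<close>

lemma weak_limit_exists:
  fixes y :: "nat \<Rightarrow> 'a::separable_hilbert"
  assumes bound: "\<And>n. norm (y n) \<le> C" and D: "closure D = UNIV" and conv: "\<And>z. z \<in> D \<Longrightarrow> convergent (\<lambda>n. y n \<bullet> z)"
  shows "\<exists>l. \<forall>z. (\<lambda>n. y n \<bullet> z) \<longlonglongrightarrow> l \<bullet> z"
proof -
  have C: "0 \<le> C" using bound[of 0] norm_ge_zero[of "y 0"] by linarith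
  have cz: "convergent (\<lambda>n. y n \<bullet> z)" for z
  proof -
    have "Cauchy (\<lambda>n. y n \<bullet> z)"
    proof (rule metric_CauchyI)
      fix e :: real assume "e > 0"
      \<comment> \<open>\<open>C + 1\<close> keeps the denominator positive when
        \<open>C = 0\<close>.\<close>
      define r where "r = e / (3 * (C + 1))"
      have r: "r > 0" using \<open>e > 0\<close> C by (simp add: r_def)
      obtain z' where z': "z' \<in> D" "norm (z - z') < r"
        using D closure_approachable[of z D] r by (auto simp: dist_norm norm_minus_commute)
      have small: "\<bar>y n \<bullet> (z - z')\<bar> < e / 3" for n
      proof -
        have "\<bar>y n \<bullet> (z - z')\<bar> \<le> norm (y n) * norm (z - z')" by (rule Cauchy_Schwarz_ineq2)
        also have "\<dots> \<le> C * r" using bound z' by (intro mult_mono) (auto simp: C)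
        also have "\<dots> < (C + 1) * r" using r by simp
        also have "\<dots> = e / 3" using C by (simp add: r_def divide_simps)
        finally show ?thesis .
      qed
      have "Cauchy (\<lambda>n. y n \<bullet> z')" using conv[OF z'(1)] by (rule convergent_Cauchy)
      then obtain N where N: "\<And>m n. m \<ge> N \<Longrightarrow> n \<ge> N \<Longrightarrow> \<bar>y m \<bullet> z' - y n \<bullet> z'\<bar> < e / 3"
        unfolding Cauchy_def dist_real_def using \<open>e > 0\<close> by (metis divide_pos_pos zero_less_numeral)
      have "\<bar>y m \<bullet> z - y n \<bullet> z\<bar> < e" if "m \<ge> N" "n \<ge> N" for m n
        using N[OF that] small[of m] small[of n] unfolding inner_diff_right by linarith
      then show "\<exists>M. \<forall>m\<ge>M. \<forall>n\<ge>M. dist (y m \<bullet> z) (y n \<bullet> z) < e" unfolding dist_real_def by blast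
    qed
    then show ?thesis by (rule Cauchy_convergent)
  qed
  define F where "F z = lim (\<lambda>n. y n \<bullet> z)" for z
  have F: "(\<lambda>n. y n \<bullet> z) \<longlonglongrightarrow> F z" for z using cz[of z] unfolding F_def by (simp add: convergent_LIMSEQ_iff)
  have "bounded_linear F"
  proof (rule bounded_linear_intro[where K=C])
    fix x z and r :: real
    have "(\<lambda>n. y n \<bullet> (x + z)) \<longlonglongrightarrow> F x + F z" unfolding inner_add_right by (intro tendsto_add F)
    from LIMSEQ_unique[OF F this] show "F (x + z) = F x + F z" .
    have "(\<lambda>n. y n \<bullet> (r *\<^sub>R x)) \<longlonglongrightarrow> r * F x" unfolding inner_scaleR_right by (intro tendsto_mult tendsto_const F)
    from LIMSEQ_unique[OF F this] show "F (r *\<^sub>R x) = r *\<^sub>R F x" by simp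
    have "\<bar>y n \<bullet> x\<bar> \<le> norm x * C" for n
    proof -
      have "\<bar>y n \<bullet> x\<bar> \<le> norm (y n) * norm x" by (rule Cauchy_Schwarz_ineq2)
      also have "\<dots> \<le> C * norm x" using bound by (intro mult_right_mono) auto
      finally show ?thesis by (simp add: mult.commute)
    qed
    then show "norm (F x) \<le> norm x * C"
      by (intro LIMSEQ_le_const2[OF tendsto_norm[OF F]]) auto
  qed
  then obtain l where "\<And>z. F z = l \<bullet> z" using riesz_representation by blast
  then show ?thesis using F by metis
qed

section \<open>Weak derivatives and Sobolev functions in coordinates\<close>

context onb
begin

lemma is_weak_deriv_iff:
  "is_weak_deriv G i u v \<longleftrightarrow> v \<in> sqi M \<and> (\<forall>\<phi>\<in>test_fun G. ip M u (partial i \<phi>) = - ip M v \<phi>)"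
  by (simp add: is_weak_deriv_def L2_fun_sqi L2_inner_ip)

lemma is_weak_deriv_\<Phi>:
  "u \<in> sqi M \<Longrightarrow> v \<in> sqi M \<Longrightarrow>
    is_weak_deriv G i u v \<longleftrightarrow> (\<forall>\<phi>\<in>test_fun G. \<Phi> u \<bullet> \<Phi> (partial i \<phi>) = - (\<Phi> v \<bullet> \<Phi> \<phi>))"
  by (simp add: is_weak_deriv_iff inner_\<Phi> test_sqi test_fun_partial)

lemma test_total:
  assumes "\<And>\<phi>. \<phi> \<in> test_fun G \<Longrightarrow> x \<bullet> \<Phi> \<phi> = 0"
  shows "x = 0"
proof -
  have "ip M (\<Phi>inv x) \<phi> = 0" if "\<phi> \<in> test_fun G" for \<phi>
    using assms[OF that] inner_\<Phi>[OF \<Phi>inv(1) test_sqi[OF that], of x] by (simp add: \<Phi>inv(2))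
  from du_Bois_Reymond[OF \<Phi>inv(1) this] have "\<Phi> (\<Phi>inv x) = \<Phi> (\<lambda>_. 0)"
    by (subst \<Phi>_eq_iff) (auto simp: \<Phi>inv)
  also have "\<Phi> (\<lambda>_. 0) = 0" using \<Phi>_cmult[of "\<lambda>_. 0" 0] by simp
  finally show ?thesis by (simp add: \<Phi>inv)
qed

text \<open>The corners are in the wrong order, so the box is empty and this bump is the zero
  function.\<close>

lemma test_fun_nonempty: "box_bump 1 0 0 \<in> test_fun G"
  by (rule box_bump_test) (auto simp: mem_box_cart subset_eq, metis not_one_le_zero order_trans)

lemma test_subspace: "subspace (\<Phi> ` test_fun G)"
proof (rule subspace_imageI[OF _ test_fun_nonempty])
  fix u v p q assume uv: "u \<in> test_fun G" "v \<in> test_fun G"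
  have "p *\<^sub>R \<Phi> u + q *\<^sub>R \<Phi> v = \<Phi> (\<lambda>x. p * u x + q * v x)"
    by (simp add: \<Phi>_add \<Phi>_cmult sqi_cmult test_sqi uv)
  then show "p *\<^sub>R \<Phi> u + q *\<^sub>R \<Phi> v \<in> \<Phi> ` test_fun G"
    using imageI[OF test_fun_lincomb[OF uv, of p q]] by simp
qed

lemma test_dense: "closure (\<Phi> ` test_fun G) = UNIV"
proof -
  let ?S = "closure (\<Phi> ` test_fun G)"
  have S: "closed ?S" "subspace ?S" by (auto intro: subspace_closure test_subspace)
  have "x \<in> ?S" for x
  proof -
    have "x - proj ?S x = 0"
    proof (rule test_total)
      fix \<phi> assume "\<phi> \<in> test_fun G"
      then have "\<Phi> \<phi> \<in> ?S" by (intro subsetD[OF closure_subset] imageI)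
      then show "(x - proj ?S x) \<bullet> \<Phi> \<phi> = 0" by (rule proj_orthogonal[OF S])
    qed
    then show ?thesis using proj_in[OF S, of x] by simp
  qed
  then show ?thesis by blast
qed

lemma weak_deriv_unique:
  assumes "u \<in> sqi M" "is_weak_deriv G i u v" "is_weak_deriv G i u' v'" "u' \<in> sqi M" "\<Phi> u = \<Phi> u'"
  shows "\<Phi> v = \<Phi> v'"
proof -
  have v: "v \<in> sqi M" "v' \<in> sqi M" using assms by (auto simp: is_weak_deriv_iff)
  have "\<Phi> v - \<Phi> v' = 0"
    by (rule test_total) (use assms v in \<open>simp add: is_weak_deriv_\<Phi> inner_diff_left\<close>)
  then show ?thesis by simp
qed

lemma H1_iff: "u \<in> H1 G \<longleftrightarrow> u \<in> sqi M \<and> (\<forall>i. \<exists>v. is_weak_deriv G i u v)"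
  by (simp add: H1_def L2_fun_sqi)

lemma weak_deriv: "u \<in> H1 G \<Longrightarrow> is_weak_deriv G i u (weak_deriv G i u)"
  unfolding weak_deriv_def H1_iff by (metis someI_ex)

lemma weak_deriv_sqi: "u \<in> H1 G \<Longrightarrow> weak_deriv G i u \<in> sqi M"
  using weak_deriv is_weak_deriv_iff by blast

lemma H1_sqi: "u \<in> H1 G \<Longrightarrow> u \<in> sqi M"
  by (simp add: H1_iff)

definition \<Psi> :: "(real^'n \<Rightarrow> real) \<Rightarrow> ell2 \<times> (ell2 ^ 'n)" where
  "\<Psi> u = (\<Phi> u, \<chi> i. \<Phi> (weak_deriv G i u))"

lemma H1_\<Psi>I:
  assumes "u \<in> sqi M" "\<And>i. is_weak_deriv G i u (v i)"
  shows "u \<in> H1 G" "\<Psi> u = (\<Phi> u, \<chi> i. \<Phi> (v i))"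
proof -
  show "u \<in> H1 G" using assms by (auto simp: H1_iff)
  then show "\<Psi> u = (\<Phi> u, \<chi> i. \<Phi> (v i))"
    unfolding \<Psi>_def using weak_deriv_unique[OF assms(1) weak_deriv assms(2) assms(1) refl]
    by (simp add: vec_eq_iff)
qed

lemma \<Psi>_lincomb:
  assumes u: "u \<in> H1 G" and v: "v \<in> H1 G"
  shows "(\<lambda>x. p * u x + q * v x) \<in> H1 G" "\<Psi> (\<lambda>x. p * u x + q * v x) = p *\<^sub>R \<Psi> u + q *\<^sub>R \<Psi> v"
proof -
  note s = H1_sqi[OF u] H1_sqi[OF v] weak_deriv_sqi[OF u] weak_deriv_sqi[OF v]
  have lin: "\<Phi> (\<lambda>x. p * f x + q * g x) = p *\<^sub>R \<Phi> f + q *\<^sub>R \<Phi> g" if "f \<in> sqi M" "g \<in> sqi M" for f g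
    using that by (simp add: \<Phi>_add \<Phi>_cmult sqi_cmult)
  have w: "is_weak_deriv G i (\<lambda>x. p * u x + q * v x) (\<lambda>x. p * weak_deriv G i u x + q * weak_deriv G i v x)" for i
    using weak_deriv[OF u, of i] weak_deriv[OF v, of i]
    by (simp add: is_weak_deriv_\<Phi> s sqi_add sqi_cmult lin inner_add_left)
  show "(\<lambda>x. p * u x + q * v x) \<in> H1 G" "\<Psi> (\<lambda>x. p * u x + q * v x) = p *\<^sub>R \<Psi> u + q *\<^sub>R \<Psi> v"
    using H1_\<Psi>I[OF _ w] s by (auto simp: sqi_add sqi_cmult lin \<Psi>_def vec_eq_iff)
qed

lemma norm_\<Psi>: "u \<in> H1 G \<Longrightarrow> norm (\<Psi> u) = H1_norm G u"
  by (simp add: \<Psi>_def H1_norm_def norm_Pair norm_vec_def L2_set_def sum_nonneg L2_norm_nrm norm_\<Phi> H1_sqi weak_deriv_sqi)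

text \<open>A product of two test functions is a test function, so its partial derivative integrates
  to 0; the product rule splits that integral.\<close>

lemma test_weak_deriv:
  assumes \<phi>: "\<phi> \<in> test_fun G"
  shows "is_weak_deriv G i \<phi> (partial i \<phi>)"
  unfolding is_weak_deriv_iff
proof (intro conjI ballI)
  show p: "partial i \<phi> \<in> sqi M" by (intro test_sqi test_fun_partial \<phi>)
  fix \<psi> assume \<psi>: "\<psi> \<in> test_fun G"
  have d: "\<And>x. \<phi> differentiable (at x)" "\<And>x. \<psi> differentiable (at x)"
    using \<phi> \<psi> by (auto simp: test_fun_def smooth_differentiable)
  have "(\<integral>x. partial i (\<lambda>x. \<phi> x * \<psi> x) x \<partial>M) = 0"
    by (rule integral_partial_test, rule test_fun_mult[OF \<psi>]) (use \<phi> in \<open>simp add: test_fun_def\<close>)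
  moreover have "partial i (\<lambda>x. \<phi> x * \<psi> x) x = \<phi> x * partial i \<psi> x + partial i \<phi> x * \<psi> x" for x
    by (rule partial_mult[OF d])
  moreover have "integrable M (\<lambda>x. \<phi> x * partial i \<psi> x)" "integrable M (\<lambda>x. partial i \<phi> x * \<psi> x)"
    using sqi_inner[OF test_sqi[OF \<phi>] test_sqi[OF test_fun_partial[OF \<psi>]]] sqi_inner[OF p test_sqi[OF \<psi>]] by auto
  ultimately show "ip M \<phi> (partial i \<psi>) = - ip M (partial i \<phi>) \<psi>"
    by (simp add: ip_def)
qed

lemma test_H1: "\<phi> \<in> test_fun G \<Longrightarrow> \<phi> \<in> H1 G" "\<phi> \<in> test_fun G \<Longrightarrow> \<Psi> \<phi> = (\<Phi> \<phi>, \<chi> i. \<Phi> (partial i \<phi>))"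
  using H1_\<Psi>I[OF test_sqi test_weak_deriv] by auto

text \<open>By \<open>H10_iff\<close> and \<open>V_surj\<close> this is the image of
  \<open>H10 G\<close> under \<open>\<Psi>\<close>; taking the closure makes it closed by
  construction.\<close>

definition V :: "(ell2 \<times> (ell2 ^ 'n)) set" where
  "V = closure (\<Psi> ` test_fun G)"

lemma closed_V: "closed V" by (simp add: V_def)

lemma subspace_V: "subspace V"
  unfolding V_def
proof (rule subspace_closure, rule subspace_imageI[OF _ test_fun_nonempty])
  fix u v p q assume uv: "u \<in> test_fun G" "v \<in> test_fun G"
  then show "p *\<^sub>R \<Psi> u + q *\<^sub>R \<Psi> v \<in> \<Psi> ` test_fun G"
    using imageI[OF test_fun_lincomb[OF uv, of p q], of \<Psi>] \<Psi>_lincomb(2)[OF test_H1(1)[OF uv(1)] test_H1(1)[OF uv(2)], of p q]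
    by simp
qed

text \<open>Since \<open>\<Psi>\<close> is isometric, approximability by test functions in
  \<open>H1_norm\<close> is membership in the closure of their image.\<close>

lemma H10_iff: "u \<in> H10 G \<longleftrightarrow> u \<in> H1 G \<and> \<Psi> u \<in> V"
proof -
  have "H1_norm G (\<lambda>x. u x - \<phi> x) = dist (\<Psi> \<phi>) (\<Psi> u)" if u: "u \<in> H1 G" and "\<phi> \<in> test_fun G" for \<phi>
    using \<Psi>_lincomb[OF u test_H1(1)[OF that(2)], of 1 "-1"] norm_\<Psi>[of "\<lambda>x. u x - \<phi> x"]
    by (simp add: dist_norm norm_minus_commute)
  then show ?thesis
    by (auto simp: H10_def V_def closure_approachable)
qed

lemma H10_H1: "u \<in> H10 G \<Longrightarrow> u \<in> H1 G" and H10_V: "u \<in> H10 G \<Longrightarrow> \<Psi> u \<in> V"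
  by (auto simp: H10_iff)

lemma H10_lincomb: "u \<in> H10 G \<Longrightarrow> v \<in> H10 G \<Longrightarrow> (\<lambda>x. p * u x + q * v x) \<in> H10 G"
  by (simp add: H10_iff \<Psi>_lincomb subspace_add subspace_scale subspace_V)

text \<open>A set where two continuous functions agree is closed, so identities checked on test
  functions extend to \<open>V\<close>; weak derivatives and products are handled in this
  way.\<close>

lemma V_closure_induct:
  assumes "\<And>\<phi>. \<phi> \<in> test_fun G \<Longrightarrow> f (\<Psi> \<phi>) = g (\<Psi> \<phi>)" and "continuous_on UNIV f" "continuous_on UNIV g" and "y \<in> V"
  shows "f y = (g y :: real)"
proof -
  have "V \<subseteq> {y. f y = g y}"
    unfolding V_def by (rule closure_minimal) (use assms in \<open>auto intro: closed_Collect_eq\<close>)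
  then show ?thesis using assms by blast
qed

text \<open>For a fixed test function the relation defining a weak derivative equates two continuous
  functionals of the pair, so it survives the closure. Any representatives of the components then
  form a function with its weak derivatives.\<close>

lemma V_surj:
  assumes y: "y \<in> V"
  shows "\<exists>u\<in>H10 G. \<Psi> u = y"
proof -
  let ?u = "\<Phi>inv (fst y)" and ?v = "\<lambda>i. \<Phi>inv (snd y $ i)"
  have w: "is_weak_deriv G i ?u (?v i)" for i
  proof (subst is_weak_deriv_\<Phi>)
    show "\<forall>\<psi>\<in>test_fun G. \<Phi> ?u \<bullet> \<Phi> (partial i \<psi>) = - (\<Phi> (?v i) \<bullet> \<Phi> \<psi>)"
    proof
      fix \<psi> assume \<psi>: "\<psi> \<in> test_fun G"
      have "fst y \<bullet> \<Phi> (partial i \<psi>) = - (snd y $ i \<bullet> \<Phi> \<psi>)"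
      proof (rule V_closure_induct[OF _ _ _ y])
        fix \<phi> assume \<phi>: "\<phi> \<in> test_fun G"
        have "\<Phi> \<phi> \<bullet> \<Phi> (partial i \<psi>) = - (\<Phi> (partial i \<phi>) \<bullet> \<Phi> \<psi>)"
          using test_weak_deriv[OF \<phi>, of i] \<psi> is_weak_deriv_\<Phi>[OF test_sqi[OF \<phi>] test_sqi[OF test_fun_partial[OF \<phi>]]] by blast
        then show "fst (\<Psi> \<phi>) \<bullet> \<Phi> (partial i \<psi>) = - (snd (\<Psi> \<phi>) $ i \<bullet> \<Phi> \<psi>)"
          by (simp add: test_H1(2)[OF \<phi>])
      qed (intro continuous_intros)+
      then show "\<Phi> ?u \<bullet> \<Phi> (partial i \<psi>) = - (\<Phi> (?v i) \<bullet> \<Phi> \<psi>)" by (simp add: \<Phi>inv)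
    qed
  qed (simp_all add: \<Phi>inv)
  have "?u \<in> H1 G" "\<Psi> ?u = y"
    using H1_\<Psi>I[OF \<Phi>inv(1) w] by (auto simp: \<Phi>inv vec_eq_iff prod_eq_iff)
  then show ?thesis using y by (auto simp: H10_iff)
qed

lemma fst_V_dense: "closure (fst ` V) = UNIV"
proof -
  have "\<Phi> ` test_fun G \<subseteq> fst ` V"
  proof
    fix x assume "x \<in> \<Phi> ` test_fun G"
    then obtain \<phi> where "\<phi> \<in> test_fun G" "x = \<Phi> \<phi>" by blast
    then have "\<Psi> \<phi> \<in> V" "x = fst (\<Psi> \<phi>)" using closure_subset[of "\<Psi> ` test_fun G"] by (auto simp: V_def \<Psi>_def)
    then show "x \<in> fst ` V" by blast
  qed
  then show ?thesis using closure_mono test_dense by blast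
qed

text \<open>Closability of the weak gradient: a weak derivative of the zero function is orthogonal
  to all test functions. This provides the hypothesis \<open>inj\<close> of
  \<open>weak_solution_wellposed\<close>.\<close>

lemma V_inj:
  assumes "y \<in> V" "fst y = 0"
  shows "y = 0"
proof -
  obtain u where u: "u \<in> H1 G" "\<Psi> u = y" using V_surj[OF assms(1)] H10_H1 by blast
  have u0: "\<Phi> u = 0" using u assms(2) by (auto simp: \<Psi>_def)
  have "\<Phi> (weak_deriv G i u) = 0" for i
  proof (rule test_total)
    fix \<phi> assume "\<phi> \<in> test_fun G"
    then show "\<Phi> (weak_deriv G i u) \<bullet> \<Phi> \<phi> = 0"
      using weak_deriv[OF u(1), of i] is_weak_deriv_\<Phi>[OF H1_sqi[OF u(1)] weak_deriv_sqi[OF u(1)], of i i] u0 by simp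
  qed
  then show ?thesis using u(2) u0 by (simp add: \<Psi>_def zero_prod_def vec_eq_iff prod_eq_iff)
qed

section \<open>Lipschitz coefficients\<close>

text \<open>The bounded weak derivative of a Lipschitz function is the weak limit of its difference
  quotients.\<close>

lemma lipschitz_weak_deriv:
  assumes lip: "L-lipschitz_on (closure G) a"
  shows "bmeas a" "\<exists>d. bmeas d \<and> (\<forall>\<psi>\<in>test_fun G. ip M a (partial i \<psi>) = - ip M d \<psi>)"
proof -
  have L: "0 \<le> L" using lip by (rule lipschitz_on_nonneg)
  have cont: "continuous_on (closure G) a" using lip by (rule lipschitz_on_continuous_on)
  have "compact (closure G)" using bounded_G by (simp add: compact_closure)
  then have "compact (a ` closure G)" using cont by (rule compact_continuous_image[rotated])
  then obtain B where B: "\<And>x. x \<in> closure G \<Longrightarrow> \<bar>a x\<bar> \<le> B" by (metis bounded_iff compact_imp_bounded imageI real_norm_def)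
  have BG: "\<bar>a x\<bar> \<le> B" if "x \<in> G" for x using B closure_subset that by blast
  \<comment> \<open>\<open>a\<close> is controlled only on the closure of \<open>G\<close>; its zero
    extension is a bounded Borel function on the whole space, as
    \<open>difference_quotient_limit\<close> requires.\<close>
  define \<alpha> where "\<alpha> x = indicat_real G x *\<^sub>R a x" for x
  have \<alpha>G: "\<alpha> x = a x" if "x \<in> G" for x using that by (simp add: \<alpha>_def)
  have \<alpha>[measurable]: "\<alpha> \<in> borel_measurable borel" unfolding \<alpha>_def[abs_def]
    by (rule borel_measurable_continuous_on_indicator) (use continuous_on_subset[OF cont closure_subset] in auto)
  have \<alpha>B: "\<bar>\<alpha> x\<bar> \<le> \<bar>B\<bar>" for x using BG[of x] by (auto simp: \<alpha>_def indicator_def)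
  have "a \<in> borel_measurable M"
    using borel_lebesgue_on[OF \<alpha>] by (subst measurable_cong[of M a \<alpha>]) (auto simp: \<alpha>G)
  then show "bmeas a" using BG unfolding bmeas_def by blast
  let ?t = "\<lambda>n. inverse (real (Suc n))" and ?e = "axis i 1 :: real^'n"
  \<comment> \<open>The quotient is replaced by 0 where the shift leaves \<open>G\<close> or starts
    outside it, so that the Lipschitz bound holds everywhere. Against a fixed test function nothing
    changes for large \<open>n\<close>.\<close>
  define g where "g n x = (if x \<in> G \<and> x - ?t n *\<^sub>R ?e \<in> G then (\<alpha> (x - ?t n *\<^sub>R ?e) - \<alpha> x) / ?t n else 0)" for n x
  have gL: "\<bar>g n x\<bar> \<le> L" for n x
  proof (cases "x \<in> G \<and> x - ?t n *\<^sub>R ?e \<in> G")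
    case True
    then have "dist (a (x - ?t n *\<^sub>R ?e)) (a x) \<le> L * dist (x - ?t n *\<^sub>R ?e) x"
      using closure_subset by (intro lipschitz_onD[OF lip]) auto
    also have "dist (x - ?t n *\<^sub>R ?e) x = ?t n" by (simp add: dist_norm)
    finally have "\<bar>a (x - ?t n *\<^sub>R ?e) - a x\<bar> \<le> L * ?t n" by (simp add: dist_real_def)
    then show ?thesis using True by (simp add: g_def \<alpha>G divide_le_eq abs_divide del: of_nat_Suc)
  qed (auto simp: g_def L)
  have gm: "g n \<in> borel_measurable borel" for n
  proof -
    have [measurable]: "G \<in> sets borel" by simp
    show ?thesis unfolding g_def[abs_def] by measurable
  qed
  have gs: "g n \<in> sqi M" for n by (rule bounded_sqi[OF borel_lebesgue_on[OF gm] gL])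
  have nb: "norm (\<Phi> (g n)) \<le> L * nrm M (\<lambda>_. 1 :: real)" for n
  proof -
    have "nrm M (g n) \<le> L * nrm M (\<lambda>_. 1 :: real)"
      by (rule nrm_mono_AE(2)[OF sqi_measurable[OF gs]]) (use gL L in \<open>auto intro: bounded_sqi[of _ 1]\<close>)
    then show ?thesis by (simp add: norm_\<Phi> gs)
  qed
  have lim: "(\<lambda>n. \<Phi> (g n) \<bullet> \<Phi> \<psi>) \<longlonglongrightarrow> ip M a (partial i \<psi>)" if \<psi>: "\<psi> \<in> test_fun G" for \<psi>
  proof -
    have e0: "(\<integral>x. \<alpha> x * partial i \<psi> x \<partial>M) = ip M a (partial i \<psi>)"
      unfolding ip_def by (intro Bochner_Integration.integral_cong) (auto simp: \<alpha>G)
    have ev: "\<forall>\<^sub>F n in sequentially. (\<integral>x. (\<alpha> (x - ?t n *\<^sub>R ?e) - \<alpha> x) / ?t n * \<psi> x \<partial>M) = \<Phi> (g n) \<bullet> \<Phi> \<psi>"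
    proof -
      let ?K = "closure {x. \<psi> x \<noteq> 0}"
      obtain d where d: "d > 0" "(\<Union>x\<in>?K. ball x d) \<subseteq> G"
        using compact_subset_open_imp_ball_epsilon_subset[of ?K G] \<psi> open_G by (auto simp: test_fun_def)
      have "\<forall>\<^sub>F n in sequentially. ?t n < d"
        using LIMSEQ_inverse_real_of_nat d(1) by (rule order_tendstoD)
      then show ?thesis
      proof eventually_elim
        case (elim n)
        have "(\<alpha> (x - ?t n *\<^sub>R ?e) - \<alpha> x) / ?t n * \<psi> x = g n x * \<psi> x" if "x \<in> G" for x
        proof (cases "\<psi> x = 0")
          case False
          then have "x \<in> ?K" using closure_subset[of "{x. \<psi> x \<noteq> 0}"] by auto
          moreover have "x - ?t n *\<^sub>R ?e \<in> ball x d" using elim by (simp add: dist_norm)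
          ultimately have "x - ?t n *\<^sub>R ?e \<in> G" using d(2) by blast
          then show ?thesis using that unfolding g_def by simp
        qed simp
        then have "(\<integral>x. (\<alpha> (x - ?t n *\<^sub>R ?e) - \<alpha> x) / ?t n * \<psi> x \<partial>M) = (\<integral>x. g n x * \<psi> x \<partial>M)"
          by (intro Bochner_Integration.integral_cong) auto
        then show ?case using inner_\<Phi>[OF gs test_sqi[OF \<psi>], of n] by (simp add: ip_def)
      qed
    qed
    show ?thesis
      using Lim_transform_eventually[OF difference_quotient_limit[OF \<psi> \<alpha> \<alpha>B, of i] ev] unfolding e0 .
  qed
  have "\<exists>l. \<forall>z. (\<lambda>n. \<Phi> (g n) \<bullet> z) \<longlonglongrightarrow> l \<bullet> z"
  proof (rule weak_limit_exists[OF nb test_dense])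
    fix z assume "z \<in> \<Phi> ` test_fun G"
    then obtain \<psi> where \<psi>: "\<psi> \<in> test_fun G" "z = \<Phi> \<psi>" by (rule imageE)
    show "convergent (\<lambda>n. \<Phi> (g n) \<bullet> z)" unfolding \<psi>(2) by (rule convergentI[OF lim[OF \<psi>(1)]])
  qed
  then obtain y where y: "\<And>z. (\<lambda>n. \<Phi> (g n) \<bullet> z) \<longlonglongrightarrow> y \<bullet> z" by blast
  define w where "w = \<Phi>inv y"
  have w: "w \<in> sqi M" "\<Phi> w = y" by (simp_all add: w_def \<Phi>inv)
  note [measurable] = sqi_measurable[OF w(1)]
  \<comment> \<open>Testing the weak limit with its sign on the set where it exceeds
    \<open>L\<close> shows that this set is null: weak limits inherit the bound
    \<open>L\<close>.\<close>
  define s where "s x = (if \<bar>w x\<bar> > L then sgn (w x) else 0)" for x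
  have sm: "s \<in> borel_measurable M" unfolding s_def[abs_def] by measurable
  have s: "s \<in> sqi M" by (rule bounded_sqi[OF sm, of 1]) (auto simp: s_def sgn_if)
  have si: "integrable M (\<lambda>x. L * \<bar>s x\<bar>)" using fin.sqi_imp_integrable[OF s] by simp
  have ws: "w x * s x - L * \<bar>s x\<bar> = (if \<bar>w x\<bar> > L then \<bar>w x\<bar> - L else 0)" for x
    using L by (auto simp: s_def sgn_if abs_if)
  have "ip M w s \<le> (\<integral>x. L * \<bar>s x\<bar> \<partial>M)"
  proof (rule LIMSEQ_le_const2)
    show "(\<lambda>n. \<Phi> (g n) \<bullet> \<Phi> s) \<longlonglongrightarrow> ip M w s" using y[of "\<Phi> s"] inner_\<Phi>[OF w(1) s] unfolding w(2) by simp
    have "\<Phi> (g n) \<bullet> \<Phi> s \<le> (\<integral>x. L * \<bar>s x\<bar> \<partial>M)" for n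
      unfolding inner_\<Phi>[OF gs s] ip_def
    proof (rule integral_mono_AE[OF sqi_inner[OF gs s] si], rule AE_I2)
      fix x
      have "g n x * s x \<le> \<bar>g n x\<bar> * \<bar>s x\<bar>" by (metis abs_ge_self abs_mult)
      also have "\<dots> \<le> L * \<bar>s x\<bar>" by (intro mult_right_mono gL) simp
      finally show "g n x \<bullet> s x \<le> L * \<bar>s x\<bar>" by simp
    qed
    then show "\<exists>N. \<forall>n\<ge>N. \<Phi> (g n) \<bullet> \<Phi> s \<le> (\<integral>x. L * \<bar>s x\<bar> \<partial>M)" by blast
  qed
  then have "(\<integral>x. w x * s x - L * \<bar>s x\<bar> \<partial>M) \<le> 0"
    using sqi_inner[OF w(1) s] si by (simp add: ip_def)
  moreover have wi: "integrable M (\<lambda>x. w x * s x - L * \<bar>s x\<bar>)"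
    using sqi_inner[OF w(1) s] si by simp
  moreover have nn: "AE x in M. 0 \<le> w x * s x - L * \<bar>s x\<bar>" by (simp add: ws)
  ultimately have "AE x in M. w x * s x - L * \<bar>s x\<bar> = 0"
    using integral_nonneg_eq_0_iff_AE[OF wi nn] integral_nonneg_AE[OF nn] by linarith
  then have wL: "AE x in M. \<bar>w x\<bar> \<le> L" by eventually_elim (auto simp: ws split: if_splits)
  \<comment> \<open>The minus sign undoes the backward shift \<open>x - t\<close> in the difference
    quotients, and changing \<open>w\<close> on a null set makes the bound hold at every
    point.\<close>
  define d where "d x = (if \<bar>w x\<bar> \<le> L then - w x else 0)" for x
  have dm: "d \<in> borel_measurable M" unfolding d_def[abs_def] by measurable
  have dL: "\<bar>d x\<bar> \<le> L" for x using L by (simp add: d_def)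
  have ds: "d \<in> sqi M" by (rule bounded_sqi[OF dm dL])
  have "\<Phi> d = \<Phi> (\<lambda>x. (-1) * w x)"
    by (subst \<Phi>_eq_iff) (use wL ds sqi_cmult[OF w(1), of "-1"] in \<open>auto simp: d_def elim!: eventually_mono\<close>)
  then have \<Phi>d: "\<Phi> d = - y" by (simp only: \<Phi>_cmult[OF w(1)] w(2)) simp
  have "ip M a (partial i \<psi>) = - ip M d \<psi>" if \<psi>: "\<psi> \<in> test_fun G" for \<psi>
    using LIMSEQ_unique[OF lim[OF \<psi>] y[of "\<Phi> \<psi>"]] inner_\<Phi>[OF ds test_sqi[OF \<psi>]] by (simp add: \<Phi>d)
  moreover have "bmeas d" using dm dL unfolding bmeas_def by blast
  ultimately show "\<exists>d. bmeas d \<and> (\<forall>\<psi>\<in>test_fun G. ip M a (partial i \<psi>) = - ip M d \<psi>)" by blast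
qed

text \<open>If \<open>\<phi>\<close> is a test function, so is \<open>\<phi> * \<psi>\<close>, and
  the weak derivative of \<open>a\<close> is tested with it. Both sides depend continuously on
  \<open>\<Psi> \<phi>\<close>, so the formula extends to \<open>H10 G\<close>.\<close>

lemma weak_deriv_product:
  assumes a: "bmeas a" and d: "bmeas d" and ad: "\<And>\<psi>. \<psi> \<in> test_fun G \<Longrightarrow> ip M a (partial i \<psi>) = - ip M d \<psi>"
    and \<phi>: "\<phi> \<in> H10 G"
  shows "is_weak_deriv G i (\<lambda>x. a x * \<phi> x) (\<lambda>x. a x * weak_deriv G i \<phi> x + d x * \<phi> x)"
proof -
  note s = H1_sqi[OF H10_H1[OF \<phi>]] weak_deriv_sqi[OF H10_H1[OF \<phi>], of i]
  have bl: "bounded_linear (mult a)" "bounded_linear (mult d)" by (intro bounded_linear_mult a d)+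
  have "mult a (fst (\<Psi> \<phi>)) \<bullet> \<Phi> (partial i \<psi>) = - ((mult a (snd (\<Psi> \<phi>) $ i) + mult d (fst (\<Psi> \<phi>))) \<bullet> \<Phi> \<psi>)"
    if \<psi>: "\<psi> \<in> test_fun G" for \<psi>
  proof (rule V_closure_induct[OF _ _ _ H10_V[OF \<phi>]])
    fix f assume f: "f \<in> test_fun G"
    have ds: "\<And>x. f differentiable (at x)" "\<And>x. \<psi> differentiable (at x)"
      using f \<psi> by (auto simp: test_fun_def smooth_differentiable)
    have t: "(\<lambda>x. f x * \<psi> x) \<in> test_fun G" by (rule test_fun_mult[OF \<psi>]) (use f in \<open>simp add: test_fun_def\<close>)
    note fs = test_sqi[OF f] test_sqi[OF test_fun_partial[OF f]] test_sqi[OF \<psi>] test_sqi[OF test_fun_partial[OF \<psi>]]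
    have i: "integrable M (\<lambda>x. a x * f x * partial i \<psi> x)" "integrable M (\<lambda>x. a x * partial i f x * \<psi> x)"
      using sqi_inner[OF bmeas_sqi[OF a fs(1)] fs(4)] sqi_inner[OF bmeas_sqi[OF a fs(2)] fs(3)] by auto
    have "(\<integral>x. a x * f x * partial i \<psi> x \<partial>M) + (\<integral>x. a x * partial i f x * \<psi> x \<partial>M) =
        ip M a (partial i (\<lambda>x. f x * \<psi> x))"
      unfolding ip_def partial_mult[OF ds] using i
      by (subst Bochner_Integration.integral_add[symmetric]) (auto simp: algebra_simps)
    also have "\<dots> = - (\<integral>x. d x * f x * \<psi> x \<partial>M)" unfolding ad[OF t] by (simp add: ip_def mult.assoc)
    finally show "mult a (fst (\<Psi> f)) \<bullet> \<Phi> (partial i \<psi>) = - ((mult a (snd (\<Psi> f) $ i) + mult d (fst (\<Psi> f))) \<bullet> \<Phi> \<psi>)"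
      by (simp add: test_H1(2)[OF f] inner_mult a d fs inner_add_left)
  qed (intro continuous_intros linear_continuous_on bounded_linear.continuous_on[OF bl(1)] bounded_linear.continuous_on[OF bl(2)])+
  then show ?thesis
    by (subst is_weak_deriv_\<Phi>) (auto simp: bmeas_sqi a d s sqi_add \<Phi>_add \<Psi>_def mult_\<Phi>)
qed

end

section \<open>The differential operators in coordinates and the Garding inequality\<close>

locale coefficients = onb G h for G :: "(real^'n::finite) set" and h +
  fixes a :: "'n \<Rightarrow> 'n \<Rightarrow> real^'n \<Rightarrow> real" and b \<sigma> :: "'n \<Rightarrow> real^'n \<Rightarrow> real" and c \<nu> :: "real^'n \<Rightarrow> real"
    and ck :: "nat \<Rightarrow> real" and A1 :: real
  assumes a_lip: "\<And>i j. \<exists>L. L-lipschitz_on (closure G) (a i j)"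
    and b_meas: "\<And>i. bmeas (b i)" and c_meas: "bmeas c" and \<sigma>_meas: "\<And>i. bmeas (\<sigma> i)" and \<nu>_meas: "bmeas \<nu>"
    and A1: "A1 > 0" and elliptic: "\<And>x y. x \<in> G \<Longrightarrow> A1 * (norm y)\<^sup>2 \<le> (\<Sum>i\<in>UNIV. \<Sum>j\<in>UNIV. a i j x * y $ i * y $ j)"
    and ck: "\<And>k. ck k > 0" "\<And>k x. x \<in> G \<Longrightarrow> \<bar>h k x\<bar> \<le> ck k"
begin

lemma a_meas: "bmeas (a i j)"
  using a_lip[of i j] lipschitz_weak_deriv(1) by blast

lemma h_meas: "bmeas (h k)"
  unfolding bmeas_def using ck(2)[of _ k] sqi_measurable[OF h_sqi] by blast

definition da :: "'n \<Rightarrow> 'n \<Rightarrow> real^'n \<Rightarrow> real" where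
  "da i j = (SOME d. bmeas d \<and> (\<forall>\<psi>\<in>test_fun G. ip M (a i j) (partial i \<psi>) = - ip M d \<psi>))"

lemma da: "bmeas (da i j)" "\<psi> \<in> test_fun G \<Longrightarrow> ip M (a i j) (partial i \<psi>) = - ip M (da i j) \<psi>"
proof -
  obtain L where "L-lipschitz_on (closure G) (a i j)" using a_lip by blast
  from someI_ex[OF lipschitz_weak_deriv(2)[OF this, of i]]
  show "bmeas (da i j)" "\<psi> \<in> test_fun G \<Longrightarrow> ip M (a i j) (partial i \<psi>) = - ip M (da i j) \<psi>"
    unfolding da_def by blast+
qed

lemmas mult_bl = bounded_linear_compose[OF bounded_linear_mult]
lemmas snd_bl = bounded_linear_compose[OF bounded_linear_vec_nth bounded_linear_snd]

text \<open>The part of the form that is paired with the test function itself and not with its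
  gradient. The functions \<open>da i j\<close> come from the product rule for \<open>a i j\<close>
  times the test function.\<close>

definition R0 :: "ell2 \<times> (ell2 ^ 'n) \<Rightarrow> ell2" where
  "R0 x = (\<Sum>i\<in>UNIV. \<Sum>j\<in>UNIV. mult (da i j) (snd x $ j)) - (\<Sum>i\<in>UNIV. mult (b i) (snd x $ i)) - mult c (fst x)"

text \<open>Represents the negative of \<open>op_A\<close>, see \<open>op_A_eq\<close>; with this
  sign the principal part is coercive.\<close>

definition A0 :: "ell2 \<times> (ell2 ^ 'n) \<Rightarrow> ell2 \<times> (ell2 ^ 'n)" where
  "A0 x = (R0 x, \<chi> i. \<Sum>j\<in>UNIV. mult (a i j) (snd x $ j))"

text \<open>The noise operator before multiplication by \<open>h k\<close>. Splitting off this
  factor leaves a bounded operator that does not depend on \<open>k\<close>.\<close>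

definition N0 :: "ell2 \<times> (ell2 ^ 'n) \<Rightarrow> ell2" where
  "N0 x = (\<Sum>i\<in>UNIV. mult (\<sigma> i) (snd x $ i)) + mult \<nu> (fst x)"

lemma bounded_linear_R0: "bounded_linear R0"
  unfolding R0_def[abs_def]
  by (intro bounded_linear_sub bounded_linear_sum mult_bl[OF da(1) snd_bl] mult_bl[OF b_meas snd_bl] mult_bl[OF c_meas bounded_linear_fst])

lemma bounded_linear_A0: "bounded_linear A0"
  unfolding A0_def[abs_def]
  by (intro bounded_linear_Pair bounded_linear_R0 bounded_linear_vec_lambda bounded_linear_sum mult_bl[OF a_meas snd_bl])

lemma bounded_linear_N0: "bounded_linear N0"
  unfolding N0_def[abs_def]
  by (intro bounded_linear_add bounded_linear_sum mult_bl[OF \<sigma>_meas snd_bl] mult_bl[OF \<nu>_meas bounded_linear_fst])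

lemma A0_inner: "A0 x \<bullet> y = R0 x \<bullet> fst y + (\<Sum>i\<in>UNIV. \<Sum>j\<in>UNIV. mult (a i j) (snd x $ j) \<bullet> snd y $ i)"
  by (simp add: A0_def inner_prod_def inner_vec_def inner_sum_left)

lemma op_A_eq:
  assumes v: "v \<in> H10 G" and \<phi>: "\<phi> \<in> H10 G"
  shows "op_A G a b c v \<phi> = - (A0 (\<Psi> v) \<bullet> \<Psi> \<phi>)"
proof -
  note vs = H1_sqi[OF H10_H1[OF v]] weak_deriv_sqi[OF H10_H1[OF v]]
  note \<phi>s = H1_sqi[OF H10_H1[OF \<phi>]] weak_deriv_sqi[OF H10_H1[OF \<phi>]]
  have 1: "L2_inner G (weak_deriv G j v) (weak_deriv G i (\<lambda>x. a i j x * \<phi> x)) =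
      mult (a i j) (snd (\<Psi> v) $ j) \<bullet> snd (\<Psi> \<phi>) $ i + mult (da i j) (snd (\<Psi> v) $ j) \<bullet> fst (\<Psi> \<phi>)" for i j
  proof -
    have w: "is_weak_deriv G i (\<lambda>x. a i j x * \<phi> x) (\<lambda>x. a i j x * weak_deriv G i \<phi> x + da i j x * \<phi> x)"
      by (rule weak_deriv_product[OF a_meas da(1) da(2) \<phi>])
    \<comment> \<open>\<open>weak_deriv\<close> makes an arbitrary choice; the product formula
      supplies one weak derivative, so the chosen one is a weak derivative too and has the same
      coordinates.\<close>
    have "is_weak_deriv G i (\<lambda>x. a i j x * \<phi> x) (weak_deriv G i (\<lambda>x. a i j x * \<phi> x))"
      unfolding weak_deriv_def by (rule someI[of "is_weak_deriv G i (\<lambda>x. a i j x * \<phi> x)", OF w])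
    then have w2: "weak_deriv G i (\<lambda>x. a i j x * \<phi> x) \<in> sqi M"
      "\<Phi> (weak_deriv G i (\<lambda>x. a i j x * \<phi> x)) = \<Phi> (\<lambda>x. a i j x * weak_deriv G i \<phi> x + da i j x * \<phi> x)"
      using weak_deriv_unique[OF _ _ w, of "\<lambda>x. a i j x * \<phi> x"] bmeas_sqi[OF a_meas \<phi>s(1)] by (auto simp: is_weak_deriv_iff)
    have "L2_inner G (weak_deriv G j v) (weak_deriv G i (\<lambda>x. a i j x * \<phi> x)) =
        \<Phi> (weak_deriv G j v) \<bullet> (mult (a i j) (\<Phi> (weak_deriv G i \<phi>)) + mult (da i j) (\<Phi> \<phi>))"
      by (simp add: L2_inner_ip inner_\<Phi>[symmetric] vs w2 \<Phi>_add bmeas_sqi a_meas da(1) \<phi>s mult_\<Phi>)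
    then show ?thesis
      by (simp add: \<Psi>_def inner_add_right mult_symm a_meas da(1))
  qed
  have 2: "L2_inner G (\<lambda>x. (\<Sum>i\<in>UNIV. b i x * weak_deriv G i v x) + c x * v x) \<phi> =
      ((\<Sum>i\<in>UNIV. mult (b i) (snd (\<Psi> v) $ i)) + mult c (fst (\<Psi> v))) \<bullet> fst (\<Psi> \<phi>)"
    by (simp add: L2_inner_ip inner_\<Phi>[symmetric] vs \<phi>s sqi_add sqi_sum bmeas_sqi b_meas c_meas \<Phi>_add \<Phi>_sum mult_\<Phi> \<Psi>_def)
  show ?thesis
    unfolding op_A_def 1 2 A0_inner R0_def
    by (simp add: inner_add_left inner_diff_left inner_sum_left sum.distrib sum_negf sum_subtractf)
qed

lemma op_M_eq:
  assumes v: "v \<in> H10 G" and \<phi>: "\<phi> \<in> H10 G"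
  shows "op_M G \<sigma> \<nu> (h k) v \<phi> = mult (h k) (N0 (\<Psi> v)) \<bullet> fst (\<Psi> \<phi>)"
proof -
  note vs = H1_sqi[OF H10_H1[OF v]] weak_deriv_sqi[OF H10_H1[OF v]]
  note \<phi>s = H1_sqi[OF H10_H1[OF \<phi>]] weak_deriv_sqi[OF H10_H1[OF \<phi>]]
  let ?w = "\<lambda>x. (\<Sum>i\<in>UNIV. \<sigma> i x * weak_deriv G i v x) + \<nu> x * v x"
  have w: "?w \<in> sqi M" by (intro sqi_add sqi_sum bmeas_sqi \<sigma>_meas \<nu>_meas vs)
  have "N0 (\<Psi> v) = \<Phi> ?w"
    by (simp add: N0_def \<Psi>_def vs sqi_sum bmeas_sqi \<sigma>_meas \<nu>_meas \<Phi>_add \<Phi>_sum mult_\<Phi>)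
  then show ?thesis
    by (simp add: op_M_def L2_inner_ip inner_\<Phi>[symmetric] mult_\<Phi> h_meas w bmeas_sqi \<phi>s \<Psi>_def mult.commute[of _ "h k _"])
qed

text \<open>Ellipticity, integrated over representatives, controls the gradient part; adding
  \<open>A1\<close> times the square of \<open>fst x\<close> restores the full norm. The remaining
  term is at most \<open>K * norm x * norm (fst x)\<close>, and Young's inequality pays for it with
  half of \<open>A1\<close>, whence \<open>K\<^sup>2 / (2 * A1)\<close>. The inequality holds on the
  whole space, not only on \<open>V\<close>.\<close>

lemma garding: "\<exists>\<delta>>0. \<exists>\<Lambda>. \<forall>x. \<delta> * (norm x)\<^sup>2 \<le> A0 x \<bullet> x + \<Lambda> * (norm (fst x))\<^sup>2"
proof -
  define K where "K = onorm R0"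
  have K: "0 \<le> K" unfolding K_def by (rule onorm_pos_le[OF bounded_linear_R0])
  have "A1 / 2 * (norm x)\<^sup>2 \<le> A0 x \<bullet> x + (A1 + K\<^sup>2 / (2 * A1)) * (norm (fst x))\<^sup>2" for x
  proof -
    let ?u = "\<lambda>i. \<Phi>inv (snd x $ i)"
    have S: "(\<Sum>i\<in>UNIV. \<Sum>j\<in>UNIV. mult (a i j) (snd x $ j) \<bullet> snd x $ i) \<ge> A1 * (norm (snd x))\<^sup>2"
    proof -
      have i: "integrable M (\<lambda>z. a i j z * ?u j z * ?u i z)" for i j
        using sqi_inner[OF bmeas_sqi[OF a_meas \<Phi>inv(1)] \<Phi>inv(1)] by simp
      have e: "mult (a i j) (snd x $ j) \<bullet> snd x $ i = (\<integral>z. a i j z * ?u j z * ?u i z \<partial>M)" for i j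
        using inner_mult[OF a_meas \<Phi>inv(1) \<Phi>inv(1), of i j "snd x $ j" "snd x $ i"] by (simp add: \<Phi>inv)
      have n: "(norm (snd x))\<^sup>2 = (\<Sum>i\<in>UNIV. \<integral>z. (?u i z)\<^sup>2 \<partial>M)"
      proof -
        have "(norm (snd x $ i))\<^sup>2 = (\<integral>z. (?u i z)\<^sup>2 \<partial>M)" for i
          using norm_\<Phi>[OF \<Phi>inv(1), of "snd x $ i"] nrm_sq[of M "?u i"] by (simp add: \<Phi>inv)
        then show ?thesis by (simp add: norm_vec_def L2_set_def sum_nonneg)
      qed
      have iu: "integrable M (\<lambda>z. (?u i z)\<^sup>2)" for i using sqi_integrable[OF \<Phi>inv(1), of "snd x $ i"] by simp
      have "A1 * (norm (snd x))\<^sup>2 = (\<integral>z. A1 * (\<Sum>i\<in>UNIV. (?u i z)\<^sup>2) \<partial>M)"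
        using iu by (simp add: n)
      also have "\<dots> \<le> (\<integral>z. (\<Sum>i\<in>UNIV. \<Sum>j\<in>UNIV. a i j z * ?u j z * ?u i z) \<partial>M)"
      proof (rule integral_mono_AE)
        show "AE z in M. A1 * (\<Sum>i\<in>UNIV. (?u i z)\<^sup>2) \<le> (\<Sum>i\<in>UNIV. \<Sum>j\<in>UNIV. a i j z * ?u j z * ?u i z)"
        proof (rule AE_I2)
          fix z assume "z \<in> space M"
          then have "A1 * (norm (\<chi> i. ?u i z))\<^sup>2 \<le> (\<Sum>i\<in>UNIV. \<Sum>j\<in>UNIV. a i j z * (\<chi> i. ?u i z) $ i * (\<chi> i. ?u i z) $ j)"
            by (intro elliptic) simp
          moreover have "(norm (\<chi> i. ?u i z))\<^sup>2 = (\<Sum>i\<in>UNIV. (?u i z)\<^sup>2)"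
            by (simp add: norm_vec_def L2_set_def sum_nonneg)
          moreover have "(\<Sum>i\<in>UNIV. \<Sum>j\<in>UNIV. a i j z * (\<chi> i. ?u i z) $ i * (\<chi> i. ?u i z) $ j) =
              (\<Sum>i\<in>UNIV. \<Sum>j\<in>UNIV. a i j z * ?u j z * ?u i z)"
            unfolding vec_lambda_beta by (intro sum.cong refl) (simp only: ac_simps)
          ultimately show "A1 * (\<Sum>i\<in>UNIV. (?u i z)\<^sup>2) \<le> (\<Sum>i\<in>UNIV. \<Sum>j\<in>UNIV. a i j z * ?u j z * ?u i z)"
            by (simp only:)
        qed
      qed (use i iu in auto)
      also have "\<dots> = (\<Sum>i\<in>UNIV. \<Sum>j\<in>UNIV. mult (a i j) (snd x $ j) \<bullet> snd x $ i)"
        unfolding e using i by (simp add: Bochner_Integration.integral_sum)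
      finally show ?thesis .
    qed
    have nx: "(norm x)\<^sup>2 = (norm (fst x))\<^sup>2 + (norm (snd x))\<^sup>2"
      by (cases x) (simp add: norm_Pair)
    have "\<bar>R0 x \<bullet> fst x\<bar> \<le> (K * norm x) * norm (fst x)"
      using Cauchy_Schwarz_ineq2[of "R0 x" "fst x"] onorm[OF bounded_linear_R0, of x]
      by (smt (verit) K_def mult_right_mono norm_ge_zero)
    moreover have "(K * norm x) * norm (fst x) \<le> A1 / 2 * (norm x)\<^sup>2 + K\<^sup>2 / (2 * A1) * (norm (fst x))\<^sup>2"
    proof -
      have "0 \<le> (A1 * norm x - K * norm (fst x))\<^sup>2 / (2 * A1)" using A1 by simp
      also have "\<dots> = A1 / 2 * (norm x)\<^sup>2 + K\<^sup>2 / (2 * A1) * (norm (fst x))\<^sup>2 - (K * norm x) * norm (fst x)"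
        using A1 by (simp add: power2_eq_square field_simps)
      finally show ?thesis by simp
    qed
    moreover have "A0 x \<bullet> x \<ge> R0 x \<bullet> fst x + A1 * (norm (snd x))\<^sup>2" using S by (simp add: A0_inner)
    moreover have "A1 * (norm (snd x))\<^sup>2 = A1 * (norm x)\<^sup>2 - A1 * (norm (fst x))\<^sup>2" unfolding nx by (simp add: algebra_simps)
    ultimately show ?thesis unfolding distrib_right by linarith
  qed
  moreover have "A1 / 2 > 0" using A1 by simp
  ultimately show ?thesis by blast
qed

lemma norm_mult_h_le: "norm (mult (h k) x) \<le> ck k * norm x"
  using norm_mult_le[of "h k" "ck k" x] ck h_meas unfolding bmeas_def by (simp add: less_imp_le)

end

section \<open>Curves\<close>

text \<open>A simple curve takes finitely many values, each on a measurable set, so any map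
  \<open>e\<close> may be composed with it.\<close>

lemma simple_curve_measurable:
  fixes e :: "('b \<Rightarrow> real) \<Rightarrow> 'c::topological_space"
  assumes s: "simple_curve I S s" and I: "I \<in> sets lebesgue"
  shows "(\<lambda>t. e (s t)) \<in> borel_measurable (lebesgue_on I)"
proof (rule measurableI)
  fix B :: "'c set" assume "B \<in> sets borel"
  have "(\<lambda>t. e (s t)) -` B \<inter> I = (\<Union>y\<in>{y\<in>s ` I. e y \<in> B}. {t\<in>I. s t = y})" by auto
  also have "\<dots> \<in> sets lebesgue"
    using s unfolding simple_curve_def by (intro sets.finite_UN) auto
  finally show "(\<lambda>t. e (s t)) -` B \<inter> space (lebesgue_on I) \<in> sets (lebesgue_on I)"
    using I by (simp add: sets_restrict_space_iff)
qed simp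

text \<open>The isometry \<open>e\<close> turns approximation by simple curves into pointwise
  convergence of measurable maps; the limit is measurable and equals the image of the curve almost
  everywhere.\<close>

lemma L2_curve_sqi:
  fixes e :: "('b \<Rightarrow> real) \<Rightarrow> 'c::separable_hilbert"
  assumes w: "w \<in> L2_curve T S N"
    and iso: "\<And>x y. x \<in> S \<Longrightarrow> y \<in> S \<Longrightarrow> norm (e x - e y) = N (\<lambda>z. x z - y z)"
    and iso1: "\<And>x. x \<in> S \<Longrightarrow> norm (e x) = N x"
  shows "(\<lambda>t. e (w t)) \<in> sqi (tm T)" "nrm (tm T) (\<lambda>t. e (w t)) = L2_curve_norm T N w"
proof -
  have wS: "AE t in tm T. w t \<in> S" and wi: "integrable (tm T) (\<lambda>t. (N (w t))\<^sup>2)"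
    using w by (auto simp: L2_curve_def)
  obtain s where s: "\<And>n. simple_curve {0<..<T} S (s n)" and conv: "AE t in tm T. (\<lambda>n. N (\<lambda>z. w t z - s n t z)) \<longlonglongrightarrow> 0"
    using w unfolding L2_curve_def strongly_measurable_def by auto
  have sm: "(\<lambda>t. e (s n t)) \<in> borel_measurable (tm T)" for n
    by (rule simple_curve_measurable[OF s]) simp
  have lm: "(\<lambda>t. lim (\<lambda>n. e (s n t))) \<in> borel_measurable (tm T)"
    by (rule borel_measurable_lim_metric[OF sm])
  have "AE t in tm T. lim (\<lambda>n. e (s n t)) = e (w t)"
    using wS conv AE_space
  proof eventually_elim
    case (elim t)
    have "s n t \<in> S" for n using s[of n] elim(3) unfolding simple_curve_def by auto
    then have "norm (e (w t) - e (s n t)) = N (\<lambda>z. w t z - s n t z)" for n using elim(1) by (intro iso)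
    then have "(\<lambda>n. norm (e (w t) - e (s n t))) \<longlonglongrightarrow> 0" using elim(2) by simp
    then have "(\<lambda>n. norm (e (s n t) - e (w t))) \<longlonglongrightarrow> 0" by (simp only: norm_minus_commute)
    then have "(\<lambda>n. e (s n t)) \<longlonglongrightarrow> e (w t)" by (simp only: tendsto_norm_zero_iff LIM_zero_iff)
    then show ?case by (rule limI)
  qed
  from tm.borel_measurable_AE_eq[OF lm this] have m: "(\<lambda>t. e (w t)) \<in> borel_measurable (tm T)" .
  have eq: "AE t in tm T. (N (w t))\<^sup>2 = (norm (e (w t)))\<^sup>2"
    using wS by eventually_elim (simp add: iso1)
  have m2: "(\<lambda>t. (norm (e (w t)))\<^sup>2) \<in> borel_measurable (tm T)" using m by measurable
  have "integrable (tm T) (\<lambda>t. (norm (e (w t)))\<^sup>2)"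
    by (rule integrable_cong_AE_imp[OF wi m2]) (use eq in auto)
  then show "(\<lambda>t. e (w t)) \<in> sqi (tm T)" using m by (simp add: sqi_def)
  show "nrm (tm T) (\<lambda>t. e (w t)) = L2_curve_norm T N w"
    unfolding nrm_def L2_curve_norm_def
    by (intro arg_cong[where f=sqrt] integral_cong_AE) (use wi m2 eq in auto)
qed

text \<open>Simple functions approximating \<open>W\<close> may leave \<open>V\<close>. Projecting
  them onto \<open>V\<close> keeps the convergence, since \<open>W\<close> lies in \<open>V\<close>
  almost everywhere, and brings their values into the image of \<open>e\<close>, where preimages in
  \<open>S\<close> can be chosen.\<close>

lemma sqi_L2_curve:
  fixes e :: "('b \<Rightarrow> real) \<Rightarrow> 'c::separable_hilbert"
  assumes W: "W \<in> sqi (tm T)" and V: "closed V" "subspace V" and surj: "\<And>y. y \<in> V \<Longrightarrow> \<exists>x\<in>S. e x = y"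
    and w: "AE t in tm T. w t \<in> S \<and> e (w t) = W t" and WV: "AE t in tm T. W t \<in> V"
    and iso: "\<And>x y. x \<in> S \<Longrightarrow> y \<in> S \<Longrightarrow> norm (e x - e y) = N (\<lambda>z. x z - y z)"
    and iso1: "\<And>x. x \<in> S \<Longrightarrow> norm (e x) = N x"
  shows "w \<in> L2_curve T S N"
proof -
  obtain F where F: "\<And>i. simple_function (tm T) (F i)" "\<And>t. t \<in> space (tm T) \<Longrightarrow> (\<lambda>i. F i t) \<longlonglongrightarrow> W t"
    using borel_measurable_implies_sequence_metric[OF sqi_measurable[OF W], of 0] by blast
  have "\<forall>y. \<exists>x. y \<in> V \<longrightarrow> x \<in> S \<and> e x = y" using surj by blast
  then obtain r where r: "\<And>y. y \<in> V \<Longrightarrow> r y \<in> S" "\<And>y. y \<in> V \<Longrightarrow> e (r y) = y" by metis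
  define s where "s n t = r (proj V (F n t))" for n t
  have "simple_curve {0<..<T} S (s n)" for n
    unfolding simple_curve_def
  proof (intro conjI allI)
    have fin: "finite (F n ` {0<..<T})" using simple_functionD(1)[OF F(1), of n] by simp
    have im: "s n ` {0<..<T} = (\<lambda>c. r (proj V c)) ` (F n ` {0<..<T})" by (auto simp: s_def)
    show "finite (s n ` {0<..<T})" unfolding im using fin by simp
    show "s n ` {0<..<T} \<subseteq> S" using r(1) proj_in[OF V] by (auto simp: s_def)
    fix y
    have "{t \<in> {0<..<T}. s n t = y} = (\<Union>c\<in>{c\<in>F n ` {0<..<T}. r (proj V c) = y}. F n -` {c} \<inter> space (tm T))"
      by (auto simp: s_def)
    also have "\<dots> \<in> sets (tm T)"
      using fin simple_functionD(2)[OF F(1), of n] by (intro sets.finite_UN) auto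
    finally show "{t \<in> {0<..<T}. s n t = y} \<in> sets lebesgue"
      by (subst (asm) sets_restrict_space_iff) auto
  qed
  moreover have "AE t in tm T. (\<lambda>n. N (\<lambda>z. w t z - s n t z)) \<longlonglongrightarrow> 0"
    using w WV AE_space
  proof eventually_elim
    case (elim t)
    have "N (\<lambda>z. w t z - s n t z) = norm (W t - proj V (F n t))" for n
      using elim iso[of "w t" "s n t"] r proj_in[OF V, of "F n t"] by (simp add: s_def)
    moreover have "(\<lambda>n. norm (W t - proj V (F n t))) \<longlonglongrightarrow> norm (W t - proj V (W t))"
      by (intro tendsto_intros bounded_linear.tendsto[OF bounded_linear_proj[OF V]] F elim)
    ultimately show ?case using elim by (simp add: proj_id[OF V])
  qed
  ultimately have sm: "strongly_measurable {0<..<T} S N w" unfolding strongly_measurable_def by blast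
  have eq: "AE t in tm T. (norm (W t))\<^sup>2 = (N (w t))\<^sup>2"
    using w by eventually_elim (auto simp: iso1[symmetric])
  have "(\<lambda>t. (N (w t))\<^sup>2) \<in> borel_measurable (tm T)"
    by (rule tm.borel_measurable_AE_eq[OF borel_measurable_integrable[OF sqi_integrable[OF W]] eq])
  then have "integrable (tm T) (\<lambda>t. (N (w t))\<^sup>2)"
    by (rule integrable_cong_AE_imp[OF sqi_integrable[OF W]]) (use eq in auto)
  then show ?thesis using sm w unfolding L2_curve_def by (auto elim: eventually_mono)
qed

text \<open>The equation integrates over a closed segment and \<open>tm T\<close> lives on the open
  interval; the difference consists of endpoints, a null set.\<close>

lemma integral_initial_segment:
  fixes F :: "real \<Rightarrow> real"
  assumes F: "F \<in> borel_measurable (tm T)" and t: "t \<in> {0..T}"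
  shows "(LINT s|lebesgue_on {0..t}. F s) = prim T F t"
proof -
  have m: "(\<lambda>s. indicat_real {0<..<T} s *\<^sub>R (indicat_real {..t} s * F s)) \<in> borel_measurable lebesgue"
    by (subst borel_measurable_restrict_space_iff[symmetric])
       (use F borel_sets_tm[of "{..t}" T] in \<open>auto intro!: borel_measurable_times\<close>)
  have "AE s in lebesgue. s \<noteq> 0 \<and> s \<noteq> T"
    using AE_completion[OF AE_lborel_singleton[of "0::real"]] AE_completion[OF AE_lborel_singleton[of T]]
    by eventually_elim auto
  then have eq: "AE s in lebesgue. indicat_real {0<..<T} s *\<^sub>R (indicat_real {..t} s * F s) = indicat_real {0..t} s *\<^sub>R F s"
    by eventually_elim (use t in \<open>auto simp: indicator_def\<close>)
  have m2: "(\<lambda>s. indicat_real {0..t} s *\<^sub>R F s) \<in> borel_measurable lebesgue"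
    by (rule completion.borel_measurable_AE_eq[OF m eq])
  have "prim T F t = (LINT s|lebesgue. indicat_real {0<..<T} s *\<^sub>R (indicat_real {..t} s * F s))"
    unfolding prim_def by (subst integral_restrict_space) auto
  also have "\<dots> = (LINT s|lebesgue. indicat_real {0..t} s *\<^sub>R F s)"
    by (rule integral_cong_AE[OF m m2 eq])
  also have "\<dots> = (LINT s|lebesgue_on {0..t}. F s)"
    by (subst integral_restrict_space) auto
  finally show ?thesis by simp
qed

section \<open>Isometries of the function spaces and Riesz representation of the dual\<close>

context onb
begin

lemma \<Psi>_iso: "u \<in> H10 G \<Longrightarrow> v \<in> H10 G \<Longrightarrow> norm (\<Psi> u - \<Psi> v) = H1_norm G (\<lambda>z. u z - v z)"
  using \<Psi>_lincomb[OF H10_H1 H10_H1, of u v 1 "-1"] norm_\<Psi>[of "\<lambda>z. u z - v z"] by simp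

lemma \<Psi>_iso1: "u \<in> H10 G \<Longrightarrow> norm (\<Psi> u) = H1_norm G u"
  by (rule norm_\<Psi>[OF H10_H1])

lemma \<Phi>_iso: "u \<in> L2_fun G \<Longrightarrow> v \<in> L2_fun G \<Longrightarrow> norm (\<Phi> u - \<Phi> v) = L2_norm G (\<lambda>z. u z - v z)"
  by (simp add: L2_fun_sqi L2_norm_nrm norm_\<Phi>[symmetric] sqi_diff \<Phi>_diff)

lemma \<Phi>_iso1: "u \<in> L2_fun G \<Longrightarrow> norm (\<Phi> u) = L2_norm G u"
  by (simp add: L2_fun_sqi L2_norm_nrm norm_\<Phi>)

definition \<Psi>inv :: "ell2 \<times> (ell2 ^ 'n) \<Rightarrow> real^'n \<Rightarrow> real" where
  "\<Psi>inv y = (SOME u. u \<in> H10 G \<and> \<Psi> u = y)"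

lemma \<Psi>inv: "y \<in> V \<Longrightarrow> \<Psi>inv y \<in> H10 G" "y \<in> V \<Longrightarrow> \<Psi> (\<Psi>inv y) = y"
  using someI_ex[of "\<lambda>u. u \<in> H10 G \<and> \<Psi> u = y"] V_surj[of y] unfolding \<Psi>inv_def by blast+

definition riesz :: "((real^'n \<Rightarrow> real) \<Rightarrow> real) \<Rightarrow> ell2 \<times> (ell2 ^ 'n)" where
  "riesz F = (SOME z. z \<in> V \<and> (\<forall>\<phi>\<in>H10 G. F \<phi> = z \<bullet> \<Psi> \<phi>))"

text \<open>Boundedness makes \<open>F \<phi>\<close> depend only on \<open>\<Psi> \<phi>\<close>,
  so \<open>F\<close> descends to \<open>V\<close> although \<open>\<Psi>inv\<close> is an arbitrary
  choice. Composition with the projection gives a functional on the whole Hilbert space.\<close>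

lemma riesz:
  assumes F: "F \<in> Hm1 G"
  shows "riesz F \<in> V" "\<phi> \<in> H10 G \<Longrightarrow> F \<phi> = riesz F \<bullet> \<Psi> \<phi>"
proof -
  obtain K where lin: "\<And>\<phi> \<psi> p q. \<phi> \<in> H10 G \<Longrightarrow> \<psi> \<in> H10 G \<Longrightarrow> F (\<lambda>x. p * \<phi> x + q * \<psi> x) = p * F \<phi> + q * F \<psi>"
    and K: "\<And>\<phi>. \<phi> \<in> H10 G \<Longrightarrow> \<bar>F \<phi>\<bar> \<le> K * H1_norm G \<phi>"
    using F unfolding Hm1_def by blast
  have wd: "F \<phi> = F \<psi>" if p: "\<phi> \<in> H10 G" "\<psi> \<in> H10 G" and e: "\<Psi> \<phi> = \<Psi> \<psi>" for \<phi> \<psi>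
  proof -
    have "\<bar>F (\<lambda>x. 1 * \<phi> x + (-1) * \<psi> x)\<bar> \<le> K * H1_norm G (\<lambda>x. 1 * \<phi> x + (-1) * \<psi> x)"
      by (intro K H10_lincomb p)
    also have "H1_norm G (\<lambda>x. 1 * \<phi> x + (-1) * \<psi> x) = 0" using \<Psi>_iso[OF p] e by simp
    finally show ?thesis unfolding lin[OF p] by simp
  qed
  let ?f = "\<lambda>x. F (\<Psi>inv (proj V x))"
  note Pin = proj_in[OF closed_V subspace_V]
  have "bounded_linear ?f"
  proof (rule bounded_linear_intro[where K="\<bar>K\<bar>"])
    fix x y and r :: real
    have comb: "F (\<Psi>inv (proj V z)) = p * F (\<Psi>inv (proj V x)) + q * F (\<Psi>inv (proj V y))"
      if "proj V z = p *\<^sub>R proj V x + q *\<^sub>R proj V y" for z p q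
    proof -
      have "F (\<Psi>inv (proj V z)) = F (\<lambda>t. p * \<Psi>inv (proj V x) t + q * \<Psi>inv (proj V y) t)"
      proof (rule wd)
        show "\<Psi> (\<Psi>inv (proj V z)) = \<Psi> (\<lambda>t. p * \<Psi>inv (proj V x) t + q * \<Psi>inv (proj V y) t)"
          unfolding \<Psi>_lincomb(2)[OF H10_H1[OF \<Psi>inv(1)[OF Pin]] H10_H1[OF \<Psi>inv(1)[OF Pin]]] \<Psi>inv(2)[OF Pin] by (rule that)
      qed (intro H10_lincomb \<Psi>inv(1) Pin)+
      also have "\<dots> = p * F (\<Psi>inv (proj V x)) + q * F (\<Psi>inv (proj V y))"
        by (intro lin \<Psi>inv(1) Pin)
      finally show ?thesis .
    qed
    interpret P: bounded_linear "proj V" by (rule bounded_linear_proj[OF closed_V subspace_V])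
    show "?f (x + y) = ?f x + ?f y" using comb[of "x + y" 1 1] by (simp add: P.add)
    show "?f (r *\<^sub>R x) = r *\<^sub>R ?f x" using comb[of "r *\<^sub>R x" r 0] by (simp add: P.scaleR)
    have "\<bar>?f x\<bar> \<le> K * H1_norm G (\<Psi>inv (proj V x))" by (intro K \<Psi>inv(1) Pin)
    also have "H1_norm G (\<Psi>inv (proj V x)) = norm (proj V x)"
      using \<Psi>_iso1[OF \<Psi>inv(1)[OF Pin], of x] \<Psi>inv(2)[OF Pin, of x] by simp
    also have "K * norm (proj V x) \<le> \<bar>K\<bar> * norm x"
      by (intro mult_mono norm_proj_le[OF closed_V subspace_V]) auto
    finally show "norm (?f x) \<le> norm x * \<bar>K\<bar>" by (simp add: mult.commute)
  qed
  then obtain z where z: "\<And>x. ?f x = z \<bullet> x" using riesz_representation by blast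
  have "F \<phi> = proj V z \<bullet> \<Psi> \<phi>" if \<phi>: "\<phi> \<in> H10 G" for \<phi>
  proof -
    have p: "proj V (\<Psi> \<phi>) = \<Psi> \<phi>" by (rule proj_id[OF closed_V subspace_V H10_V[OF \<phi>]])
    have "F \<phi> = ?f (\<Psi> \<phi>)"
      unfolding p by (rule wd[OF \<phi>]) (simp_all add: \<Psi>inv H10_V[OF \<phi>])
    also have "\<dots> = proj V z \<bullet> \<Psi> \<phi>"
      unfolding z using proj_inner[OF closed_V subspace_V H10_V[OF \<phi>], of z] by simp
    finally show ?thesis .
  qed
  then have "\<exists>z. z \<in> V \<and> (\<forall>\<phi>\<in>H10 G. F \<phi> = z \<bullet> \<Psi> \<phi>)" using Pin by blast
  from someI_ex[OF this] show "riesz F \<in> V" "\<phi> \<in> H10 G \<Longrightarrow> F \<phi> = riesz F \<bullet> \<Psi> \<phi>"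
    unfolding riesz_def by blast+
qed

text \<open>The supremum is attained at the preimage of the normalised \<open>z\<close>, which lies
  in \<open>V\<close>.\<close>

lemma Hm1_norm_eq:
  assumes z: "z \<in> V" and F: "\<And>\<phi>. \<phi> \<in> H10 G \<Longrightarrow> F \<phi> = z \<bullet> \<Psi> \<phi>"
  shows "Hm1_norm G F = norm z"
proof -
  let ?X = "{\<bar>F \<phi>\<bar> | \<phi>. \<phi> \<in> H10 G \<and> H1_norm G \<phi> \<le> 1}"
  have le: "x \<le> norm z" if "x \<in> ?X" for x
  proof -
    from that obtain \<phi> where \<phi>: "\<phi> \<in> H10 G" "H1_norm G \<phi> \<le> 1" "x = \<bar>F \<phi>\<bar>" by (elim CollectE exE conjE)
    have "x \<le> norm z * norm (\<Psi> \<phi>)" unfolding \<phi>(3) F[OF \<phi>(1)] by (rule Cauchy_Schwarz_ineq2)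
    also have "\<dots> \<le> norm z * 1" using \<phi> by (intro mult_left_mono) (auto simp: \<Psi>_iso1)
    finally show ?thesis by simp
  qed
  have "norm z \<in> ?X"
  proof -
    \<comment> \<open>For \<open>z = 0\<close> this is 0, where the supremum 0 is attained as
      well.\<close>
    define y where "y = z /\<^sub>R norm z"
    have y: "y \<in> V" unfolding y_def by (rule subspace_scale[OF subspace_V z])
    have "z \<bullet> y = norm z"
      by (cases "z = 0") (simp_all add: y_def power2_eq_square flip: power2_norm_eq_inner)
    then have "norm z = \<bar>F (\<Psi>inv y)\<bar>" using F[OF \<Psi>inv(1)[OF y]] by (simp add: \<Psi>inv(2)[OF y])
    moreover have "H1_norm G (\<Psi>inv y) \<le> 1"
    proof -
      have "H1_norm G (\<Psi>inv y) = norm y"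
        using \<Psi>_iso1[OF \<Psi>inv(1)[OF y]] unfolding \<Psi>inv(2)[OF y] by (rule sym)
      then show ?thesis by (cases "z = 0") (simp_all add: y_def)
    qed
    ultimately show ?thesis using \<Psi>inv(1)[OF y] by blast
  qed
  then show ?thesis unfolding Hm1_norm_def using le by (rule cSup_eq_maximum)
qed

lemma riesz_iso1:
  assumes F: "F \<in> Hm1 G"
  shows "norm (riesz F) = Hm1_norm G F"
  using Hm1_norm_eq[of "riesz F" F, OF riesz(1)[OF F] riesz(2)[OF F]] by (rule sym)

lemma riesz_iso:
  assumes F: "F \<in> Hm1 G" "F' \<in> Hm1 G"
  shows "norm (riesz F - riesz F') = Hm1_norm G (\<lambda>\<phi>. F \<phi> - F' \<phi>)"
proof (rule Hm1_norm_eq[of "riesz F - riesz F'" "\<lambda>\<phi>. F \<phi> - F' \<phi>", symmetric])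
  show "riesz F - riesz F' \<in> V" by (intro subspace_diff[OF subspace_V] riesz(1) F)
  fix \<phi> assume \<phi>: "\<phi> \<in> H10 G"
  show "F \<phi> - F' \<phi> = (riesz F - riesz F') \<bullet> \<Psi> \<phi>"
    by (simp only: inner_diff_left riesz(2)[OF F(1) \<phi>] riesz(2)[OF F(2) \<phi>])
qed

end

section \<open>The equation of a single coefficient\<close>

context coefficients
begin

text \<open>Separates the analysis of one coefficient from the chaos recursion: \<open>F\<close>
  will collect the forcing and the coefficients of lower degree.\<close>

definition coef_eq :: "real \<Rightarrow> ell2 \<Rightarrow> (real \<Rightarrow> ell2 \<times> (ell2 ^ 'n)) \<Rightarrow> (real \<Rightarrow> real^'n \<Rightarrow> real) \<Rightarrow> bool" where
  "coef_eq T x0 F w \<longleftrightarrow> w \<in> L2_curve T (H10 G) (H1_norm G) \<inter> C_curve T (L2_fun G) (L2_norm G) \<and>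
     (\<forall>t\<in>{0..T}. \<forall>\<phi>\<in>H10 G. L2_inner G (w t) \<phi> = x0 \<bullet> \<Phi> \<phi> + prim T (\<lambda>s. (F s - A0 (\<Psi> (w s))) \<bullet> \<Psi> \<phi>) t)"

lemma L2_curve_\<Psi>:
  assumes "w \<in> L2_curve T (H10 G) (H1_norm G)"
  shows "(\<lambda>t. \<Psi> (w t)) \<in> sqi (tm T)" "nrm (tm T) (\<lambda>t. \<Psi> (w t)) = L2_curve_norm T (H1_norm G) w"
  using L2_curve_sqi[where e=\<Psi> and S="H10 G" and N="H1_norm G", OF assms \<Psi>_iso \<Psi>_iso1] by simp_all

lemma fst_\<Psi>: "fst (\<Psi> u) = \<Phi> u"
  by (simp add: \<Psi>_def)

lemma coef_eq_weak_solution: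
  assumes w: "coef_eq T x0 F w"
  shows "weak_solution V fst A0 T x0 F (\<lambda>t. \<Psi> (w t)) (\<lambda>t. \<Phi> (w t))"
  unfolding weak_solution_def
proof (intro conjI ballI)
  have wL: "w \<in> L2_curve T (H10 G) (H1_norm G)" and wC: "w \<in> C_curve T (L2_fun G) (L2_norm G)"
    using w by (auto simp: coef_eq_def)
  show "(\<lambda>t. \<Psi> (w t)) \<in> sqi (tm T)" by (rule L2_curve_\<Psi>(1)[OF wL])
  show "AE t in tm T. \<Psi> (w t) \<in> V"
    using wL unfolding L2_curve_def by (auto elim!: eventually_mono intro: H10_V)
  show "AE t in tm T. \<Phi> (w t) = fst (\<Psi> (w t))" by (simp add: fst_\<Psi>)
  show "continuous_on {0..T} (\<lambda>t. \<Phi> (w t))"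
    unfolding continuous_on_def
  proof
    fix t assume t: "t \<in> {0..T}"
    have lim: "((\<lambda>s. L2_norm G (\<lambda>z. w s z - w t z)) \<longlongrightarrow> 0) (at t within {0..T})"
      using wC t by (simp add: C_curve_def)
    have "((\<lambda>s. norm (\<Phi> (w s) - \<Phi> (w t))) \<longlongrightarrow> 0) (at t within {0..T})"
    proof (rule Lim_transform_eventually[OF lim])
      show "\<forall>\<^sub>F s in at t within {0..T}. L2_norm G (\<lambda>z. w s z - w t z) = norm (\<Phi> (w s) - \<Phi> (w t))"
        unfolding eventually_at_filter
        by (rule always_eventually) (use wC t in \<open>simp add: C_curve_def \<Phi>_iso\<close>)
    qed
    then show "((\<lambda>t. \<Phi> (w t)) \<longlongrightarrow> \<Phi> (w t)) (at t within {0..T})"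
      by (simp only: tendsto_norm_zero_iff LIM_zero_iff)
  qed
  fix t y assume t: "t \<in> {0..T}" and y: "y \<in> V"
  then obtain \<phi> where \<phi>: "\<phi> \<in> H10 G" "\<Psi> \<phi> = y" using V_surj by blast
  have "w t \<in> sqi M" using wC t by (simp add: C_curve_def L2_fun_sqi)
  then have "L2_inner G (w t) \<phi> = \<Phi> (w t) \<bullet> \<Phi> \<phi>"
    by (simp add: L2_inner_ip inner_\<Phi> H1_sqi[OF H10_H1[OF \<phi>(1)]])
  moreover have "L2_inner G (w t) \<phi> = x0 \<bullet> \<Phi> \<phi> + prim T (\<lambda>s. (F s - A0 (\<Psi> (w s))) \<bullet> \<Psi> \<phi>) t"
    using w t \<phi>(1) by (simp add: coef_eq_def)
  ultimately show "\<Phi> (w t) \<bullet> fst y = x0 \<bullet> fst y + prim T (\<lambda>s. (F s - A0 (\<Psi> (w s))) \<bullet> y) t"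
    unfolding \<phi>(2)[symmetric] fst_\<Psi> by simp
qed

lemma weak_solution_coef_eq:
  assumes uv: "weak_solution V fst A0 T x0 F u v" and F: "F \<in> sqi (tm T)"
  shows "\<exists>w. coef_eq T x0 F w"
proof -
  have u: "u \<in> sqi (tm T)" and uV: "AE t in tm T. u t \<in> V" and vc: "continuous_on {0..T} v"
    and vu: "AE t in tm T. v t = fst (u t)"
    and eq: "\<And>t y. t \<in> {0..T} \<Longrightarrow> y \<in> V \<Longrightarrow> v t \<bullet> fst y = x0 \<bullet> fst y + prim T (\<lambda>s. (F s - A0 (u s)) \<bullet> y) t"
    using uv by (auto simp: weak_solution_def)
  \<comment> \<open>One function has to serve two demands: a representative of \<open>v t\<close> at
    every time, for continuity, and an element of \<open>H10 G\<close> with image \<open>u t\<close>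
    at almost every time. At the exceptional times only the first is kept.\<close>
  define w where "w t = (if u t \<in> V \<and> v t = fst (u t) then \<Psi>inv (u t) else \<Phi>inv (v t))" for t
  have \<Phi>w: "w t \<in> L2_fun G" "\<Phi> (w t) = v t" for t
  proof -
    have "w t \<in> sqi M \<and> \<Phi> (w t) = v t"
    proof (cases "u t \<in> V \<and> v t = fst (u t)")
      case True
      then show ?thesis
        using \<Psi>inv[of "u t"] H1_sqi[OF H10_H1[OF \<Psi>inv(1)]] fst_\<Psi>[of "\<Psi>inv (u t)"] by (simp add: w_def)
    next
      case False
      then have "w t = \<Phi>inv (v t)" unfolding w_def by (rule if_not_P)
      then show ?thesis by (simp add: \<Phi>inv)
    qed
    then show "w t \<in> L2_fun G" "\<Phi> (w t) = v t" by (auto simp: L2_fun_sqi)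
  qed
  have \<Psi>w: "AE t in tm T. w t \<in> H10 G \<and> \<Psi> (w t) = u t"
    using uV vu by eventually_elim (simp add: w_def \<Psi>inv)
  have wL: "w \<in> L2_curve T (H10 G) (H1_norm G)"
    by (rule sqi_L2_curve[where e=\<Psi> and N="H1_norm G", OF u closed_V subspace_V V_surj \<Psi>w uV \<Psi>_iso \<Psi>_iso1])
  have wC: "w \<in> C_curve T (L2_fun G) (L2_norm G)"
    unfolding C_curve_def
  proof (intro CollectI ballI conjI)
    fix t assume t: "t \<in> {0..T}"
    show "w t \<in> L2_fun G" by (rule \<Phi>w)
    have "(v \<longlongrightarrow> v t) (at t within {0..T})" using vc t by (simp add: continuous_on_def)
    then have "((\<lambda>s. norm (v s - v t)) \<longlongrightarrow> 0) (at t within {0..T})"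
      by (simp only: tendsto_norm_zero_iff LIM_zero_iff)
    moreover have "norm (v s - v t) = L2_norm G (\<lambda>z. w s z - w t z)" for s
      using \<Phi>_iso[OF \<Phi>w(1) \<Phi>w(1), of s t] by (simp add: \<Phi>w(2))
    ultimately show "((\<lambda>s. L2_norm G (\<lambda>z. w s z - w t z)) \<longlongrightarrow> 0) (at t within {0..T})" by simp
  qed
  have "L2_inner G (w t) \<phi> = x0 \<bullet> \<Phi> \<phi> + prim T (\<lambda>s. (F s - A0 (\<Psi> (w s))) \<bullet> \<Psi> \<phi>) t"
    if t: "t \<in> {0..T}" and \<phi>: "\<phi> \<in> H10 G" for t \<phi>
  proof -
    have "L2_inner G (w t) \<phi> = v t \<bullet> fst (\<Psi> \<phi>)"
      using \<Phi>w[of t] by (simp add: L2_inner_ip L2_fun_sqi inner_\<Phi>[symmetric] H1_sqi[OF H10_H1[OF \<phi>]] fst_\<Psi>)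
    also have "\<dots> = x0 \<bullet> fst (\<Psi> \<phi>) + prim T (\<lambda>s. (F s - A0 (u s)) \<bullet> \<Psi> \<phi>) t"
      by (rule eq[OF t H10_V[OF \<phi>]])
    also have "prim T (\<lambda>s. (F s - A0 (u s)) \<bullet> \<Psi> \<phi>) t = prim T (\<lambda>s. (F s - A0 (\<Psi> (w s))) \<bullet> \<Psi> \<phi>) t"
    proof (rule prim_cong_AE)
      have c: "(\<lambda>_. \<Psi> \<phi>) \<in> sqi (tm T)" by (simp add: sqi_def)
      show "(\<lambda>s. (F s - A0 (u s)) \<bullet> \<Psi> \<phi>) \<in> borel_measurable (tm T)"
        by (rule borel_measurable_integrable[OF sqi_inner[OF sqi_diff[OF F sqi_bounded_linear(1)[OF bounded_linear_A0 u]] c]])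
      show "(\<lambda>s. (F s - A0 (\<Psi> (w s))) \<bullet> \<Psi> \<phi>) \<in> borel_measurable (tm T)"
        by (rule borel_measurable_integrable[OF sqi_inner[OF sqi_diff[OF F sqi_bounded_linear(1)[OF bounded_linear_A0 L2_curve_\<Psi>(1)[OF wL]]] c]])
      show "AE s in tm T. (F s - A0 (u s)) \<bullet> \<Psi> \<phi> = (F s - A0 (\<Psi> (w s))) \<bullet> \<Psi> \<phi>"
        using \<Psi>w by eventually_elim simp
    qed
    finally show ?thesis by (simp add: fst_\<Psi>)
  qed
  then show ?thesis using wL wC unfolding coef_eq_def by blast
qed

lemma coef_eq_wellposed:
  assumes T: "T > 0"
  shows "\<exists>C>0. \<forall>x0. \<forall>F\<in>sqi (tm T). (\<exists>w. coef_eq T x0 F w) \<and>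
    (\<forall>w. coef_eq T x0 F w \<longrightarrow> L2_curve_norm T (H1_norm G) w \<le> C * (norm x0 + nrm (tm T) F))"
proof -
  obtain \<delta> \<Lambda> where g: "\<delta> > 0" "\<And>x. \<delta> * (norm x)\<^sup>2 \<le> A0 x \<bullet> x + \<Lambda> * (norm (fst x))\<^sup>2"
    using garding by blast
  obtain C where C: "C > 0" "\<And>x0 F. F \<in> sqi (tm T) \<Longrightarrow> \<exists>u v. weak_solution V fst A0 T x0 F u v"
    "\<And>x0 F u v. F \<in> sqi (tm T) \<Longrightarrow> weak_solution V fst A0 T x0 F u v \<Longrightarrow> nrm (tm T) u \<le> C * (norm x0 + nrm (tm T) F)"
    using weak_solution_wellposed[OF closed_V subspace_V bounded_linear_fst bounded_linear_A0 T g(1) g(2) fst_V_dense V_inj] by blast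
  have 1: "\<exists>w. coef_eq T x0 F w" if F: "F \<in> sqi (tm T)" for x0 F
    using C(2)[OF F, of x0] weak_solution_coef_eq[OF _ F] by blast
  have 2: "L2_curve_norm T (H1_norm G) w \<le> C * (norm x0 + nrm (tm T) F)"
    if F: "F \<in> sqi (tm T)" and w: "coef_eq T x0 F w" for x0 F w
  proof -
    have "w \<in> L2_curve T (H10 G) (H1_norm G)" using w by (simp add: coef_eq_def)
    from L2_curve_\<Psi>(2)[OF this] C(3)[OF F coef_eq_weak_solution[OF w]] show ?thesis by simp
  qed
  show ?thesis using C(1) 1 2 by blast
qed

end

section \<open>Multi-indices and weights\<close>

text \<open>\<open>eps k\<close> abbreviates \<open>single k 1\<close>; rewriting \<open>1\<close> to \<open>Suc 0\<close> would hide it from the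
  rules below.\<close>

declare One_nat_def [simp del]

lemma lookup_minus_eps: "Poly_Mapping.lookup (\<alpha> - eps k) j = Poly_Mapping.lookup \<alpha> j - (if j = k then 1 else 0)"
  by (simp add: lookup_minus lookup_single when_def)

lemma keys_minus_eps: "Poly_Mapping.keys (\<alpha> - eps k) \<subseteq> Poly_Mapping.keys \<alpha>"
  by (auto simp: in_keys_iff lookup_minus_eps)

lemma prod_keys_superset:
  fixes f :: "nat \<Rightarrow> nat \<Rightarrow> real"
  assumes "finite K" "Poly_Mapping.keys \<alpha> \<subseteq> K" "\<And>k. f k 0 = 1"
  shows "(\<Prod>k\<in>Poly_Mapping.keys \<alpha>. f k (Poly_Mapping.lookup \<alpha> k)) = (\<Prod>k\<in>K. f k (Poly_Mapping.lookup \<alpha> k))"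
  using assms by (intro prod.mono_neutral_left) (auto simp: in_keys_iff)

text \<open>Both \<open>mi_power\<close> and \<open>two_nat_power\<close> are products of this kind.
  The support may shrink when one is subtracted, which \<open>f k 0 = 1\<close> makes
  harmless.\<close>

lemma prod_keys_minus_eps:
  fixes f :: "nat \<Rightarrow> nat \<Rightarrow> real"
  assumes k: "k \<in> Poly_Mapping.keys \<alpha>" and f: "\<And>k. f k 0 = 1" "\<And>n. f k (Suc n) = c * f k n"
  shows "(\<Prod>j\<in>Poly_Mapping.keys \<alpha>. f j (Poly_Mapping.lookup \<alpha> j)) =
    c * (\<Prod>j\<in>Poly_Mapping.keys (\<alpha> - eps k). f j (Poly_Mapping.lookup (\<alpha> - eps k) j))"
proof -
  let ?K = "Poly_Mapping.keys \<alpha>" and ?\<beta> = "\<alpha> - eps k"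
  have l: "Poly_Mapping.lookup \<alpha> k = Suc (Poly_Mapping.lookup ?\<beta> k)"
    using k by (simp add: lookup_minus_eps in_keys_iff)
  have o: "Poly_Mapping.lookup ?\<beta> j = Poly_Mapping.lookup \<alpha> j" if "j \<noteq> k" for j
    using that by (simp add: lookup_minus_eps)
  have "(\<Prod>j\<in>Poly_Mapping.keys ?\<beta>. f j (Poly_Mapping.lookup ?\<beta> j)) = (\<Prod>j\<in>?K. f j (Poly_Mapping.lookup ?\<beta> j))"
    by (rule prod_keys_superset) (use keys_minus_eps f(1) in auto)
  also have "\<dots> = f k (Poly_Mapping.lookup ?\<beta> k) * (\<Prod>j\<in>?K - {k}. f j (Poly_Mapping.lookup ?\<beta> j))"
    by (rule prod.remove[OF finite_keys k])
  also have "(\<Prod>j\<in>?K - {k}. f j (Poly_Mapping.lookup ?\<beta> j)) = (\<Prod>j\<in>?K - {k}. f j (Poly_Mapping.lookup \<alpha> j))"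
    by (rule prod.cong) (auto simp: o)
  finally show ?thesis
    using prod.remove[OF finite_keys k, of "\<lambda>j. f j (Poly_Mapping.lookup \<alpha> j)"] by (simp add: l f(2))
qed

lemma mi_deg_minus_eps:
  assumes k: "k \<in> Poly_Mapping.keys \<alpha>"
  shows "mi_deg \<alpha> = Suc (mi_deg (\<alpha> - eps k))"
proof -
  let ?K = "Poly_Mapping.keys \<alpha>" and ?\<beta> = "\<alpha> - eps k"
  have "mi_deg ?\<beta> = (\<Sum>j\<in>?K. Poly_Mapping.lookup ?\<beta> j)"
    unfolding mi_deg_def by (rule sum.mono_neutral_left[OF finite_keys keys_minus_eps]) (simp add: in_keys_iff)
  also have "\<dots> = Poly_Mapping.lookup ?\<beta> k + (\<Sum>j\<in>?K - {k}. Poly_Mapping.lookup ?\<beta> j)"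
    by (rule sum.remove[OF finite_keys k])
  also have "(\<Sum>j\<in>?K - {k}. Poly_Mapping.lookup ?\<beta> j) = (\<Sum>j\<in>?K - {k}. Poly_Mapping.lookup \<alpha> j)"
    by (rule sum.cong) (auto simp: lookup_minus_eps)
  finally show ?thesis
    using sum.remove[OF finite_keys k, of "Poly_Mapping.lookup \<alpha>"] k
    by (simp add: mi_deg_def[of \<alpha>] lookup_minus_eps in_keys_iff)
qed

lemma mi_deg_0_iff: "mi_deg \<alpha> = 0 \<longleftrightarrow> \<alpha> = 0"
  unfolding mi_deg_def by (auto simp: in_keys_iff poly_mapping_eq_iff fun_eq_iff)

lemma minus_eps_add: "k \<in> Poly_Mapping.keys \<alpha> \<Longrightarrow> \<alpha> - eps k + eps k = \<alpha>"
  by (rule poly_mapping_eqI) (simp add: lookup_add lookup_minus_eps lookup_single when_def in_keys_iff)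

lemma deg_1_cases:
  assumes "mi_deg \<alpha> = 1"
  obtains k where "\<alpha> = eps k"
proof -
  have "\<alpha> \<noteq> 0" using assms mi_deg_0_iff[of \<alpha>] by simp
  then obtain k where k: "k \<in> Poly_Mapping.keys \<alpha>" using keys_eq_empty[of \<alpha>] by blast
  then have "\<alpha> - eps k = 0" using mi_deg_minus_eps[OF k] assms mi_deg_0_iff by simp
  then show ?thesis using minus_eps_add[OF k] that[of k] by simp
qed

lemma mi_deg_eps: "mi_deg (eps k) = 1"
  by (simp add: mi_deg_def)

lemma eps_neq_0: "eps k \<noteq> 0"
  using mi_deg_eps[of k] mi_deg_0_iff[of "eps k"] by simp

text \<open>Evaluates the description operator in \<open>forcing\<close>.\<close>

lemma the_eps: "(THE j. eps k = eps j) = k"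
  by (rule the_equality) (auto dest: arg_cong[where f="\<lambda>p. Poly_Mapping.lookup p k"] simp: lookup_single when_def split: if_splits)

lemma weight_r_0: "weight_r ck l 0 = 1"
  by (simp add: weight_r_def mi_power_def two_nat_power_def mi_deg_def)

lemma weight_r_nonneg: "two_nat_power p \<alpha> \<ge> 0" "weight_r ck l \<alpha> \<ge> 0"
proof -
  show "two_nat_power p \<alpha> \<ge> 0" for p unfolding two_nat_power_def by (rule prod_nonneg) simp
  then show "weight_r ck l \<alpha> \<ge> 0" unfolding weight_r_def by simp
qed

lemma weight_r_sq:
  "(weight_r ck l \<alpha>)\<^sup>2 = inverse ((mi_power ck \<alpha>)\<^sup>2) * inverse (fact (mi_deg \<alpha>)) * two_nat_power (- 2 * l) \<alpha>"
  unfolding weight_r_def using weight_r_nonneg(1)[of "-2 * l" \<alpha>] by simp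

text \<open>The weights are made for this cancellation. The factor
  \<open>mi_deg \<alpha> * (ck k)\<^sup>2\<close> is what Cauchy-Schwarz produces; the factorial
  absorbs the degree, \<open>mi_power\<close> absorbs \<open>ck k\<close>, and only the power of
  \<open>2 * (k + 1)\<close> remains.\<close>

lemma weight_r_step:
  assumes k: "k \<in> Poly_Mapping.keys \<alpha>" and ck: "ck k > 0"
  shows "(weight_r ck l \<alpha>)\<^sup>2 * (real (mi_deg \<alpha>) * (ck k)\<^sup>2) =
    (2 * real (k + 1)) powr (- 2 * l) * (weight_r ck l (\<alpha> - eps k))\<^sup>2"
proof -
  have 1: "mi_power ck \<alpha> = ck k * mi_power ck (\<alpha> - eps k)"
    unfolding mi_power_def by (rule prod_keys_minus_eps[where f="\<lambda>k n. ck k ^ n", OF k]) simp_all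
  have 2: "two_nat_power p \<alpha> = (2 * real (k + 1)) powr p * two_nat_power p (\<alpha> - eps k)" for p
    unfolding two_nat_power_def
    by (rule prod_keys_minus_eps[where f="\<lambda>k n. (2 * real (k + 1)) powr (p * real n)", OF k])
       (simp_all add: distrib_left powr_add)
  have d: "real (mi_deg \<alpha>) * inverse (fact (mi_deg \<alpha>)) = inverse (fact (mi_deg (\<alpha> - eps k)))"
    unfolding mi_deg_minus_eps[OF k] fact_Suc of_nat_mult by (simp add: nonzero_inverse_mult_distrib)
  have c: "(ck k)\<^sup>2 * inverse ((mi_power ck \<alpha>)\<^sup>2) = inverse ((mi_power ck (\<alpha> - eps k))\<^sup>2)"
    unfolding 1 using ck by (simp add: power_mult_distrib field_simps)
  have "(weight_r ck l \<alpha>)\<^sup>2 * (real (mi_deg \<alpha>) * (ck k)\<^sup>2) = real (mi_deg \<alpha>) * inverse (fact (mi_deg \<alpha>)) *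
      ((ck k)\<^sup>2 * inverse ((mi_power ck \<alpha>)\<^sup>2)) * two_nat_power (- 2 * l) \<alpha>"
    unfolding weight_r_sq by (simp only: ac_simps)
  then show ?thesis unfolding d c weight_r_sq[of ck l "\<alpha> - eps k"] 2 by (simp only: ac_simps)
qed

text \<open>Summing the recursive inequality over all multi-indices of degree \<open>n\<close> gains a factor
  \<open>\<Sum>\<^sub>k q\<^sub>k \<le> 1/2\<close> over degree \<open>n - 1\<close>.\<close>

lemma multi_index_recursion_summable:
  fixes Y :: "multi_index \<Rightarrow> real"
  assumes Y: "\<And>\<alpha>. Y \<alpha> \<ge> 0" and q: "\<And>k. q k \<ge> 0" "\<And>K. finite K \<Longrightarrow> (\<Sum>k\<in>K. q k) \<le> 1 / 2"
    and rec: "\<And>\<alpha>. \<alpha> \<noteq> 0 \<Longrightarrow> Y \<alpha> \<le> (\<Sum>k\<in>Poly_Mapping.keys \<alpha>. q k * Y (\<alpha> - eps k))"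
  shows "Y summable_on UNIV" "(\<Sum>\<^sub>\<infinity>\<alpha>. Y \<alpha>) \<le> 2 * Y 0"
proof -
  have level: "finite F \<Longrightarrow> (\<And>\<alpha>. \<alpha> \<in> F \<Longrightarrow> mi_deg \<alpha> = n) \<Longrightarrow> (\<Sum>\<alpha>\<in>F. Y \<alpha>) \<le> (1/2)^n * Y 0" for F n
  proof (induction n arbitrary: F)
    case 0
    then have "F \<subseteq> {0}" by (auto simp: mi_deg_0_iff)
    then have "F = {} \<or> F = {0}" by auto
    then show ?case using Y[of 0] by auto
  next
    case (Suc n)
    let ?S = "SIGMA \<alpha>:F. Poly_Mapping.keys \<alpha>"
    define K where "K = (\<Union>\<alpha>\<in>F. Poly_Mapping.keys \<alpha>)"
    define F' where "F' = (\<lambda>(\<alpha>, k). \<alpha> - eps k) ` ?S"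
    have fin: "finite ?S" "finite K" "finite F'" using Suc.prems(1) by (auto simp: K_def F'_def)
    have deg: "mi_deg \<beta> = n" if \<beta>: "\<beta> \<in> F'" for \<beta>
    proof -
      obtain \<alpha> k where "\<alpha> \<in> F" "k \<in> Poly_Mapping.keys \<alpha>" "\<beta> = \<alpha> - eps k" using \<beta> by (auto simp: F'_def)
      then show ?thesis using mi_deg_minus_eps[of k \<alpha>] Suc.prems(2) by simp
    qed
    \<comment> \<open>\<open>k\<close> and \<open>\<alpha> - eps k\<close> determine
      \<open>\<alpha>\<close>, so the double sum is part of a sum over the product
      \<open>K \<times> F'\<close>.\<close>
    have inj: "inj_on (\<lambda>(\<alpha>, k). (k, \<alpha> - eps k)) ?S"
    proof (rule inj_onI, clarsimp)
      fix \<alpha> \<alpha>' k assume "k \<in> Poly_Mapping.keys \<alpha>" "k \<in> Poly_Mapping.keys \<alpha>'" "\<alpha> - eps k = \<alpha>' - eps k"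
      then show "\<alpha> = \<alpha>'" using minus_eps_add by metis
    qed
    have "(\<Sum>\<alpha>\<in>F. Y \<alpha>) \<le> (\<Sum>\<alpha>\<in>F. \<Sum>k\<in>Poly_Mapping.keys \<alpha>. q k * Y (\<alpha> - eps k))"
      proof (rule sum_mono, rule rec)
      fix \<alpha> assume "\<alpha> \<in> F"
      then show "\<alpha> \<noteq> 0" using Suc.prems(2)[of \<alpha>] mi_deg_0_iff[of \<alpha>] by simp
    qed
    also have "\<dots> = (\<Sum>(\<alpha>, k)\<in>?S. q k * Y (\<alpha> - eps k))"
      using Suc.prems(1) by (intro sum.Sigma) auto
    also have "\<dots> = (\<Sum>(k, \<beta>)\<in>(\<lambda>(\<alpha>, k). (k, \<alpha> - eps k)) ` ?S. q k * Y \<beta>)"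
      by (subst sum.reindex[OF inj]) (simp add: case_prod_unfold comp_def)
    also have "\<dots> \<le> (\<Sum>(k, \<beta>)\<in>K \<times> F'. q k * Y \<beta>)"
      by (rule sum_mono2) (use fin q(1) Y in \<open>auto simp: K_def F'_def\<close>)
    also have "\<dots> = (\<Sum>k\<in>K. q k) * (\<Sum>\<beta>\<in>F'. Y \<beta>)"
      by (simp add: sum_product sum.cartesian_product)
    also have "\<dots> \<le> 1 / 2 * ((1/2)^n * Y 0)"
      using q(2)[OF fin(2)] Suc.IH[OF fin(3) deg] by (intro mult_mono sum_nonneg Y) auto
    finally show ?case by simp
  qed
  have bound: "(\<Sum>\<alpha>\<in>F. Y \<alpha>) \<le> 2 * Y 0" if F: "finite F" for F
  proof -
    \<comment> \<open>Inserting 0 keeps the maximum defined for empty \<open>F\<close>.\<close>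
    define m where "m = Suc (Max (insert 0 (mi_deg ` F)))"
    have dm: "mi_deg \<alpha> < m" if "\<alpha> \<in> F" for \<alpha>
      unfolding m_def less_Suc_eq_le by (rule Max_ge) (use F that in auto)
    have "(\<Sum>\<alpha>\<in>F. Y \<alpha>) = (\<Sum>n<m. \<Sum>\<alpha>\<in>{\<alpha>\<in>F. mi_deg \<alpha> = n}. Y \<alpha>)"
      by (rule sum.group[symmetric]) (use F dm in auto)
    also have "\<dots> \<le> (\<Sum>n<m. (1/2)^n * Y 0)"
      by (intro sum_mono level) (use F in auto)
    also have "\<dots> = (\<Sum>n<m. (1/2)^n) * Y 0" by (simp add: sum_distrib_right)
    also have "(\<Sum>n<m. (1/2)^n) = 2 - 2 * (1/2 :: real)^m" by (induction m) (simp_all add: field_simps)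
    also have "(2 - 2 * (1/2)^m) * Y 0 \<le> 2 * Y 0" using Y[of 0] by (intro mult_right_mono) auto
    finally show ?thesis .
  qed
  show s: "Y summable_on UNIV"
    by (rule nonneg_bdd_above_summable_on) (use Y bound in \<open>auto intro!: bdd_aboveI2\<close>)
  show "(\<Sum>\<^sub>\<infinity>\<alpha>. Y \<alpha>) \<le> 2 * Y 0"
    by (rule infsum_le_finite_sums[OF s]) (use bound in auto)
qed

lemma sum_inverse_squares_le: "finite K \<Longrightarrow> (\<Sum>k\<in>K. inverse ((2 * real (k + 1))\<^sup>2)) \<le> 1 / 2"
proof -
  assume K: "finite K"
  then obtain N where N: "K \<subseteq> {..<N}" using finite_nat_iff_bounded by blast
  have "(\<Sum>k<N. inverse ((2 * real (k + 1))\<^sup>2)) \<le> 1 / 2 - 1 / (2 * real (N + 1))"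
  proof (induction N)
    case (Suc N)
    \<comment> \<open>With \<open>x = N + 1\<close> this compares \<open>1 / (4 x^2)\<close> with
      \<open>1 / (2 x (x + 1))\<close>, which holds for \<open>x \<ge> 1\<close> and
      telescopes.\<close>
    have "inverse ((2 * real (N + 1))\<^sup>2) \<le> 1 / (2 * real (N + 1)) - 1 / (2 * real (Suc N + 1))"
      by (simp add: power2_eq_square divide_simps)
    then show ?case using Suc by simp
  qed simp
  moreover have "(\<Sum>k\<in>K. inverse ((2 * real (k + 1))\<^sup>2)) \<le> (\<Sum>k<N. inverse ((2 * real (k + 1))\<^sup>2))"
    by (rule sum_mono2[OF _ N]) auto
  moreover have "1 / (2 * real (N + 1)) \<ge> 0" by simp
  ultimately show ?thesis by linarith
qed

text \<open>Every base is at least 2. With \<open>2 * l = 2 * (m + 1) + 2\<close> the first part of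
  the exponent beats \<open>C\<^sup>2 < 4 ^ m\<close>, and the other two powers leave the inverse
  squares.\<close>

lemma weight_exponent_exists:
  fixes C :: real
  shows "\<exists>l>1. \<forall>K::nat set. finite K \<longrightarrow> (\<Sum>k\<in>K. C\<^sup>2 * (2 * real (k + 1)) powr (- 2 * l)) \<le> 1 / 2"
proof -
  obtain m :: nat where m: "C\<^sup>2 < 4 ^ m" using real_arch_pow[of 4 "C\<^sup>2"] by auto
  define l where "l = real m + 2"
  have le: "C\<^sup>2 * (2 * real (k + 1)) powr (- 2 * l) \<le> inverse ((2 * real (k + 1))\<^sup>2)" for k
  proof -
    let ?x = "2 * real (k + 1)"
    have x: "?x \<ge> 2" by simp
    have "?x powr (- 2 * l) = ?x powr (- 2 * real (m + 1)) * ?x powr (- 2)"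
      unfolding l_def powr_add[symmetric] by (simp add: algebra_simps)
    also have "?x powr (- 2) = inverse (?x\<^sup>2)" using x by (simp add: powr_minus powr_numeral)
    also have "?x powr (- 2 * real (m + 1)) = inverse (?x powr (real (2 * (m + 1))))"
      by (simp add: powr_minus[symmetric] algebra_simps)
    also have "?x powr (real (2 * (m + 1))) = ?x ^ (2 * (m + 1))" using x by (intro powr_realpow) linarith
    finally have e: "?x powr (- 2 * l) = inverse (?x ^ (2 * (m + 1))) * inverse (?x\<^sup>2)" .
    have "C\<^sup>2 \<le> 4 ^ (m + 1)" by (rule order_trans[OF less_imp_le[OF m]]) simp
    also have "(4::real) ^ (m + 1) = 2 ^ (2 * (m + 1))" by (subst power_mult) simp
    also have "\<dots> \<le> ?x ^ (2 * (m + 1))" using x by (intro power_mono) auto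
    finally have "C\<^sup>2 \<le> ?x ^ (2 * (m + 1))" .
    moreover have "0 < ?x ^ (2 * (m + 1))" by (rule zero_less_power) simp
    ultimately have "C\<^sup>2 * inverse (?x ^ (2 * (m + 1))) \<le> 1"
      by (simp only: divide_inverse[symmetric] divide_le_eq_1_pos)
    then have "C\<^sup>2 * inverse (?x ^ (2 * (m + 1))) * inverse (?x\<^sup>2) \<le> 1 * inverse (?x\<^sup>2)"
      by (rule mult_right_mono) simp
    then show ?thesis unfolding e by (simp add: mult.assoc)
  qed
  have "(\<Sum>k\<in>K. C\<^sup>2 * (2 * real (k + 1)) powr (- 2 * l)) \<le> 1 / 2" if "finite K" for K :: "nat set"
    using sum_mono[of K "\<lambda>k. C\<^sup>2 * (2 * real (k + 1)) powr (- 2 * l)" "\<lambda>k. inverse ((2 * real (k + 1))\<^sup>2)"] le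
      sum_inverse_squares_le[OF that] by fastforce
  then show ?thesis by (intro exI[of _ l]) (auto simp: l_def)
qed

section \<open>The chaos expansion\<close>

context coefficients
begin

definition noise_term :: "nat \<Rightarrow> ell2 \<times> (ell2 ^ 'n) \<Rightarrow> ell2 \<times> (ell2 ^ 'n)" where
  "noise_term k x = (mult (h k) (N0 x), 0)"

lemma bounded_linear_noise_term: "bounded_linear (noise_term k)"
  unfolding noise_term_def[abs_def]
  by (intro bounded_linear_Pair bounded_linear_compose[OF bounded_linear_mult[OF h_meas] bounded_linear_N0] bounded_linear_zero)

lemma norm_noise_term: "norm (noise_term k x) \<le> ck k * onorm N0 * norm x"
proof -
  have "norm (noise_term k x) = norm (mult (h k) (N0 x))" by (simp add: noise_term_def norm_Pair)
  also have "\<dots> \<le> ck k * norm (N0 x)" by (rule norm_mult_h_le)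
  also have "\<dots> \<le> ck k * (onorm N0 * norm x)"
    by (intro mult_left_mono onorm[OF bounded_linear_N0]) (simp add: ck(1) less_imp_le)
  finally show ?thesis by (simp add: mult.assoc)
qed

definition force :: "(real \<Rightarrow> (real^'n \<Rightarrow> real) \<Rightarrow> real) \<Rightarrow> (real \<Rightarrow> real^'n \<Rightarrow> real) \<Rightarrow> multi_index \<Rightarrow> real \<Rightarrow> ell2 \<times> (ell2 ^ 'n)" where
  "force f g \<alpha> t = (if \<alpha> = 0 then riesz (f t)
     else if mi_deg \<alpha> = 1 then (mult (h (THE k. \<alpha> = eps k)) (\<Phi> (g t)), 0) else 0)"

definition total_force where
  "total_force f g u \<alpha> s = force f g \<alpha> s +
     (\<Sum>k\<in>Poly_Mapping.keys \<alpha>. sqrt (real (Poly_Mapping.lookup \<alpha> k)) *\<^sub>R noise_term k (\<Psi> (u (\<alpha> - eps k) s)))"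

text \<open>One index of \<open>chaos_solution\<close>, with the candidate \<open>w\<close>
  separated from the family \<open>u\<close> of earlier coefficients, the shape required by a choice
  along a well-founded relation.\<close>

definition chaos_coef where
  "chaos_coef T u0 f g u \<alpha> w \<longleftrightarrow> w \<in> L2_curve T (H10 G) (H1_norm G) \<inter> C_curve T (L2_fun G) (L2_norm G) \<and>
       (\<forall>t\<in>{0..T}. \<forall>\<phi>\<in>H10 G.
          L2_inner G (w t) \<phi> =
          (if \<alpha> = 0 then L2_inner G u0 \<phi> else 0) +
          (LINT s|lebesgue_on {0..t}.
             op_A G a b c (w s) \<phi> + forcing G h f g \<alpha> s \<phi> +
             (\<Sum>k\<in>Poly_Mapping.keys \<alpha>. sqrt (real (Poly_Mapping.lookup \<alpha> k)) * op_M G \<sigma> \<nu> (h k) (u (\<alpha> - eps k) s) \<phi>)))"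

lemma chaos_solution_iff: "chaos_solution G h T a b c \<sigma> \<nu> u0 f g u \<longleftrightarrow> (\<forall>\<alpha>. chaos_coef T u0 f g u \<alpha> (u \<alpha>))"
  unfolding chaos_solution_def chaos_coef_def ..

definition start :: "(real^'n \<Rightarrow> real) \<Rightarrow> multi_index \<Rightarrow> ell2" where
  "start u0 \<alpha> = (if \<alpha> = 0 then \<Phi> u0 else 0)"

context
  fixes T u0 f g
  assumes T: "T > (0::real)" and u0: "u0 \<in> L2_fun G" and f: "f \<in> L2_curve T (Hm1 G) (Hm1_norm G)"
    and g: "g \<in> L2_curve T (L2_fun G) (L2_norm G)"
begin

lemma riesz_f: "(\<lambda>t. riesz (f t)) \<in> sqi (tm T)" "nrm (tm T) (\<lambda>t. riesz (f t)) = L2_curve_norm T (Hm1_norm G) f"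
  using L2_curve_sqi[where e=riesz and S="Hm1 G" and N="Hm1_norm G", OF f riesz_iso riesz_iso1] by simp_all

lemma \<Phi>_g: "(\<lambda>t. \<Phi> (g t)) \<in> sqi (tm T)" "nrm (tm T) (\<lambda>t. \<Phi> (g t)) = L2_curve_norm T (L2_norm G) g"
  using L2_curve_sqi[where e=\<Phi> and S="L2_fun G" and N="L2_norm G", OF g \<Phi>_iso \<Phi>_iso1] by simp_all

lemma force_eps: "force f g (eps k) = (\<lambda>t. (mult (h k) (\<Phi> (g t)), 0))"
  by (simp add: fun_eq_iff force_def mi_deg_eps the_eps eps_neq_0)

lemma force_sqi: "force f g \<alpha> \<in> sqi (tm T)"
  and force_0: "nrm (tm T) (force f g 0) = L2_curve_norm T (Hm1_norm G) f"
  and force_1: "nrm (tm T) (force f g (eps k)) \<le> ck k * L2_curve_norm T (L2_norm G) g"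
  and force_2: "\<alpha> \<noteq> 0 \<Longrightarrow> mi_deg \<alpha> \<noteq> 1 \<Longrightarrow> nrm (tm T) (force f g \<alpha>) = 0"
proof -
  have e0: "force f g 0 = (\<lambda>t. riesz (f t))" by (simp add: force_def fun_eq_iff)
  have e2: "force f g \<alpha> = (\<lambda>t. 0)" if "\<alpha> \<noteq> 0" "mi_deg \<alpha> \<noteq> 1" for \<alpha> using that by (simp add: force_def fun_eq_iff)
  have bl: "bounded_linear (\<lambda>x. (mult (h k) x, 0 :: ell2 ^ 'n))" for k
    by (intro bounded_linear_Pair bounded_linear_mult h_meas bounded_linear_zero)
  have s1: "force f g (eps k) \<in> sqi (tm T)" for k
    unfolding force_eps by (rule sqi_bounded_linear(1)[OF bl \<Phi>_g(1)])
  show "nrm (tm T) (force f g 0) = L2_curve_norm T (Hm1_norm G) f" by (simp add: e0 riesz_f)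
  show "nrm (tm T) (force f g (eps k)) \<le> ck k * L2_curve_norm T (L2_norm G) g"
    unfolding \<Phi>_g(2)[symmetric]
  proof (rule nrm_mono_AE(2)[OF sqi_measurable[OF s1] \<Phi>_g(1)])
    show "AE t in tm T. norm (force f g (eps k) t) \<le> ck k * norm (\<Phi> (g t))"
      by (simp add: force_eps norm_Pair norm_mult_h_le)
  qed (simp add: ck(1) less_imp_le)
  show "\<alpha> \<noteq> 0 \<Longrightarrow> mi_deg \<alpha> \<noteq> 1 \<Longrightarrow> nrm (tm T) (force f g \<alpha>) = 0" by (simp add: e2 nrm_def)
  consider "\<alpha> = 0" | "mi_deg \<alpha> = 1" | "\<alpha> \<noteq> 0" "mi_deg \<alpha> \<noteq> 1" by blast
  then show "force f g \<alpha> \<in> sqi (tm T)"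
  proof cases
    case 2
    then show ?thesis using s1 by (metis deg_1_cases)
  qed (simp_all add: e0 e2 riesz_f)
qed

lemma noise_sqi: "w \<in> L2_curve T (H10 G) (H1_norm G) \<Longrightarrow> (\<lambda>s. noise_term k (\<Psi> (w s))) \<in> sqi (tm T)"
  by (rule sqi_bounded_linear(1)[OF bounded_linear_noise_term L2_curve_\<Psi>(1)])

lemma noise_nrm:
  assumes w: "w \<in> L2_curve T (H10 G) (H1_norm G)"
  shows "nrm (tm T) (\<lambda>s. noise_term k (\<Psi> (w s))) \<le> ck k * onorm N0 * L2_curve_norm T (H1_norm G) w"
  unfolding L2_curve_\<Psi>(2)[OF w, symmetric]
proof (rule nrm_mono_AE(2)[OF sqi_measurable[OF noise_sqi[OF w]] L2_curve_\<Psi>(1)[OF w]])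
  show "AE s in tm T. norm (noise_term k (\<Psi> (w s))) \<le> ck k * onorm N0 * norm (\<Psi> (w s))" by (simp add: norm_noise_term)
  show "0 \<le> ck k * onorm N0" using ck(1)[of k] onorm_pos_le[OF bounded_linear_N0] by (simp add: less_imp_le)
qed

lemma total_force_sqi:
  assumes "\<And>k. k \<in> Poly_Mapping.keys \<alpha> \<Longrightarrow> u (\<alpha> - eps k) \<in> L2_curve T (H10 G) (H1_norm G)"
  shows "total_force f g u \<alpha> \<in> sqi (tm T)"
  unfolding total_force_def[abs_def]
  by (rule sqi_add[OF force_sqi sqi_sum]) (rule sqi_scaleR, rule noise_sqi, rule assms)

text \<open>The two integrands agree at almost every time, namely when all the curves involved take
  values in their spaces. Measurability is known on the Hilbert space side and is carried to the
  operators on functions by completeness of the measure.\<close>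

lemma chaos_coef_iff:
  assumes u: "\<And>k. k \<in> Poly_Mapping.keys \<alpha> \<Longrightarrow> u (\<alpha> - eps k) \<in> L2_curve T (H10 G) (H1_norm G)"
  shows "chaos_coef T u0 f g u \<alpha> w \<longleftrightarrow> coef_eq T (start u0 \<alpha>) (total_force f g u \<alpha>) w"
proof -
  have "(LINT s|lebesgue_on {0..t}. op_A G a b c (w s) \<phi> + forcing G h f g \<alpha> s \<phi> +
             (\<Sum>k\<in>Poly_Mapping.keys \<alpha>. sqrt (real (Poly_Mapping.lookup \<alpha> k)) * op_M G \<sigma> \<nu> (h k) (u (\<alpha> - eps k) s) \<phi>))
      = prim T (\<lambda>s. (total_force f g u \<alpha> s - A0 (\<Psi> (w s))) \<bullet> \<Psi> \<phi>) t"
    if w: "w \<in> L2_curve T (H10 G) (H1_norm G)" and t: "t \<in> {0..T}" and \<phi>: "\<phi> \<in> H10 G" for t \<phi>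
  proof -
    let ?L = "\<lambda>s. op_A G a b c (w s) \<phi> + forcing G h f g \<alpha> s \<phi> +
             (\<Sum>k\<in>Poly_Mapping.keys \<alpha>. sqrt (real (Poly_Mapping.lookup \<alpha> k)) * op_M G \<sigma> \<nu> (h k) (u (\<alpha> - eps k) s) \<phi>)"
    let ?R = "\<lambda>s. (total_force f g u \<alpha> s - A0 (\<Psi> (w s))) \<bullet> \<Psi> \<phi>"
    have c: "(\<lambda>_. \<Psi> \<phi>) \<in> sqi (tm T)" by (simp add: sqi_def)
    have R: "?R \<in> borel_measurable (tm T)"
      by (rule borel_measurable_integrable[OF sqi_inner[OF sqi_diff[OF total_force_sqi[where \<alpha>=\<alpha> and u=u, OF u]
              sqi_bounded_linear(1)[OF bounded_linear_A0 L2_curve_\<Psi>(1)[OF w]]] c]])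
    have AEf: "AE s in tm T. forcing G h f g \<alpha> s \<phi> = force f g \<alpha> s \<bullet> \<Psi> \<phi>"
    proof -
      have ff: "AE s in tm T. f s \<in> Hm1 G" and gg: "AE s in tm T. g s \<in> L2_fun G"
        using f g by (auto simp: L2_curve_def)
      show ?thesis
        using ff gg
      proof eventually_elim
        case (elim s)
        consider "\<alpha> = 0" | k where "\<alpha> = eps k" | "\<alpha> \<noteq> 0" "mi_deg \<alpha> \<noteq> 1" by (metis deg_1_cases)
        then show ?case
        proof cases
          case 1
          then show ?thesis using riesz(2)[OF elim(1) \<phi>] by (simp add: forcing_def force_def)
        next
          case (2 k)
          have gs: "g s \<in> sqi M" using elim(2) by (simp add: L2_fun_sqi)
          have "forcing G h f g \<alpha> s \<phi> = L2_inner G (\<lambda>x. g s x * h k x) \<phi>"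
            unfolding 2 forcing_def mi_deg_eps the_eps by (simp add: eps_neq_0)
          also have "\<dots> = \<Phi> (\<lambda>x. h k x * g s x) \<bullet> \<Phi> \<phi>"
            by (simp add: L2_inner_ip inner_\<Phi> bmeas_sqi h_meas gs H1_sqi[OF H10_H1[OF \<phi>]] mult.commute[of "g s _"])
          also have "\<dots> = force f g \<alpha> s \<bullet> \<Psi> \<phi>"
            unfolding 2 force_eps by (simp add: inner_prod_def fst_\<Psi> mult_\<Phi> h_meas gs)
          finally show ?thesis .
        next
          case 3
          then show ?thesis by (simp add: forcing_def force_def)
        qed
      qed
    qed
    have AEk: "AE s in tm T. \<forall>k\<in>Poly_Mapping.keys \<alpha>. u (\<alpha> - eps k) s \<in> H10 G"
      using u by (intro AE_finite_allI) (auto simp: L2_curve_def)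
    have AEw: "AE s in tm T. w s \<in> H10 G" using w by (simp add: L2_curve_def)
    have eq: "AE s in tm T. ?R s = ?L s"
      using AEf AEk AEw
    proof eventually_elim
      case (elim s)
      have "noise_term k (\<Psi> (u (\<alpha> - eps k) s)) \<bullet> \<Psi> \<phi> = op_M G \<sigma> \<nu> (h k) (u (\<alpha> - eps k) s) \<phi>" if "k \<in> Poly_Mapping.keys \<alpha>" for k
        using op_M_eq[OF _ \<phi>, of "u (\<alpha> - eps k) s" k] elim(2) that by (simp add: noise_term_def inner_prod_def)
      then show ?case
        using op_A_eq[OF elim(3) \<phi>] elim(1)
        by (simp add: total_force_def inner_add_left inner_diff_left inner_sum_left)
    qed
    have L: "?L \<in> borel_measurable (tm T)" by (rule tm.borel_measurable_AE_eq[OF R eq])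
    show ?thesis
      unfolding integral_initial_segment[OF L t] by (rule prim_cong_AE[OF R L eq, symmetric])
  qed
  moreover have "(if \<alpha> = 0 then L2_inner G u0 \<phi> else 0) = start u0 \<alpha> \<bullet> \<Phi> \<phi>" if "\<phi> \<in> H10 G" for \<phi>
    using u0 H1_sqi[OF H10_H1[OF that]] by (simp add: start_def L2_inner_ip inner_\<Phi> L2_fun_sqi)
  ultimately show ?thesis
    unfolding chaos_coef_def coef_eq_def by (intro conj_cong refl ball_cong) simp
qed

text \<open>The equation for \<open>\<alpha>\<close> involves only the multi-indices
  \<open>\<alpha> - eps k\<close> of smaller degree, so the coefficients can be chosen by
  well-founded recursion on the degree.\<close>

lemma chaos_solution_exists: "\<exists>u. chaos_solution G h T a b c \<sigma> \<nu> u0 f g u"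
proof -
  have wf: "wf (inv_image less_than mi_deg)" by (rule wf_inv_image[OF wf_less_than])
  have "\<exists>u. \<forall>\<alpha>. chaos_coef T u0 f g u \<alpha> (u \<alpha>)"
  proof (rule dependent_wf_choice[OF wf])
    fix u v :: "multi_index \<Rightarrow> real \<Rightarrow> real^'n \<Rightarrow> real" and \<alpha> w
    assume uv: "\<And>z. (z, \<alpha>) \<in> inv_image less_than mi_deg \<Longrightarrow> u z = v z"
    have e: "u (\<alpha> - eps k) = v (\<alpha> - eps k)" if "k \<in> Poly_Mapping.keys \<alpha>" for k
      by (rule uv) (simp add: mi_deg_minus_eps[OF that])
    have "(\<Sum>k\<in>Poly_Mapping.keys \<alpha>. sqrt (real (Poly_Mapping.lookup \<alpha> k)) * op_M G \<sigma> \<nu> (h k) (u (\<alpha> - eps k) s) \<phi>) =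
        (\<Sum>k\<in>Poly_Mapping.keys \<alpha>. sqrt (real (Poly_Mapping.lookup \<alpha> k)) * op_M G \<sigma> \<nu> (h k) (v (\<alpha> - eps k) s) \<phi>)" for s \<phi>
      by (rule sum.cong) (simp_all add: e)
    then show "chaos_coef T u0 f g u \<alpha> w = chaos_coef T u0 f g v \<alpha> w"
      unfolding chaos_coef_def by simp
  next
    fix \<alpha> and u :: "multi_index \<Rightarrow> real \<Rightarrow> real^'n \<Rightarrow> real"
    assume IH: "\<And>\<beta>. (\<beta>, \<alpha>) \<in> inv_image less_than mi_deg \<Longrightarrow> chaos_coef T u0 f g u \<beta> (u \<beta>)"
    have u: "u (\<alpha> - eps k) \<in> L2_curve T (H10 G) (H1_norm G)" if "k \<in> Poly_Mapping.keys \<alpha>" for k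
      using IH[of "\<alpha> - eps k"] mi_deg_minus_eps[OF that] by (simp add: chaos_coef_def)
    have "\<exists>w. coef_eq T (start u0 \<alpha>) (total_force f g u \<alpha>) w"
      using coef_eq_wellposed[OF T] total_force_sqi[where \<alpha>=\<alpha> and u=u, OF u] by blast
    then show "\<exists>w. chaos_coef T u0 f g u \<alpha> w" using chaos_coef_iff[where \<alpha>=\<alpha> and u=u, OF u] by simp
  qed
  then show ?thesis by (simp add: chaos_solution_iff)
qed

end

text \<open>The majorant \<open>N'\<close> hides the data in its value at 0. At degree one the force
  has norm at most \<open>ck k\<close> times the norm of \<open>g\<close>, hence at most
  \<open>ck k * N' 0\<close>, which is the term that the sum already contains; at higher degree
  there is no force.\<close>

lemma chaos_estimate:
  assumes T: "T > (0::real)"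
  shows "\<exists>C1>0. \<exists>C2>0. \<forall>u0 f g u. u0 \<in> L2_fun G \<longrightarrow> f \<in> L2_curve T (Hm1 G) (Hm1_norm G) \<longrightarrow>
    g \<in> L2_curve T (L2_fun G) (L2_norm G) \<longrightarrow> chaos_solution G h T a b c \<sigma> \<nu> u0 f g u \<longrightarrow>
    (\<exists>N'. N' 0 = C2 * (L2_norm G u0 + L2_curve_norm T (Hm1_norm G) f + L2_curve_norm T (L2_norm G) g) \<and>
      (\<forall>\<alpha>. L2_curve_norm T (H1_norm G) (u \<alpha>) \<le> N' \<alpha>) \<and>
      (\<forall>\<alpha>. \<alpha> \<noteq> 0 \<longrightarrow> N' \<alpha> \<le> C1 * (\<Sum>k\<in>Poly_Mapping.keys \<alpha>. sqrt (real (Poly_Mapping.lookup \<alpha> k)) * (ck k * N' (\<alpha> - eps k)))))"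
proof -
  obtain C where C: "C > 0" and est: "\<And>x0 F w. F \<in> sqi (tm T) \<Longrightarrow> coef_eq T x0 F w \<Longrightarrow>
      L2_curve_norm T (H1_norm G) w \<le> C * (norm x0 + nrm (tm T) F)"
    using coef_eq_wellposed[OF T] by blast
  define K where "K = onorm N0"
  have K: "K \<ge> 0" unfolding K_def by (rule onorm_pos_le[OF bounded_linear_N0])
  \<comment> \<open>In \<open>C + C * K\<close> the first summand pays for the force and the second
    for the noise terms. \<open>C + 1\<close> in place of \<open>C\<close> makes the value at 0
    dominate the zero coefficient and also \<open>g\<close>.\<close>
  have pos: "C + C * K > 0" "C + 1 > 0" using C K by (auto intro: add_pos_nonneg)
  show ?thesis
  proof (rule exI[of _ "C + C * K"], rule conjI[OF pos(1)], rule exI[of _ "C + 1"], rule conjI[OF pos(2)], intro allI impI)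
    fix u0 f g u
    assume u0: "u0 \<in> L2_fun G" and f: "f \<in> L2_curve T (Hm1 G) (Hm1_norm G)"
      and g: "g \<in> L2_curve T (L2_fun G) (L2_norm G)" and sol: "chaos_solution G h T a b c \<sigma> \<nu> u0 f g u"
    define fn where "fn = L2_curve_norm T (Hm1_norm G) f"
    define gn where "gn = L2_curve_norm T (L2_norm G) g"
    define D where "D = L2_norm G u0 + fn + gn"
    define N where "N \<alpha> = L2_curve_norm T (H1_norm G) (u \<alpha>)" for \<alpha>
    have uL: "u \<alpha> \<in> L2_curve T (H10 G) (H1_norm G)" for \<alpha> using sol by (simp add: chaos_solution_def)
    have TF: "total_force f g u \<alpha> \<in> sqi (tm T)" for \<alpha>
      by (rule total_force_sqi[OF T u0 f g]) (rule uL)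
    have fg0: "0 \<le> fn" "0 \<le> gn" "0 \<le> L2_norm G u0"
      unfolding fn_def gn_def riesz_f(2)[OF T u0 f g, symmetric] \<Phi>_g(2)[OF T u0 f g, symmetric] L2_norm_nrm by auto
    have D0: "0 \<le> D" "gn \<le> D" using fg0 by (auto simp: D_def)
    have N0: "0 \<le> N \<alpha>" for \<alpha> unfolding N_def L2_curve_\<Psi>(2)[OF uL, symmetric] by simp
    have eqn: "coef_eq T (start u0 \<alpha>) (total_force f g u \<alpha>) (u \<alpha>)" for \<alpha>
      using sol unfolding chaos_solution_iff by (subst chaos_coef_iff[OF T u0 f g, symmetric]) (auto intro: uL)
    have Nle: "N \<alpha> \<le> C * (norm (start u0 \<alpha>) + nrm (tm T) (total_force f g u \<alpha>))" for \<alpha>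
      unfolding N_def by (rule est[OF TF eqn])
    have TFn: "nrm (tm T) (total_force f g u \<alpha>) \<le> nrm (tm T) (force f g \<alpha>) +
        (\<Sum>k\<in>Poly_Mapping.keys \<alpha>. sqrt (real (Poly_Mapping.lookup \<alpha> k)) * (ck k * K * N (\<alpha> - eps k)))" for \<alpha>
    proof -
      let ?n = "\<lambda>k s. sqrt (real (Poly_Mapping.lookup \<alpha> k)) *\<^sub>R noise_term k (\<Psi> (u (\<alpha> - eps k) s))"
      have ns: "?n k \<in> sqi (tm T)" for k by (rule sqi_scaleR, rule noise_sqi[OF T u0 f g uL])
      have "nrm (tm T) (total_force f g u \<alpha>) \<le> nrm (tm T) (force f g \<alpha>) + nrm (tm T) (\<lambda>s. \<Sum>k\<in>Poly_Mapping.keys \<alpha>. ?n k s)"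
        unfolding total_force_def[abs_def] by (rule nrm_triangle[OF force_sqi[OF T u0 f g] sqi_sum[OF ns]])
      also have "nrm (tm T) (\<lambda>s. \<Sum>k\<in>Poly_Mapping.keys \<alpha>. ?n k s) \<le> (\<Sum>k\<in>Poly_Mapping.keys \<alpha>. nrm (tm T) (?n k))"
        by (rule nrm_sum[OF ns])
      also have "\<dots> \<le> (\<Sum>k\<in>Poly_Mapping.keys \<alpha>. sqrt (real (Poly_Mapping.lookup \<alpha> k)) * (ck k * K * N (\<alpha> - eps k)))"
        unfolding nrm_scaleR N_def K_def using noise_nrm[OF T u0 f g uL]
        by (intro sum_mono mult_mono) auto
      finally show ?thesis by simp
    qed
    define N' where "N' \<alpha> = (if \<alpha> = 0 then (C + 1) * D else N \<alpha>)" for \<alpha>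
    have N_0: "N 0 \<le> C * D"
    proof -
      have "N 0 \<le> C * (L2_norm G u0 + fn)"
        using Nle[of 0] TFn[of 0] force_0[OF T u0 f g] \<Phi>_iso1[OF u0] C
        by (simp add: start_def fn_def) (smt (verit) mult_left_mono)
      also have "\<dots> \<le> C * D" using fg0 C by (intro mult_left_mono) (auto simp: D_def)
      finally show ?thesis .
    qed
    have NN': "N \<alpha> \<le> N' \<alpha>" for \<alpha> using N_0 D0 by (simp add: N'_def distrib_right)
    have N'0: "0 \<le> N' \<alpha>" for \<alpha> using NN'[of \<alpha>] N0[of \<alpha>] by linarith
    have step: "N' \<alpha> \<le> (C + C * K) * (\<Sum>k\<in>Poly_Mapping.keys \<alpha>. sqrt (real (Poly_Mapping.lookup \<alpha> k)) * (ck k * N' (\<alpha> - eps k)))"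
      if \<alpha>: "\<alpha> \<noteq> 0" for \<alpha>
    proof -
      let ?S = "\<Sum>k\<in>Poly_Mapping.keys \<alpha>. sqrt (real (Poly_Mapping.lookup \<alpha> k)) * (ck k * N' (\<alpha> - eps k))"
      have terms: "0 \<le> sqrt (real (Poly_Mapping.lookup \<alpha> k)) * (ck k * N' (\<alpha> - eps k))" for k
        using N'0 ck(1)[of k] by (simp add: less_imp_le)
      have S0: "0 \<le> ?S" by (rule sum_nonneg) (rule terms)
      have F: "nrm (tm T) (force f g \<alpha>) \<le> ?S"
      proof (cases "mi_deg \<alpha> = 1")
        case True
        then obtain k where k: "\<alpha> = eps k" by (rule deg_1_cases)
        have "nrm (tm T) (force f g \<alpha>) \<le> ck k * gn" unfolding k gn_def by (rule force_1[OF T u0 f g])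
        also have "\<dots> \<le> ck k * ((C + 1) * D)"
          using D0 C ck(1)[of k] by (intro mult_left_mono) (auto simp: distrib_right intro: order_trans)
        also have "\<dots> = ?S" by (simp add: k N'_def)
        finally show ?thesis .
      next
        case False
        then show ?thesis using force_2[OF T u0 f g \<alpha>] S0 by simp
      qed
      have "(\<Sum>k\<in>Poly_Mapping.keys \<alpha>. sqrt (real (Poly_Mapping.lookup \<alpha> k)) * (ck k * K * N (\<alpha> - eps k))) \<le> K * ?S"
        unfolding sum_distrib_left
      proof (rule sum_mono)
        fix k
        have "sqrt (real (Poly_Mapping.lookup \<alpha> k)) * (ck k * K * N (\<alpha> - eps k)) \<le> sqrt (real (Poly_Mapping.lookup \<alpha> k)) * (ck k * K * N' (\<alpha> - eps k))"
          using K ck(1)[of k] NN' by (intro mult_left_mono) (auto simp: less_imp_le)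
        then show "sqrt (real (Poly_Mapping.lookup \<alpha> k)) * (ck k * K * N (\<alpha> - eps k)) \<le> K * (sqrt (real (Poly_Mapping.lookup \<alpha> k)) * (ck k * N' (\<alpha> - eps k)))"
          by (simp only: ac_simps)
      qed
      then have "nrm (tm T) (total_force f g u \<alpha>) \<le> ?S + K * ?S" using TFn[of \<alpha>] F by linarith
      then have "N \<alpha> \<le> C * (?S + K * ?S)"
        using Nle[of \<alpha>] \<alpha> C by (simp add: start_def) (meson mult_left_mono order_trans less_imp_le)
      then show ?thesis using \<alpha> by (simp add: N'_def algebra_simps)
    qed
    show "\<exists>N'. N' 0 = (C + 1) * (L2_norm G u0 + L2_curve_norm T (Hm1_norm G) f + L2_curve_norm T (L2_norm G) g) \<and>
      (\<forall>\<alpha>. L2_curve_norm T (H1_norm G) (u \<alpha>) \<le> N' \<alpha>) \<and>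
      (\<forall>\<alpha>. \<alpha> \<noteq> 0 \<longrightarrow> N' \<alpha> \<le> (C + C * K) * (\<Sum>k\<in>Poly_Mapping.keys \<alpha>. sqrt (real (Poly_Mapping.lookup \<alpha> k)) * (ck k * N' (\<alpha> - eps k))))"
      using NN' step by (intro exI[of _ N']) (auto simp: N_def N'_def D_def fn_def gn_def)
  qed
qed

lemma chaos_solution_wellposed:
  assumes T: "T > (0::real)"
  shows "\<exists>l>1. \<exists>C>0.
    \<forall>u0\<in>L2_fun G. \<forall>f\<in>L2_curve T (Hm1 G) (Hm1_norm G). \<forall>g\<in>L2_curve T (L2_fun G) (L2_norm G).
      (\<exists>u. chaos_solution G h T a b c \<sigma> \<nu> u0 f g u) \<and>
      (\<forall>u. chaos_solution G h T a b c \<sigma> \<nu> u0 f g u \<longrightarrow>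
         u \<in> RL2 (weight_r ck l) (L2_curve T (H10 G) (H1_norm G)) (L2_curve_norm T (H1_norm G)) \<and>
         RL2_norm (weight_r ck l) (L2_curve_norm T (H1_norm G)) u
           \<le> C * (L2_norm G u0 + L2_curve_norm T (Hm1_norm G) f + L2_curve_norm T (L2_norm G) g))"
proof -
  obtain C1 C2 where C: "C1 > 0" "C2 > 0" and est: "\<forall>u0 f g u. u0 \<in> L2_fun G \<longrightarrow> f \<in> L2_curve T (Hm1 G) (Hm1_norm G) \<longrightarrow>
    g \<in> L2_curve T (L2_fun G) (L2_norm G) \<longrightarrow> chaos_solution G h T a b c \<sigma> \<nu> u0 f g u \<longrightarrow>
    (\<exists>N'. N' 0 = C2 * (L2_norm G u0 + L2_curve_norm T (Hm1_norm G) f + L2_curve_norm T (L2_norm G) g) \<and>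
      (\<forall>\<alpha>. L2_curve_norm T (H1_norm G) (u \<alpha>) \<le> N' \<alpha>) \<and>
      (\<forall>\<alpha>. \<alpha> \<noteq> 0 \<longrightarrow> N' \<alpha> \<le> C1 * (\<Sum>k\<in>Poly_Mapping.keys \<alpha>. sqrt (real (Poly_Mapping.lookup \<alpha> k)) * (ck k * N' (\<alpha> - eps k)))))"
    by (insert chaos_estimate[OF T], elim exE conjE) (rule that)
  \<comment> \<open>\<open>l\<close> is chosen from \<open>C1\<close> alone, before any data are
    fixed.\<close>
  obtain l where l: "l > 1" "\<And>K::nat set. finite K \<Longrightarrow> (\<Sum>k\<in>K. C1\<^sup>2 * (2 * real (k + 1)) powr (- 2 * l)) \<le> 1 / 2"
    using weight_exponent_exists[of C1] by blast
  have main: "u \<in> RL2 (weight_r ck l) (L2_curve T (H10 G) (H1_norm G)) (L2_curve_norm T (H1_norm G)) \<and>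
         RL2_norm (weight_r ck l) (L2_curve_norm T (H1_norm G)) u
           \<le> sqrt 2 * C2 * (L2_norm G u0 + L2_curve_norm T (Hm1_norm G) f + L2_curve_norm T (L2_norm G) g)"
    if u0: "u0 \<in> L2_fun G" and f: "f \<in> L2_curve T (Hm1 G) (Hm1_norm G)"
      and g: "g \<in> L2_curve T (L2_fun G) (L2_norm G)" and sol: "chaos_solution G h T a b c \<sigma> \<nu> u0 f g u" for u0 f g u
  proof -
    let ?r = "weight_r ck l" and ?N = "\<lambda>\<alpha>. L2_curve_norm T (H1_norm G) (u \<alpha>)"
    have uL: "u \<alpha> \<in> L2_curve T (H10 G) (H1_norm G)" for \<alpha> using sol by (simp add: chaos_solution_def)
    have N0: "0 \<le> ?N \<alpha>" for \<alpha> unfolding L2_curve_\<Psi>(2)[OF uL, symmetric] by simp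
    obtain N' where N': "N' 0 = C2 * (L2_norm G u0 + L2_curve_norm T (Hm1_norm G) f + L2_curve_norm T (L2_norm G) g)"
      "\<And>\<alpha>. ?N \<alpha> \<le> N' \<alpha>"
      "\<And>\<alpha>. \<alpha> \<noteq> 0 \<Longrightarrow> N' \<alpha> \<le> C1 * (\<Sum>k\<in>Poly_Mapping.keys \<alpha>. sqrt (real (Poly_Mapping.lookup \<alpha> k)) * (ck k * N' (\<alpha> - eps k)))"
      using est[rule_format, OF u0 f g sol] by (elim exE conjE) (rule that, assumption, erule spec, erule allE, erule mp, assumption)
    have N'0: "0 \<le> N' \<alpha>" for \<alpha> using N'(2)[of \<alpha>] N0[of \<alpha>] by linarith
    define Y where "Y \<alpha> = (?r \<alpha>)\<^sup>2 * (N' \<alpha>)\<^sup>2" for \<alpha>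
    define q where "q k = C1\<^sup>2 * (2 * real (k + 1)) powr (- 2 * l)" for k
    have rec: "Y \<alpha> \<le> (\<Sum>k\<in>Poly_Mapping.keys \<alpha>. q k * Y (\<alpha> - eps k))" if \<alpha>: "\<alpha> \<noteq> 0" for \<alpha>
    proof -
      let ?s = "\<lambda>k. sqrt (real (Poly_Mapping.lookup \<alpha> k))" and ?x = "\<lambda>k. ck k * N' (\<alpha> - eps k)"
      have "(N' \<alpha>)\<^sup>2 \<le> (C1 * (\<Sum>k\<in>Poly_Mapping.keys \<alpha>. ?s k * ?x k))\<^sup>2"
        by (rule power_mono[OF N'(3)[OF \<alpha>] N'0])
      also have "\<dots> = C1\<^sup>2 * (\<Sum>k\<in>Poly_Mapping.keys \<alpha>. ?s k * ?x k)\<^sup>2" by (simp add: power_mult_distrib)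
      also have "\<dots> \<le> C1\<^sup>2 * ((\<Sum>k\<in>Poly_Mapping.keys \<alpha>. (?s k)\<^sup>2) * (\<Sum>k\<in>Poly_Mapping.keys \<alpha>. (?x k)\<^sup>2))"
        by (intro mult_left_mono Cauchy_Schwarz_ineq_sum) simp
      also have "(\<Sum>k\<in>Poly_Mapping.keys \<alpha>. (?s k)\<^sup>2) = real (mi_deg \<alpha>)" by (simp add: mi_deg_def)
      finally have "Y \<alpha> \<le> (?r \<alpha>)\<^sup>2 * (C1\<^sup>2 * (real (mi_deg \<alpha>) * (\<Sum>k\<in>Poly_Mapping.keys \<alpha>. (?x k)\<^sup>2)))"
        unfolding Y_def by (rule mult_left_mono) simp
      also have "\<dots> = (\<Sum>k\<in>Poly_Mapping.keys \<alpha>. C1\<^sup>2 * (N' (\<alpha> - eps k))\<^sup>2 * ((?r \<alpha>)\<^sup>2 * (real (mi_deg \<alpha>) * (ck k)\<^sup>2)))"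
        unfolding sum_distrib_left by (rule sum.cong) (simp_all add: power_mult_distrib)
      also have "\<dots> = (\<Sum>k\<in>Poly_Mapping.keys \<alpha>. q k * Y (\<alpha> - eps k))"
        by (rule sum.cong[OF refl]) (subst weight_r_step[OF _ ck(1)], assumption, simp only: q_def Y_def ac_simps)
      finally show ?thesis .
    qed
    have Y0: "Y 0 = (N' 0)\<^sup>2" by (simp add: Y_def weight_r_0)
    have Ynn: "0 \<le> Y \<alpha>" for \<alpha> by (simp add: Y_def)
    have qnn: "0 \<le> q k" for k by (simp add: q_def)
    have q2: "finite K \<Longrightarrow> (\<Sum>k\<in>K. q k) \<le> 1 / 2" for K unfolding q_def by (rule l(2))
    have summ: "Y summable_on UNIV" "(\<Sum>\<^sub>\<infinity>\<alpha>. Y \<alpha>) \<le> 2 * Y 0"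
      by (rule multi_index_recursion_summable[of Y q]; (rule Ynn qnn q2 rec)?; assumption)+
    have le: "(?r \<alpha>)\<^sup>2 * (?N \<alpha>)\<^sup>2 \<le> Y \<alpha>" for \<alpha>
      unfolding Y_def by (intro mult_left_mono power_mono N'(2) N0) simp
    have sum: "(\<lambda>\<alpha>. (?r \<alpha>)\<^sup>2 * (?N \<alpha>)\<^sup>2) summable_on UNIV"
      by (rule summable_on_comparison_test[OF summ(1)]) (rule le, simp)
    have "(\<Sum>\<^sub>\<infinity>\<alpha>. (?r \<alpha>)\<^sup>2 * (?N \<alpha>)\<^sup>2) \<le> (\<Sum>\<^sub>\<infinity>\<alpha>. Y \<alpha>)"
      by (rule infsum_mono[OF sum summ(1)]) (rule le)
    \<comment> \<open>The factor 2 is the sum of the geometric series over the degrees; its root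
      appears in the final constant.\<close>
    also have "\<dots> \<le> 2 * (N' 0)\<^sup>2" using summ(2) Y0 by simp
    finally have "RL2_norm ?r (L2_curve_norm T (H1_norm G)) u \<le> sqrt (2 * (N' 0)\<^sup>2)"
      unfolding RL2_norm_def by (rule real_sqrt_le_mono)
    also have "\<dots> = sqrt 2 * N' 0" using N'0[of 0] by (simp add: real_sqrt_mult)
    finally show ?thesis using sum uL by (simp add: N'(1) RL2_def mult.assoc)
  qed
  show ?thesis
  proof (rule exI[of _ l], rule conjI[OF l(1)], rule exI[of _ "sqrt 2 * C2"], rule conjI, use C(2) in simp, intro ballI conjI)
    fix u0 f g assume d: "u0 \<in> L2_fun G" "f \<in> L2_curve T (Hm1 G) (Hm1_norm G)" "g \<in> L2_curve T (L2_fun G) (L2_norm G)"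
    show "\<exists>u. chaos_solution G h T a b c \<sigma> \<nu> u0 f g u" by (rule chaos_solution_exists[OF T d])
    show "\<forall>u. chaos_solution G h T a b c \<sigma> \<nu> u0 f g u \<longrightarrow>
         u \<in> RL2 (weight_r ck l) (L2_curve T (H10 G) (H1_norm G)) (L2_curve_norm T (H1_norm G)) \<and>
         RL2_norm (weight_r ck l) (L2_curve_norm T (H1_norm G)) u
           \<le> sqrt 2 * C2 * (L2_norm G u0 + L2_curve_norm T (Hm1_norm G) f + L2_curve_norm T (L2_norm G) g)"
      using main[OF d] by blast
  qed
qed

end

theorem theorem1:
  fixes P :: "'w measure" and \<xi> :: "nat \<Rightarrow> 'w \<Rightarrow> real"
    and G :: "(real^'n::finite) set"
    and h :: "nat \<Rightarrow> real^'n \<Rightarrow> real" and ck :: "nat \<Rightarrow> real" and T :: real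
    and a :: "'n \<Rightarrow> 'n \<Rightarrow> real^'n \<Rightarrow> real" and b \<sigma> :: "'n \<Rightarrow> real^'n \<Rightarrow> real"
    and c \<nu> :: "real^'n \<Rightarrow> real" and A1 A2 :: real
  assumes noise: "gaussian_noise_space P \<xi>"
    and G: "smooth_bounded_domain G"
    and h: "orthonormal_basis_L2 G h"
    and ck: "\<And>k. ck k > 0" "\<And>k x. x \<in> G \<Longrightarrow> \<bar>h k x\<bar> \<le> ck k"
    and T: "T > 0"
    and D1_a: "\<And>i j. \<exists>L. L-lipschitz_on (closure G) (a i j)"
    and D1_b: "\<And>i. b i \<in> borel_measurable (lebesgue_on (closure G))"
              "\<And>i. bounded (b i ` closure G)"
    and D1_c: "c \<in> borel_measurable (lebesgue_on (closure G))" "bounded (c ` closure G)"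
    and D1_\<sigma>: "\<And>i. \<sigma> i \<in> borel_measurable (lebesgue_on (closure G))"
              "\<And>i. bounded (\<sigma> i ` closure G)"
    and D1_\<nu>: "\<nu> \<in> borel_measurable (lebesgue_on (closure G))" "bounded (\<nu> ` closure G)"
    and D2: "A1 > 0" "A2 > 0"
      "\<And>x y. x \<in> closure G \<Longrightarrow>
         A1 * (norm y)\<^sup>2 \<le> (\<Sum>i\<in>UNIV. \<Sum>j\<in>UNIV. a i j x * y $ i * y $ j) \<and>
         (\<Sum>i\<in>UNIV. \<Sum>j\<in>UNIV. a i j x * y $ i * y $ j) \<le> A2 * (norm y)\<^sup>2"
  shows "\<exists>l>1. \<exists>C>0.
    \<forall>u0\<in>L2_fun G.
    \<forall>f\<in>L2_curve T (Hm1 G) (Hm1_norm G).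
    \<forall>g\<in>L2_curve T (L2_fun G) (L2_norm G).
      (\<exists>u. chaos_solution G h T a b c \<sigma> \<nu> u0 f g u) \<and>
      (\<forall>u. chaos_solution G h T a b c \<sigma> \<nu> u0 f g u \<longrightarrow>
         u \<in> RL2 (weight_r ck l) (L2_curve T (H10 G) (H1_norm G)) (L2_curve_norm T (H1_norm G)) \<and>
         RL2_norm (weight_r ck l) (L2_curve_norm T (H1_norm G)) u
           \<le> C * (L2_norm G u0 + L2_curve_norm T (Hm1_norm G) f + L2_curve_norm T (L2_norm G) g))"
proof -
  interpret onb G h
    by unfold_locales (use G h in \<open>auto simp: smooth_bounded_domain_def\<close>)
  \<comment> \<open>The hypotheses concern the closure of \<open>G\<close>, whereas the operators
    act on functions over the open set; measurability and bounds restrict.\<close>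
  have bm: "bmeas m" if m: "m \<in> borel_measurable (lebesgue_on (closure G))" "bounded (m ` closure G)" for m
  proof -
    obtain B where "\<And>x. x \<in> closure G \<Longrightarrow> \<bar>m x\<bar> \<le> B" using m(2) by (auto simp: bounded_iff)
    moreover have "m \<in> borel_measurable M"
      by (rule measurable_restrict_mono[OF m(1) closure_subset])
    ultimately show ?thesis using closure_subset unfolding bmeas_def by blast
  qed
  interpret coefficients G h a b \<sigma> c \<nu> ck A1
  proof (rule coefficients.intro[OF onb_axioms], rule coefficients_axioms.intro)
    show "A1 * (norm y)\<^sup>2 \<le> (\<Sum>i\<in>UNIV. \<Sum>j\<in>UNIV. a i j x * y $ i * y $ j)" if "x \<in> G" for x y
      using D2(3)[of x y] that closure_subset by blast
  qed (use D1_a D1_b D1_c D1_\<sigma> D1_\<nu> D2(1) ck bm in auto)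
  show ?thesis by (rule chaos_solution_wellposed[OF T])
qed

end
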